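(* Let $u\in U_{ad}^0$ be given. The operator $e(\cdot,u):Y\to Z$ is Fréchet differentiable.
   Context: Setting. $\Omega\subset\mathbb{R}^n$, $n=3$, is a polynomially/polygonally bounded Lipschitz domain. $(\cdot,\cdot)$ is the $L^2(\Omega)$ inner product, $(\cdot,\cdot)_{\partial\Omega}$ the $L^2(\partial\Omega)$ inner product. $H_\sigma(\Omega)=\{v\in H^1_0(\Omega)^n : (\operatorname{div}v,q)=0\ \forall q\in L^2(\Omega),\ \int_\Omega q\,dx=0\}$. $2Dv=\nabla v+(\nabla v)^t$. $0=t_0<\dots<t_M=T$ is an equidistant time grid with step size $\tau>0$. Initial data $\varphi^0=\varphi_0\in H^1(\Omega)\cap L^\infty(\Omega)$ and $v^0=v_0\in H_\sigma(\Omega)$ are fixed. Fixed constants: $\epsilon>0$, $b>0$, $r\ge0$, $\sigma_{lg}>0$, $c_W>0$, $\sigma=c_W\sigma_{lg}$, gravity vector $g$, equilibrium angle $\theta_{eq}$. Data. $\rho,\eta:\mathbb{R}\to\mathbb{R}$ are bounded, strictly positive, continuously differentiable, globally Lipschitz; $\rho\in C^2(\mathbb{R})$; $\rho_{\min}=\min_{t\in\mathbb R}\rho(t)$. $W\in C^{2,1}(\mathbb{R})$ has exactly two minima at $\pm1$ with $W(\pm1)=0$, and $W=W_++W_-$ with $W_+$ convex, $W_+'(0)=0$, $W_-$ concave; for some $C>0$, each $F\in\{W,W_+,W_-\}$ satisfies $F(\varphi)\le C(1+|\varphi|^4)$, $|F'(\varphi)|\le C(1+|\varphi|^3)$, $|F''(\varphi)|\le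 C(1+|\varphi|^2)$. $\vartheta\in C^{1,1}(\mathbb{R})\cap C^2(\mathbb{R})$ with $\vartheta(t)=-\frac12$ for $t\le-1$, $\vartheta(t)=\frac12$ for $t\ge1$ (and bounded second derivative). Control. $U$ is a normed reflexive space, $B:U\to L^2(0,T;L^2(\partial\Omega))$ is linear, continuous, injective; $U_{ad}^0=\{u\in U: -1\le\cos(\theta_{eq})+Bu\le1\}$; $B_mu=\frac1\tau\int_{t_{m-1}}^{t_m}(Bu)(t)\,dt$. Contact line energy: $\gamma_u'(\varphi^{m-1})=\sigma_{lg}(\cos(\theta_{eq})+B_mu)\vartheta'(\varphi^{m-1})$. $S_\gamma$ is a stabilization constant with $S_\gamma\ge\frac12\max_s|\gamma_u''(s)|$. Trilinear form: $a(u,v,w)=\frac12\int_\Omega((u\cdot\nabla)v)\cdot w-\frac12\int_\Omega((u\cdot\nabla)w)\cdot v$ on $(L^3(\Omega))^n\times H^1(\Omega)^n\times H^1(\Omega)^n$. Spaces. $Y=\left(H_\sigma(\Omega)\times(H^1(\Omega)\cap L^\infty(\Omega))\times W^{1,3}(\Omega)\right)^M$ with elements $y=(v_\tau,\varphi_\tau,\mu_\tau)=((v^m)_{m=1}^M,(\varphi^m)_{m=1}^M,(\mu^m)_{m=1}^M)$ and norm $\|y\|_Y=\max_m\|v^m\|_{H^1(\Omega)}+\max_m\|\varphi^m\|_{H^1(\Omega)}+\max_m\|\varphi^m\|_{L^\infty(\Omega)}+\max_m\|\mu^m\|_{W^{1,3}(\Omega)}$. $Z=\left((H_\sigma(\Omega)\times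 H^1(\Omega)\times H^1(\Omega))^\star\right)^M$. Operator $e:Y\times U\to Z$. With $\rho^k=\rho(\varphi^k)$, $\eta^k=\eta(\varphi^k)$, $J^m=-b\rho'(\varphi^m)\nabla\mu^m$, for $z=((w^m)_m,(\Psi^m)_m,(\Phi^m)_m)\in Z^\star$ with $w^m\in H_\sigma(\Omega)$, $\Psi^m,\Phi^m\in H^1(\Omega)$: $$\begin{aligned}\langle z,e(y,u)\rangle_{Z^\star,Z}=\sum_{m=1}^M\Big\{&\big(\tfrac{\rho^m+\rho^{m-1}}2v^m-\rho^{m-1}v^{m-1},w^m\big)+\tau a(\rho^{m-1}v^{m-1}+J^m,v^m,w^m)+\tau(2\eta^mDv^m,Dw^m)\\&+\tau(\varphi^{m-1}\nabla\mu^m,w^m)-\tau(g\rho^m,w^m)\\&+(\varphi^m-\varphi^{m-1},\Psi^m)-\tau(\varphi^{m-1}v^{m-1},\nabla\Psi^m)+\tfrac{\tau^2}{\rho_{\min}}(|\varphi^{m-1}|^2\nabla\mu^m,\nabla\Psi^m)+\tau b(\nabla\mu^m,\nabla\Psi^m)\\&+\tau\sigma\epsilon(\nabla\varphi^m,\nabla\Phi^m)+\tau\tfrac\sigma\epsilon(W_+'(\varphi^m)+W_-'(\varphi^{m-1}),\Phi^m)-\tau(\mu^m,\Phi^m)\\&+r(\varphi^m-\varphi^{m-1},\Phi^m)_{\partial\Omega}+\tau\big(\tfrac{S_\gamma}2(\varphi^m-\varphi^{m-1})+\gamma_u'(\varphi^{m-1}),\Phi^m\big)_{\partial\Omega}\Big\}.\end{aligned}$$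 *)

theory Defs
  imports
    "HOL-Analysis.Analysis"
    "HOL-Library.Function_Algebras"
    "HOL-Probability.Essential_Supremum"
begin

text \<open>
  Function spaces depend on the domain, so they are given as sets of representatives (subspaces of a
  function type) together with a seminorm; two representatives of the same element are at
  seminorm-distance zero. Linear and differentiable maps between such spaces are defined below so
  that they descend to the quotients.
\<close>

instantiation "fun" :: (type, real_vector) real_vector
begin

definition scaleR_fun :: "real \<Rightarrow> ('a \<Rightarrow> 'b) \<Rightarrow> 'a \<Rightarrow> 'b" where
  "scaleR_fun c f = (\<lambda>x. c *\<^sub>R f x)"

instance
  by standard (auto simp: scaleR_fun_def fun_eq_iff scaleR_add_right scaleR_add_left)

end

type_synonym R3 = "real ^ 3"


section \<open>Linear and differentiable maps between seminormed spaces\<close>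

text \<open>Linearity is required modulo elements of seminorm zero.\<close>

definition bounded_linear_btw ::
  "'a::real_vector set \<Rightarrow> ('a \<Rightarrow> real) \<Rightarrow> 'b::real_vector set \<Rightarrow> ('b \<Rightarrow> real) \<Rightarrow> ('a \<Rightarrow> 'b) \<Rightarrow> bool" where
  "bounded_linear_btw X nX Y nY A \<longleftrightarrow>
     (\<forall>x\<in>X. A x \<in> Y) \<and>
     (\<forall>x\<in>X. \<forall>y\<in>X. nY (A (x + y) - A x - A y) = 0) \<and>
     (\<forall>c. \<forall>x\<in>X. nY (A (c *\<^sub>R x) - c *\<^sub>R A x) = 0) \<and>
     (\<exists>C. \<forall>x\<in>X. nY (A x) \<le> C * nX x)"

definition frechet_differentiable ::
  "'a::real_vector set \<Rightarrow> ('a \<Rightarrow> real) \<Rightarrow> 'b::real_vector set \<Rightarrow> ('b \<Rightarrow> real) \<Rightarrow> ('a \<Rightarrow> 'b) \<Rightarrow> bool" where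
  "frechet_differentiable X nX Y nY F \<longleftrightarrow>
     (\<forall>x\<in>X. F x \<in> Y) \<and>
     (\<forall>x\<in>X. \<exists>A. bounded_linear_btw X nX Y nY A \<and>
        (\<forall>\<epsilon>>0. \<exists>\<delta>>0. \<forall>h\<in>X. nX h < \<delta> \<longrightarrow> nY (F (x + h) - F x - A h) \<le> \<epsilon> * nX h))"

definition dual_space :: "'a::real_vector set \<Rightarrow> ('a \<Rightarrow> real) \<Rightarrow> ('a \<Rightarrow> real) set" where
  "dual_space X nX = {f. bounded_linear_btw X nX UNIV abs f}"

definition dual_norm :: "'a set \<Rightarrow> ('a \<Rightarrow> real) \<Rightarrow> ('a \<Rightarrow> real) \<Rightarrow> real" where
  "dual_norm X nX f = Sup {\<bar>f x\<bar> | x. x \<in> X \<and> nX x \<le> 1}"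

definition reflexive_space :: "'u::real_normed_vector itself \<Rightarrow> bool" where
  "reflexive_space _ \<longleftrightarrow>
     (\<forall>F :: ('u \<Rightarrow>\<^sub>L real) \<Rightarrow>\<^sub>L real. \<exists>x::'u. \<forall>f. blinfun_apply F f = blinfun_apply f x)"


section \<open>Lebesgue and Bochner spaces\<close>

definition Lp :: "'a measure \<Rightarrow> real \<Rightarrow> ('a \<Rightarrow> 'b::euclidean_space) set" where
  "Lp M p = {f \<in> borel_measurable M. integrable M (\<lambda>x. norm (f x) powr p)}"

definition Lp_norm :: "'a measure \<Rightarrow> real \<Rightarrow> ('a \<Rightarrow> 'b::euclidean_space) \<Rightarrow> real" where
  "Lp_norm M p f = (LINT x|M. norm (f x) powr p) powr (1 / p)"

definition Linf :: "'a measure \<Rightarrow> ('a \<Rightarrow> real) set" where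
  "Linf M = {f \<in> borel_measurable M. esssup M (\<lambda>x. ereal \<bar>f x\<bar>) < \<infinity>}"

definition Linf_norm :: "'a measure \<Rightarrow> ('a \<Rightarrow> real) \<Rightarrow> real" where
  "Linf_norm M f = real_of_ereal (esssup M (\<lambda>x. ereal \<bar>f x\<bar>))"

definition L2_inner :: "'a measure \<Rightarrow> ('a \<Rightarrow> 'b::euclidean_space) \<Rightarrow> ('a \<Rightarrow> 'b) \<Rightarrow> real" where
  "L2_inner M f h = (LINT x|M. f x \<bullet> h x)"

text \<open>The library's Bochner integral needs a Banach space given as a type; here the values lie in a
  seminormed space \<open>(V, nV)\<close>.\<close>

definition strongly_measurable ::
  "'t measure \<Rightarrow> 'v::real_vector set \<Rightarrow> ('v \<Rightarrow> real) \<Rightarrow> ('t \<Rightarrow> 'v) \<Rightarrow> bool" where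
  "strongly_measurable M V nV f \<longleftrightarrow>
     (\<forall>t\<in>space M. f t \<in> V) \<and>
     (\<exists>s. (\<forall>k::nat. simple_function M (s k) \<and> (\<forall>t\<in>space M. s k t \<in> V)) \<and>
          (AE t in M. (\<lambda>k. nV (s k t - f t)) \<longlonglongrightarrow> 0))"

definition bochner_L2 ::
  "'t measure \<Rightarrow> 'v::real_vector set \<Rightarrow> ('v \<Rightarrow> real) \<Rightarrow> ('t \<Rightarrow> 'v) set" where
  "bochner_L2 M V nV = {f. strongly_measurable M V nV f \<and> integrable M (\<lambda>t. (nV (f t))\<^sup>2)}"

definition bochner_L2_norm ::
  "'t measure \<Rightarrow> ('v::real_vector \<Rightarrow> real) \<Rightarrow> ('t \<Rightarrow> 'v) \<Rightarrow> real" where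
  "bochner_L2_norm M nV f = sqrt (LINT t|M. (nV (f t))\<^sup>2)"

definition simple_integral_vec :: "'t measure \<Rightarrow> ('t \<Rightarrow> 'v::real_vector) \<Rightarrow> 'v" where
  "simple_integral_vec M s = (\<Sum>v\<in>s ` space M. measure M (s -` {v} \<inter> space M) *\<^sub>R v)"

definition is_bochner_integral ::
  "'t measure \<Rightarrow> 'v::real_vector set \<Rightarrow> ('v \<Rightarrow> real) \<Rightarrow> ('t \<Rightarrow> 'v) \<Rightarrow> 'v \<Rightarrow> bool" where
  "is_bochner_integral M V nV f g \<longleftrightarrow> g \<in> V \<and>
     (\<exists>s. (\<forall>k::nat. simple_function M (s k) \<and> (\<forall>t\<in>space M. s k t \<in> V)) \<and>
          (\<lambda>k. \<integral>\<^sup>+ t. ennreal (nV (s k t - f t)) \<partial>M) \<longlonglongrightarrow> 0 \<and>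
          (\<lambda>k. nV (simple_integral_vec M (s k) - g)) \<longlonglongrightarrow> 0)"

definition bochner_integral ::
  "'t measure \<Rightarrow> 'v::real_vector set \<Rightarrow> ('v \<Rightarrow> real) \<Rightarrow> ('t \<Rightarrow> 'v) \<Rightarrow> 'v" where
  "bochner_integral M V nV f = (SOME g. is_bochner_integral M V nV f g)"


section \<open>Sobolev spaces\<close>

definition partial :: "3 \<Rightarrow> (R3 \<Rightarrow> real) \<Rightarrow> R3 \<Rightarrow> real" where
  "partial i f x = frechet_derivative f (at x) (axis i 1)"

primrec Ck_R3 :: "nat \<Rightarrow> (R3 \<Rightarrow> real) \<Rightarrow> bool" where
  "Ck_R3 0 f \<longleftrightarrow> continuous_on UNIV f"
| "Ck_R3 (Suc k) f \<longleftrightarrow> (\<forall>x. f differentiable (at x)) \<and> (\<forall>i. Ck_R3 k (partial i f))"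

definition test_functions :: "R3 set \<Rightarrow> (R3 \<Rightarrow> real) set" where
  "test_functions \<Omega> = {\<phi>. (\<forall>k. Ck_R3 k \<phi>) \<and>
     compact (closure {x. \<phi> x \<noteq> 0}) \<and> closure {x. \<phi> x \<noteq> 0} \<subseteq> \<Omega>}"

definition locally_integrable :: "R3 set \<Rightarrow> (R3 \<Rightarrow> 'b::euclidean_space) \<Rightarrow> bool" where
  "locally_integrable \<Omega> f \<longleftrightarrow> f \<in> borel_measurable (lebesgue_on \<Omega>) \<and>
     (\<forall>K. compact K \<and> K \<subseteq> \<Omega> \<longrightarrow> integrable (lebesgue_on K) f)"

definition is_weak_gradient :: "R3 set \<Rightarrow> (R3 \<Rightarrow> real) \<Rightarrow> (R3 \<Rightarrow> R3) \<Rightarrow> bool" where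
  "is_weak_gradient \<Omega> f G \<longleftrightarrow> locally_integrable \<Omega> f \<and> locally_integrable \<Omega> G \<and>
     (\<forall>\<phi>\<in>test_functions \<Omega>. \<forall>i.
        (LINT x|lebesgue_on \<Omega>. f x * partial i \<phi> x) = - (LINT x|lebesgue_on \<Omega>. G x $ i * \<phi> x))"

definition wgrad :: "R3 set \<Rightarrow> (R3 \<Rightarrow> real) \<Rightarrow> R3 \<Rightarrow> R3" where
  "wgrad \<Omega> f = (SOME G. is_weak_gradient \<Omega> f G)"

definition W1p :: "R3 set \<Rightarrow> real \<Rightarrow> (R3 \<Rightarrow> real) set" where
  "W1p \<Omega> p = {f \<in> Lp (lebesgue_on \<Omega>) p. \<exists>G \<in> Lp (lebesgue_on \<Omega>) p. is_weak_gradient \<Omega> f G}"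

definition W1p_norm :: "R3 set \<Rightarrow> real \<Rightarrow> (R3 \<Rightarrow> real) \<Rightarrow> real" where
  "W1p_norm \<Omega> p f =
     (Lp_norm (lebesgue_on \<Omega>) p f powr p + Lp_norm (lebesgue_on \<Omega>) p (wgrad \<Omega> f) powr p) powr (1 / p)"

abbreviation H1 :: "R3 set \<Rightarrow> (R3 \<Rightarrow> real) set" where
  "H1 \<Omega> \<equiv> W1p \<Omega> 2"

abbreviation H1_norm :: "R3 set \<Rightarrow> (R3 \<Rightarrow> real) \<Rightarrow> real" where
  "H1_norm \<Omega> \<equiv> W1p_norm \<Omega> 2"

definition H1_0 :: "R3 set \<Rightarrow> (R3 \<Rightarrow> real) set" where
  "H1_0 \<Omega> = {f \<in> H1 \<Omega>. \<forall>\<epsilon>>0. \<exists>\<phi>\<in>test_functions \<Omega>. H1_norm \<Omega> (f - \<phi>) < \<epsilon>}"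

definition H1v_norm :: "R3 set \<Rightarrow> (R3 \<Rightarrow> R3) \<Rightarrow> real" where
  "H1v_norm \<Omega> v = L2_set (\<lambda>i. H1_norm \<Omega> (\<lambda>x. v x $ i)) UNIV"

definition wjac :: "R3 set \<Rightarrow> (R3 \<Rightarrow> R3) \<Rightarrow> R3 \<Rightarrow> real ^ 3 ^ 3" where
  "wjac \<Omega> v x = (\<chi> i. wgrad \<Omega> (\<lambda>y. v y $ i) x)"

definition wdiv :: "R3 set \<Rightarrow> (R3 \<Rightarrow> R3) \<Rightarrow> R3 \<Rightarrow> real" where
  "wdiv \<Omega> v x = (\<Sum>i\<in>UNIV. wjac \<Omega> v x $ i $ i)"

definition sym_grad :: "R3 set \<Rightarrow> (R3 \<Rightarrow> R3) \<Rightarrow> R3 \<Rightarrow> real ^ 3 ^ 3" where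
  "sym_grad \<Omega> v x = (1 / 2) *\<^sub>R (wjac \<Omega> v x + transpose (wjac \<Omega> v x))"

definition H_sigma :: "R3 set \<Rightarrow> (R3 \<Rightarrow> R3) set" where
  "H_sigma \<Omega> = {v. (\<forall>i. (\<lambda>x. v x $ i) \<in> H1_0 \<Omega>) \<and>
     (\<forall>q \<in> Lp (lebesgue_on \<Omega>) 2. (LINT x|lebesgue_on \<Omega>. q x) = 0 \<longrightarrow>
        L2_inner (lebesgue_on \<Omega>) (wdiv \<Omega> v) q = 0)}"

definition trilinear :: "R3 set \<Rightarrow> (R3 \<Rightarrow> R3) \<Rightarrow> (R3 \<Rightarrow> R3) \<Rightarrow> (R3 \<Rightarrow> R3) \<Rightarrow> real" where
  "trilinear \<Omega> u v w =
     1 / 2 * L2_inner (lebesgue_on \<Omega>) (\<lambda>x. wjac \<Omega> v x *v u x) w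
   - 1 / 2 * L2_inner (lebesgue_on \<Omega>) (\<lambda>x. wjac \<Omega> w x *v u x) v"


section \<open>The domain, its surface measure and traces\<close>

text \<open>Near each boundary point the domain lies on one side of the graph of a Lipschitz function over
  the plane orthogonal to a unit vector \<open>d\<close>; only the values of \<open>\<psi>\<close> on that plane matter.\<close>

definition lipschitz_boundary :: "R3 set \<Rightarrow> bool" where
  "lipschitz_boundary \<Omega> \<longleftrightarrow>
     (\<forall>p\<in>frontier \<Omega>. \<exists>\<epsilon>>0. \<exists>d \<psi> L. norm d = 1 \<and> L-lipschitz_on UNIV \<psi> \<and>
        \<Omega> \<inter> ball p \<epsilon> = {x \<in> ball p \<epsilon>. \<psi> (x - (x \<bullet> d) *\<^sub>R d) < x \<bullet> d})"

definition polygonal_lipschitz_domain :: "R3 set \<Rightarrow> bool" where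
  "polygonal_lipschitz_domain \<Omega> \<longleftrightarrow>
     open \<Omega> \<and> connected \<Omega> \<and> bounded \<Omega> \<and> \<Omega> \<noteq> {} \<and> lipschitz_boundary \<Omega> \<and>
     (\<exists>\<F>. finite \<F> \<and> (\<forall>F\<in>\<F>. polytope F \<and> aff_dim F = 2) \<and> frontier \<Omega> = \<Union>\<F>)"

text \<open>Two-dimensional Hausdorff measure, normalised (factor \<open>\<pi>/4\<close>) to agree with area.\<close>

definition hausdorff2_pre :: "real \<Rightarrow> R3 set \<Rightarrow> ennreal" where
  "hausdorff2_pre \<delta> A =
     Inf {(\<Sum>i. ennreal (pi / 4 * (diameter (C i))\<^sup>2)) | C :: nat \<Rightarrow> R3 set.
            A \<subseteq> (\<Union>i. C i) \<and> (\<forall>i. bounded (C i) \<and> diameter (C i) \<le> \<delta>)}"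

definition hausdorff2 :: "R3 set \<Rightarrow> ennreal" where
  "hausdorff2 A = (SUP \<delta>\<in>{0<..}. hausdorff2_pre \<delta> A)"

definition surface_measure :: "R3 set \<Rightarrow> R3 measure" where
  "surface_measure \<Omega> = restrict_space (measure_of UNIV (sets borel) hausdorff2) (frontier \<Omega>)"

text \<open>The trace is the continuous extension of the restriction map from \<open>C\<^sup>1\<close> functions to the
  Sobolev space.\<close>

definition is_trace :: "R3 set \<Rightarrow> (R3 \<Rightarrow> real) \<Rightarrow> (R3 \<Rightarrow> real) \<Rightarrow> bool" where
  "is_trace \<Omega> f h \<longleftrightarrow> h \<in> Lp (surface_measure \<Omega>) 2 \<and>
     (\<exists>\<psi>. (\<forall>k::nat. Ck_R3 1 (\<psi> k)) \<and>
          (\<lambda>k. H1_norm \<Omega> (\<psi> k - f)) \<longlonglongrightarrow> 0 \<and>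
          (\<lambda>k. Lp_norm (surface_measure \<Omega>) 2 (\<psi> k - h)) \<longlonglongrightarrow> 0)"

definition btrace :: "R3 set \<Rightarrow> (R3 \<Rightarrow> real) \<Rightarrow> R3 \<Rightarrow> real" where
  "btrace \<Omega> f = (SOME h. is_trace \<Omega> f h)"


section \<open>Smoothness classes on the real line\<close>

primrec Ck_real :: "nat \<Rightarrow> (real \<Rightarrow> real) \<Rightarrow> bool" where
  "Ck_real 0 f \<longleftrightarrow> continuous_on UNIV f"
| "Ck_real (Suc k) f \<longleftrightarrow> (\<forall>x. f differentiable (at x)) \<and> Ck_real k (deriv f)"

text \<open>The Lipschitz condition in \<open>C\<^sup>2\<^sup>,\<^sup>1\<close> is local: a quartic double well satisfies it only in this form.\<close>

definition C21_real :: "(real \<Rightarrow> real) \<Rightarrow> bool" where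
  "C21_real f \<longleftrightarrow> Ck_real 2 f \<and> (\<forall>R. \<exists>L. L-lipschitz_on {-R..R} (deriv (deriv f)))"

definition twice_differentiable :: "(real \<Rightarrow> real) \<Rightarrow> bool" where
  "twice_differentiable f \<longleftrightarrow> (\<forall>x. f differentiable (at x)) \<and> (\<forall>x. deriv f differentiable (at x))"

definition admissible_coefficient :: "(real \<Rightarrow> real) \<Rightarrow> bool" where
  "admissible_coefficient f \<longleftrightarrow> bounded (range f) \<and> (\<forall>t. 0 < f t) \<and> Ck_real 1 f \<and>
     (\<exists>L. L-lipschitz_on UNIV f)"

definition admissible_potential ::
  "(real \<Rightarrow> real) \<Rightarrow> (real \<Rightarrow> real) \<Rightarrow> (real \<Rightarrow> real) \<Rightarrow> bool" where
  "admissible_potential W Wp Wm \<longleftrightarrow>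
     C21_real W \<and> {s. \<forall>t. W s \<le> W t} = {-1, 1} \<and> W (-1) = 0 \<and> W 1 = 0 \<and>
     (\<forall>t. W t = Wp t + Wm t) \<and>
     twice_differentiable Wp \<and> twice_differentiable Wm \<and>
     convex_on UNIV Wp \<and> deriv Wp 0 = 0 \<and> concave_on UNIV Wm \<and>
     (\<exists>C>0. \<forall>F\<in>{W, Wp, Wm}. \<forall>t.
        F t \<le> C * (1 + \<bar>t\<bar> ^ 4) \<and>
        \<bar>deriv F t\<bar> \<le> C * (1 + \<bar>t\<bar> ^ 3) \<and>
        \<bar>deriv (deriv F) t\<bar> \<le> C * (1 + \<bar>t\<bar>\<^sup>2))"

definition admissible_contact_profile :: "(real \<Rightarrow> real) \<Rightarrow> bool" where
  "admissible_contact_profile \<theta> \<longleftrightarrow>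
     Ck_real 2 \<theta> \<and> (\<exists>L. L-lipschitz_on UNIV (deriv \<theta>)) \<and> bounded (range (deriv (deriv \<theta>))) \<and>
     (\<forall>t\<le>-1. \<theta> t = - 1 / 2) \<and> (\<forall>t\<ge>1. \<theta> t = 1 / 2)"


section \<open>The time-discrete system\<close>

record model =
  Dom :: "R3 set"
  end_time :: real
  steps :: nat
  rho :: "real \<Rightarrow> real"
  rho_min :: real
  eta :: "real \<Rightarrow> real"
  W :: "real \<Rightarrow> real"
  W_plus :: "real \<Rightarrow> real"
  W_minus :: "real \<Rightarrow> real"
  vtheta :: "real \<Rightarrow> real"
  eps :: real
  mobility :: real
  relax :: real
  sigma_lg :: real
  c_W :: real
  gravity :: R3
  theta_eq :: real
  S_gamma :: real
  v_init :: "R3 \<Rightarrow> R3"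
  phi_init :: "R3 \<Rightarrow> real"

definition tau :: "model \<Rightarrow> real" where
  "tau P = end_time P / real (steps P)"

definition sigma :: "model \<Rightarrow> real" where
  "sigma P = c_W P * sigma_lg P"

definition admissible_model :: "model \<Rightarrow> bool" where
  "admissible_model P \<longleftrightarrow>
     polygonal_lipschitz_domain (Dom P) \<and> 0 < end_time P \<and> 1 \<le> steps P \<and>
     admissible_coefficient (rho P) \<and> Ck_real 2 (rho P) \<and>
     rho_min P \<in> range (rho P) \<and> (\<forall>t. rho_min P \<le> rho P t) \<and>
     admissible_coefficient (eta P) \<and>
     admissible_potential (W P) (W_plus P) (W_minus P) \<and>
     admissible_contact_profile (vtheta P) \<and>
     0 < eps P \<and> 0 < mobility P \<and> 0 \<le> relax P \<and> 0 < sigma_lg P \<and> 0 < c_W P \<and>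
     v_init P \<in> H_sigma (Dom P) \<and>
     phi_init P \<in> H1 (Dom P) \<inter> Linf (lebesgue_on (Dom P))"

abbreviation boundary_L2 :: "model \<Rightarrow> (R3 \<Rightarrow> real) set" where
  "boundary_L2 P \<equiv> Lp (surface_measure (Dom P)) 2"

abbreviation boundary_L2_norm :: "model \<Rightarrow> (R3 \<Rightarrow> real) \<Rightarrow> real" where
  "boundary_L2_norm P \<equiv> Lp_norm (surface_measure (Dom P)) 2"

abbreviation time_measure :: "model \<Rightarrow> real measure" where
  "time_measure P \<equiv> lebesgue_on {0<..<end_time P}"

definition control_operator ::
  "model \<Rightarrow> ('u::real_normed_vector \<Rightarrow> real \<Rightarrow> R3 \<Rightarrow> real) \<Rightarrow> bool" where
  "control_operator P B \<longleftrightarrow>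
     bounded_linear_btw UNIV norm
       (bochner_L2 (time_measure P) (boundary_L2 P) (boundary_L2_norm P))
       (bochner_L2_norm (time_measure P) (boundary_L2_norm P)) B \<and>
     (\<forall>u u'. bochner_L2_norm (time_measure P) (boundary_L2_norm P) (B u - B u') = 0 \<longrightarrow> u = u')"

definition U_ad0 :: "model \<Rightarrow> ('u \<Rightarrow> real \<Rightarrow> R3 \<Rightarrow> real) \<Rightarrow> 'u set" where
  "U_ad0 P B = {u. AE t in time_measure P. AE x in surface_measure (Dom P).
     -1 \<le> cos (theta_eq P) + B u t x \<and> cos (theta_eq P) + B u t x \<le> 1}"

definition B_mean ::
  "model \<Rightarrow> ('u \<Rightarrow> real \<Rightarrow> R3 \<Rightarrow> real) \<Rightarrow> nat \<Rightarrow> 'u \<Rightarrow> R3 \<Rightarrow> real" where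
  "B_mean P B m u = (1 / tau P) *\<^sub>R
     bochner_integral (lebesgue_on {real (m - 1) * tau P <..< real m * tau P})
       (boundary_L2 P) (boundary_L2_norm P) (B u)"

definition gamma' ::
  "model \<Rightarrow> ('u \<Rightarrow> real \<Rightarrow> R3 \<Rightarrow> real) \<Rightarrow> 'u \<Rightarrow> nat \<Rightarrow> R3 \<Rightarrow> real \<Rightarrow> real" where
  "gamma' P B u m x s = sigma_lg P * (cos (theta_eq P) + B_mean P B m u x) * deriv (vtheta P) s"

definition stabilizing :: "model \<Rightarrow> ('u \<Rightarrow> real \<Rightarrow> R3 \<Rightarrow> real) \<Rightarrow> 'u \<Rightarrow> bool" where
  "stabilizing P B u \<longleftrightarrow>
     (\<forall>m\<in>{1..steps P}. AE x in surface_measure (Dom P).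
        \<forall>s. 1 / 2 * \<bar>deriv (gamma' P B u m x) s\<bar> \<le> S_gamma P)"

text \<open>Elements of \<open>M\<close>-fold products are functions on the naturals of which only the entries
  \<open>1, \<dots>, M\<close> count.\<close>

type_synonym state = "(nat \<Rightarrow> R3 \<Rightarrow> R3) \<times> (nat \<Rightarrow> R3 \<Rightarrow> real) \<times> (nat \<Rightarrow> R3 \<Rightarrow> real)"
type_synonym test = "(R3 \<Rightarrow> R3) \<times> (R3 \<Rightarrow> real) \<times> (R3 \<Rightarrow> real)"

definition Y_space :: "model \<Rightarrow> state set" where
  "Y_space P = {(v, \<phi>, \<mu>). \<forall>m\<in>{1..steps P}.
     v m \<in> H_sigma (Dom P) \<and>
     \<phi> m \<in> H1 (Dom P) \<inter> Linf (lebesgue_on (Dom P)) \<and>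
     \<mu> m \<in> W1p (Dom P) 3}"

definition Y_norm :: "model \<Rightarrow> state \<Rightarrow> real" where
  "Y_norm P = (\<lambda>(v, \<phi>, \<mu>).
     (MAX m\<in>{1..steps P}. H1v_norm (Dom P) (v m)) +
     (MAX m\<in>{1..steps P}. H1_norm (Dom P) (\<phi> m)) +
     (MAX m\<in>{1..steps P}. Linf_norm (lebesgue_on (Dom P)) (\<phi> m)) +
     (MAX m\<in>{1..steps P}. W1p_norm (Dom P) 3 (\<mu> m)))"

definition test_space :: "model \<Rightarrow> test set" where
  "test_space P = H_sigma (Dom P) \<times> H1 (Dom P) \<times> H1 (Dom P)"

definition test_norm :: "model \<Rightarrow> test \<Rightarrow> real" where
  "test_norm P = (\<lambda>(w, \<Psi>, \<Phi>).
     sqrt ((H1v_norm (Dom P) w)\<^sup>2 + (H1_norm (Dom P) \<Psi>)\<^sup>2 + (H1_norm (Dom P) \<Phi>)\<^sup>2))"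

definition Z_space :: "model \<Rightarrow> (nat \<Rightarrow> test \<Rightarrow> real) set" where
  "Z_space P = {F. \<forall>m\<in>{1..steps P}. F m \<in> dual_space (test_space P) (test_norm P)}"

definition Z_norm :: "model \<Rightarrow> (nat \<Rightarrow> test \<Rightarrow> real) \<Rightarrow> real" where
  "Z_norm P F = (MAX m\<in>{1..steps P}. dual_norm (test_space P) (test_norm P) (F m))"

text \<open>The \<open>m\<close>-th component of the operator as a functional; its pairing with \<open>z \<in> Z\<^sup>*\<close> is
  the sum of these functionals at the components \<open>z m\<close>.\<close>

definition e_op ::
  "model \<Rightarrow> ('u \<Rightarrow> real \<Rightarrow> R3 \<Rightarrow> real) \<Rightarrow> state \<Rightarrow> 'u \<Rightarrow> nat \<Rightarrow> test \<Rightarrow> real" where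
  "e_op P B = (\<lambda>(v\<^sub>\<tau>, \<phi>\<^sub>\<tau>, \<mu>\<^sub>\<tau>) u m (w, \<Psi>, \<Phi>).
     let \<Omega> = Dom P; \<tau> = tau P; \<sigma> = sigma P;
         ip = (\<lambda>f h. L2_inner (lebesgue_on \<Omega>) f h);
         ipv = (\<lambda>f h :: R3 \<Rightarrow> R3. L2_inner (lebesgue_on \<Omega>) f h);
         ipm = (\<lambda>f h :: R3 \<Rightarrow> real^3^3. L2_inner (lebesgue_on \<Omega>) f h);
         ipb = (\<lambda>f h. L2_inner (surface_measure \<Omega>) f h);
         v = v\<^sub>\<tau> m; v' = (if m = 1 then v_init P else v\<^sub>\<tau> (m - 1));
         \<phi> = \<phi>\<^sub>\<tau> m; \<phi>' = (if m = 1 then phi_init P else \<phi>\<^sub>\<tau> (m - 1));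
         \<mu> = \<mu>\<^sub>\<tau> m;
         \<rho> = (\<lambda>x. rho P (\<phi> x)); \<rho>' = (\<lambda>x. rho P (\<phi>' x)); \<eta> = (\<lambda>x. eta P (\<phi> x));
         J = (\<lambda>x. - (mobility P * deriv (rho P) (\<phi> x)) *\<^sub>R wgrad \<Omega> \<mu> x)
     in
       ipv (\<lambda>x. ((\<rho> x + \<rho>' x) / 2) *\<^sub>R v x - \<rho>' x *\<^sub>R v' x) w
     + \<tau> * trilinear \<Omega> (\<lambda>x. \<rho>' x *\<^sub>R v' x + J x) v w
     + \<tau> * ipm (\<lambda>x. (2 * \<eta> x) *\<^sub>R sym_grad \<Omega> v x) (sym_grad \<Omega> w)
     + \<tau> * ipv (\<lambda>x. \<phi>' x *\<^sub>R wgrad \<Omega> \<mu> x) w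
     - \<tau> * ipv (\<lambda>x. \<rho> x *\<^sub>R gravity P) w
     + ip (\<lambda>x. \<phi> x - \<phi>' x) \<Psi>
     - \<tau> * ipv (\<lambda>x. \<phi>' x *\<^sub>R v' x) (wgrad \<Omega> \<Psi>)
     + \<tau>\<^sup>2 / rho_min P * ipv (\<lambda>x. \<bar>\<phi>' x\<bar>\<^sup>2 *\<^sub>R wgrad \<Omega> \<mu> x) (wgrad \<Omega> \<Psi>)
     + \<tau> * mobility P * ipv (wgrad \<Omega> \<mu>) (wgrad \<Omega> \<Psi>)
     + \<tau> * \<sigma> * eps P * ipv (wgrad \<Omega> \<phi>) (wgrad \<Omega> \<Phi>)
     + \<tau> * (\<sigma> / eps P) * ip (\<lambda>x. deriv (W_plus P) (\<phi> x) + deriv (W_minus P) (\<phi>' x)) \<Phi>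
     - \<tau> * ip \<mu> \<Phi>
     + relax P * ipb (\<lambda>x. btrace \<Omega> \<phi> x - btrace \<Omega> \<phi>' x) (btrace \<Omega> \<Phi>)
     + \<tau> * ipb (\<lambda>x. S_gamma P / 2 * (btrace \<Omega> \<phi> x - btrace \<Omega> \<phi>' x)
                     + gamma' P B u m x (btrace \<Omega> \<phi>' x)) (btrace \<Omega> \<Phi>))"

end

theory Submission
 imports Defs
begin

text \<open>Every summand of the residual pairs a nonlinear function of the state with a linear function of
  the test element, so differentiability follows from the chain rule and from product rules for
  bounded bilinear maps once three facts about the spaces are known.

  First, superposition. A continuously differentiable function acts differentiably on bounded
  measurable functions (\<open>fd_superposition_Linf\<close>), which covers density, viscosity and contact line
  profile. The parts \<open>W_plus\<close> and \<open>W_minus\<close> have second derivatives that need not be continuous; dominated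
  convergence of difference quotients still gives differentiability into \<open>L\<^sup>2\<close> (\<open>fd_superposition_L2\<close>).

  Second, the Sobolev embedding of \<open>H\<^sup>1\<^sub>0\<close> into \<open>L\<^sup>6\<close> (\<open>Sobolev_embedding\<close>). The convecting field contains
  the gradient of the chemical potential and lies in \<open>L\<^sup>3\<close> only, the velocity gradient lies in \<open>L\<^sup>2\<close>, so
  the test field has to supply the exponent 6. The embedding comes from the Loomis-Whitney inequality.

  Third, the trace. It is defined as a limit of restrictions of \<open>C\<^sup>1\<close> functions, so its existence rests on the
  density of such functions up to the boundary (\<open>H1_approximable\<close>) and on a trace inequality
  (\<open>local_trace_inequality\<close>), which compares the product of surface measure and arc length with the volume.
  The contact line energy is nonlinear in the trace and differentiable on bounded functions only;
  hence the approximants are chosen bounded, which makes the trace a bounded map between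
  the spaces of essentially bounded functions (\<open>btrace_Linf_bound\<close>). The coefficient of that energy is a Bochner
  mean of the control. It is measurable because the mean exists in \<open>L\<^sup>2\<close>, and bounded by the condition on
  the stabilisation constant (\<open>contact_coefficient_Linf\<close>).

  All spaces consist of representatives with a seminorm, and maps such as the weak gradient are
  linear only up to elements of seminorm zero. The calculus of the first section is set up for this.
  The domain is written \<open>U\<close> and its surface measure \<open>Ga\<close>.\<close>

notation (input) pair_measure (infixr "OM" 80)
notation (input) scaleR (infixr "*R" 75)
notation (input) LIMSEQ ("((_)/ ----> (_))" [60, 60] 60)
abbreviation (input) "bmeas \<equiv> borel_measurable"
abbreviation (input) lborel_integral :: "('a::euclidean_space => ennreal) => ennreal" (binder "NN " 10) where
 "lborel_integral f \<equiv> nn_integral lborel f"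
abbreviation (input) sqn :: "(R3 => real) => ennreal" where "sqn f \<equiv> NN x. ennreal ((f x)^2)"
lemmas borel_contI = borel_measurable_continuous_onI
abbreviation "cube a r \<equiv> cbox (a - vec r) (a + vec r :: R3)"

section \<open>Differential calculus between seminormed spaces of representatives\<close>

locale seminormed =
 fixes X :: "'a::real_vector set" and n :: "'a => real"
 assumes add_mem: "x : X ==> y : X ==> x + y : X"
  and scale_mem: "x : X ==> c *R x : X"
  and zero_mem: "0 : X"
  and triangle: "x : X ==> y : X ==> n (x + y) <= n x + n y"
  and scale: "x : X ==> n (c *R x) = \<bar>c\<bar> * n x"
begin

lemma minus_mem: "x : X ==> - x : X" using scale_mem[of x "-1"] by simp

lemma diff_mem: "x : X ==> y : X ==> x - y : X" using add_mem[of x "- y"] minus_mem[of y] by simp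

lemma n_zero [simp]: "n 0 = 0" using scale[OF zero_mem, of 0] by simp

lemma n_minus: "x : X ==> n (- x) = n x" using scale[of x "-1"] by simp

lemma nonneg: "x : X ==> 0 <= n x" using triangle[of x "- x"] minus_mem[of x] n_minus[of x] by simp

lemma triangle_diff: "x : X ==> y : X ==> n (x - y) <= n x + n y"
 using triangle[of x "- y"] minus_mem[of y] n_minus[of y] by simp

lemma n_commute: "x : X ==> y : X ==> n (x - y) = n (y - x)" using n_minus[of "x - y"] diff_mem[of x y] by simp

lemma triangle_sub: "x : X ==> y : X ==> n x <= n y + n (x - y)" using triangle[of y "x - y"] diff_mem[of x y] by simp

lemma sum_mem: "finite I ==> (!!i. i : I ==> f i : X) ==> sum f I : X"
 by (induction I rule: finite_induct) (auto intro: add_mem zero_mem)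

lemma triangle_sum: "finite I ==> (!!i. i : I ==> f i : X) ==> n (sum f I) <= (\<Sum>i\<in>I. n (f i))"
proof (induction I rule: finite_induct)
 case (insert i I)
 hence "n (f i + sum f I) <= n (f i) + n (sum f I)" by (intro triangle) (auto intro: sum_mem)
 with insert show ?case by auto
qed auto

end

text \<open>The domain of a differentiable map enters only through closure under addition and the sign of
  its gauge; a triangle inequality is needed in the target alone.\<close>

definition gauged :: "'a::real_vector set => ('a => real) => bool" where
 "gauged X n \<longleftrightarrow> (ALL x:X. ALL y:X. x + y : X) & (ALL x:X. ALL c. c *R x : X) & (ALL x:X. 0 <= n x)"

lemma (in seminormed) gauged: "gauged X n" by (auto simp: gauged_def intro: add_mem scale_mem nonneg)

abbreviation fderiv where
 "fderiv X nX Y nY F x A \<equiv> bounded_linear_btw X nX Y nY A \<and>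
    (ALL ep>0. EX de>0. ALL h:X. nX h < de --> nY (F (x + h) - F x - A h) <= ep * nX h)"

lemma fd_memD: "frechet_differentiable X nX Y nY F ==> x : X ==> F x : Y" by (auto simp: frechet_differentiable_def)

lemma fd_deriv:
 assumes "frechet_differentiable X nX Y nY F" "x : X"
 shows "EX A. fderiv X nX Y nY F x A" using assms unfolding frechet_differentiable_def by blast

lemma gauged_nonneg: "gauged X nX ==> x : X ==> 0 <= nX x" by (auto simp: gauged_def)

lemma fdI:
 assumes "!!x. x : X ==> F x : Y" "!!x. x : X ==> EX A. fderiv X nX Y nY F x A"
 shows "frechet_differentiable X nX Y nY F" using assms unfolding frechet_differentiable_def by blast

lemma bl_mem: "bounded_linear_btw X nX Y nY A ==> x : X ==> A x : Y"
 and bl_add: "bounded_linear_btw X nX Y nY A ==> x : X ==> y : X ==> nY (A (x + y) - A x - A y) = 0"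
 and bl_scale: "bounded_linear_btw X nX Y nY A ==> x : X ==> nY (A (c *R x) - c *R A x) = 0"
 by (auto simp: bounded_linear_btw_def)

lemma bl_bound:
 assumes "bounded_linear_btw X nX Y nY A" "!!x. x : X ==> 0 <= nX x"
 shows "EX C>0. ALL x:X. nY (A x) <= C * nX x"
proof -
 obtain C where C: "!!x. x : X ==> nY (A x) <= C * nX x" using assms(1) unfolding bounded_linear_btw_def by blast
 have "nY (A x) <= max C 1 * nX x" if "x : X" for x
  using C[OF that] assms(2)[OF that] mult_right_mono[of C "max C 1" "nX x"] by linarith
 thus ?thesis by (intro exI[of _ "max C 1"]) auto
qed

lemma bl_exactI:
 assumes "!!x. x : X ==> A x : Y" "!!x y. x : X ==> y : X ==> A (x + y) = A x + A y"
  "!!c x. x : X ==> A (c *R x) = c *R A x" "!!x. x : X ==> nY (A x) <= C * nX x" "nY 0 = 0"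
 shows "bounded_linear_btw X nX Y nY A" unfolding bounded_linear_btw_def using assms by (auto intro!: exI[of _ C])

text \<open>Linearity modulo null elements still controls differences.\<close>
lemma bl_diff:
 assumes Y: "seminormed Y nY" and X: "gauged X nX" and A: "bounded_linear_btw X nX Y nY A"
  and x: "x : X" and y: "y : X"
 shows "nY (A x - A y - A (x - y)) = 0"
proof -
 interpret Y: seminormed Y nY by fact
 have d: "x - y : X" using X x y unfolding gauged_def by (metis diff_conv_add_uminus scaleR_minus_left scaleR_one)
 have "nY (A (y + (x - y)) - A y - A (x - y)) = 0" by (rule bl_add[OF A y d])
 thus ?thesis by simp
qed

text \<open>Bounded maps that are linear modulo null elements send null elements to null elements, which is
  what composition requires.\<close>

lemma bl_compose:
 assumes Y: "seminormed Y nY" and Z: "seminormed Z nZ" and X: "gauged X nX"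
  and A: "bounded_linear_btw X nX Y nY A" and B: "bounded_linear_btw Y nY Z nZ B"
 shows "bounded_linear_btw X nX Z nZ (%x. B (A x))"
proof -
 interpret Y: seminormed Y nY by fact
 interpret Z: seminormed Z nZ by fact
 obtain C where C: "C > 0" "!!x. x : X ==> nY (A x) <= C * nX x" using bl_bound[OF A gauged_nonneg[OF X]] by blast
 obtain D where D: "D > 0" "!!x. x : Y ==> nZ (B x) <= D * nY x" using bl_bound[OF B Y.nonneg] by blast
 have Am: "!!x. x : X ==> A x : Y" and Bm: "!!y. y : Y ==> B y : Z" using A B by (auto dest: bl_mem)
 have null: "nZ (B p - B q) = 0" if "p : Y" "q : Y" "nY (p - q) = 0" for p q
 proof -
  have "nZ (B p - B q) <= nZ (B (p - q)) + nZ (B p - B q - B (p - q))"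
   using that Bm by (intro Z.triangle_sub) (auto intro: Z.diff_mem Y.diff_mem)
  also have "... <= D * nY (p - q) + 0"
   using D(2)[of "p - q"] bl_diff[OF Z Y.gauged B that(1,2)] that Y.diff_mem[of p q] by simp
  finally show ?thesis using that Z.nonneg[of "B p - B q"] Bm Z.diff_mem by fastforce
 qed
 show ?thesis unfolding bounded_linear_btw_def
 proof (intro conjI ballI allI)
  show "B (A x) : Z" if "x : X" for x using that Am Bm by auto
  fix x assume x: "x : X"
  { fix y assume y: "y : X"
   have xy: "x + y : X" using X x y by (auto simp: gauged_def)
   have 1: "nY (A (x + y) - (A x + A y)) = 0" using bl_add[OF A x y] by (simp add: diff_diff_eq)
   have 2: "nZ (B (A (x + y)) - B (A x + A y)) = 0"
    by (rule null) (use Am x y xy 1 in \<open>auto intro: Y.add_mem\<close>)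
   have 3: "nZ (B (A x + A y) - B (A x) - B (A y)) = 0" using Am x y by (intro bl_add[OF B]) auto
   have "B (A (x + y)) - B (A x) - B (A y) =
     (B (A (x + y)) - B (A x + A y)) + (B (A x + A y) - B (A x) - B (A y))" by simp
   moreover have "nZ ... <= 0 + 0" by (rule order_trans[OF Z.triangle])
      (use 2 3 Am Bm x y xy in \<open>auto intro!: Z.diff_mem Y.add_mem\<close>)
   ultimately have "nZ (B (A (x + y)) - B (A x) - B (A y)) <= 0" by (simp only: add_0_right)
   moreover have "B (A (x + y)) - B (A x) - B (A y) : Z" using Am Bm x y xy by (auto intro!: Z.diff_mem)
   ultimately show "nZ (B (A (x + y)) - B (A x) - B (A y)) = 0" using Z.nonneg by fastforce }
  { fix c :: real
   have cx: "c *R x : X" using X x by (auto simp: gauged_def)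
   have 2: "nZ (B (A (c *R x)) - B (c *R A x)) = 0"
    by (rule null) (use Am x cx bl_scale[OF A x] in \<open>auto intro: Y.scale_mem\<close>)
   have 3: "nZ (B (c *R A x) - c *R B (A x)) = 0" using Am x by (intro bl_scale[OF B]) auto
   have "B (A (c *R x)) - c *R B (A x) =
     (B (A (c *R x)) - B (c *R A x)) + (B (c *R A x) - c *R B (A x))" by simp
   moreover have "nZ ... <= 0 + 0" by (rule order_trans[OF Z.triangle])
      (use 2 3 Am Bm x cx in \<open>auto intro!: Z.diff_mem Y.scale_mem Z.scale_mem\<close>)
   ultimately have "nZ (B (A (c *R x)) - c *R B (A x)) <= 0" by (simp only: add_0_right)
   moreover have "B (A (c *R x)) - c *R B (A x) : Z" using Am Bm x cx by (auto intro!: Z.diff_mem Z.scale_mem)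
   ultimately show "nZ (B (A (c *R x)) - c *R B (A x)) = 0" using Z.nonneg by fastforce }
 next
  have "nZ (B (A x)) <= (D * C) * nX x" if "x : X" for x
   using D(2)[OF Am[OF that]] mult_left_mono[OF C(2)[OF that] less_imp_le[OF D(1)]] unfolding mult.assoc by linarith
  thus "EX C. ALL x:X. nZ (B (A x)) <= C * nX x" by blast
 qed
qed

lemma fd_chain:
 assumes Y: "seminormed Y nY" and Z: "seminormed Z nZ" and X: "gauged X nX"
  and F: "frechet_differentiable X nX Y nY F" and G: "frechet_differentiable Y nY Z nZ G"
 shows "frechet_differentiable X nX Z nZ (%x. G (F x))"
proof (rule fdI)
 fix x assume x: "x : X"
 interpret Y: seminormed Y nY by fact
 interpret Z: seminormed Z nZ by fact
 show "G (F x) : Z" using fd_memD[OF F x] fd_memD[OF G] by blast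
 have Fm: "!!x. x : X ==> F x : Y" and Gm: "!!x. x : Y ==> G x : Z" using fd_memD[OF F] fd_memD[OF G] by blast+
 obtain A where A: "bounded_linear_btw X nX Y nY A"
  and A': "!!ep. ep > 0 ==> EX de>0. ALL h:X. nX h < de --> nY (F (x + h) - F x - A h) <= ep * nX h"
  using fd_deriv[OF F x] by blast
 obtain B where B: "bounded_linear_btw Y nY Z nZ B"
  and B': "!!ep. ep > 0 ==> EX de>0. ALL h:Y. nY h < de --> nZ (G (F x + h) - G (F x) - B h) <= ep * nY h"
  using fd_deriv[OF G Fm[OF x]] by blast
 obtain C where C: "C > 0" "!!x. x : X ==> nY (A x) <= C * nX x" using bl_bound[OF A gauged_nonneg[OF X]] by blast
 obtain D where D: "D > 0" "!!x. x : Y ==> nZ (B x) <= D * nY x" using bl_bound[OF B Y.nonneg] by blast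
 have "EX de>0. ALL h:X. nX h < de --> nZ (G (F (x + h)) - G (F x) - B (A h)) <= ep * nX h" if e: "ep > 0" for ep
 proof -
  define e1 where "e1 = ep / (2 * (C + 1))"
  define e2 where "e2 = min 1 (ep / (2 * D))"
  have e1: "e1 > 0" and e2: "e2 > 0" using e C D by (auto simp: e1_def e2_def)
  obtain d1 where d1: "d1 > 0" "!!h. h : Y ==> nY h < d1 ==> nZ (G (F x + h) - G (F x) - B h) <= e1 * nY h"
   using B'[OF e1] by blast
  obtain d2 where d2: "d2 > 0" "!!h. h : X ==> nX h < d2 ==> nY (F (x + h) - F x - A h) <= e2 * nX h"
   using A'[OF e2] by blast
  define d where "d = min d2 (d1 / (C + 1))"
  have "nZ (G (F (x + h)) - G (F x) - B (A h)) <= ep * nX h" if h: "h : X" "nX h < d" for h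
  proof -
   have h0: "nX h >= 0" and xh: "x + h : X" using X h x by (auto simp: gauged_def)
   have Ah: "A h : Y" using bl_mem[OF A h(1)] .
   define k where "k = F (x + h) - F x"
   have k: "k : Y" using Fm x xh Y.diff_mem by (auto simp: k_def)
   have r: "nY (k - A h) <= e2 * nX h" using d2(2)[of h] h by (auto simp: k_def d_def)
   have "nY k <= nY (A h) + nY (k - A h)" by (rule Y.triangle_sub) fact+
   also have "... <= C * nX h + 1 * nX h" using C(2)[OF h(1)] r mult_right_mono[of e2 1 "nX h"] h0 by (simp add: e2_def)
   finally have kb: "nY k <= (C + 1) * nX h" by (simp add: algebra_simps)
   also have "... < d1" using h C by (simp add: d_def pos_less_divide_eq mult.commute)
   finally have kd: "nZ (G (F x + k) - G (F x) - B k) <= e1 * nY k" using d1(2) k by auto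
   have kAh: "k - A h : Y" using k Ah Y.diff_mem by auto
   have "nZ (B k - B (A h)) <= nZ (B (k - A h)) + nZ (B k - B (A h) - B (k - A h))"
    using k Ah kAh B by (intro Z.triangle_sub) (auto intro!: Z.diff_mem dest: bl_mem)
   also have "nZ (B k - B (A h) - B (k - A h)) = 0" by (rule bl_diff[OF Z Y.gauged B k Ah])
   also have "nZ (B (k - A h)) + 0 <= D * (e2 * nX h)"
    using order_trans[OF D(2)[OF kAh] mult_left_mono[OF r less_imp_le[OF D(1)]]] by simp
   also have "... <= ep / 2 * nX h"
   proof -
    have "D * e2 <= D * (ep / (2 * D))" using D(1) by (intro mult_left_mono) (auto simp: e2_def)
    hence "D * e2 <= ep / 2" using D(1) by simp
    thus ?thesis using h0 mult_right_mono[of "D * e2" "ep / 2" "nX h"] by (simp add: mult.assoc)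
   qed
   finally have 2: "nZ (B k - B (A h)) <= ep / 2 * nX h" .
   have "e1 * nY k <= e1 * ((C + 1) * nX h)" using kb e1 by simp
   also have "... = ep / 2 * nX h" using C by (simp add: e1_def field_simps)
   finally have 1: "nZ (G (F x + k) - G (F x) - B k) <= ep / 2 * nX h" using kd by simp
   have "G (F (x + h)) - G (F x) - B (A h) = (G (F x + k) - G (F x) - B k) + (B k - B (A h))" by (simp add: k_def)
   moreover have "nZ ... <= nZ (G (F x + k) - G (F x) - B k) + nZ (B k - B (A h))"
    using k Ah B Gm Fm x by (intro Z.triangle) (auto intro!: Z.diff_mem Y.add_mem dest: bl_mem)
   ultimately show ?thesis using 1 2 by simp
  qed
  thus ?thesis using d1 d2 C by (intro exI[of _ d]) (auto simp: d_def)
 qed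
 thus "EX A. fderiv X nX Z nZ (%x. G (F x)) x A" using bl_compose[OF Y Z X A B] by blast
qed

lemma fd_linear:
 assumes Y: "seminormed Y nY" and X: "gauged X nX" and L: "bounded_linear_btw X nX Y nY L"
 shows "frechet_differentiable X nX Y nY L"
proof (rule fdI)
 fix x assume x: "x : X"
 show "L x : Y" using bl_mem[OF L x] .
 have "nY (L (x + h) - L x - L h) <= ep * nX h" if "h : X" "ep > 0" for h ep
  using bl_add[OF L x that(1)] that X by (auto simp: gauged_def)
 thus "EX A. fderiv X nX Y nY L x A" using L by (intro exI[of _ L]) (auto intro: exI[of _ 1])
qed

lemma fd_const:
 assumes Y: "seminormed Y nY" and X: "gauged X nX" and c: "c : Y"
 shows "frechet_differentiable X nX Y nY (%_. c)"
proof (rule fdI)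
 interpret Y: seminormed Y nY by fact
 have "bounded_linear_btw X nX Y nY (%_. 0)" by (rule bl_exactI[where C=0]) (auto intro: Y.zero_mem)
 thus "EX A. fderiv X nX Y nY (%_. c) x A" for x
  using X by (intro exI[of _ "%_. 0"]) (auto simp: gauged_def intro: exI[of _ 1])
qed (rule c)

lemma fd_cong:
 assumes "!!x. x : X ==> F x = G x" "gauged X nX" "frechet_differentiable X nX Y nY G"
 shows "frechet_differentiable X nX Y nY F" using assms unfolding frechet_differentiable_def gauged_def by simp

lemma seminormed_prod:
 assumes Y: "seminormed Y nY" and Z: "seminormed Z nZ"
 shows "seminormed (Y \<times> Z) (%p. nY (fst p) + nZ (snd p))"
proof -
 interpret Y: seminormed Y nY by fact
 interpret Z: seminormed Z nZ by fact
 show ?thesis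
 proof
  fix x y assume "x : Y \<times> Z" "y : Y \<times> Z"
  thus "nY (fst (x + y)) + nZ (snd (x + y)) <= nY (fst x) + nZ (snd x) + (nY (fst y) + nZ (snd y))"
   using Y.triangle[of "fst x" "fst y"] Z.triangle[of "snd x" "snd y"] by auto
 qed (auto simp: Y.add_mem Z.add_mem Y.scale_mem Z.scale_mem Y.zero_mem Z.zero_mem Y.scale Z.scale
     zero_prod_def distrib_left)
qed

lemma fd_pair:
 assumes Y: "seminormed Y nY" and Z: "seminormed Z nZ" and X: "gauged X nX"
  and F: "frechet_differentiable X nX Y nY F" and G: "frechet_differentiable X nX Z nZ G"
 shows "frechet_differentiable X nX (Y \<times> Z) (%p. nY (fst p) + nZ (snd p)) (%x. (F x, G x))"
proof (rule fdI)
 fix x assume x: "x : X"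
 show "(F x, G x) : Y \<times> Z" using fd_memD[OF F x] fd_memD[OF G x] by simp
 obtain A where A: "bounded_linear_btw X nX Y nY A"
  and A': "!!ep. ep > 0 ==> EX de>0. ALL h:X. nX h < de --> nY (F (x + h) - F x - A h) <= ep * nX h"
  using fd_deriv[OF F x] by blast
 obtain B where B: "bounded_linear_btw X nX Z nZ B"
  and B': "!!ep. ep > 0 ==> EX de>0. ALL h:X. nX h < de --> nZ (G (x + h) - G x - B h) <= ep * nX h"
  using fd_deriv[OF G x] by blast
 obtain C where C: "C > 0" "!!x. x : X ==> nY (A x) <= C * nX x" using bl_bound[OF A gauged_nonneg[OF X]] by blast
 obtain D where D: "D > 0" "!!x. x : X ==> nZ (B x) <= D * nX x" using bl_bound[OF B gauged_nonneg[OF X]] by blast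
 have bl: "bounded_linear_btw X nX (Y \<times> Z) (%p. nY (fst p) + nZ (snd p)) (%x. (A x, B x))"
  unfolding bounded_linear_btw_def
 proof (intro conjI)
  have "nY (A x) + nZ (B x) <= (C + D) * nX x" if "x : X" for x
   using C(2)[OF that] D(2)[OF that] by (simp add: distrib_right)
  thus "EX C. ALL x:X. nY (fst (A x, B x)) + nZ (snd (A x, B x)) <= C * nX x" by auto
 qed (use A B in \<open>auto simp: bounded_linear_btw_def\<close>)
 have "EX de>0. ALL h:X. nX h < de --> nY (F (x + h) - F x - A h) + nZ (G (x + h) - G x - B h) <= ep * nX h"
  if "ep > 0" for ep
 proof -
  obtain d where d: "d > 0" "!!h. h\<in>X ==> nX h < d ==> nY (F (x + h) - F x - A h) <= (ep/2) * nX h"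
   using A'[of "ep/2"] \<open>ep > 0\<close> by auto
  obtain d' where d': "d' > 0" "!!h. h\<in>X ==> nX h < d' ==> nZ (G (x + h) - G x - B h) <= (ep/2) * nX h"
   using B'[of "ep/2"] \<open>ep > 0\<close> by auto
  have "nY (F (x + h) - F x - A h) + nZ (G (x + h) - G x - B h) <= ep * nX h"
   if "h : X" "nX h < min d d'" for h using d(2)[of h] d'(2)[of h] that by (auto simp: field_simps)
  thus ?thesis using d(1) d'(1) by (intro exI[of _ "min d d'"]) auto
 qed
 thus "EX A. fderiv X nX (Y \<times> Z) (%p. nY (fst p) + nZ (snd p)) (%x. (F x, G x)) x A"
  using bl by (intro exI[of _ "%x. (A x, B x)"]) auto
qed

definition bounded_bilinear_btw where
 "bounded_bilinear_btw Y nY Z nZ V nV b \<longleftrightarrow>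
   (ALL y:Y. ALL z:Z. b y z : V) \<and>
   (ALL y:Y. ALL y':Y. ALL z:Z. nV (b (y + y') z - b y z - b y' z) = 0) \<and>
   (ALL y:Y. ALL z:Z. ALL z':Z. nV (b y (z + z') - b y z - b y z') = 0) \<and>
   (ALL c. ALL y:Y. ALL z:Z. nV (b (c *R y) z - c *R b y z) = 0) \<and>
   (ALL c. ALL y:Y. ALL z:Z. nV (b y (c *R z) - c *R b y z) = 0) \<and>
   (EX C. ALL y:Y. ALL z:Z. nV (b y z) <= C * nY y * nZ z)"

text \<open>The remainder of a product at \<open>(y, z)\<close> is \<open>b k l\<close> up to null elements, hence quadratic in the
  increment.\<close>
lemma fd_bilinear_map:
 assumes Y: "seminormed Y nY" and Z: "seminormed Z nZ" and V: "seminormed V nV"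
  and b: "bounded_bilinear_btw Y nY Z nZ V nV b"
 shows "frechet_differentiable (Y \<times> Z) (%p. nY (fst p) + nZ (snd p)) V nV (%p. b (fst p) (snd p))"
proof (rule fdI)
 interpret Y: seminormed Y nY by fact
 interpret Z: seminormed Z nZ by fact
 interpret V: seminormed V nV by fact
 have mem: "!!y z. y : Y ==> z : Z ==> b y z : V"
  and add1: "!!y y' z. y : Y ==> y' : Y ==> z : Z ==> nV (b (y + y') z - b y z - b y' z) = 0"
  and add2: "!!y z z'. y : Y ==> z : Z ==> z' : Z ==> nV (b y (z + z') - b y z - b y z') = 0"
  and sc1: "!!c y z. y : Y ==> z : Z ==> nV (b (c *R y) z - c *R b y z) = 0"
  and sc2: "!!c y z. y : Y ==> z : Z ==> nV (b y (c *R z) - c *R b y z) = 0"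
  using b unfolding bounded_bilinear_btw_def by blast+
 obtain C0 where C0: "!!y z. y : Y ==> z : Z ==> nV (b y z) <= C0 * nY y * nZ z"
  using b unfolding bounded_bilinear_btw_def by blast
 define C where "C = max C0 1"
 have C: "nV (b y z) <= C * nY y * nZ z" if "y : Y" "z : Z" for y z
 proof -
  have "C0 * (nY y * nZ z) <= C * (nY y * nZ z)"
   using that Y.nonneg Z.nonneg by (intro mult_right_mono) (auto simp: C_def)
  thus ?thesis using C0[OF that] by (simp add: mult.assoc)
 qed
 have Cpos: "C > 0" by (simp add: C_def)
 have null_add: "nV (p + q) = 0" if "p : V" "q : V" "nV p = 0" "nV q = 0" for p q
  using V.triangle[OF that(1,2)] V.nonneg[OF V.add_mem[OF that(1,2)]] that by simp
 fix x assume "x : Y \<times> Z"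
 then obtain y z where x: "x = (y, z)" and y: "y : Y" and z: "z : Z" by auto
 show "b (fst x) (snd x) : V" using x y z mem by auto
 define A where "A = (%p. b (fst p) z + b y (snd p))"
 have bl: "bounded_linear_btw (Y \<times> Z) (%p. nY (fst p) + nZ (snd p)) V nV A" unfolding bounded_linear_btw_def
 proof (intro conjI ballI allI)
  fix p assume "p : Y \<times> Z"
  hence p: "fst p : Y" "snd p : Z" by auto
  show "A p : V" using p y z mem by (auto simp: A_def intro!: V.add_mem)
  { fix q assume "q : Y \<times> Z"
   hence q: "fst q : Y" "snd q : Z" by auto
   have "A (p + q) - A p - A q = (b (fst p + fst q) z - b (fst p) z - b (fst q) z)
      + (b y (snd p + snd q) - b y (snd p) - b y (snd q))" by (simp add: A_def)
   also have "nV ... = 0" by (rule null_add)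
      (use p q y z mem add1 add2 in \<open>auto intro!: V.diff_mem simp: Y.add_mem Z.add_mem\<close>)
   finally show "nV (A (p + q) - A p - A q) = 0" . }
  { fix c
   have "A (c *R p) - c *R A p = (b (c *R fst p) z - c *R b (fst p) z)
      + (b y (c *R snd p) - c *R b y (snd p))" by (simp add: A_def scaleR_add_right)
   also have "nV ... = 0" by (rule null_add)
      (use p y z mem sc1 sc2 in \<open>auto intro!: V.diff_mem V.scale_mem simp: Y.scale_mem Z.scale_mem\<close>)
   finally show "nV (A (c *R p) - c *R A p) = 0" . }
 next
  have "nV (A p) <= (C * nZ z + C * nY y) * (nY (fst p) + nZ (snd p))" if "p : Y \<times> Z" for p
  proof -
   have p: "fst p : Y" "snd p : Z" using that by auto
   have "nV (A p) <= nV (b (fst p) z) + nV (b y (snd p))" unfolding A_def using p y z mem by (intro V.triangle) auto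
   also have "... <= C * nY (fst p) * nZ z + C * nY y * nZ (snd p)" by (intro add_mono C p y z)
   also have "... <= (C * nZ z + C * nY y) * (nY (fst p) + nZ (snd p))"
   proof -
    have "0 <= C * nZ z * nZ (snd p)" "0 <= C * nY y * nY (fst p)" using p y z Cpos Y.nonneg Z.nonneg by auto
    thus ?thesis by (simp add: algebra_simps)
   qed
   finally show ?thesis .
  qed
  thus "EX C. ALL p:Y \<times> Z. nV (A p) <= C * (nY (fst p) + nZ (snd p))" by blast
 qed
 have "EX de>0. ALL h:Y\<times>Z. nY (fst h) + nZ (snd h) < de -->
   nV (b (fst (x + h)) (snd (x + h)) - b (fst x) (snd x) - A h) <= ep * (nY (fst h) + nZ (snd h))"
  if e: "ep > 0" for ep
 proof -
  have "nV (b (fst (x + h)) (snd (x + h)) - b (fst x) (snd x) - A h) <= ep * (nY (fst h) + nZ (snd h))"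
   if "h : Y \<times> Z" and hd: "nY (fst h) + nZ (snd h) < ep / C" for h
  proof -
   obtain k l where h: "h = (k, l)" and k: "k : Y" and l: "l : Z" using \<open>h : Y \<times> Z\<close> by auto
   have kn: "0 <= nY k" "0 <= nZ l" using k l Y.nonneg Z.nonneg by auto
   have yk: "y + k : Y" and zl: "z + l : Z" using y k z l Y.add_mem Z.add_mem by auto
   let ?E1 = "b (y + k) (z + l) - b y (z + l) - b k (z + l)"
   let ?E2 = "b y (z + l) - b y z - b y l"
   let ?E3 = "b k (z + l) - b k z - b k l"
   have E: "nV ?E1 = 0" "nV ?E2 = 0" "nV ?E3 = 0" using y k z l yk zl add1 add2 by auto
   have Em: "?E1 : V" "?E2 : V" "?E3 : V" "b k l : V" using y k z l yk zl mem by (auto intro!: V.diff_mem)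
   have "b (fst (x + h)) (snd (x + h)) - b (fst x) (snd x) - A h = b k l + (?E1 + (?E2 + ?E3))" by (simp add: x h A_def)
   also have "nV ... <= nV (b k l) + nV (?E1 + (?E2 + ?E3))" using Em by (intro V.triangle V.add_mem) auto
   also have "nV (?E1 + (?E2 + ?E3)) = 0" using Em E by (intro null_add V.add_mem) auto
   also have "nV (b k l) + 0 <= C * nY k * nZ l" using C[OF k l] by simp
   also have "... <= C * (ep / C) * nZ l" using hd kn Cpos unfolding h by (intro mult_right_mono mult_left_mono) auto
   also have "... = ep * nZ l" using Cpos by simp
   also have "... <= ep * (nY (fst h) + nZ (snd h))" using kn e by (simp add: h)
   finally show ?thesis .
  qed
  thus ?thesis using e Cpos by (intro exI[of _ "ep / C"]) auto
 qed
 thus "EX A. fderiv (Y \<times> Z) (%p. nY (fst p) + nZ (snd p)) V nV (%p. b (fst p) (snd p)) x A" using bl by blast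
qed

lemma fd_bilinear:
 assumes Y: "seminormed Y nY" and Z: "seminormed Z nZ" and V: "seminormed V nV" and X: "gauged X nX"
  and b: "bounded_bilinear_btw Y nY Z nZ V nV b"
  and F: "frechet_differentiable X nX Y nY F" and G: "frechet_differentiable X nX Z nZ G"
 shows "frechet_differentiable X nX V nV (%x. b (F x) (G x))"
 using fd_chain[OF seminormed_prod[OF Y Z] V X fd_pair[OF Y Z X F G] fd_bilinear_map[OF Y Z V b]] by simp

lemma fd_add:
 assumes Y: "seminormed Y nY" and X: "gauged X nX"
  and F: "frechet_differentiable X nX Y nY F" and G: "frechet_differentiable X nX Y nY G"
 shows "frechet_differentiable X nX Y nY (%x. F x + G x)"
proof -
 interpret Y: seminormed Y nY by fact
 interpret YY: seminormed "Y \<times> Y" "%p. nY (fst p) + nY (snd p)" by (rule seminormed_prod[OF Y Y])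
 have "bounded_linear_btw (Y \<times> Y) (%p. nY (fst p) + nY (snd p)) Y nY (%p. fst p + snd p)"
  by (rule bl_exactI[where C=1]) (auto intro: Y.add_mem Y.triangle simp: scaleR_add_right)
 from fd_chain[OF seminormed_prod[OF Y Y] Y X fd_pair[OF Y Y X F G] fd_linear[OF Y YY.gauged this]]
 show ?thesis by simp
qed

lemma fd_scale:
 assumes Y: "seminormed Y nY" and X: "gauged X nX" and F: "frechet_differentiable X nX Y nY F"
 shows "frechet_differentiable X nX Y nY (%x. c *R F x)"
proof -
 interpret Y: seminormed Y nY by fact
 have "bounded_linear_btw Y nY Y nY (%p. c *R p)"
  by (rule bl_exactI[where C="\<bar>c\<bar>"]) (auto intro: Y.scale_mem simp: scaleR_add_right Y.scale)
 from fd_chain[OF Y Y X F fd_linear[OF Y Y.gauged this]] show ?thesis .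
qed

lemma fd_diff:
 assumes Y: "seminormed Y nY" and X: "gauged X nX"
  and F: "frechet_differentiable X nX Y nY F" and G: "frechet_differentiable X nX Y nY G"
 shows "frechet_differentiable X nX Y nY (%x. F x - G x)" using fd_add[OF Y X F fd_scale[OF Y X G, of "-1"]] by simp

subsection \<open>The dual of a seminormed space\<close>

text \<open>Only absolute homogeneity of the gauge on the primal space is used here.\<close>

definition homogeneous :: "'a::real_vector set => ('a => real) => bool" where
 "homogeneous X n \<longleftrightarrow> gauged X n & 0 : X & (ALL x:X. ALL c. n (c *R x) = \<bar>c\<bar> * n x)"

lemma (in seminormed) homogeneous: "homogeneous X n" by (auto simp: homogeneous_def gauged scale zero_mem)

lemma dual_spaceI:
 assumes "!!x y. x : X ==> y : X ==> f (x + y) = f x + f y"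
  "!!c x. x : X ==> f (c *R x) = c * f x" "!!x. x : X ==> \<bar>f x\<bar> <= C * nX x"
 shows "f : dual_space X nX" unfolding dual_space_def bounded_linear_btw_def using assms by (auto intro!: exI[of _ C])

lemma dual_spaceD: "f : dual_space X nX ==> bounded_linear_btw X nX UNIV abs f" by (simp add: dual_space_def)

lemma dual_norm_le:
 assumes X: "homogeneous X nX" and f: "!!x. x : X ==> \<bar>f x\<bar> <= C * nX x" "C >= 0"
 shows "dual_norm X nX f <= C" unfolding dual_norm_def
proof (rule cSup_least)
 have "nX 0 = 0" using X unfolding homogeneous_def by (metis abs_zero mult_zero_left scaleR_zero_left)
 thus "{\<bar>f x\<bar> |x. x : X & nX x <= 1} ~= {}" using X by (auto simp: homogeneous_def intro!: exI[of _ 0])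
 fix t assume "t : {\<bar>f x\<bar> |x. x : X & nX x <= 1}"
 then obtain x where "x : X" "nX x <= 1" "t = \<bar>f x\<bar>" by auto
 thus "t <= C" using f(1)[of x] mult_left_mono[of "nX x" 1 C] f(2) by simp
qed

lemma dual_norm_bound:
 assumes X: "homogeneous X nX" and f: "f : dual_space X nX" and x: "x : X"
 shows "\<bar>f x\<bar> <= dual_norm X nX f * nX x"
proof -
 have hom: "!!c x. x : X ==> nX (c *R x) = \<bar>c\<bar> * nX x" and nn: "!!x. x : X ==> 0 <= nX x"
  and sm: "!!c x. x : X ==> c *R x : X" using X by (auto simp: homogeneous_def gauged_def)
 obtain C where C: "C > 0" "!!x. x : X ==> \<bar>f x\<bar> <= C * nX x" using bl_bound[OF dual_spaceD[OF f] nn] by blast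
 show ?thesis
 proof (cases "nX x = 0")
  case True
  thus ?thesis using C(2)[OF x] by simp
 next
  case False
  hence p: "nX x > 0" using nn[OF x] by simp
  let ?y = "(1 / nX x) *R x"
  have y: "?y : X" "nX ?y <= 1" using sm x hom[OF x, of "1 / nX x"] p by auto
  have bdd: "bdd_above {\<bar>f x\<bar> |x. x : X & nX x <= 1}"
  proof (rule bdd_aboveI)
   fix t assume "t : {\<bar>f x\<bar> |x. x : X & nX x <= 1}"
   then obtain x where "x : X" "nX x <= 1" "t = \<bar>f x\<bar>" by auto
   thus "t <= C" using C(2)[of x] mult_left_mono[of "nX x" 1 C] C(1) by linarith
  qed
  have "\<bar>f ?y\<bar> <= dual_norm X nX f" unfolding dual_norm_def by (rule cSup_upper[OF _ bdd]) (use y in blast)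
  moreover have "f ?y = (1 / nX x) * f x" using f x unfolding dual_space_def bounded_linear_btw_def by auto
  ultimately show ?thesis using p by (simp add: abs_mult field_simps)
 qed
qed

lemma seminormed_dual:
 assumes X: "homogeneous X nX"
 shows "seminormed (dual_space X nX) (dual_norm X nX)"
proof -
 have nn: "!!x. x : X ==> 0 <= nX x" and z: "0 : X" using X by (auto simp: homogeneous_def gauged_def)
 have lin: "f (x + y) = f x + f y" "f (c *R x) = c * f x"
  if "f : dual_space X nX" "x : X" "y : X" for f x y c
  using that unfolding dual_space_def bounded_linear_btw_def by force+
 have nn': "dual_norm X nX f >= 0" if "f : dual_space X nX" for f
 proof -
  obtain C where C: "C > 0" "!!x. x : X ==> \<bar>f x\<bar> <= C * nX x"
   using bl_bound[OF dual_spaceD[OF \<open>f : dual_space X nX\<close>] nn] by blast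
  have n0: "nX 0 = 0" using X unfolding homogeneous_def by (metis abs_zero mult_zero_left scaleR_zero_left)
  have bdd: "bdd_above {\<bar>f x\<bar> |x. x : X & nX x <= 1}"
  proof (rule bdd_aboveI)
   fix t assume "t : {\<bar>f x\<bar> |x. x : X & nX x <= 1}"
   then obtain x where "x : X" "nX x <= 1" "t = \<bar>f x\<bar>" by auto
   thus "t <= C" using C(2)[of x] mult_left_mono[of "nX x" 1 C] C(1) by linarith
  qed
  have "\<bar>f 0\<bar> <= dual_norm X nX f" unfolding dual_norm_def by (rule cSup_upper[OF _ bdd]) (use z n0 in force)
  thus ?thesis by simp
 qed
 have b: "!!f x. f : dual_space X nX ==> x : X ==> \<bar>f x\<bar> <= dual_norm X nX f * nX x"
  using dual_norm_bound[OF X] .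
 show ?thesis
 proof
  fix f g assume f: "f : dual_space X nX" and g: "g : dual_space X nX"
  have bb: "\<bar>(f + g) x\<bar> <= (dual_norm X nX f + dual_norm X nX g) * nX x" if "x : X" for x
   using b[OF f that] b[OF g that] by (simp add: distrib_right)
  show "f + g : dual_space X nX" by (rule dual_spaceI[OF _ _ bb]) (auto simp: lin[OF f] lin[OF g] distrib_left)
  show "dual_norm X nX (f + g) <= dual_norm X nX f + dual_norm X nX g"
   by (rule dual_norm_le[OF X bb]) (auto intro: add_nonneg_nonneg nn' f g)
 next
  fix c f assume f: "f : dual_space X nX"
  have sc: "h : dual_space X nX ==> c *R h : dual_space X nX & dual_norm X nX (c *R h) <= \<bar>c\<bar> * dual_norm X nX h" for c h
  proof
   assume h: "h : dual_space X nX"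
   have bb: "\<bar>(c *R h) x\<bar> <= (\<bar>c\<bar> * dual_norm X nX h) * nX x" if "x : X" for x
    using mult_left_mono[OF b[OF h that], of "\<bar>c\<bar>"] by (simp add: abs_mult mult.assoc scaleR_fun_def)
   show "c *R h : dual_space X nX" by (rule dual_spaceI[OF _ _ bb]) (auto simp: lin[OF h] distrib_left scaleR_fun_def)
   show "dual_norm X nX (c *R h) <= \<bar>c\<bar> * dual_norm X nX h"
    by (rule dual_norm_le[OF X bb]) (use nn'[OF h] in auto)
  qed
  show cf: "c *R f : dual_space X nX" using sc f by auto
  show "dual_norm X nX (c *R f) = \<bar>c\<bar> * dual_norm X nX f"
  proof (cases "c = 0")
   case True
   thus ?thesis using sc[OF f, of 0] nn'[OF cf] by simp
  next
   case False
   have "dual_norm X nX f <= \<bar>1/c\<bar> * dual_norm X nX (c *R f)" using sc[OF cf, of "1/c"] False by simp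
   thus ?thesis using sc[OF f, of c] False by (simp add: field_simps abs_mult)
  qed
 next
  show "0 : dual_space X nX" by (rule dual_spaceI[where C=0]) auto
 qed
qed

lemma dual_norm_null:
 assumes X: "homogeneous X nX" and z: "!!x. x : X ==> f x = 0"
 shows "dual_norm X nX f = 0"
proof -
 interpret D: seminormed "dual_space X nX" "dual_norm X nX" by (rule seminormed_dual[OF X])
 have cl: "x + y : X" "c *R x : X" if "x : X" "y : X" for x y c using X that by (auto simp: homogeneous_def gauged_def)
 have f: "f : dual_space X nX" by (rule dual_spaceI[where C=0]) (simp_all add: z cl)
 have "dual_norm X nX f <= 0" by (rule dual_norm_le[OF X]) (simp_all add: z)
 with D.nonneg[OF f] show ?thesis by simp
qed

lemma pairing_bounded_bilinear:
 assumes X: "homogeneous X nX" and Y: "!!y. y : Y ==> 0 <= nY y" and Z: "!!z. z : Z ==> 0 <= nZ z"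
  and l1: "!!y y' z x. y : Y ==> y' : Y ==> z : Z ==> x : X ==> b (y + y') z x = b y z x + b y' z x"
  and l2: "!!c y z x. y : Y ==> z : Z ==> x : X ==> b (c *R y) z x = c * b y z x"
  and m1: "!!y z z' x. y : Y ==> z : Z ==> z' : Z ==> x : X ==> b y (z + z') x = b y z x + b y z' x"
  and m2: "!!c y z x. y : Y ==> z : Z ==> x : X ==> b y (c *R z) x = c * b y z x"
  and r1: "!!y z x x'. y : Y ==> z : Z ==> x : X ==> x' : X ==> b y z (x + x') = b y z x + b y z x'"
  and r2: "!!c y z x. y : Y ==> z : Z ==> x : X ==> b y z (c *R x) = c * b y z x"
  and bd: "!!y z x. y : Y ==> z : Z ==> x : X ==> \<bar>b y z x\<bar> <= C * nY y * nZ z * nX x" and C: "C >= 0"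
 shows "bounded_bilinear_btw Y nY Z nZ (dual_space X nX) (dual_norm X nX) b"
proof -
 interpret D: seminormed "dual_space X nX" "dual_norm X nX" by (rule seminormed_dual[OF X])
 have mem: "b y z : dual_space X nX" if "y : Y" "z : Z" for y z
  using that bd by (intro dual_spaceI[where C="C * nY y * nZ z"]) (auto simp: r1 r2)
 note dd = dual_norm_null[OF X]
 show ?thesis unfolding bounded_bilinear_btw_def
 proof (intro conjI ballI allI)
  have "dual_norm X nX (b y z) <= C * nY y * nZ z" if "y : Y" "z : Z" for y z
   using dual_norm_le[OF X bd[OF that]] C Y Z that by simp
  thus "EX C. ALL y:Y. ALL z:Z. dual_norm X nX (b y z) <= C * nY y * nZ z" by (intro exI[of _ C]) auto
 qed (auto simp: mem l1 l2 m1 m2 scaleR_fun_def intro!: dd)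
qed

section \<open>Lebesgue spaces\<close>

lemma integrable_divide_cancel:
 fixes f :: "'a => real"
 assumes "integrable M (%x. f x / c)" "c > 0"
 shows "integrable M f" using Bochner_Integration.integrable_mult_left[OF assms(1), of c] assms(2) by simp

lemma LpD: "f : Lp M p ==> f : bmeas M" "f : Lp M p ==> integrable M (%x. norm (f x) powr p)" by (auto simp: Lp_def)

lemma Lp_norm_nonneg: "0 <= Lp_norm M p f" by (simp add: Lp_norm_def)

lemma Lp_norm_powr: "p > 0 ==> Lp_norm M p f powr p = (LINT x|M. norm (f x) powr p)"
 by (simp add: Lp_norm_def powr_powr)

lemma Lp_norm_leI: "p > 0 ==> a >= 0 ==> (LINT x|M. norm (f x) powr p) <= a powr p ==> Lp_norm M p f <= a"
 unfolding Lp_norm_def by (rule order_trans[OF powr_mono2[where y="a powr p"]]) (auto simp: powr_powr)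

lemma Lp_dominated:
 assumes g: "g : Lp M p" and f: "f : bmeas M" and le: "AE x in M. norm (f x) <= norm (g x)" and p: "p > 0"
 shows "f : Lp M p" "Lp_norm M p f <= Lp_norm M p g"
proof -
 have le': "AE x in M. norm (f x) powr p <= norm (g x) powr p"
  using le by eventually_elim (use p in \<open>auto intro: powr_mono2\<close>)
 have i: "integrable M (%x. norm (f x) powr p)"
  by (rule Bochner_Integration.integrable_bound[OF LpD(2)[OF g]]) (use f le' in auto)
 thus "f : Lp M p" using f by (auto simp: Lp_def)
 have "(LINT x|M. norm (f x) powr p) <= (LINT x|M. norm (g x) powr p)" by (rule integral_mono_AE[OF i LpD(2)[OF g] le'])
 thus "Lp_norm M p f <= Lp_norm M p g" by (intro Lp_norm_leI) (auto simp: p Lp_norm_nonneg Lp_norm_powr)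
qed

lemma Lp_AE_cong:
 assumes "AE x in M. f x = g x" "f : bmeas M" "g : bmeas M"
 shows "Lp_norm M p f = Lp_norm M p g" "g : Lp M p ==> f : Lp M p"
proof -
 have ae: "AE x in M. norm (f x) powr p = norm (g x) powr p" using assms(1) by eventually_elim auto
 have m: "(%x. norm (f x) powr p) : bmeas M" "(%x. norm (g x) powr p) : bmeas M" using assms(2,3) by measurable
 show "Lp_norm M p f = Lp_norm M p g" unfolding Lp_norm_def using integral_cong_AE[OF m ae] by simp
 show "f : Lp M p" if "g : Lp M p" using that integrable_cong_AE[OF m ae] assms(2) by (simp add: Lp_def)
qed

lemma Lp_norm_eq_0:
 assumes "f : Lp M p" "p > 0" shows "Lp_norm M p f = 0 \<longleftrightarrow> (AE x in M. f x = 0)"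
proof -
 have "Lp_norm M p f = 0 \<longleftrightarrow> (LINT x|M. norm (f x) powr p) = 0" by (simp add: Lp_norm_def)
 also have "... \<longleftrightarrow> (AE x in M. norm (f x) powr p = 0)"
  by (rule integral_nonneg_eq_0_iff_AE[OF LpD(2)[OF assms(1)]]) auto
 finally show ?thesis by simp
qed

lemma Lp_scale:
 assumes "f : Lp M p" "p > 0"
 shows "(%x. c *R f x) : Lp M p" "Lp_norm M p (%x. c *R f x) = \<bar>c\<bar> * Lp_norm M p f"
proof -
 have eq: "norm (c *R f x) powr p = \<bar>c\<bar> powr p * norm (f x) powr p" for x by (simp add: powr_mult)
 have [measurable]: "f : bmeas M" using LpD(1)[OF assms(1)] .
 show "(%x. c *R f x) : Lp M p" using LpD[OF assms(1)] by (simp add: Lp_def powr_mult)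
 show "Lp_norm M p (%x. c *R f x) = \<bar>c\<bar> * Lp_norm M p f"
  using assms(2) by (simp add: Lp_norm_def powr_mult powr_powr)
qed

text \<open>Inequalities between norms are proved for functions of norm at most one. Dividing by
  \<open>Lp_norm M p f + e\<close> instead of \<open>Lp_norm M p f\<close> avoids treating null functions apart.\<close>

lemma Lp_normalized:
 assumes "f : Lp M p" "p > 0" "Lp_norm M p f <= a" "a > 0"
 shows "integrable M (%x. (norm (f x) / a) powr p)" "(LINT x|M. (norm (f x) / a) powr p) <= 1"
proof -
 have eq: "(norm (f x) / a) powr p = norm (f x) powr p / a powr p" for x using assms(4) by (simp add: powr_divide)
 show "integrable M (%x. (norm (f x) / a) powr p)" unfolding eq using LpD(2)[OF assms(1)] by simp
 have "(LINT x|M. norm (f x) powr p) <= a powr p"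
  using assms powr_mono2[of p "Lp_norm M p f" a] by (simp add: Lp_norm_powr[symmetric] Lp_norm_nonneg)
 thus "(LINT x|M. (norm (f x) / a) powr p) <= 1" unfolding eq using assms(4) by simp
qed

lemma powr_convex_combination:
 assumes "p >= 1" "x >= 0" "y >= 0" "0 <= s" "s <= 1"
 shows "(s * x + (1 - s) * y :: real) powr p <= s * x powr p + (1 - s) * y powr p"
proof -
 have le: "t powr p <= t" if "0 <= t" "t <= 1" for t :: real
  using powr_mono'[of 1 p t] that assms(1) by (cases "t = 0") auto
 consider "x = 0" | "y = 0" | "x > 0" "y > 0" using assms by linarith
 thus ?thesis
 proof cases
  case 1
  thus ?thesis using le[of "1 - s"] assms by (auto simp: powr_mult intro!: mult_right_mono)
 next
  case 2
  thus ?thesis using le[of s] assms by (auto simp: powr_mult intro!: mult_right_mono)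
 next
  case 3
  thus ?thesis using convex_onD[OF powr_convex[OF assms(1)], of "1 - s" x y] assms by simp
 qed
qed

lemma Lp_add:
 assumes f: "f : Lp M p" and g: "g : Lp M p" and p: "p >= 1"
 shows "(%x. f x + g x) : Lp M p" "Lp_norm M p (%x. f x + g x) <= Lp_norm M p f + Lp_norm M p g"
proof -
 have [measurable]: "f : bmeas M" "g : bmeas M" using LpD f g by auto
 have main: "integrable M (%x. (norm (f x + g x) / (a + b)) powr p) \<and>
   (LINT x|M. (norm (f x + g x) / (a + b)) powr p) <= 1"
  if a: "Lp_norm M p f <= a" "a > 0" and b: "Lp_norm M p g <= b" "b > 0" for a b
 proof -
  define s where "s = a / (a + b)"
  have s: "0 <= s" "s <= 1" "1 - s = b / (a + b)" using a b by (auto simp: s_def field_simps)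
  have pw: "(norm (f x + g x) / (a + b)) powr p <= s * (norm (f x) / a) powr p + (1 - s) * (norm (g x) / b) powr p" for x
  proof -
   have "norm (f x + g x) / (a + b) <= (norm (f x) + norm (g x)) / (a + b)"
    using a b norm_triangle_ineq by (intro divide_right_mono) auto
   also have "... = s * (norm (f x) / a) + (1 - s) * (norm (g x) / b)"
    using a b unfolding s(3) by (simp add: s_def add_divide_distrib)
   finally have "(norm (f x + g x) / (a + b)) powr p <= (s * (norm (f x) / a) + (1 - s) * (norm (g x) / b)) powr p"
    using p a b by (intro powr_mono2) auto
   also have "... <= s * (norm (f x) / a) powr p + (1 - s) * (norm (g x) / b) powr p"
    using p a b s by (intro powr_convex_combination) auto
   finally show ?thesis .
  qed
  have F: "integrable M (%x. (norm (f x) / a) powr p)" "(LINT x|M. (norm (f x) / a) powr p) <= 1"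
   using Lp_normalized[OF f _ a] p by auto
  have G: "integrable M (%x. (norm (g x) / b) powr p)" "(LINT x|M. (norm (g x) / b) powr p) <= 1"
   using Lp_normalized[OF g _ b] p by auto
  have I: "integrable M (%x. s * (norm (f x) / a) powr p + (1 - s) * (norm (g x) / b) powr p)" using F G by auto
  have J: "integrable M (%x. (norm (f x + g x) / (a + b)) powr p)"
   by (rule Bochner_Integration.integrable_bound[OF I]) (use pw s in \<open>auto intro!: AE_I2 order_trans[OF _ abs_ge_self]\<close>)
  have "(LINT x|M. (norm (f x + g x) / (a + b)) powr p) \<le>
    (LINT x|M. s * (norm (f x) / a) powr p + (1 - s) * (norm (g x) / b) powr p)" by (rule integral_mono[OF J I pw])
  also have "... = s * (LINT x|M. (norm (f x) / a) powr p) + (1 - s) * (LINT x|M. (norm (g x) / b) powr p)"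
   using F G by simp
  also have "... <= s * 1 + (1 - s) * 1" using F G s by (intro add_mono mult_left_mono) auto
  finally show ?thesis using J by simp
 qed
 have eq: "(norm (f x + g x) / c) powr p = norm (f x + g x) powr p / c powr p" if "c > 0" for x c
  using that by (simp add: powr_divide)
 let ?c = "(Lp_norm M p f + 1) + (Lp_norm M p g + 1)"
 have c: "?c > 0" using Lp_norm_nonneg[of M p f] Lp_norm_nonneg[of M p g] by linarith
 have "integrable M (%x. (norm (f x + g x) / ?c) powr p)"
  using main[of "Lp_norm M p f + 1" "Lp_norm M p g + 1"] Lp_norm_nonneg[of M p f] Lp_norm_nonneg[of M p g] by auto
 hence "integrable M (%x. norm (f x + g x) powr p)"
  unfolding eq[OF c] by (rule integrable_divide_cancel) (use c in simp)
 thus "(%x. f x + g x) : Lp M p" by (auto simp: Lp_def)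
 show "Lp_norm M p (%x. f x + g x) <= Lp_norm M p f + Lp_norm M p g"
 proof (rule field_le_epsilon)
  fix e :: real assume e: "e > 0"
  define a where "a = Lp_norm M p f + e/2"
  define b where "b = Lp_norm M p g + e/2"
  have ab: "a > 0" "b > 0" "a + b > 0" "Lp_norm M p f <= a" "Lp_norm M p g <= b"
   using e Lp_norm_nonneg[of M p f] Lp_norm_nonneg[of M p g] by (auto simp: a_def b_def)
  have "(LINT x|M. norm (f x + g x) powr p) / (a + b) powr p <= 1" using main[of a b] ab unfolding eq[OF ab(3)] by auto
  hence "(LINT x|M. norm (f x + g x) powr p) <= (a + b) powr p" using ab by (simp add: divide_le_eq)
  hence "Lp_norm M p (%x. f x + g x) <= a + b" using p ab by (intro Lp_norm_leI) auto
  thus "Lp_norm M p (%x. f x + g x) <= Lp_norm M p f + Lp_norm M p g + e" by (simp add: a_def b_def)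
 qed
qed

lemma Lp_zero: "(%_. 0) : Lp M p" by (auto simp: Lp_def)

lemma seminormed_Lp: "p >= 1 ==> seminormed (Lp M p) (Lp_norm M p)"
 by standard (auto simp: plus_fun_def scaleR_fun_def zero_fun_def Lp_add Lp_scale Lp_zero)

lemma Lp_diff:
 assumes f: "f : Lp M p" and g: "g : Lp M p" and p: "p >= 1"
 shows "(%x. f x - g x) : Lp M p" "Lp_norm M p (%x. f x - g x) <= Lp_norm M p f + Lp_norm M p g"
 using Lp_add[OF f Lp_scale(1)[OF g, of "-1"] p] Lp_scale(2)[OF g, of "-1"] p by auto

lemma Lp_sum:
 assumes "finite I" "!!i. i : I ==> f i : Lp M p" "p >= 1"
 shows "(%x. \<Sum>i\<in>I. f i x) : Lp M p" "Lp_norm M p (%x. \<Sum>i\<in>I. f i x) <= (\<Sum>i\<in>I. Lp_norm M p (f i))"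
proof -
 interpret seminormed "Lp M p" "Lp_norm M p" by (rule seminormed_Lp) fact
 have "(%x. \<Sum>i\<in>I. f i x) = sum f I" by (induction I rule: infinite_finite_induct) (auto simp: fun_eq_iff)
 thus "(%x. \<Sum>i\<in>I. f i x) : Lp M p" "Lp_norm M p (%x. \<Sum>i\<in>I. f i x) <= (\<Sum>i\<in>I. Lp_norm M p (f i))"
  using sum_mem[OF assms(1,2)] triangle_sum[OF assms(1,2)] by auto
qed

lemma Lp_linear_image:
 assumes T: "bounded_linear T" and f: "f : Lp M p" and p: "p >= 1"
 shows "(%x. T (f x)) : Lp M p" "Lp_norm M p (%x. T (f x)) <= onorm T * Lp_norm M p f"
proof -
 have [measurable]: "f : bmeas M" using LpD(1)[OF f] .
 have c: "continuous_on UNIV T" using T by (simp add: linear_continuous_on)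
 have m: "(%x. T (f x)) : bmeas M" using measurable_compose[OF LpD(1)[OF f] borel_contI[OF c]] .
 have le: "AE x in M. norm (T (f x)) <= norm (onorm T *R f x)" using onorm[OF T] onorm_pos_le[OF T] by auto
 note D = Lp_dominated[OF Lp_scale(1)[OF f, of "onorm T"] m le]
 show "(%x. T (f x)) : Lp M p" using D(1) p by simp
 show "Lp_norm M p (%x. T (f x)) <= onorm T * Lp_norm M p f"
  using D(2) Lp_scale(2)[OF f, of "onorm T"] onorm_pos_le[OF T] p by simp
qed

lemma bl_Lp_linear_image:
 assumes T: "bounded_linear T" and p: "p >= 1"
 shows "bounded_linear_btw (Lp M p) (Lp_norm M p) (Lp M p) (Lp_norm M p) (%f x. T (f x))"
proof -
 interpret T: bounded_linear T by fact
 show ?thesis by (rule bl_exactI[where C="onorm T"])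
    (auto simp: seminormed.n_zero[OF seminormed_Lp[OF p]] Lp_linear_image[OF T _ p] T.add T.scaleR scaleR_fun_def fun_eq_iff)
qed

lemma Lp_component:
 fixes f :: "'a => 'b::euclidean_space ^ 'n"
 shows "f : Lp M p ==> p >= 1 ==> (%x. f x $ i) : Lp M p"
  "f : Lp M p ==> p >= 1 ==> Lp_norm M p (%x. f x $ i) <= Lp_norm M p f"
proof -
 assume f: "f : Lp M p" and p: "p >= 1"
 have m: "(%x. f x $ i) : bmeas M" using measurable_compose[OF LpD(1)[OF f] borel_contI[of "%y. y $ i"]]
  by (simp add: continuous_on_component)
 note D = Lp_dominated[OF f m]
 show "(%x. f x $ i) : Lp M p" "Lp_norm M p (%x. f x $ i) <= Lp_norm M p f"
  using D p by (auto simp: Finite_Cartesian_Product.norm_nth_le)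
qed

lemma Lp_componentsI:
 fixes f :: "'a => 'b::euclidean_space ^ 'n"
 assumes f: "!!i. (%x. f x $ i) : Lp M p" and p: "p >= 1"
 shows "f : Lp M p" "Lp_norm M p f <= (\<Sum>i\<in>UNIV. Lp_norm M p (%x. f x $ i))"
proof -
 have ax: "bounded_linear (%y::'b. axis i y :: 'b ^ 'n)" for i
  by (rule bounded_linearI'[where 'a='b]) (auto simp: vec_eq_iff axis_def)
 have na: "norm (axis i y :: 'b ^ 'n) = norm y" for i and y :: 'b
  unfolding norm_vec_def L2_set_def axis_def by (simp add: if_distrib[of norm] if_distrib[of "%t. t^2"] cong: if_cong)
 have fi: "(%x. axis i (f x $ i) :: 'b ^ 'n) : Lp M p" for i using Lp_linear_image(1)[OF ax f p] .
 have ni: "Lp_norm M p (%x. axis i (f x $ i) :: 'b ^ 'n) = Lp_norm M p (%x. f x $ i)" for i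
  by (simp add: Lp_norm_def na)
 have eq: "f = (%x. \<Sum>i\<in>UNIV. axis i (f x $ i))"
  by (auto simp: fun_eq_iff vec_eq_iff axis_def sum_component if_distrib cong: if_cong)
 show "f : Lp M p" by (subst eq, rule Lp_sum(1)) (use fi p in auto)
 show "Lp_norm M p f <= (\<Sum>i\<in>UNIV. Lp_norm M p (%x. f x $ i))"
  by (subst eq, rule order_trans[OF Lp_sum(2)]) (use fi ni p in auto)
qed

lemma Lp_mono_exponent:
 assumes M: "finite_measure M" and q: "1 <= q" "q <= p" and f: "f : Lp M p"
 shows "f : Lp M q" "Lp_norm M q f <= (measure M (space M) + 1) * Lp_norm M p f"
proof -
 interpret finite_measure M by fact
 have [measurable]: "f : bmeas M" using LpD(1)[OF f] .
 have main: "integrable M (%x. (norm (f x) / a) powr q) \<and>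
   (LINT x|M. (norm (f x) / a) powr q) <= measure M (space M) + 1"
  if a: "Lp_norm M p f <= a" "a > 0" for a
 proof -
  have F: "integrable M (%x. (norm (f x) / a) powr p)" "(LINT x|M. (norm (f x) / a) powr p) <= 1"
   using Lp_normalized[OF f _ a] q by auto
  have pw: "(norm (f x) / a) powr q <= 1 + (norm (f x) / a) powr p" for x
  proof (cases "norm (f x) / a <= 1")
   case True
   hence "(norm (f x) / a) powr q <= 1 powr q" using a q by (intro powr_mono2) auto
   also have "... = 1" by simp
   finally show ?thesis using powr_ge_zero[of "norm (f x) / a" p] by linarith
  next
   case False
   hence "(norm (f x) / a) powr q <= (norm (f x) / a) powr p" using q by (intro powr_mono) auto
   thus ?thesis by simp
  qed
  have I: "integrable M (%x. 1 + (norm (f x) / a) powr p)" using F by auto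
  have J: "integrable M (%x. (norm (f x) / a) powr q)"
   by (rule Bochner_Integration.integrable_bound[OF I]) (use pw in \<open>auto intro!: AE_I2 order_trans[OF _ abs_ge_self]\<close>)
  have "(LINT x|M. (norm (f x) / a) powr q) <= (LINT x|M. 1 + (norm (f x) / a) powr p)"
   by (rule integral_mono[OF J I pw])
  also have "... <= measure M (space M) + 1" using F by simp
  finally show ?thesis using J by simp
 qed
 have eq: "(norm (f x) / a) powr q = norm (f x) powr q / a powr q" if "a > 0" for x a
  using that by (simp add: powr_divide)
 have c: "Lp_norm M p f + 1 > 0" using Lp_norm_nonneg[of M p f] by linarith
 have "integrable M (%x. (norm (f x) / (Lp_norm M p f + 1)) powr q)" using main[of "Lp_norm M p f + 1"] c by auto
 hence "integrable M (%x. norm (f x) powr q)" unfolding eq[OF c] by (rule integrable_divide_cancel) (use c in simp)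
 thus "f : Lp M q" by (auto simp: Lp_def)
 let ?m = "measure M (space M) + 1"
 have m1: "?m >= 1" by simp
 have "Lp_norm M q f <= ?m * (Lp_norm M p f + e)" if e: "e > 0" for e
 proof -
  define a where "a = Lp_norm M p f + e"
  have a: "Lp_norm M p f <= a" "a > 0" using e Lp_norm_nonneg[of M p f] by (auto simp: a_def)
  have "(LINT x|M. norm (f x) powr q) <= ?m * a powr q"
   using main[OF a] a unfolding eq[OF a(2)] by (simp add: divide_le_eq)
  also have "... <= ?m powr q * a powr q" using m1 q powr_mono[of 1 q ?m] by (intro mult_right_mono) auto
  also have "... = (?m * a) powr q" using m1 a by (simp add: powr_mult)
  finally show ?thesis using q a m1 unfolding a_def[symmetric] by (intro Lp_norm_leI) auto
 qed
 hence *: "!!e. e > 0 ==> Lp_norm M q f <= ?m * Lp_norm M p f + ?m * e" by (simp add: distrib_left)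
 have "Lp_norm M q f <= ?m * Lp_norm M p f + e" if "e > 0" for e
 proof -
  have "?m > 0" using m1 by linarith
  hence "e / ?m > 0" "?m * (e / ?m) = e" using that by (auto intro: divide_pos_pos)
  with *[of "e / ?m"] show ?thesis by simp
 qed
 thus "Lp_norm M q f <= ?m * Lp_norm M p f" by (rule field_le_epsilon)
qed

lemma bl_Lp_mono_exponent:
 assumes M: "finite_measure M" and q: "1 <= q" "q <= p"
 shows "bounded_linear_btw (Lp M p) (Lp_norm M p) (Lp M q) (Lp_norm M q) (%f. f)"
proof -
 interpret seminormed "Lp M q :: ('a => 'b) set" "Lp_norm M q" by (rule seminormed_Lp) fact
 show ?thesis by (rule bl_exactI[where C="measure M (space M) + 1"])
    (auto intro: Lp_mono_exponent[OF M q])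
qed

subsection \<open>Products\<close>

lemma young_3_2_6:
 fixes x y z :: real
 assumes "x >= 0" "y >= 0" "z >= 0"
 shows "x * y * z <= x ^ 3 + y^2 + z ^ 6"
proof -
 have "0 <= (x - z^2)^2 * (2 * x + z^2)" using assms by auto
 also have "... = 2 * x ^ 3 - 3 * (x * z)^2 + z ^ 6"
  by (simp add: power2_eq_square power3_eq_cube algebra_simps power_numeral_reduce)
 finally have 1: "3 * (x * z)^2 <= 2 * x ^ 3 + z ^ 6" by simp
 have "0 <= (y - x * z)^2" by simp
 hence 2: "2 * (x * y * z) <= y^2 + (x * z)^2" by (simp add: power2_eq_square algebra_simps)
 have "0 <= x ^ 3" "0 <= y^2" "0 <= z ^ 6" using assms by auto
 with 1 2 show ?thesis by linarith
qed

text \<open>The factor 3 comes from bounding the product of normalised functions by the sum of their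
  powers.\<close>

lemma Holder_3_2_6:
 fixes f :: "'a => 'b::euclidean_space" and g :: "'a => 'c::euclidean_space" and h :: "'a => 'd::euclidean_space"
 assumes f: "f : Lp M 3" and g: "g : Lp M 2" and h: "h : Lp M 6"
 shows "integrable M (%x. norm (f x) * norm (g x) * norm (h x))"
  "(LINT x|M. norm (f x) * norm (g x) * norm (h x)) <= 3 * (Lp_norm M 3 f * Lp_norm M 2 g * Lp_norm M 6 h)"
proof -
 have [measurable]: "f : bmeas M" "g : bmeas M" "h : bmeas M" using LpD f g h by auto
 have main: "integrable M (%x. norm (f x) * norm (g x) * norm (h x)) \<and>
   (LINT x|M. norm (f x) * norm (g x) * norm (h x)) <= 3 * (a * b * c)"
  if a: "Lp_norm M 3 f <= a" "a > 0" and b: "Lp_norm M 2 g <= b" "b > 0" and c: "Lp_norm M 6 h <= c" "c > 0" for a b c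
 proof -
  have F: "integrable M (%x. (norm (f x) / a) ^ 3)" "(LINT x|M. (norm (f x) / a) ^ 3) <= 1"
   using Lp_normalized[OF f _ a] a by auto
  have G: "integrable M (%x. (norm (g x) / b)^2)" "(LINT x|M. (norm (g x) / b)^2) <= 1"
   using Lp_normalized[OF g _ b] b by auto
  have H: "integrable M (%x. (norm (h x) / c) ^ 6)" "(LINT x|M. (norm (h x) / c) ^ 6) <= 1"
   using Lp_normalized[OF h _ c] c by auto
  let ?r = "%x. (norm (f x) / a) ^ 3 + (norm (g x) / b)^2 + (norm (h x) / c) ^ 6"
  have I: "integrable M (%x. a * b * c * ?r x)" using F G H by auto
  have pw: "norm (f x) * norm (g x) * norm (h x) <= a * b * c * ?r x" for x
  proof -
   have "norm (f x) * norm (g x) * norm (h x) = a * b * c * ((norm (f x) / a) * (norm (g x) / b) * (norm (h x) / c))"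
    using a b c by simp
   also have "... <= a * b * c * ?r x" using a b c by (intro mult_left_mono young_3_2_6) auto
   finally show ?thesis .
  qed
  have J: "integrable M (%x. norm (f x) * norm (g x) * norm (h x))"
   by (rule Bochner_Integration.integrable_bound[OF I]) (use pw in \<open>auto intro!: AE_I2 order_trans[OF _ abs_ge_self]\<close>)
  have "(LINT x|M. norm (f x) * norm (g x) * norm (h x)) <= (LINT x|M. a * b * c * ?r x)"
   by (rule integral_mono[OF J I pw])
  also have "... = a * b * c * ((LINT x|M. (norm (f x) / a) ^ 3) + (LINT x|M. (norm (g x) / b)^2) + (LINT x|M. (norm (h x) / c) ^ 6))"
   using F G H by simp
  also have "... <= a * b * c * 3" using F G H a b c by (intro mult_left_mono) auto
  finally show ?thesis using J by simp
 qed
 let ?A = "Lp_norm M 3 f" and ?B = "Lp_norm M 2 g" and ?C = "Lp_norm M 6 h"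
 have nn: "?A >= 0" "?B >= 0" "?C >= 0" by (auto simp: Lp_norm_nonneg)
 show "integrable M (%x. norm (f x) * norm (g x) * norm (h x))" using main[of "?A + 1" "?B + 1" "?C + 1"] nn by auto
 have lim: "((%e. 3 * ((?A + e) * (?B + e) * (?C + e))) \<longlongrightarrow> 3 * ((?A + 0) * (?B + 0) * (?C + 0))) (at_right 0)"
  by (intro tendsto_intros)
 have "eventually (%e. (LINT x|M. norm (f x) * norm (g x) * norm (h x)) <= 3 * ((?A + e) * (?B + e) * (?C + e))) (at_right 0)"
  unfolding eventually_at_right_field using main[of "?A + _" "?B + _" "?C + _"] nn by (intro exI[of _ 1]) auto
 from tendsto_lowerbound[OF lim this] show
  "(LINT x|M. norm (f x) * norm (g x) * norm (h x)) <= 3 * (?A * ?B * ?C)" by simp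
qed

lemma L2_integrable_sq: "f : Lp M 2 \<longleftrightarrow> f : bmeas M & integrable M (%x. (norm (f x))^2)"
 by (simp add: Lp_def)

lemma L2_norm_sq: "(Lp_norm M 2 f)^2 = (LINT x|M. (norm (f x))^2)"
 using Lp_norm_powr[of 2 M f] by (simp add: Lp_norm_nonneg)

lemma L2_prod:
 fixes f :: "'a => 'b::euclidean_space" and g :: "'a => 'c::euclidean_space"
 assumes f: "f : Lp M 2" and g: "g : Lp M 2"
 shows "integrable M (%x. norm (f x) * norm (g x))"
  "(LINT x|M. norm (f x) * norm (g x)) <= Lp_norm M 2 f * Lp_norm M 2 g"
proof -
 have [measurable]: "f : bmeas M" "g : bmeas M" using LpD f g by auto
 have F: "integrable M (%x. (norm (f x))^2)" and G: "integrable M (%x. (norm (g x))^2)"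
  using f g by (auto simp: L2_integrable_sq)
 have pw: "norm (f x) * norm (g x) <= (norm (f x))^2 + (norm (g x))^2" for x
  using sum_squares_bound[of "norm (f x)" "norm (g x)"] mult_nonneg_nonneg[OF norm_ge_zero[of "f x"] norm_ge_zero[of "g x"]]
  by linarith
 show i: "integrable M (%x. norm (f x) * norm (g x))"
  by (rule Bochner_Integration.integrable_bound[OF Bochner_Integration.integrable_add[OF F G]]) (use pw in \<open>auto intro!: AE_I2 order_trans[OF _ abs_ge_self]\<close>)
 have "(\<integral>\<^sup>+x. ennreal (norm (f x)) * ennreal (norm (g x)) \<partial>M)^2 \<le>
   (\<integral>\<^sup>+x. (ennreal (norm (f x)))^2 \<partial>M) * (\<integral>\<^sup>+x. (ennreal (norm (g x)))^2 \<partial>M)"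
  by (rule Cauchy_Schwarz_nn_integral) auto
 also have "(\<integral>\<^sup>+x. (ennreal (norm (f x)))^2 \<partial>M) = ennreal ((Lp_norm M 2 f)^2)"
  using nn_integral_eq_integral[OF F] by (simp add: L2_norm_sq ennreal_power)
 also have "(\<integral>\<^sup>+x. (ennreal (norm (g x)))^2 \<partial>M) = ennreal ((Lp_norm M 2 g)^2)"
  using nn_integral_eq_integral[OF G] by (simp add: L2_norm_sq ennreal_power)
 also have "(\<integral>\<^sup>+x. ennreal (norm (f x)) * ennreal (norm (g x)) \<partial>M) = ennreal (LINT x|M. norm (f x) * norm (g x))"
  using nn_integral_eq_integral[OF i] by (simp add: ennreal_mult)
 finally have "(LINT x|M. norm (f x) * norm (g x))^2 <= (Lp_norm M 2 f)^2 * (Lp_norm M 2 g)^2"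
  by (simp add: ennreal_power ennreal_mult[symmetric])
 thus "(LINT x|M. norm (f x) * norm (g x)) <= Lp_norm M 2 f * Lp_norm M 2 g"
  using power2_le_imp_le[of "LINT x|M. norm (f x) * norm (g x)" "Lp_norm M 2 f * Lp_norm M 2 g"]
  by (simp add: power_mult_distrib Lp_norm_nonneg del: power_mono_iff)
qed

lemma L2_inner:
 assumes f: "f : Lp M 2" and g: "g : Lp M 2"
 shows "integrable M (%x. f x \<bullet> g x)" "\<bar>L2_inner M f g\<bar> <= Lp_norm M 2 f * Lp_norm M 2 g"
proof -
 have [measurable]: "f : bmeas M" "g : bmeas M" using LpD f g by auto
 show i: "integrable M (%x. f x \<bullet> g x)"
  by (rule Bochner_Integration.integrable_bound[OF L2_prod(1)[OF f g]]) (auto simp: Cauchy_Schwarz_ineq2)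
 have "\<bar>L2_inner M f g\<bar> <= (LINT x|M. norm (f x \<bullet> g x))"
  unfolding L2_inner_def using integral_norm_bound[of M "%x. f x \<bullet> g x"] by simp
 also have "... <= (LINT x|M. norm (f x) * norm (g x))"
  by (rule integral_mono[OF integrable_norm[OF i] L2_prod(1)[OF f g]]) (auto simp: Cauchy_Schwarz_ineq2)
 finally show "\<bar>L2_inner M f g\<bar> <= Lp_norm M 2 f * Lp_norm M 2 g" using L2_prod(2)[OF f g] by linarith
qed

subsection \<open>Essentially bounded functions\<close>

lemma Linf_bound: "f : Linf M ==> AE x in M. \<bar>f x\<bar> <= Linf_norm M f"
proof -
 assume f: "f : Linf M"
 hence fin: "esssup M (%x. ereal \<bar>f x\<bar>) < \<infinity>" by (auto simp: Linf_def)
 show ?thesis using esssup_AE[where M=M and f="%x. ereal \<bar>f x\<bar>"]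
 proof eventually_elim
  case (elim x)
  thus ?case unfolding Linf_norm_def using fin by (cases "esssup M (%x. ereal \<bar>f x\<bar>)") auto
 qed
qed

lemma LinfI:
 assumes "f : bmeas M" "AE x in M. \<bar>f x\<bar> <= c" "c >= 0"
 shows "f : Linf M" "Linf_norm M f <= c"
proof -
 have "esssup M (%x. ereal \<bar>f x\<bar>) <= ereal c" by (rule esssup_I) (use assms in auto)
 thus "f : Linf M" "Linf_norm M f <= c" using assms unfolding Linf_def Linf_norm_def
  by (cases "esssup M (%x. ereal \<bar>f x\<bar>)"; auto)+
qed

lemma Linf_meas: "f : Linf M ==> f : bmeas M" by (auto simp: Linf_def)

lemma Linf_norm_nonneg: "f : Linf M ==> 0 <= Linf_norm M f"
proof -
 assume f: "f : Linf M"
 show ?thesis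
 proof (cases "emeasure M (space M) = 0")
  case True
  hence "AE x in M. ereal \<bar>f x\<bar> <= -\<infinity>" by (metis ae_filter_eq_bot_iff eventually_bot)
  hence "esssup M (%x. ereal \<bar>f x\<bar>) <= -\<infinity>" using Linf_meas[OF f] by (intro esssup_I) auto
  thus ?thesis by (simp add: Linf_norm_def)
 next
  case False
  then obtain x where "\<bar>f x\<bar> <= Linf_norm M f"
   using eventually_happens'[OF _ Linf_bound[OF f]] ae_filter_eq_bot_iff by blast
  thus ?thesis by auto
 qed
qed

lemma seminormed_Linf: "seminormed (Linf M) (Linf_norm M)"
proof
 fix f g :: "'a => real" assume f: "f : Linf M" and g: "g : Linf M"
 have [measurable]: "f : bmeas M" "g : bmeas M" using Linf_meas f g by auto
 have ae: "AE x in M. \<bar>(f + g) x\<bar> <= Linf_norm M f + Linf_norm M g"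
  using Linf_bound[OF f] Linf_bound[OF g] by eventually_elim auto
 have m: "f + g : bmeas M" by (simp add: plus_fun_def)
 show "f + g : Linf M" "Linf_norm M (f + g) <= Linf_norm M f + Linf_norm M g"
  using LinfI[OF m ae] Linf_norm_nonneg[OF f] Linf_norm_nonneg[OF g] by (auto simp del: plus_fun_apply)
next
 fix f :: "'a => real" and c assume f: "f : Linf M"
 have sc: "c *R h : Linf M & Linf_norm M (c *R h) <= \<bar>c\<bar> * Linf_norm M h" if h: "h : Linf M" for c h
 proof -
  have [measurable]: "h : bmeas M" using Linf_meas h by auto
  have ae: "AE x in M. \<bar>(c *R h) x\<bar> <= \<bar>c\<bar> * Linf_norm M h"
   using Linf_bound[OF h] by eventually_elim (auto simp: scaleR_fun_def abs_mult intro: mult_left_mono)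
  have m: "c *R h : bmeas M" by (simp add: scaleR_fun_def)
  show ?thesis using LinfI[OF m ae] Linf_norm_nonneg[OF h] by auto
 qed
 show cf: "c *R f : Linf M" using sc f by auto
 show "Linf_norm M (c *R f) = \<bar>c\<bar> * Linf_norm M f"
 proof (cases "c = 0")
  case True
  thus ?thesis using sc[OF f, of 0] Linf_norm_nonneg[OF cf] by simp
 next
  case False
  have "Linf_norm M f <= \<bar>1/c\<bar> * Linf_norm M (c *R f)" using sc[OF cf, of "1/c"] False by simp
  thus ?thesis using sc[OF f, of c] False by (simp add: field_simps abs_mult)
 qed
next
 show "0 : Linf M" using LinfI(1)[of "%_. 0" M 0] by (simp add: zero_fun_def)
qed

lemma Linf_times_Lp:
 assumes f: "f : Linf M" and g: "g : Lp M p" and p: "p > 0"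
 shows "(%x. f x *R g x) : Lp M p" "Lp_norm M p (%x. f x *R g x) <= Linf_norm M f * Lp_norm M p g"
proof -
 have [measurable]: "f : bmeas M" "g : bmeas M" using Linf_meas f LpD g by auto
 have le: "AE x in M. norm (f x *R g x) <= norm (Linf_norm M f *R g x)"
  using Linf_bound[OF f] by eventually_elim (use Linf_norm_nonneg[OF f] in \<open>auto intro: mult_right_mono\<close>)
 have m: "(%x. f x *R g x) : bmeas M" by measurable
 show "(%x. f x *R g x) : Lp M p" "Lp_norm M p (%x. f x *R g x) <= Linf_norm M f * Lp_norm M p g"
  using Lp_dominated[OF Lp_scale(1)[OF g p] m le p] Lp_scale(2)[OF g p] Linf_norm_nonneg[OF f] by auto
qed

lemma bb_Linf_Lp:
 assumes p: "p >= 1"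
 shows "bounded_bilinear_btw (Linf M) (Linf_norm M) (Lp M p) (Lp_norm M p) (Lp M p) (Lp_norm M p)
   (%f g x. f x *R g x)"
proof -
 interpret seminormed "Lp M p :: ('a => 'b) set" "Lp_norm M p" by (rule seminormed_Lp[OF p])
 have z: "Lp_norm M p (%x. 0 :: 'b) = 0" using n_zero by (simp add: zero_fun_def)
 show ?thesis unfolding bounded_bilinear_btw_def using p Linf_times_Lp[where M=M and p=p]
  by (auto simp: scaleR_fun_def plus_fun_def fun_diff_def algebra_simps z intro!: exI[of _ 1])
qed

lemma bb_Linf_Linf:
 "bounded_bilinear_btw (Linf M) (Linf_norm M) (Linf M) (Linf_norm M) (Linf M) (Linf_norm M) (%f g x. f x * g x)"
proof -
 interpret seminormed "Linf M" "Linf_norm M" by (rule seminormed_Linf)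
 have z: "Linf_norm M (%x. 0) = 0" using n_zero by (simp add: zero_fun_def)
 have *: "(%x. f x * g x) : Linf M & Linf_norm M (%x. f x * g x) <= Linf_norm M f * Linf_norm M g"
  if f: "f : Linf M" and g: "g : Linf M" for f g
 proof -
  have [measurable]: "f : bmeas M" "g : bmeas M" using Linf_meas f g by auto
  have "AE x in M. \<bar>f x * g x\<bar> <= Linf_norm M f * Linf_norm M g"
   using Linf_bound[OF f] Linf_bound[OF g] by eventually_elim (auto simp: abs_mult intro: mult_mono)
  thus ?thesis using Linf_norm_nonneg[OF f] Linf_norm_nonneg[OF g] by (auto intro!: LinfI)
 qed
 show ?thesis unfolding bounded_bilinear_btw_def
  using * by (auto simp: scaleR_fun_def plus_fun_def fun_diff_def algebra_simps z intro!: exI[of _ 1])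
qed

lemma bl_Linf_Lp:
 assumes M: "finite_measure M" and p: "p >= 1"
 shows "bounded_linear_btw (Linf M) (Linf_norm M) (Lp M p) (Lp_norm M p) (%f x. f x *R a)"
proof -
 interpret finite_measure M by fact
 interpret seminormed "Lp M p :: ('a => 'b) set" "Lp_norm M p" by (rule seminormed_Lp[OF p])
 have a: "(%_. a) : Lp M p" by (auto simp: Lp_def)
 show ?thesis by (rule bl_exactI[where C="Lp_norm M p (%_. a)"])
    (use p Linf_times_Lp[OF _ a] in \<open>auto simp: fun_eq_iff algebra_simps scaleR_fun_def\<close>)
qed

subsection \<open>Superposition operators\<close>

lemma borel_measurable_deriv:
 assumes "!!x. g differentiable (at (x::real))"
 shows "deriv g : bmeas borel"
proof (rule borel_measurable_LIMSEQ_real)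
 have g: "(g has_real_derivative deriv g x) (at x)" for x
  using assms[of x] by (simp add: DERIV_deriv_iff_real_differentiable)
 have c: "continuous_on UNIV g" using g by (auto intro!: continuous_at_imp_continuous_on DERIV_isCont)
 show "(%x. real (Suc n) * (g (x + 1 / real (Suc n)) - g x)) : bmeas borel" for n
  by (intro borel_contI continuous_intros continuous_on_compose2[OF c]) auto
 fix x :: real
 have "((%h. (g (x + h) - g x) / h) \<longlongrightarrow> deriv g x) (at 0)" using g[of x] by (simp add: DERIV_def)
 moreover have "filterlim (%n. 1 / real (Suc n)) (at 0) sequentially"
  unfolding filterlim_at using LIMSEQ_inverse_real_of_nat by (auto simp: inverse_eq_divide)
 ultimately have "(%n. (g (x + 1 / real (Suc n)) - g x) / (1 / real (Suc n))) ----> deriv g x"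
  by (rule filterlim_compose)
 thus "(%n. real (Suc n) * (g (x + 1 / real (Suc n)) - g x)) ----> deriv g x" by (simp add: mult.commute)
qed

lemma mvt_bound:
 assumes g: "!!x. (g has_real_derivative g' x) (at (x::real))"
  and b: "!!s. \<bar>s\<bar> <= \<bar>h\<bar> ==> \<bar>g' (a + s) - c\<bar> <= L"
 shows "\<bar>g (a + h) - g a - c * h\<bar> <= L * \<bar>h\<bar>"
proof (cases "h = 0")
 case False
 have "EX z. \<bar>z - a\<bar> <= \<bar>h\<bar> & g (a + h) - g a = h * g' z"
 proof (cases "h > 0")
  case True
  then obtain z where "a < z" "z < a + h" "g (a + h) - g a = (a + h - a) * g' z" using MVT2[of a "a + h" g g'] g by auto
  thus ?thesis by (intro exI[of _ z]) auto
 next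
  case h: False
  then obtain z where "a + h < z" "z < a" "g a - g (a + h) = (a - (a + h)) * g' z"
   using MVT2[of "a + h" a g g'] g False by auto
  thus ?thesis by (intro exI[of _ z]) auto
 qed
 then obtain z where z: "\<bar>z - a\<bar> <= \<bar>h\<bar>" "g (a + h) - g a = h * g' z" by blast
 hence "g (a + h) - g a - c * h = (g' (a + (z - a)) - c) * h" by (simp add: algebra_simps)
 moreover have "\<bar>g' (a + (z - a)) - c\<bar> <= L" using b z by blast
 ultimately show ?thesis by (simp add: abs_mult mult_right_mono)
qed simp

text \<open>On the bounded set of values taken near a given function the derivative is uniformly
  continuous, which makes the mean value remainder uniformly small.\<close>

lemma fd_superposition_Linf:
 assumes g: "!!x. (g has_real_derivative g' x) (at (x::real))" and g': "continuous_on UNIV g'"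
 shows "frechet_differentiable (Linf M) (Linf_norm M) (Linf M) (Linf_norm M) (%f x. g (f x))"
proof (rule fdI)
 interpret seminormed "Linf M" "Linf_norm M" by (rule seminormed_Linf)
 have gc: "continuous_on UNIV g" using g by (auto intro!: continuous_at_imp_continuous_on DERIV_isCont)
 have mem: "(%x. k (f x)) : Linf M" if k: "continuous_on UNIV k" and f: "f : Linf M" for k :: "real => real" and f
 proof -
  obtain c where c: "!!t. \<bar>t\<bar> <= Linf_norm M f ==> \<bar>k t\<bar> <= c"
  proof -
   have "compact (k ` {-Linf_norm M f..Linf_norm M f})"
    by (intro compact_continuous_image continuous_on_subset[OF k]) auto
   then obtain c where "!!y. y : k ` {-Linf_norm M f..Linf_norm M f} ==> norm y <= c"
    using compact_imp_bounded bounded_iff by metis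
   thus ?thesis by (intro that[of c]) (auto simp: abs_le_iff)
  qed
  show ?thesis
  proof (rule LinfI)
   show "(%x. k (f x)) : bmeas M" using measurable_compose[OF Linf_meas[OF f] borel_contI[OF k]] .
   show "AE x in M. \<bar>k (f x)\<bar> <= max c 0" using Linf_bound[OF f] by eventually_elim (use c in fastforce)
  qed auto
 qed
 fix f assume f: "f : Linf M"
 show "(%x. g (f x)) : Linf M" by (rule mem[OF gc f])
 have g'f: "(%x. g' (f x)) : Linf M" by (rule mem[OF g' f])
 define A where "A = (%h x. g' (f x) * h x)"
 have bb: "(%x. p x * q x) : Linf M & Linf_norm M (%x. p x * q x) <= Linf_norm M p * Linf_norm M q"
  if p: "p : Linf M" and q: "q : Linf M" for p q
 proof -
  have [measurable]: "p : bmeas M" "q : bmeas M" using Linf_meas p q by auto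
  have "AE x in M. \<bar>p x * q x\<bar> <= Linf_norm M p * Linf_norm M q"
   using Linf_bound[OF p] Linf_bound[OF q] by eventually_elim (auto simp: abs_mult intro: mult_mono)
  thus ?thesis using Linf_norm_nonneg[OF p] Linf_norm_nonneg[OF q] by (auto intro!: LinfI)
 qed
 have Am: "A h : Linf M" if "h : Linf M" for h using bb[OF g'f that] by (simp add: A_def)
 have A: "bounded_linear_btw (Linf M) (Linf_norm M) (Linf M) (Linf_norm M) A"
  by (rule bl_exactI[where C="Linf_norm M (%x. g' (f x))"])
   (use bb[OF g'f] in \<open>auto simp: A_def fun_eq_iff algebra_simps scaleR_fun_def\<close>)
 have "EX de>0. ALL h:Linf M. Linf_norm M h < de -->
   Linf_norm M ((%x. g ((f + h) x)) - (%x. g (f x)) - A h) <= e * Linf_norm M h" if e: "e > 0" for e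
 proof -
  let ?K = "{- (Linf_norm M f + 1)..Linf_norm M f + 1}"
  have "uniformly_continuous_on ?K g'" by (intro compact_uniformly_continuous continuous_on_subset[OF g']) auto
  then obtain d where d: "d > 0" "!!s t. s : ?K ==> t : ?K ==> dist t s < d ==> dist (g' t) (g' s) < e"
   using e unfolding uniformly_continuous_on_def by metis
  have "Linf_norm M ((%x. g ((f + h) x)) - (%x. g (f x)) - A h) <= e * Linf_norm M h"
   if h: "h : Linf M" and hd: "Linf_norm M h < min d 1" for h
  proof (rule LinfI)
   have "(%x. g ((f + h) x)) : Linf M" by (rule mem[OF gc add_mem[OF f h]])
   thus "(%x. g ((f + h) x)) - (%x. g (f x)) - A h : bmeas M" using mem[OF gc f] Am[OF h] by (intro Linf_meas diff_mem)
   show "AE x in M. \<bar>((%x. g ((f + h) x)) - (%x. g (f x)) - A h) x\<bar> <= e * Linf_norm M h"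
    using Linf_bound[OF f] Linf_bound[OF h]
   proof eventually_elim
    case (elim x)
    have "\<bar>g (f x + h x) - g (f x) - g' (f x) * h x\<bar> <= e * \<bar>h x\<bar>"
    proof (rule mvt_bound[OF g])
     fix s assume s: "\<bar>s\<bar> <= \<bar>h x\<bar>"
     have "dist (g' (f x + s)) (g' (f x)) < e" using s elim hd by (intro d(2)) (auto simp: dist_real_def abs_le_iff)
     thus "\<bar>g' (f x + s) - g' (f x)\<bar> <= e" by (simp add: dist_real_def)
    qed
    also have "... <= e * Linf_norm M h" using elim e by simp
    finally show ?case by (simp add: A_def fun_diff_def)
   qed
   show "0 <= e * Linf_norm M h" using e Linf_norm_nonneg[OF h] by simp
  qed
  thus ?thesis using d(1) by (intro exI[of _ "min d 1"]) auto
 qed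
 thus "EX A. fderiv (Linf M) (Linf_norm M) (Linf M) (Linf_norm M) (%f x. g (f x)) f A" using A by blast
qed

text \<open>If the derivative exists everywhere but may be discontinuous, the difference quotients still
  converge pointwise. They are bounded, so dominated convergence gives differentiability into a
  weaker space.\<close>

lemma fd_superposition_L2:
 assumes M: "finite_measure M" and g: "!!x. (g has_real_derivative g' x) (at (x::real))"
  and b: "!!R. EX L. ALL x. \<bar>x\<bar> <= R --> \<bar>g' x\<bar> <= L"
 shows "frechet_differentiable (Linf M) (Linf_norm M) (Lp M 2) (Lp_norm M 2) (%f x. g (f x))"
proof (rule fdI)
 interpret finite_measure M by fact
 interpret Li: seminormed "Linf M" "Linf_norm M" by (rule seminormed_Linf)
 interpret L2: seminormed "Lp M 2 :: ('a => real) set" "Lp_norm M 2" by (rule seminormed_Lp) simp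
 have gc: "continuous_on UNIV g" using g by (auto intro!: continuous_at_imp_continuous_on DERIV_isCont)
 have gm: "g : bmeas borel" using gc by (rule borel_contI)
 have g'e: "g' = deriv g" using g DERIV_imp_deriv by (metis ext)
 have g'm: "g' : bmeas borel" unfolding g'e by (rule borel_measurable_deriv) (use g real_differentiable_def in blast)
 have L2I: "f : Lp M 2" if "f : bmeas M" "AE x in M. \<bar>f x\<bar> <= c" for f :: "'a => real" and c
 proof -
  have "(%_. c) : Lp M 2" by (auto simp: Lp_def)
  moreover have "AE x in M. norm (f x) <= norm c" using that(2) by eventually_elim auto
  ultimately show ?thesis using that(1) by (auto intro: Lp_dominated)
 qed
 fix f assume f: "f : Linf M"
 have [measurable]: "f : bmeas M" using Linf_meas[OF f] .
 define N where "N = Linf_norm M f"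
 have N: "N >= 0" using Linf_norm_nonneg[OF f] by (simp add: N_def)
 obtain L where L: "!!x. \<bar>x\<bar> <= N + 1 ==> \<bar>g' x\<bar> <= L" using b by blast
 have L0: "L >= 0" using L[of 0] N by fastforce
 have lip: "\<bar>g (a + h) - g a\<bar> <= L * \<bar>h\<bar>" if "\<bar>a\<bar> <= N" "\<bar>h\<bar> <= 1" for a h
  using mvt_bound[OF g, of h a 0 L] L that by fastforce
 have "compact (g ` {-N..N})" by (intro compact_continuous_image continuous_on_subset[OF gc]) auto
 then obtain c where c: "!!y. y : g ` {-N..N} ==> norm y <= c" using compact_imp_bounded bounded_iff by metis
 show mem: "(%x. g (f x)) : Lp M 2"
 proof (rule L2I)
  show "(%x. g (f x)) : bmeas M" using gm by measurable
  show "AE x in M. \<bar>g (f x)\<bar> <= c"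
   using Linf_bound[OF f] by eventually_elim (use c in \<open>auto simp: N_def abs_le_iff\<close>)
 qed
 define A where "A = (%h x. g' (f x) * h x)"
 have [measurable]: "(%x. g' (f x)) : bmeas M" using g'm by measurable
 have g'f: "(%x. g' (f x)) : Lp M 2"
  by (rule L2I[where c=L]) (use Linf_bound[OF f] in \<open>auto simp: N_def[symmetric] intro!: L elim: eventually_mono\<close>)
 have A: "bounded_linear_btw (Linf M) (Linf_norm M) (Lp M 2) (Lp_norm M 2) A"
  by (rule bl_exactI[where C="Lp_norm M 2 (%x. g' (f x))"])
   (use Linf_times_Lp[OF _ g'f] in \<open>auto simp: A_def fun_eq_iff algebra_simps scaleR_fun_def\<close>)
 have "EX de>0. ALL h:Linf M. Linf_norm M h < de -->
   Lp_norm M 2 ((%x. g ((f + h) x)) - (%x. g (f x)) - A h) <= e * Linf_norm M h" if e: "e > 0" for e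
 proof (rule ccontr)
  assume neg: "\<not> ?thesis"
  have "EX h:Linf M. Linf_norm M h < 1 / real (Suc n) \<and>
    \<not> Lp_norm M 2 ((%x. g ((f + h) x)) - (%x. g (f x)) - A h) <= e * Linf_norm M h" for n
   using neg by (auto dest!: spec[of _ "1 / real (Suc n)"])
  then obtain h where h: "!!n. h n : Linf M" "!!n. Linf_norm M (h n) < 1 / real (Suc n)"
   "!!n. e * Linf_norm M (h n) < Lp_norm M 2 ((%x. g ((f + h n) x)) - (%x. g (f x)) - A (h n))" by (metis not_le)
  define R where "R = (%n x. g (f x + h n x) - g (f x) - g' (f x) * h n x)"
  have hm[measurable]: "h n : bmeas M" for n using Linf_meas[OF h(1)] .
  have Rm[measurable]: "R n : bmeas M" for n unfolding R_def using gm by measurable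
  have h3: "e * Linf_norm M (h n) < Lp_norm M 2 (R n)" for n using h(3)[of n] by (simp add: R_def A_def fun_diff_def)
  have ae: "AE x in M. ALL n. \<bar>h n x\<bar> <= Linf_norm M (h n)"
   using Linf_bound[OF h(1)] by (simp add: AE_all_countable)
  have Rb: "AE x in M. ALL n. \<bar>R n x\<bar> <= 2 * L * \<bar>h n x\<bar>" using ae Linf_bound[OF f]
  proof eventually_elim
   case (elim x)
   show ?case
   proof
    fix n
    have "1 / real (Suc n) <= 1" by simp
    hence "\<bar>h n x\<bar> <= 1" using elim(1)[rule_format, of n] h(2)[of n] by linarith
    hence "\<bar>g (f x + h n x) - g (f x)\<bar> <= L * \<bar>h n x\<bar>" using elim(2) by (intro lip) (auto simp: N_def)
    moreover have "\<bar>g' (f x) * h n x\<bar> <= L * \<bar>h n x\<bar>"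
     using L[of "f x"] elim(2) by (auto simp: abs_mult N_def intro!: mult_right_mono)
    ultimately show "\<bar>R n x\<bar> <= 2 * L * \<bar>h n x\<bar>" unfolding R_def by linarith
   qed
  qed
  have pos: "Linf_norm M (h n) > 0" for n
  proof (rule ccontr)
   assume "\<not> ?thesis"
   hence 0: "Linf_norm M (h n) = 0" using Linf_norm_nonneg[OF h(1)[of n]] by simp
   have "AE x in M. R n x = 0" using ae Rb
    by eventually_elim (use 0 in \<open>metis abs_le_zero_iff mult_zero_right abs_zero\<close>)
   hence "Lp_norm M 2 (R n) = Lp_norm M 2 (%_. 0 :: real)" by (rule Lp_AE_cong(1)) auto
   also have "... = 0" by (simp add: Lp_norm_def)
   finally have "Lp_norm M 2 (R n) = 0" .
   thus False using h3[of n] 0 by simp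
  qed
  define q where "q = (%n x. R n x / Linf_norm M (h n))"
  have qm[measurable]: "q n : bmeas M" for n by (simp add: q_def)
  have qb: "AE x in M. \<bar>q n x\<bar> <= 2 * L" for n using ae Rb
  proof eventually_elim
   case (elim x)
   have "\<bar>R n x\<bar> <= 2 * L * Linf_norm M (h n)"
    using order_trans[OF elim(2)[rule_format] mult_left_mono[OF elim(1)[rule_format]]] L0 by simp
   thus ?case using pos[of n] by (simp add: q_def abs_divide divide_le_eq)
  qed
  have ql: "AE x in M. (%n. q n x) ----> 0" using ae
  proof eventually_elim
   case (elim x)
   have h0: "(%n. h n x) ----> 0"
   proof (rule Lim_null_comparison[OF _ LIMSEQ_inverse_real_of_nat])
    show "\<forall>\<^sub>F n in sequentially. norm (h n x) <= inverse (real (Suc n))"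
     using order_trans[OF elim[rule_format] less_imp_le[OF h(2)]]
     by (intro always_eventually) (simp add: inverse_eq_divide)
   qed
   show ?case
   proof (rule LIMSEQ_I)
    fix r :: real assume r: "r > 0"
    have "((%k. (g (f x + k) - g (f x)) / k) \<longlongrightarrow> g' (f x)) (at 0)" using g[of "f x"] by (simp add: DERIV_def)
    then obtain d where d: "d > 0" "!!k. k ~= 0 ==> \<bar>k\<bar> < d ==> \<bar>(g (f x + k) - g (f x)) / k - g' (f x)\<bar> < r"
     using r unfolding LIM_def by (metis diff_zero dist_real_def)
    obtain n0 where n0: "!!n. n >= n0 ==> \<bar>h n x\<bar> < d" using LIMSEQ_D[OF h0 d(1)] by auto
    have "norm (q n x - 0) < r" if "n >= n0" for n
    proof (cases "h n x = 0")
     case True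
     thus ?thesis using r by (simp add: q_def R_def)
    next
     case False
     have "R n x = ((g (f x + h n x) - g (f x)) / h n x - g' (f x)) * h n x"
      using False by (simp add: R_def field_simps)
     hence "\<bar>R n x\<bar> <= \<bar>(g (f x + h n x) - g (f x)) / h n x - g' (f x)\<bar> * Linf_norm M (h n)"
      using elim[rule_format, of n] by (simp add: abs_mult mult_left_mono)
     hence "\<bar>q n x\<bar> <= \<bar>(g (f x + h n x) - g (f x)) / h n x - g' (f x)\<bar>"
      using pos[of n] by (simp add: q_def abs_divide divide_le_eq)
     also have "... < r" using d(2) False n0[OF that] by blast
     finally show ?thesis by simp
    qed
    thus "EX no. ALL n>=no. norm (q n x - 0) < r" by blast
   qed
  qed
  have "(%n. LINT x|M. (q n x)^2) ----> (LINT x|M. 0)"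
  proof (rule integral_dominated_convergence[where w="%_. (2 * L)^2"])
   show "AE x in M. (%n. (q n x)^2) ----> 0" using ql by eventually_elim (auto intro: tendsto_eq_intros)
   show "AE x in M. norm ((q n x)^2) <= (2 * L)^2" for n
    using qb[of n] by eventually_elim (metis abs_ge_zero norm_power power2_abs power_mono real_norm_def)
  qed auto
  hence lim: "(%n. LINT x|M. (q n x)^2) ----> 0" by simp
  have "e^2 < (LINT x|M. (q n x)^2)" for n
  proof -
   have "(e * Linf_norm M (h n))^2 < (Lp_norm M 2 (R n))^2" using h3[of n] e pos[of n] by (intro power_strict_mono) auto
   also have "... = (LINT x|M. (Linf_norm M (h n))^2 * (q n x)^2)"
    unfolding L2_norm_sq using pos[of n] by (simp add: q_def power_divide)
   finally show ?thesis using pos[of n] by (simp add: power_mult_distrib mult.commute)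
  qed
  hence "e^2 <= 0" using lim by (intro LIMSEQ_le_const[OF lim]) (auto intro: less_imp_le)
  thus False using e by simp
 qed
 thus "EX A. fderiv (Linf M) (Linf_norm M) (Lp M 2) (Lp_norm M 2) (%f x. g (f x)) f A" using A by blast
qed

subsection \<open>Completeness of \<open>L\<^sup>2\<close>\<close>

lemma L2_complete:
 fixes f :: "nat => 'a => real"
 assumes f: "!!n. f n : Lp M 2"
  and cauchy: "!!e. e > 0 ==> EX N. ALL m>=N. ALL n>=N. Lp_norm M 2 (f m - f n) < e"
 shows "EX g:Lp M 2. (%n. Lp_norm M 2 (f n - g)) ----> 0"
proof -
 interpret L2: seminormed "Lp M 2 :: ('a => real) set" "Lp_norm M 2" by (rule seminormed_Lp) simp
 have fm[measurable]: "f n : bmeas M" for n using LpD(1)[OF f] .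
 have sq: "(\<integral>\<^sup>+x. ennreal ((h x)^2) \<partial>M) = ennreal ((Lp_norm M 2 h)^2)" if "h : Lp M 2" for h :: "'a => real"
  using that nn_integral_eq_integral[of M "%x. (h x)^2"] by (simp add: L2_integrable_sq L2_norm_sq)
 have "EX N. ALL m>=N. ALL n>=N. Lp_norm M 2 (f m - f n) < 1 / 4 ^ k" for k using cauchy[of "1 / 4 ^ k"] by simp
 then obtain N where N: "!!k m n. m >= N k ==> n >= N k ==> Lp_norm M 2 (f m - f n) < 1 / 4 ^ k" by metis
 (* increasing, and beyond the index at which the sequence oscillates by less than 1 / 4 ^ k *)
 define s where "s = (%k. k + Max (N ` {..k}))"
 have sN: "N k <= s k" "s k <= s (Suc k)" "k <= s k" for k
 proof -
  have "Max (N ` {..k}) <= Max (N ` {..Suc k})" by (rule Max_mono) auto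
  thus "s k <= s (Suc k)" unfolding s_def by linarith
 qed (auto simp: s_def intro!: Max_ge trans_le_add2)
 define d where "d = (%k x. f (s (Suc k)) x - f (s k) x)"
 have dm: "d k : Lp M 2" for k unfolding d_def using Lp_diff[OF f f] by simp
 have dn: "Lp_norm M 2 (d k) < 1 / 4 ^ k" for k
  using N[of k "s (Suc k)" "s k"] sN(1)[of k] sN(2)[of k] by (simp add: d_def fun_diff_def)
 have [measurable]: "d k : bmeas M" for k using LpD(1)[OF dm] .
  text \<open>Weights \<open>4\<^sup>k\<close> make the sum of the squares finite almost everywhere, so the increments of the
    subsequence are dominated by a geometric series.\<close>
 have "(\<integral>\<^sup>+x. (\<Sum>k. ennreal (4 ^ k * (d k x)^2)) \<partial>M) = (\<Sum>k. \<integral>\<^sup>+x. ennreal (4 ^ k * (d k x)^2) \<partial>M)"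
  by (rule nn_integral_suminf) measurable
 also have "... = (\<Sum>k. ennreal (4 ^ k * (Lp_norm M 2 (d k))^2))"
  by (simp add: ennreal_mult nn_integral_cmult sq[OF dm])
 also have "... <= (\<Sum>k. ennreal ((1/4) ^ k))"
 proof (intro suminf_le allI ennreal_leI)
  fix k
  have "(Lp_norm M 2 (d k))^2 <= (1 / 4 ^ k)^2" using dn[of k] Lp_norm_nonneg by (intro power_mono) auto
  hence "4 ^ k * (Lp_norm M 2 (d k))^2 <= 4 ^ k * (1 / 4 ^ k)^2" by (intro mult_left_mono) auto
  also have "... = (1/4) ^ k" by (simp add: power2_eq_square power_divide)
  finally show "4 ^ k * (Lp_norm M 2 (d k))^2 <= (1/4) ^ k" .
 qed auto
 also have "... < \<infinity>" by (subst suminf_ennreal2) (auto intro!: summable_geometric)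
 finally have "AE x in M. (\<Sum>k. ennreal (4 ^ k * (d k x)^2)) ~= \<infinity>" by (intro nn_integral_PInf_AE) auto
 hence conv: "AE x in M. convergent (%k. f (s k) x)"
 proof eventually_elim
  case (elim x)
  have b: "\<bar>d k x\<bar> <= (1 + enn2real (\<Sum>k. ennreal (4 ^ k * (d k x)^2))) * (1/2) ^ k" for k
  proof -
   let ?S = "enn2real (\<Sum>k. ennreal (4 ^ k * (d k x)^2))"
   have "ennreal (4 ^ k * (d k x)^2) <= (\<Sum>k. ennreal (4 ^ k * (d k x)^2))"
    by (rule order_trans[OF _ sum_le_suminf[OF summableI, of "{k}"]]) simp_all
   also have "... = ennreal ?S" using elim by (simp add: less_top)
   finally have "4 ^ k * (d k x)^2 <= ?S" by (simp add: enn2real_nonneg)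
   also have "... <= (1 + ?S)^2" by (simp add: power2_eq_square algebra_simps enn2real_nonneg)
   also have "4 ^ k * (d k x)^2 = (2 ^ k * \<bar>d k x\<bar>)^2"
   proof -
    have "(2 ^ k)^2 = (4::real) ^ k" by (simp add: power2_eq_square flip: power_mult_distrib)
    thus ?thesis by (simp add: power_mult_distrib)
   qed
   finally have "2 ^ k * \<bar>d k x\<bar> <= 1 + ?S" by (rule power2_le_imp_le) (simp add: enn2real_nonneg)
   thus ?thesis by (simp add: power_divide field_simps)
  qed
  have "summable (%k. d k x)"
   by (rule summable_comparison_test'[of "%k. (1 + enn2real (\<Sum>k. ennreal (4 ^ k * (d k x)^2))) * (1/2) ^ k"])
     (use b in \<open>auto intro!: summable_mult summable_geometric\<close>)
  hence "convergent (%n. \<Sum>k<n. d k x)" by (simp add: summable_iff_convergent)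
  hence "convergent (%n. f (s n) x - f (s 0) x)" by (simp add: d_def sum_lessThan_telescope[of "%n. f (s n) x"])
  from convergent_add[OF this convergent_const[of "f (s 0) x"]] show ?case by simp
 qed
 define g where "g = (%x. lim (%k. f (s k) x))"
 have gm[measurable]: "g : bmeas M" unfolding g_def by measurable
 have gl: "AE x in M. (%k. f (s k) x) ----> g x" using conv by eventually_elim (simp add: g_def convergent_LIMSEQ_iff)
 have bound: "(\<integral>\<^sup>+x. ennreal ((f n x - g x)^2) \<partial>M) <= ennreal (e^2)"
  if e: "e > 0" and n: "n >= n0" and n0: "!!m n. m >= n0 ==> n >= n0 ==> Lp_norm M 2 (f m - f n) < e" for e n n0
 proof -
  have "(\<integral>\<^sup>+x. ennreal ((f n x - g x)^2) \<partial>M) = (\<integral>\<^sup>+x. liminf (%k. ennreal ((f n x - f (s k) x)^2)) \<partial>M)"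
  proof (rule nn_integral_cong_AE)
   show "AE x in M. ennreal ((f n x - g x)^2) = liminf (%k. ennreal ((f n x - f (s k) x)^2))" using gl
   proof eventually_elim
    case (elim x)
    have "(%k. ennreal ((f n x - f (s k) x)^2)) ----> ennreal ((f n x - g x)^2)" by (intro tendsto_intros elim)
    from lim_imp_Liminf[OF _ this] show ?case by simp
   qed
  qed
  also have "... <= liminf (%k. \<integral>\<^sup>+x. ennreal ((f n x - f (s k) x)^2) \<partial>M)"
   by (rule nn_integral_liminf) measurable
  also have "... <= ennreal (e^2)"
  proof (rule Liminf_le)
   have "(\<integral>\<^sup>+x. ennreal ((f n x - f (s k) x)^2) \<partial>M) <= ennreal (e^2)" if "k >= n0" for k
   proof -
    have "Lp_norm M 2 (f n - f (s k)) < e" using n0[OF n, of "s k"] sN(3)[of k] that by simp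
    hence "(Lp_norm M 2 (f n - f (s k)))^2 <= e^2" using Lp_norm_nonneg by (intro power_mono) auto
    thus ?thesis using sq[OF L2.diff_mem[OF f[of n] f[of "s k"]]] by (simp add: fun_diff_def)
   qed
   thus "\<forall>\<^sub>F k in sequentially. (\<integral>\<^sup>+x. ennreal ((f n x - f (s k) x)^2) \<partial>M) <= ennreal (e^2)"
    unfolding eventually_sequentially by blast
  qed simp
  finally show ?thesis .
 qed
 have fin: "f n - g : Lp M 2 & Lp_norm M 2 (f n - g) <= e"
  if e: "e > 0" and n: "n >= n0" and n0: "!!m n. m >= n0 ==> n >= n0 ==> Lp_norm M 2 (f m - f n) < e" for e n n0
 proof -
  have b: "(\<integral>\<^sup>+x. ennreal ((f n x - g x)^2) \<partial>M) <= ennreal (e^2)" by (rule bound[OF e n n0])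
  also have "... < \<infinity>" by simp
  finally have "integrable M (%x. (f n x - g x)^2)" by (intro integrableI_bounded) auto
  hence m: "f n - g : Lp M 2" by (auto simp: L2_integrable_sq fun_diff_def)
  have "ennreal ((Lp_norm M 2 (f n - g))^2) <= ennreal (e^2)" using b sq[OF m] by (simp add: fun_diff_def)
  hence "(Lp_norm M 2 (f n - g))^2 <= e^2" by simp
  hence "Lp_norm M 2 (f n - g) <= e" by (rule power2_le_imp_le) (use e in simp)
  with m show ?thesis by simp
 qed
 show ?thesis
 proof
  obtain n0 where n0: "!!m n. m >= n0 ==> n >= n0 ==> Lp_norm M 2 (f m - f n) < 1" using cauchy[of 1] by auto
  have "f n0 - g : Lp M 2" using fin[of 1 n0 n0] n0 by auto
  from L2.diff_mem[OF f[of n0] this] show "g : Lp M 2" by simp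
  show "(%n. Lp_norm M 2 (f n - g)) ----> 0"
  proof (rule LIMSEQ_I)
   fix r :: real assume r: "r > 0"
   then obtain n0 where n0: "!!m n. m >= n0 ==> n >= n0 ==> Lp_norm M 2 (f m - f n) < r/2" using cauchy[of "r/2"] by auto
   have "norm (Lp_norm M 2 (f n - g) - 0) < r" if "n >= n0" for n
    using fin[of "r/2" n0 n] n0 that r Lp_norm_nonneg[of M 2 "f n - g"] by auto
   thus "EX no. ALL n>=no. norm (Lp_norm M 2 (f n - g) - 0) < r" by blast
  qed
 qed
qed

section \<open>Existence of Bochner integrals\<close>

lemma simple_integral_vec_eq: "simple_integral_vec M s = Bochner_Integration.simple_bochner_integral M s"
 unfolding simple_integral_vec_def simple_bochner_integral_def
 by (intro sum.cong arg_cong2[where f=scaleR] arg_cong2[where f=measure]) auto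

lemma (in seminormed) simple_integral_bound:
 assumes M: "finite_measure M" and s: "simple_function M s" "!!t. t : space M ==> s t : X"
 shows "simple_integral_vec M s : X"
  "ennreal (n (simple_integral_vec M s)) <= (\<integral>\<^sup>+t. ennreal (n (s t)) \<partial>M)"
proof -
 interpret finite_measure M by fact
 have fin: "finite (s ` space M)" using s(1) by (simp add: simple_function_def)
 have sb: "Bochner_Integration.simple_bochner_integrable M s"
  by (rule simple_bochner_integrable.intros[OF s(1)]) (simp add: emeasure_eq_measure)
 show "simple_integral_vec M s : X"
  unfolding simple_integral_vec_def using fin s(2) by (intro sum_mem) (auto intro: scale_mem)
 have sf: "simple_function M (%t. \<bar>n (s t)\<bar>)" using simple_function_compose1[OF s(1), of "%y. \<bar>n y\<bar>"] .
 have sb': "Bochner_Integration.simple_bochner_integrable M (%t. \<bar>n (s t)\<bar>)"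
  by (rule simple_bochner_integrable.intros[OF sf]) (simp add: emeasure_eq_measure)
 have "n (simple_integral_vec M s) <= (\<Sum>y\<in>s ` space M. n (measure M {x : space M. s x = y} *R y))"
  unfolding simple_integral_vec_eq simple_bochner_integral_def
  using fin s(2) by (intro triangle_sum) (auto intro: scale_mem)
 also have "... = (\<Sum>y\<in>s ` space M. measure M {x : space M. s x = y} *R \<bar>n y\<bar>)"
  using s(2) by (intro sum.cong) (auto simp: scale nonneg)
 also have "... = Bochner_Integration.simple_bochner_integral M (%t. \<bar>n (s t)\<bar>)"
  by (rule simple_bochner_integral_partition[symmetric, OF sb' s(1)]) auto
 finally have "ennreal (n (simple_integral_vec M s)) <= ennreal (Bochner_Integration.simple_bochner_integral M (%t. \<bar>n (s t)\<bar>))"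
  by (rule ennreal_leI)
 also have "... = (\<integral>\<^sup>+t. ennreal \<bar>n (s t)\<bar> \<partial>M)"
  by (rule simple_bochner_integral_eq_nn_integral[OF sb']) simp
 also have "... = (\<integral>\<^sup>+t. ennreal (n (s t)) \<partial>M)"
  using s(2) by (intro nn_integral_cong) (auto simp: nonneg)
 finally show "ennreal (n (simple_integral_vec M s)) <= (\<integral>\<^sup>+t. ennreal (n (s t)) \<partial>M)" .
qed

text \<open>The approximating simple functions are truncated where their norm exceeds twice that of the
  limit. The distance to the limit need not be measurable a priori; almost everywhere it is a limit
  of distances between simple functions.\<close>

lemma (in seminormed) is_bochner_integral_bochner_integral:
 assumes complete: "!!f. (!!k. f k : X) ==>
   (!!e. e > 0 ==> EX N. ALL i>=N. ALL j>=N. n (f i - f j) < e) ==> EX g:X. (%k::nat. n (f k - g)) ----> 0"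
  and M: "finite_measure M" and f: "strongly_measurable M X n f" and sq: "integrable M (%t. (n (f t))^2)"
 shows "is_bochner_integral M X n f (bochner_integral M X n f)"
proof -
 interpret finite_measure M by fact
 have fX: "!!t. t : space M ==> f t : X" using f by (auto simp: strongly_measurable_def)
 obtain s where s: "!!k::nat. simple_function M (s k)" "!!k t. t : space M ==> s k t : X"
  and sl: "AE t in M. (%k. n (s k t - f t)) ----> 0" using f unfolding strongly_measurable_def by blast
 have [measurable]: "(%t. n (f t)) : bmeas M"
 proof -
  have "(%t. sqrt ((n (f t))^2)) : bmeas M" using sq by measurable
  thus ?thesis by (rule measurable_cong[THEN iffD1, rotated]) (use fX nonneg in auto)
 qed
 have fint: "integrable M (%t. n (f t))" by (rule square_integrable_imp_integrable[OF _ sq]) measurable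
 define r where "r = (%k t. if n (s k t) <= 2 * n (f t) then s k t else 0)"
 have nsm[measurable]: "(%t. n (s k t)) : bmeas M" for k
  by (rule borel_measurable_simple_function) (rule simple_function_compose1[OF s(1), of n])
 have r: "simple_function M (r k)" for k
  unfolding r_def by (intro simple_function_If s simple_function_const) measurable
 have rX: "r k t : X" if "t : space M" for k t using s(2) that zero_mem by (auto simp: r_def)
 have rb: "n (r k t) <= 2 * n (f t)" if "t : space M" for k t using nonneg[OF fX[OF that]] by (auto simp: r_def)
 have rl: "AE t in M. (%k. n (r k t - f t)) ----> 0" using sl AE_space
 proof eventually_elim
  case (elim t)
  show ?case
  proof (cases "n (f t) = 0")
   case True
   have "n (r k t - f t) = 0" for k
    using triangle_diff[OF rX[OF elim(2)] fX[OF elim(2)], of k] rb[OF elim(2), of k] True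
     nonneg[OF diff_mem[OF rX[OF elim(2)] fX[OF elim(2)]], of k] by simp
   thus ?thesis by simp
  next
   case False
   hence "n (f t) > 0" using nonneg[OF fX[OF elim(2)]] by simp
   hence "\<forall>\<^sub>F k in sequentially. n (s k t - f t) < n (f t)" using elim(1) by (rule order_tendstoD(2)[rotated])
   hence "\<forall>\<^sub>F k in sequentially. n (s k t - f t) = n (r k t - f t)"
   proof eventually_elim
    case (elim k)
    thus ?case using triangle_sub[OF s(2) fX, OF \<open>t : space M\<close> \<open>t : space M\<close>, of k] by (simp add: r_def)
   qed
   thus ?thesis using elim(1) by (rule Lim_transform_eventually[rotated])
  qed
 qed
 define E where "E = (%k t. liminf (%j. ennreal (n (r k t - r j t))))"
 have dm[measurable]: "(%t. n (r k t - r j t)) : bmeas M" for k j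
  by (rule borel_measurable_simple_function) (rule simple_function_compose2[OF r r, of "%x y. n (x - y)"])
 have [measurable]: "E k : bmeas M" for k unfolding E_def by measurable
 have E: "AE t in M. E k t = ennreal (n (r k t - f t))" for k using rl AE_space
 proof eventually_elim
  case (elim t)
  note X = rX[OF elim(2)] fX[OF elim(2)]
  have "(%j. n (r k t - r j t)) ----> n (r k t - f t)"
  proof (rule LIMSEQ_I)
   fix e :: real assume "e > 0"
   then obtain N where N: "!!j. j >= N ==> norm (n (r j t - f t) - 0) < e" using LIMSEQ_D[OF elim(1)] by blast
   have "norm (n (r k t - r j t) - n (r k t - f t)) < e" if "j >= N" for j
   proof -
    have "n (r k t - r j t) <= n (r k t - f t) + n ((r k t - r j t) - (r k t - f t))" by (intro triangle_sub diff_mem X)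
    moreover have "n (r k t - f t) <= n (r k t - r j t) + n ((r k t - f t) - (r k t - r j t))"
     by (intro triangle_sub diff_mem X)
    moreover have "n (f t - r j t) = n (r j t - f t)" by (intro n_commute X)
    ultimately show ?thesis using N[OF that] by (simp add: abs_less_iff)
   qed
   thus "EX no. ALL j>=no. norm (n (r k t - r j t) - n (r k t - f t)) < e" by blast
  qed
  hence "(%j. ennreal (n (r k t - r j t))) ----> ennreal (n (r k t - f t))" by (rule tendsto_ennrealI)
  from lim_imp_Liminf[OF _ this] show ?case by (simp add: E_def)
 qed
 have "(%k. \<integral>\<^sup>+t. E k t \<partial>M) ----> (\<integral>\<^sup>+t. 0 \<partial>M)"
 proof (rule nn_integral_dominated_convergence[where w="%t. ennreal (3 * n (f t))"])
  show "AE t in M. E k t <= ennreal (3 * n (f t))" for k using E[of k] AE_space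
  proof eventually_elim
   case (elim t)
   thus ?case using triangle_diff[OF rX[OF elim(2)] fX[OF elim(2)], of k] rb[OF elim(2), of k]
    by (auto intro!: ennreal_leI)
  qed
  have "integrable M (%t. 3 * n (f t))" using fint by simp
  thus "(\<integral>\<^sup>+t. ennreal (3 * n (f t)) \<partial>M) < \<infinity>"
   by (subst nn_integral_eq_integral) (use fX nonneg in \<open>auto intro!: AE_I2\<close>)
  have "AE t in M. ALL k. E k t = ennreal (n (r k t - f t))" using E by (simp add: AE_all_countable)
  with rl show "AE t in M. (%k. E k t) ----> 0" by eventually_elim (use tendsto_ennrealI in fastforce)
 qed auto
 hence El: "(%k. \<integral>\<^sup>+t. E k t \<partial>M) ----> 0" by simp
 have Eeq: "(\<integral>\<^sup>+t. ennreal (n (r k t - f t)) \<partial>M) = (\<integral>\<^sup>+t. E k t \<partial>M)" for k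
  using E[of k] by (intro nn_integral_cong_AE) (auto elim: eventually_mono)
 define I where "I = (%k. simple_integral_vec M (r k))"
 have IX: "I k : X" for k unfolding I_def by (rule simple_integral_bound(1)[OF M r rX])
 have Id: "ennreal (n (I i - I j)) <= (\<integral>\<^sup>+t. E i t \<partial>M) + (\<integral>\<^sup>+t. E j t \<partial>M)" for i j
 proof -
  have sb: "Bochner_Integration.simple_bochner_integrable M (r k)" for k
   by (rule simple_bochner_integrable.intros[OF r]) (simp add: emeasure_eq_measure)
  have "I i - I j = simple_integral_vec M (%t. r i t - r j t)"
   unfolding I_def simple_integral_vec_eq by (rule simple_bochner_integral_diff[symmetric, OF sb sb])
  also have "ennreal (n ...) <= (\<integral>\<^sup>+t. ennreal (n (r i t - r j t)) \<partial>M)"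
   by (rule simple_integral_bound(2)[OF M]) (auto intro: simple_function_compose2[OF r r] diff_mem rX)
  also have "... <= (\<integral>\<^sup>+t. E i t + E j t \<partial>M)"
  proof (rule nn_integral_mono_AE)
   show "AE t in M. ennreal (n (r i t - r j t)) <= E i t + E j t" using E[of i] E[of j] AE_space
   proof eventually_elim
    case (elim t)
    note X = rX[OF elim(3)] fX[OF elim(3)]
    have "n ((r i t - f t) - (r j t - f t)) <= n (r i t - f t) + n (r j t - f t)" by (intro triangle_diff diff_mem X)
    hence "n (r i t - r j t) <= n (r i t - f t) + n (r j t - f t)" by simp
    thus ?case using elim nonneg[OF diff_mem[OF X(1) X(2)]]
     by (simp add: ennreal_plus[symmetric] ennreal_leI del: ennreal_plus)
   qed
  qed
  also have "... = (\<integral>\<^sup>+t. E i t \<partial>M) + (\<integral>\<^sup>+t. E j t \<partial>M)" by (rule nn_integral_add) measurable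
  finally show ?thesis .
 qed
 have "EX g:X. (%k. n (I k - g)) ----> 0"
 proof (rule complete[OF IX])
  fix e :: real assume e: "e > 0"
  hence "\<forall>\<^sub>F k in sequentially. (\<integral>\<^sup>+t. E k t \<partial>M) < ennreal (e / 2)"
   by (intro order_tendstoD(2)[OF El]) (auto simp: ennreal_zero_less_divide)
  then obtain N where N: "!!k. k >= N ==> (\<integral>\<^sup>+t. E k t \<partial>M) < ennreal (e / 2)"
   by (auto simp: eventually_sequentially)
  have "n (I i - I j) < e" if "i >= N" "j >= N" for i j
  proof -
   have "ennreal (n (I i - I j)) < ennreal (e / 2) + ennreal (e / 2)"
    by (rule le_less_trans[OF Id add_strict_mono[OF N[OF that(1)] N[OF that(2)]]])
   also have "... = ennreal e" using e by (simp add: ennreal_plus[symmetric] del: ennreal_plus)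
   finally show ?thesis using nonneg[OF diff_mem[OF IX IX]] by (simp add: ennreal_less_iff)
  qed
  thus "EX N. ALL i>=N. ALL j>=N. n (I i - I j) < e" by blast
 qed
 then obtain g where g: "g : X" "(%k. n (I k - g)) ----> 0" by blast
 have "is_bochner_integral M X n f g"
  unfolding is_bochner_integral_def using r rX g El by (auto simp: I_def Eeq intro!: exI[of _ r])
 thus ?thesis unfolding bochner_integral_def by (rule someI)
qed

lemma L2_bochner_integral_mem:
 fixes f :: "'t => 'a => real"
 assumes M: "finite_measure M" and f: "f : bochner_L2 M (Lp S 2) (Lp_norm S 2)"
 shows "bochner_integral M (Lp S 2) (Lp_norm S 2) f : Lp S 2"
proof -
 interpret L2: seminormed "Lp S 2 :: ('a => real) set" "Lp_norm S 2" by (rule seminormed_Lp) simp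
 have "is_bochner_integral M (Lp S 2) (Lp_norm S 2) f (bochner_integral M (Lp S 2) (Lp_norm S 2) f)"
  using f by (intro L2.is_bochner_integral_bochner_integral L2_complete M) (auto simp: bochner_L2_def)
 thus ?thesis by (simp add: is_bochner_integral_def)
qed

lemma bochner_L2_restrict:
 fixes I J :: "real set"
 assumes f: "f : bochner_L2 (lebesgue_on I) V nV" and IJ: "J <= I" "J : sets lebesgue" "I : sets lebesgue"
 shows "f : bochner_L2 (lebesgue_on J) V nV"
proof -
 have sm: "strongly_measurable (lebesgue_on I) V nV f" and int: "integrable (lebesgue_on I) (%t. (nV (f t))^2)"
  using f by (auto simp: bochner_L2_def)
 obtain s where s: "!!k::nat. simple_function (lebesgue_on I) (s k)" "!!k t. t : I ==> s k t : V"
  and sl: "AE t in lebesgue_on I. (%k. nV (s k t - f t)) ----> 0" and fV: "!!t. t : I ==> f t : V"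
  using sm unfolding strongly_measurable_def by auto
 have JI: "lebesgue_on J = restrict_space (lebesgue_on I) J" using IJ by (simp add: restrict_restrict_space Int_absorb1)
 have Jm: "J : sets (lebesgue_on I)" using IJ by (auto simp: sets_restrict_space_iff)
 have "simple_function (lebesgue_on J) (s k)" for k
 proof -
  have "s k : measurable (lebesgue_on I) (count_space UNIV)" by (rule measurable_simple_function[OF s(1)])
  hence "s k : measurable (lebesgue_on J) (count_space UNIV)" unfolding JI by (rule measurable_restrict_space1)
  moreover have "finite (s k ` J)"
   using s(1)[of k] IJ(1) by (auto simp: simple_function_def intro: finite_subset[OF image_mono])
  ultimately show ?thesis by (simp add: simple_function_eq_measurable)
 qed
 moreover have "AE t in lebesgue_on J. (%k. nV (s k t - f t)) ----> 0"
  unfolding JI using sl IJ Jm by (subst AE_restrict_space_iff) (auto elim: eventually_mono)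
 moreover have "integrable (lebesgue_on J) (%t. (nV (f t))^2)"
  unfolding JI using integrable_mult_indicator[OF Jm int] Jm IJ
  by (subst integrable_restrict_space) (auto simp: Int_absorb2)
 ultimately show ?thesis using s(2) fV IJ(1) by (auto simp: bochner_L2_def strongly_measurable_def intro!: exI[of _ s])
qed

section \<open>Smooth functions\<close>

abbreviation smooth :: "(R3 => real) => bool" where
 "smooth f \<equiv> ALL k. Ck_R3 k f"

lemma partial_eq: "(f has_derivative f') (at x) ==> partial i f x = f' (axis i 1)"
 unfolding partial_def using frechet_derivative_at by metis

lemma differentiable_has_derivative_partial:
 assumes "f differentiable (at (x::R3))"
 shows "(f has_derivative (%h. \<Sum>i\<in>UNIV. h $ i * partial i f x)) (at x)"
proof -
 obtain f' where f': "(f has_derivative f') (at x)" using assms by (auto simp: differentiable_def)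
 interpret bounded_linear f' using f' by (rule has_derivative_bounded_linear)
 have "f' h = (\<Sum>i\<in>UNIV. h $ i * partial i f x)" for h
 proof -
  have "h = (\<Sum>i\<in>UNIV. h $ i *R axis i 1)" by (simp add: vec_eq_iff axis_def if_distrib cong: if_cong)
  hence "f' h = f' (\<Sum>i\<in>UNIV. h $ i *R axis i 1)" by simp
  thus ?thesis by (simp add: sum scaleR partial_eq[OF f'])
 qed
 hence "f' = (%h. \<Sum>i\<in>UNIV. h $ i * partial i f x)" by blast
 with f' show ?thesis by simp
qed

lemma Ck_R3_Suc_imp: "Ck_R3 (Suc k) f ==> Ck_R3 k f"
proof (induction k arbitrary: f)
 case 0
 thus ?case by (auto intro!: continuous_at_imp_continuous_on differentiable_imp_continuous_within)
next
 case (Suc k)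
 from Suc.prems have "ALL x. f differentiable at x" "ALL i. Ck_R3 (Suc k) (partial i f)" by simp_all
 with Suc.IH show ?case by (metis Ck_R3.simps(2))
qed

lemma Ck_R3_cont: "Ck_R3 k f ==> continuous_on UNIV f"
 by (induction k) (use Ck_R3_Suc_imp in \<open>simp, blast\<close>)

lemma C1_D:
 assumes "Ck_R3 1 f"
 shows "f differentiable (at x)" "continuous_on UNIV f" "continuous_on UNIV (partial i f)"
 using assms Ck_R3_cont[of 1 f] by (auto simp: One_nat_def)

lemma C1_I: "(!!x. f differentiable (at x)) ==> (!!i. continuous_on UNIV (partial i f)) ==> Ck_R3 1 f"
 by (auto simp: One_nat_def)

lemma smooth_C1: "smooth f ==> Ck_R3 1 f" by blast
lemma smooth_cont: "smooth f ==> continuous_on UNIV f" using Ck_R3_cont by blast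
lemma smooth_partial: "smooth f ==> smooth (partial i f)" by (metis Ck_R3.simps(2))
lemma smooth_differentiable: "smooth f ==> f differentiable (at x)" by (metis Ck_R3.simps(2))

lemma partial_const: "partial i (%_. c) = (%_. 0)" by (rule ext) (simp add: partial_eq[OF has_derivative_const])

lemma partial_add:
 assumes "f differentiable (at x)" "g differentiable (at x)"
 shows "partial i (%x. f x + g x) x = partial i f x + partial i g x"
proof -
 obtain f' g' where d: "(f has_derivative f') (at x)" "(g has_derivative g') (at x)"
  using assms by (auto simp: differentiable_def)
 show ?thesis using partial_eq[OF has_derivative_add[OF d]] partial_eq[OF d(1)] partial_eq[OF d(2)] by simp
qed

lemma partial_mult:
 assumes "f differentiable (at x)" "g differentiable (at x)"
 shows "partial i (%x. f x * g x) x = f x * partial i g x + g x * partial i f x"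
proof -
 obtain f' g' where d: "(f has_derivative f') (at x)" "(g has_derivative g') (at x)"
  using assms by (auto simp: differentiable_def)
 show ?thesis using partial_eq[OF has_derivative_mult[OF d]] partial_eq[OF d(1)] partial_eq[OF d(2)]
  by (simp add: mult.commute)
qed

lemma Ck_R3_const: "Ck_R3 k (%_. c)" by (induction k arbitrary: c) (auto simp: partial_const)

lemma Ck_R3_add: "Ck_R3 k f ==> Ck_R3 k g ==> Ck_R3 k (%x. f x + g x)"
proof (induction k arbitrary: f g)
 case (Suc k)
 have d: "f differentiable (at x)" "g differentiable (at x)" for x using Suc.prems by auto
 have "partial i (%x. f x + g x) = (%x. partial i f x + partial i g x)" for i using partial_add[OF d] by blast
 with Suc d show ?case by (auto intro: differentiable_add)
qed (auto intro: continuous_on_add)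

lemma Ck_R3_mult: "Ck_R3 k f ==> Ck_R3 k g ==> Ck_R3 k (%x. f x * g x)"
proof (induction k arbitrary: f g)
 case (Suc k)
 have d: "f differentiable (at x)" "g differentiable (at x)" for x using Suc.prems by auto
 have eq: "partial i (%x. f x * g x) = (%x. f x * partial i g x + g x * partial i f x)" for i
  using partial_mult[OF d] by blast
 have "Ck_R3 k f" "Ck_R3 k g" using Suc.prems by (auto intro: Ck_R3_Suc_imp)
 hence "Ck_R3 k (partial i (%x. f x * g x))" for i unfolding eq using Suc.prems by (intro Ck_R3_add Suc.IH) auto
 with d show ?case by (auto intro: differentiable_mult)
qed (auto intro: continuous_on_mult)

lemma Ck_R3_cmult: "Ck_R3 k f ==> Ck_R3 k (%x. c * f x)" by (intro Ck_R3_mult Ck_R3_const)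

lemma Ck_R3_sum: "finite I ==> (!!i. i : I ==> Ck_R3 k (f i)) ==> Ck_R3 k (%x. \<Sum>i\<in>I. f i x)"
 by (induction I rule: finite_induct) (auto intro: Ck_R3_const Ck_R3_add)

lemma Ck_R3_prod: "finite I ==> (!!i. i : I ==> Ck_R3 k (f i)) ==> Ck_R3 k (%x. \<Prod>i\<in>I. f i x)"
 by (induction I rule: finite_induct) (auto intro: Ck_R3_const Ck_R3_mult)

lemma Ck_R3_power: "Ck_R3 k f ==> Ck_R3 k (%x. f x ^ n)" by (induction n) (auto intro: Ck_R3_const Ck_R3_mult)

text \<open>The functions \<open>q (1 / t) exp (- 1 / t)\<close> on the positive axis, \<open>q\<close> a polynomial, extended by
  zero: a class closed under differentiation.\<close>

definition flat :: "real poly => real => real" where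
 "flat q t = (if t > 0 then poly q (1 / t) * exp (- 1 / t) else 0)"

lemma poly_exp_tendsto_0: "((%s. poly q s * exp (- s)) \<longlongrightarrow> (0::real)) at_top"
proof -
 have "((%s. \<Sum>i\<le>degree q. coeff q i * (s ^ i / exp s)) \<longlongrightarrow> (\<Sum>i\<le>degree q. coeff q i * 0)) at_top"
  by (intro tendsto_intros tendsto_power_div_exp_0)
 thus ?thesis by (simp add: poly_altdef sum_distrib_right exp_minus divide_inverse mult.assoc)
qed

lemma flat_DERIV: "(flat q has_real_derivative flat ([:0, 0, 1:] * (q - pderiv q)) t) (at t)"
proof -
 consider "t > 0" | "t < 0" | "t = 0" by linarith
 thus ?thesis
 proof cases
  case 1
  have "((%t. poly q (1 / t) * exp (- 1 / t)) has_real_derivative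
    flat ([:0, 0, 1:] * (q - pderiv q)) t) (at t)"
   using 1 by (auto intro!: derivative_eq_intros DERIV_chain2[OF poly_DERIV]
    simp: flat_def power2_eq_square algebra_simps divide_inverse)
  thus ?thesis by (rule DERIV_cong_ev[THEN iffD1, rotated 3, OF _ refl _ refl])
     (use 1 eventually_nhds_in_open[of "{0<..}" t] in \<open>auto simp: flat_def elim!: eventually_mono\<close>)
 next
  case 2
  have "((%t. 0) has_real_derivative flat ([:0, 0, 1:] * (q - pderiv q)) t) (at t)" using 2 by (simp add: flat_def)
  thus ?thesis by (rule DERIV_cong_ev[THEN iffD1, rotated 3, OF _ refl _ refl])
     (use 2 eventually_nhds_in_open[of "{..<0}" t] in \<open>auto simp: flat_def elim!: eventually_mono\<close>)
 next
  case 3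
  have r: "((%h. flat q h / h) \<longlongrightarrow> 0) (at_right 0)"
  proof -
   have "((%h. poly ([:0, 1:] * q) (inverse h) * exp (- inverse h)) \<longlongrightarrow> 0) (at_right (0::real))"
    by (rule filterlim_compose[OF poly_exp_tendsto_0 filterlim_inverse_at_top_right])
   thus ?thesis by (rule Lim_transform_eventually)
      (auto simp: flat_def eventually_at_filter divide_inverse mult_ac)
  qed
  have l: "((%h. flat q h / h) \<longlongrightarrow> 0) (at_left 0)"
   by (rule Lim_transform_eventually[OF tendsto_const])
     (auto simp: flat_def eventually_at_filter)
  have "((%h. flat q h / h) \<longlongrightarrow> 0) (at 0)" using filterlim_split_at[OF l r] .
  thus ?thesis using 3 by (simp add: DERIV_def flat_def)
 qed
qed

lemma flat_coord_has_derivative: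
 "((%x::R3. flat q (c * x $ i + d)) has_derivative
   (%h. flat ([:0, 0, 1:] * (q - pderiv q)) (c * x $ i + d) * (c * h $ i))) (at x)"
proof -
 have "((%x::R3. c * x $ i + d) has_derivative (%h. c * h $ i)) (at x)"
  by (auto intro!: derivative_eq_intros bounded_linear.has_derivative[OF bounded_linear_vec_nth])
 from has_derivative_compose[OF this flat_DERIV[THEN has_field_derivative_imp_has_derivative]]
 show ?thesis .
qed

lemma smooth_flat_coord: "Ck_R3 k (%x. flat q (c * x $ i + d))"
proof (induction k arbitrary: q)
 case 0
 show ?case using flat_coord_has_derivative[of q c i d]
  by (auto intro!: continuous_at_imp_continuous_on has_derivative_continuous)
next
 case (Suc k)
 have "partial j (%x. flat q (c * x $ i + d)) =
   (%x. (c * axis j 1 $ i) * flat ([:0, 0, 1:] * (q - pderiv q)) (c * x $ i + d))" for j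
  by (rule ext) (simp add: partial_eq[OF flat_coord_has_derivative])
 hence "Ck_R3 k (partial j (%x. flat q (c * x $ i + d)))" for j using Ck_R3_cmult[OF Suc.IH] by simp
 thus ?case using flat_coord_has_derivative[of q c i d] by (auto simp: differentiable_def)
qed

text \<open>As \<open>n\<close> grows these bumps increase to the indicator of the open box.\<close>

definition bump :: "real => R3 => R3 => R3 => real" where
 "bump n a b x = (\<Prod>i\<in>UNIV. flat 1 (n * (x $ i - a $ i)) * flat 1 (n * (b $ i - x $ i)))"

lemma smooth_bump: "smooth (bump n a b)"
proof
 fix k
 have "Ck_R3 k (%x. flat 1 (n * (x $ i - a $ i)))" for i
  using smooth_flat_coord[of k 1 n i "- n * a $ i"] by (simp add: algebra_simps)
 moreover have "Ck_R3 k (%x. flat 1 (n * (b $ i - x $ i)))" for i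
  using smooth_flat_coord[of k 1 "- n" i "n * b $ i"] by (simp add: algebra_simps)
 ultimately show "Ck_R3 k (bump n a b)" unfolding bump_def[abs_def] by (intro Ck_R3_prod Ck_R3_mult) auto
qed

lemma bump_range: "0 <= bump n a b x" "bump n a b x <= 1" unfolding bump_def
 by (auto intro!: prod_nonneg prod_le_1 mult_nonneg_nonneg mult_le_one simp: flat_def)

lemma bump_pos: "n > 0 ==> bump n a b x > 0 \<longleftrightarrow> x : box a b"
proof -
 assume n: "n > 0"
 have "bump n a b x ~= 0 \<longleftrightarrow> x : box a b"
  using n by (auto simp: bump_def flat_def mem_box_cart zero_less_mult_iff split: if_splits)
 thus ?thesis using bump_range(1)[of n a b x] by linarith
qed

lemma bump_eq_0: "n > 0 ==> x ~: box a b ==> bump n a b x = 0"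
 using bump_pos[of n a b x] bump_range(1)[of n a b x] by linarith

lemma bump_support: "n > 0 ==> closure {x. bump n a b x ~= 0} <= cbox a b"
proof -
 assume "n > 0"
 hence "{x. bump n a b x ~= 0} <= cbox a b" using bump_eq_0 box_subset_cbox by blast
 thus ?thesis by (simp add: closure_minimal closed_cbox)
qed

lemma bump_test_function: "n > 0 ==> cbox a b <= U ==> bump n a b : test_functions U"
 using bump_support[of n a b] smooth_bump[of n a b]
 by (auto simp: test_functions_def intro!: compact_closure[THEN iffD2] bounded_subset[OF bounded_cbox[of a b]]
   dest: subset_trans[OF closure_subset])

lemma bump_limit: "(%n. bump (real (Suc n)) a b x) ----> indicator (box a b) x"
proof (cases "x : box a b")
 case True
 have f: "(%n. flat 1 (real (Suc n) * t)) ----> 1" if "t > 0" for t :: real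
 proof -
  have "(%n. exp (- (inverse (real (Suc n)) * (1 / t)))) ----> exp (- (0 * (1 / t)))"
   by (intro tendsto_intros LIMSEQ_inverse_real_of_nat)
  thus ?thesis using that by (rule_tac Lim_transform_eventually) (auto simp: flat_def divide_inverse mult_ac)
 qed
 have "(%n. bump (real (Suc n)) a b x) ----> (\<Prod>i\<in>(UNIV::3 set). 1 * 1)"
  unfolding bump_def using True by (intro tendsto_prod tendsto_mult f) (auto simp: mem_box_cart)
 thus ?thesis using True by simp
next
 case False
 thus ?thesis by (simp add: bump_eq_0)
qed

lemma test_functionsD:
 assumes "ph : test_functions U"
 shows "smooth ph" "compact (closure {x. ph x ~= 0})" "closure {x. ph x ~= 0} <= U"
 using assms by (auto simp: test_functions_def)

lemma partial_support:
 assumes "!!x. f differentiable (at x)"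
 shows "x ~: closure {x. f x ~= 0} ==> partial i f x = 0"
proof -
 assume x: "x ~: closure {x. f x ~= 0}"
 have "(f has_derivative (%_. 0)) (at x)"
 proof (rule has_derivative_transform_within_open)
  show "((%_. 0) has_derivative (%_. 0)) (at x)" by simp
  show "open (- closure {x. f x ~= 0})" by auto
  show "x : - closure {x. f x ~= 0}" using x by simp
  show "0 = f y" if "y : - closure {x. f x ~= 0}" for y using that closure_subset[of "{x. f x ~= 0}"] by auto
 qed
 thus ?thesis by (simp add: partial_eq)
qed

lemma partial_test_function:
 assumes "ph : test_functions U"
 shows "partial i ph : test_functions U"
proof -
 note D = test_functionsD[OF assms]
 have s: "closure {x. partial i ph x ~= 0} <= closure {x. ph x ~= 0}"
  using partial_support[of ph] smooth_differentiable[OF D(1)] by (intro closure_minimal) auto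
 have "compact (closure {x. partial i ph x ~= 0})"
  using compact_Int_closed[OF D(2) closed_closure, of "{x. partial i ph x ~= 0}"] s by (simp add: Int_absorb1)
 thus ?thesis using smooth_partial[OF D(1)] D(3) s by (auto simp: test_functions_def)
qed

lemma smooth_mult_test_function:
 assumes "smooth th" "ph : test_functions U"
 shows "(%x. th x * ph x) : test_functions U"
proof -
 note D = test_functionsD[OF assms(2)]
 have s: "closure {x. th x * ph x ~= 0} <= closure {x. ph x ~= 0}" by (intro closure_mono) auto
 have "compact (closure {x. th x * ph x ~= 0})"
  using compact_Int_closed[OF D(2) closed_closure, of "{x. th x * ph x ~= 0}"] s by (simp add: Int_absorb1)
 thus ?thesis using D s assms(1) by (auto simp: test_functions_def intro: Ck_R3_mult)
qed

section \<open>Weak gradients\<close>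

lemma lebesgue_on_restrict:
 assumes "K <= U" "K : sets lebesgue" "U : sets lebesgue"
 shows "lebesgue_on K = restrict_space (lebesgue_on U) K" using assms by (simp add: restrict_restrict_space Int_absorb1)

lemma continuous_measurable_lebesgue_on:
 "continuous_on UNIV f ==> f : bmeas (lebesgue_on U)"
 by (intro measurable_restrict_space1 measurable_completion) (simp add: borel_contI)

lemma integrable_compact_support:
 fixes g :: "R3 => 'b::euclidean_space" and k :: "R3 => real"
 assumes g: "locally_integrable U g" and U: "U : sets lebesgue"
  and k: "continuous_on UNIV k" and K: "compact K" "K <= U" "!!x. x ~: K ==> k x = 0"
 shows "integrable (lebesgue_on U) (%x. k x *R g x)"
proof -
 have gK: "integrable (lebesgue_on K) g" and gm: "g : bmeas (lebesgue_on U)"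
  using g K by (auto simp: locally_integrable_def)
 have Kl: "K : sets lebesgue" using K(1) by (simp add: fmeasurableD lmeasurable_compact)
 hence Km: "K : sets (lebesgue_on U)" using K U by (auto simp: sets_restrict_space_iff)
 have 1: "integrable (lebesgue_on U) (%x. indicat_real K x *R g x)"
  using gK Km K(2) unfolding lebesgue_on_restrict[OF K(2) Kl U]
  by (subst (asm) integrable_restrict_space) (auto simp: Int_absorb2)
 have "compact (k ` K)" by (intro compact_continuous_image continuous_on_subset[OF k] K) auto
 then obtain C where C: "!!x. x : K ==> \<bar>k x\<bar> <= C"
  using compact_imp_bounded bounded_iff by (metis image_eqI real_norm_def)
 have "integrable (lebesgue_on U) (%x. C *R (indicat_real K x *R g x))" using 1 by (intro integrable_scaleR_right)
 thus ?thesis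
 proof (rule Bochner_Integration.integrable_bound)
  show "(%x. k x *R g x) : bmeas (lebesgue_on U)" using gm continuous_measurable_lebesgue_on[OF k] by measurable
  have "norm (k x *R g x) <= norm (C *R indicat_real K x *R g x)" for x
  proof (cases "x : K")
   case True
   hence "\<bar>k x\<bar> <= \<bar>C\<bar>" using C[OF True] by linarith
   thus ?thesis using True by (auto intro: mult_right_mono)
  qed (simp add: K(3))
  thus "AE x in lebesgue_on U. norm (k x *R g x) <= norm (C *R indicat_real K x *R g x)" by simp
 qed
qed

lemma integrable_test:
 fixes g :: "R3 => real"
 assumes "locally_integrable U g" "open U" "ph : test_functions U"
 shows "integrable (lebesgue_on U) (%x. g x * ph x)"
proof -
 note D = test_functionsD[OF assms(3)]
 have "integrable (lebesgue_on U) (%x. ph x *R g x)"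
  by (rule integrable_compact_support[OF assms(1) _ smooth_cont[OF D(1)] D(2,3)])
    (use assms(2) closure_subset[of "{x. ph x ~= 0}"] in auto)
 thus ?thesis by (simp add: mult.commute)
qed

lemma locally_integrable_add:
 "locally_integrable U f ==> locally_integrable U g ==> locally_integrable U (%x. f x + g x)"
 by (auto simp: locally_integrable_def)

lemma locally_integrable_scale:
 "locally_integrable U f ==> locally_integrable U (%x. c *R f x)" by (auto simp: locally_integrable_def)

lemma locally_integrable_diff:
 "locally_integrable U f ==> locally_integrable U g ==> locally_integrable U (%x. f x - g x)"
 by (auto simp: locally_integrable_def)

lemma locally_integrable_component:
 fixes G :: "R3 => R3"
 assumes "locally_integrable U G"
 shows "locally_integrable U (%x. G x $ i)"
proof -
 have [measurable]: "(%y::R3. y $ i) : bmeas borel" by (intro borel_contI continuous_intros)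
 show ?thesis using assms integrable_bounded_linear[OF bounded_linear_vec_nth[of i]]
  by (auto simp: locally_integrable_def intro: measurable_compose)
qed

lemma integral_zero_boxes_imp_AE_zero:
 fixes g :: "R3 => real"
 assumes g: "integrable lborel g" and z: "!!a b. (LINT x|lborel. indicator (box a b) x * g x) = 0"
 shows "AE x in lborel. g x = 0"
proof (rule sigma_finite_measure.density_zero[OF sigma_finite_lborel g])
 let ?E = "range (%(a, b). box a b :: R3 set)"
 have si: "set_integrable lborel A g" if "A : sets borel" for A
  using integrable_mult_indicator[OF _ g, of A] that by (simp add: set_integrable_def)
 have total: "(LINT x|lborel. g x) = 0"
 proof (rule LIMSEQ_unique)
  show "(%n. LINT x|lborel. indicator (box (- real n *R One) (real n *R One)) x * g x) ----> (LINT x|lborel. g x)"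
  proof (rule integral_dominated_convergence[where w="%x. norm (g x)"])
   show "AE x in lborel. (%n. indicat_real (box (- real n *R One) (real n *R One)) x * g x) ----> g x"
   proof (intro AE_I2)
    fix x :: R3
    have "x : (\<Union>i. box (- real i *R One) (real i *R One))" using UN_box_eq_UNIV by auto
    then obtain n0 where n0: "x : box (- real n0 *R One) (real n0 *R One)" by blast
    have "\<forall>\<^sub>F n in sequentially. indicat_real (box (- real n *R One) (real n *R One)) x * g x = g x"
     unfolding eventually_sequentially
    proof (intro exI allI impI)
     fix n assume "n0 <= n"
     hence "x : box (- real n *R One) (real n *R One)"
      using n0 by (auto simp: mem_box intro: le_less_trans less_le_trans)
     thus "indicat_real (box (- real n *R One) (real n *R One)) x * g x = g x" by simp
    qed
    thus "(%n. indicat_real (box (- real n *R One) (real n *R One)) x * g x) ----> g x" by (rule tendsto_eventually)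
   qed
  qed (use g in \<open>auto simp: indicator_def\<close>)
  show "(%n. LINT x|lborel. indicator (box (- real n *R One) (real n *R One :: R3)) x * g x) ----> 0" by (simp add: z)
 qed
 fix A :: "R3 set" assume "A : sets lborel"
 hence As: "A : sigma_sets UNIV ?E" by (simp add: borel_eq_box)
 have st: "Int_stable ?E" by (auto simp: Int_stable_def box_Int_box)
 have sub: "?E <= Pow UNIV" by simp
 from st sub As show "set_lebesgue_integral lborel A g = 0"
 proof (induction A rule: sigma_sets_induct_disjoint)
  show "set_lebesgue_integral lborel A g = 0" if "A : ?E" for A using that z by (auto simp: set_lebesgue_integral_def)
  show "set_lebesgue_integral lborel {} g = 0" by (simp add: set_lebesgue_integral_def)
 next
  fix A assume A: "A : sigma_sets UNIV ?E" "set_lebesgue_integral lborel A g = 0"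
  hence Ab: "A : sets borel" by (simp add: borel_eq_box)
  have "(LINT x|lborel. g x) = (LINT x|lborel. indicator A x *R g x + indicator (UNIV - A) x *R g x)"
   by (intro Bochner_Integration.integral_cong) (auto simp: indicator_def)
  also have "... = set_lebesgue_integral lborel A g + set_lebesgue_integral lborel (UNIV - A) g"
   unfolding set_lebesgue_integral_def
   by (intro Bochner_Integration.integral_add) (use si[of A] si[of "UNIV - A"] Ab in \<open>auto simp: set_integrable_def\<close>)
  finally show "set_lebesgue_integral lborel (UNIV - A) g = 0" using total A by simp
 next
  fix A :: "nat => R3 set" assume A: "disjoint_family A" "range A <= sigma_sets UNIV ?E"
   "!!i. set_lebesgue_integral lborel (A i) g = 0"
  hence Ab: "!!i. A i : sets borel" by (auto simp: borel_eq_box)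
  have "set_lebesgue_integral lborel (\<Union>i. A i) g = (\<Sum>i. set_lebesgue_integral lborel (A i) g)"
   by (rule lebesgue_integral_countable_add) (use A(1) Ab si in \<open>auto simp: disjoint_family_on_def\<close>)
  thus "set_lebesgue_integral lborel (\<Union>i. A i) g = 0" using A(3) by simp
 qed
qed

text \<open>The fundamental lemma: letting \<open>n\<close> tend to infinity in the bumps of a box shows that all
  integrals over boxes vanish.\<close>

lemma fundamental_lemma:
 fixes g :: "R3 => real"
 assumes U: "open U" and g: "locally_integrable U g"
  and z: "!!ph. ph : test_functions U ==> (LINT x|lebesgue_on U. g x * ph x) = 0"
 shows "AE x in lebesgue_on U. g x = 0"
proof -
 have Um: "U : sets lebesgue" using U by simp
 have int: "integrable lebesgue (%x. indicator (cbox a b) x * g x)" if "cbox a b <= U" for a b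
 proof -
  have "integrable (lebesgue_on (cbox a b)) g" using g that by (auto simp: locally_integrable_def)
  thus ?thesis by (subst (asm) integrable_restrict_space) auto
 qed
 have box0: "(LINT x|lebesgue. indicator (box a b) x * g x) = 0" if ab: "cbox a b <= U" for a b
 proof (rule LIMSEQ_unique)
  have "(LINT x|lebesgue. bump (real (Suc n)) a b x * g x) = 0" for n
  proof -
   have "(LINT x|lebesgue_on U. g x * bump (real (Suc n)) a b x) = 0"
    by (rule z) (rule bump_test_function[OF _ ab], simp)
   hence "(LINT x|lebesgue. indicator U x *R (g x * bump (real (Suc n)) a b x)) = 0"
    using Um by (subst (asm) integral_restrict_space) auto
   also have "(%x. indicator U x *R (g x * bump (real (Suc n)) a b x)) = (%x. bump (real (Suc n)) a b x * g x)"
    using ab box_subset_cbox[of a b] bump_eq_0[of "real (Suc n)" _ a b]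
    by (auto simp: fun_eq_iff indicator_def mult.commute)
   finally show ?thesis by simp
  qed
  thus "(%n. LINT x|lebesgue. bump (real (Suc n)) a b x * g x) ----> 0" by simp
  show "(%n. LINT x|lebesgue. bump (real (Suc n)) a b x * g x) ----> (LINT x|lebesgue. indicator (box a b) x * g x)"
  proof (rule integral_dominated_convergence[where w="%x. norm (indicator (cbox a b) x * g x)"])
   note m = borel_measurable_integrable[OF int[OF ab]]
   have e1: "(%x. indicator (box a b) x * g x) = (%x. indicator (box a b) x * (indicator (cbox a b) x * g x))"
    using box_subset_cbox[of a b] by (auto simp: fun_eq_iff indicator_def)
   show "(%x. indicator (box a b) x * g x) : bmeas lebesgue"
    unfolding e1 by (rule borel_measurable_times[OF _ m]) (intro measurable_completion, simp)
   have e2: "(%x. bump (real (Suc n)) a b x * g x) = (%x. bump (real (Suc n)) a b x * (indicator (cbox a b) x * g x))" for n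
    using box_subset_cbox[of a b] bump_eq_0[of "real (Suc n)" _ a b] by (auto simp: fun_eq_iff indicator_def)
   have bm: "bump (real (Suc n)) a b : bmeas lebesgue" for n
    by (intro measurable_completion) (simp add: borel_contI smooth_cont smooth_bump)
   show "(%x. bump (real (Suc n)) a b x * g x) : bmeas lebesgue" for n
    by (subst e2) (rule borel_measurable_times[OF bm m])
   show "integrable lebesgue (%x. norm (indicator (cbox a b) x * g x))" using int[OF ab] by (rule integrable_norm)
   show "AE x in lebesgue. (%n. bump (real (Suc n)) a b x * g x) ----> indicator (box a b) x * g x"
    by (intro AE_I2 tendsto_mult bump_limit tendsto_const)
   have "norm (bump (real (Suc n)) a b x * g x) <= norm (indicator (cbox a b) x * g x)" for n x
   proof (cases "x : cbox a b")
    case True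
    thus ?thesis using bump_range[of "real (Suc n)" a b x] by (simp add: abs_mult mult_left_le_one_le del: of_nat_Suc)
   next
    case False
    hence "x ~: box a b" using box_subset_cbox[of a b] by blast
    hence "bump (real (Suc n)) a b x = 0" by (intro bump_eq_0) auto
    thus ?thesis by (simp del: of_nat_Suc)
   qed
   thus "AE x in lebesgue. norm (bump (real (Suc n)) a b x * g x) <= norm (indicator (cbox a b) x * g x)" for n by simp
  qed
 qed
 have loc: "AE x in lebesgue. x : box c d --> g x = 0" if cd: "cbox c d <= U" for c d
 proof -
  obtain G where Gm: "G : bmeas lborel" and G: "AE x in lborel. indicator (cbox c d) x * g x = G x"
   using completion_ex_borel_measurable_real[OF borel_measurable_integrable[OF int[OF cd]]] by auto
  have G': "AE x in lebesgue. indicator (cbox c d) x * g x = G x" using G by (rule AE_completion)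
  have Gi: "integrable lebesgue G" by (rule integrable_cong_AE[THEN iffD1, OF _ _ G' int[OF cd]])
     (use Gm int[OF cd] in \<open>auto intro: measurable_completion borel_measurable_integrable\<close>)
  have neg: "AE x in lebesgue. x ~: cbox c d - box c d"
   by (rule AE_not_in) (use negligible_frontier_interval[of c d] in \<open>simp add: negligible_iff_null_sets\<close>)
  have "AE x in lborel. G x = 0"
  proof (rule integral_zero_boxes_imp_AE_zero)
   show "integrable lborel G" using Gi Gm by (simp add: integrable_completion)
   fix a b :: R3
   define p' where "p' = (\<chi> i. max (a $ i) (c $ i))"
   define q' where "q' = (\<chi> i. min (b $ i) (d $ i))"
   have bx: "box a b \<inter> box c d = box p' q'" by (auto simp: set_eq_iff mem_box_cart p'_def q'_def)
   have cbx: "cbox p' q' <= U"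
   proof
    fix x assume "x : cbox p' q'"
    hence "x : cbox c d" by (simp add: mem_box_cart p'_def q'_def)
    with cd show "x : U" by blast
   qed
   have "(LINT x|lborel. indicator (box a b) x * G x) = (LINT x|lebesgue. indicator (box a b) x * G x)"
    using Gm by (subst integral_completion) auto
   also have "... = (LINT x|lebesgue. indicator (box p' q') x * g x)"
   proof (rule integral_cong_AE)
    show "(%x. indicator (box a b) x * G x) : bmeas lebesgue" using Gm by (intro measurable_completion) auto
    have e: "(%x. indicator (box p' q') x * g x) = (%x. indicator (box p' q') x * (indicator (cbox c d) x * g x))"
     using bx box_subset_cbox[of c d] by (auto simp: fun_eq_iff indicator_def)
    show "(%x. indicator (box p' q') x * g x) : bmeas lebesgue"
     unfolding e by (rule borel_measurable_times[OF _ borel_measurable_integrable[OF int[OF cd]]]) (intro measurable_completion, simp)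
    show "AE x in lebesgue. indicator (box a b) x * G x = indicator (box p' q') x * g x" using G' neg
    proof eventually_elim
     case (elim x)
     have iff: "x : box p' q' \<longleftrightarrow> x : box a b & x : box c d" using bx by blast
     show ?case
     proof (cases "x : box c d")
      case True
      hence "x : cbox c d" using box_subset_cbox by blast
      hence "G x = g x" using elim(1) by simp
      thus ?thesis using True by (simp add: indicator_def iff)
     next
      case False
      hence "x ~: cbox c d" using elim(2) by blast
      hence "G x = 0" using elim(1) by simp
      thus ?thesis using False by (simp add: indicator_def iff)
     qed
    qed
   qed
   also have "... = 0" by (rule box0[OF cbx])
   finally show "(LINT x|lborel. indicator (box a b) x * G x) = 0" .
  qed
  hence "AE x in lebesgue. G x = 0" by (rule AE_completion)
  with G' show ?thesis
   by eventually_elim (use box_subset_cbox[of c d] in \<open>auto simp: indicator_def split: if_splits\<close>)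
 qed
 define \<B> where "\<B> = {box c d | c d. cbox c d <= U}"
 have "\<Union>\<B> = U"
 proof
  show "\<Union>\<B> <= U" using box_subset_cbox unfolding \<B>_def by blast
  show "U <= \<Union>\<B>"
  proof
   fix x assume "x : U"
   from U this obtain c d where "cbox c d <= U" "x : box c d" "ALL i:Basis. c \<bullet> i < d \<bullet> i"
    by (rule open_contains_cbox)
   thus "x : \<Union>\<B>" by (auto simp: \<B>_def)
  qed
 qed
 moreover obtain \<B>' where \<B>': "\<B>' <= \<B>" "countable \<B>'" "\<Union>\<B>' = \<Union>\<B>"
  using Lindelof[of \<B>] by (auto simp: \<B>_def)
 ultimately have un: "\<Union>\<B>' = U" by simp
 have "ALL S:\<B>'. AE x in lebesgue. x : S --> g x = 0" using \<B>'(1) loc by (auto simp: \<B>_def)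
 hence "AE x in lebesgue. ALL S:\<B>'. x : S --> g x = 0" using \<B>'(2) by (subst AE_ball_countable) auto
 hence "AE x in lebesgue. x : U --> g x = 0" by eventually_elim (use un in auto)
 thus ?thesis using Um by (simp add: AE_restrict_space_iff)
qed

lemma weak_gradientD:
 assumes "is_weak_gradient U f G"
 shows "locally_integrable U f" "locally_integrable U G"
  "ph : test_functions U ==> (LINT x|lebesgue_on U. f x * partial i ph x) = - (LINT x|lebesgue_on U. G x $ i * ph x)"
 using assms by (auto simp: is_weak_gradient_def)

lemma weak_gradient_unique:
 assumes U: "open U" and G: "is_weak_gradient U f G" and G': "is_weak_gradient U f' G'"
  and eq: "AE x in lebesgue_on U. f x = f' x"
 shows "AE x in lebesgue_on U. G x = G' x"
proof -
 note D = weak_gradientD[OF G] and D' = weak_gradientD[OF G']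
 have "AE x in lebesgue_on U. G x $ i - G' x $ i = 0" for i
 proof (rule fundamental_lemma[OF U])
  show "locally_integrable U (%x. G x $ i - G' x $ i)"
   by (intro locally_integrable_diff locally_integrable_component D D')
  fix ph assume ph: "ph : test_functions U"
  have i1: "integrable (lebesgue_on U) (%x. G x $ i * ph x)" "integrable (lebesgue_on U) (%x. G' x $ i * ph x)"
   by (intro integrable_test[OF _ U ph] locally_integrable_component D D')+
  have "(LINT x|lebesgue_on U. f x * partial i ph x) = (LINT x|lebesgue_on U. f' x * partial i ph x)"
   by (rule integral_cong_AE)
    (use integrable_test[OF D(1) U partial_test_function[OF ph]] integrable_test[OF D'(1) U partial_test_function[OF ph]] eq
     in \<open>auto intro: borel_measurable_integrable elim: eventually_mono\<close>)
  hence "(LINT x|lebesgue_on U. G x $ i * ph x) = (LINT x|lebesgue_on U. G' x $ i * ph x)"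
   using D(3)[OF ph, of i] D'(3)[OF ph, of i] by simp
  thus "(LINT x|lebesgue_on U. (G x $ i - G' x $ i) * ph x) = 0" using i1 by (simp add: left_diff_distrib)
 qed
 hence "AE x in lebesgue_on U. ALL i:UNIV. G x $ i - G' x $ i = 0" by (intro AE_finite_allI) auto
 thus ?thesis by eventually_elim (simp add: vec_eq_iff)
qed

lemma weak_gradient_add:
 assumes U: "open U" and F: "is_weak_gradient U f F" and G: "is_weak_gradient U g G"
 shows "is_weak_gradient U (%x. f x + g x) (%x. F x + G x)"
proof -
 note D = weak_gradientD[OF F] and D' = weak_gradientD[OF G]
 have "(LINT x|lebesgue_on U. (f x + g x) * partial i ph x) = - (LINT x|lebesgue_on U. (F x + G x) $ i * ph x)"
  if ph: "ph : test_functions U" for ph i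
 proof -
  have "integrable (lebesgue_on U) (%x. F x $ i * ph x)" "integrable (lebesgue_on U) (%x. G x $ i * ph x)"
   by (intro integrable_test[OF _ U ph] locally_integrable_component D D')+
  thus ?thesis using D(3)[OF ph, of i] D'(3)[OF ph, of i]
    integrable_test[OF D(1) U partial_test_function[OF ph]] integrable_test[OF D'(1) U partial_test_function[OF ph]]
   by (simp add: distrib_right)
 qed
 thus ?thesis using D D' by (auto simp: is_weak_gradient_def intro: locally_integrable_add)
qed

lemma weak_gradient_scale:
 assumes F: "is_weak_gradient U f F"
 shows "is_weak_gradient U (%x. c * f x) (%x. c *R F x)"
 using weak_gradientD[OF F] locally_integrable_scale[of U f c] locally_integrable_scale[of U F c]
 by (auto simp: is_weak_gradient_def mult.assoc)

lemma weak_gradient_smooth_mult: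
 assumes U: "open U" and F: "is_weak_gradient U f F" and s: "smooth th"
  and li: "locally_integrable U (%x. th x * f x)" "locally_integrable U (%x. th x *R F x + f x *R (\<chi> i. partial i th x))"
 shows "is_weak_gradient U (%x. th x * f x) (%x. th x *R F x + f x *R (\<chi> i. partial i th x))"
proof -
 note D = weak_gradientD[OF F]
 have "(LINT x|lebesgue_on U. (th x * f x) * partial i ph x) =
   - (LINT x|lebesgue_on U. (th x *R F x + f x *R (\<chi> i. partial i th x)) $ i * ph x)"
  if ph: "ph : test_functions U" for ph i
 proof -
  note T = test_functionsD[OF ph]
  have t: "(%x. th x * ph x) : test_functions U" by (rule smooth_mult_test_function[OF s ph])
  have t1: "(%x. th x * partial i ph x) : test_functions U"
   by (rule smooth_mult_test_function[OF s partial_test_function[OF ph]])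
  have t2: "(%x. partial i th x * ph x) : test_functions U"
   by (rule smooth_mult_test_function[OF smooth_partial[OF s] ph])
  have p: "partial i (%x. th x * ph x) x = th x * partial i ph x + ph x * partial i th x" for x
   by (intro partial_mult smooth_differentiable s T)
  note I1 = integrable_test[OF D(1) U t1] and I2 = integrable_test[OF D(1) U t2]
   and I3 = integrable_test[OF locally_integrable_component[OF D(2)] U t, of i]
  have "(LINT x|lebesgue_on U. f x * (th x * partial i ph x)) + (LINT x|lebesgue_on U. f x * (partial i th x * ph x))
    = (LINT x|lebesgue_on U. f x * (th x * partial i ph x) + f x * (partial i th x * ph x))" using I1 I2 by simp
  also have "... = (LINT x|lebesgue_on U. f x * partial i (%x. th x * ph x) x)"
   by (intro Bochner_Integration.integral_cong) (simp_all only: p, simp add: algebra_simps)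
  also have "... = - (LINT x|lebesgue_on U. F x $ i * (th x * ph x))" by (rule D(3)[OF t])
  finally have 1: "(LINT x|lebesgue_on U. f x * (th x * partial i ph x)) =
    - ((LINT x|lebesgue_on U. F x $ i * (th x * ph x)) + (LINT x|lebesgue_on U. f x * (partial i th x * ph x)))" by simp
  also have "... = - (LINT x|lebesgue_on U. F x $ i * (th x * ph x) + f x * (partial i th x * ph x))"
   using I2 I3 by simp
  finally show ?thesis by (simp add: algebra_simps)
 qed
 thus ?thesis using li by (auto simp: is_weak_gradient_def)
qed

lemma partial_along_line:
 assumes f: "Ck_R3 1 f"
 shows "((%s. f (x + s *R d)) has_real_derivative (\<chi> i. partial i f (x + s *R d)) \<bullet> d) (at s)"
proof -
 have "f differentiable (at (x + s *R d))" using C1_D[OF f] by blast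
 hence D: "(f has_derivative (%h. (\<chi> i. partial i f (x + s *R d)) \<bullet> h)) (at (x + s *R d))"
  using differentiable_has_derivative_partial[of f "x + s *R d"] by (simp add: inner_vec_def mult.commute)
 have L: "((%s. x + s *R d) has_derivative (%h. h *R d)) (at s)" by (auto intro!: derivative_eq_intros)
 show ?thesis using has_derivative_compose[OF L D]
  by (simp add: has_field_derivative_def mult.commute[of _ "_ \<bullet> _"] mult_commute_abs)
qed

lemma lborel_integral_shift:
 fixes f :: "R3 => real"
 assumes f: "f : bmeas borel"
 shows "(LINT x|lborel. f (x + c)) = (LINT x|lborel. f x)" "integrable lborel (%x. f (x + c)) \<longleftrightarrow> integrable lborel f"
proof -
 have "(LINT x|lborel. f x) = (LINT x|distr lborel borel ((+) c). f x)" by (simp add: lborel_distr_plus)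
 also have "... = (LINT x|lborel. f (c + x))" using f by (intro integral_distr) auto
 finally show "(LINT x|lborel. f (x + c)) = (LINT x|lborel. f x)" by (simp add: add.commute)
 have "integrable lborel f = integrable (distr lborel borel ((+) c)) f" by (simp add: lborel_distr_plus)
 also have "... = integrable lborel (%x. f (c + x))" using f by (intro integrable_distr_eq) auto
 finally show "integrable lborel (%x. f (x + c)) \<longleftrightarrow> integrable lborel f" by (simp add: add.commute)
qed

lemma integral_partial_eq_0:
 assumes u: "Ck_R3 1 u" and K: "compact K" "!!x. x ~: K ==> u x = 0"
 shows "(LINT x|lborel. partial i u x) = 0"
proof -
 note C = C1_D[OF u]
 have uc: "isCont u x" for x using C(2) by (simp add: continuous_on_eq_continuous_at)
 have um: "u : bmeas borel" using C(2) by (rule borel_contI)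
 obtain a b where ab: "K <= cbox a b" using bounded_subset_cbox_symmetric[OF compact_imp_bounded[OF K(1)]] by metis
 have p0: "partial i u x = 0" if "x ~: cbox a b" for x
 proof -
  have "(u has_derivative (%_. 0)) (at x)"
  proof (rule has_derivative_transform_within_open)
   show "((%_. 0) has_derivative (%_. 0)) (at x)" by simp
   show "open (- cbox a b)" by (simp add: open_Compl closed_cbox)
   show "x : - cbox a b" using that by simp
   show "0 = u y" if "y : - cbox a b" for y using that K(2) ab by auto
  qed
  thus ?thesis by (simp add: partial_eq)
 qed
 have "compact (partial i u ` cbox a b)" by (intro compact_continuous_image continuous_on_subset[OF C(3)]) auto
 then obtain L where L': "!!x. x : cbox a b ==> \<bar>partial i u x\<bar> <= L"
  using compact_imp_bounded bounded_iff by (metis image_eqI real_norm_def)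
 have L: "\<bar>partial i u x\<bar> <= max L 0" for x using L'[of x] p0[of x] by (cases "x : cbox a b") auto
 let ?e = "axis i 1 :: R3"
 have line: "((%t. u (x + t *R ?e)) has_real_derivative partial i u (x + t *R ?e)) (at t)" for x t
  using partial_along_line[OF u, of x ?e t] by (simp add: inner_axis)
 define D where "D = (%n x. (u (x + (1 / real (Suc n)) *R ?e) - u x) / (1 / real (Suc n)))"
 have ui: "integrable lborel u"
 proof -
  have "integrable lborel (%x. indicator (cbox a b) x *R u x)"
   by (rule borel_integrable_compact[OF compact_cbox]) (rule continuous_on_subset[OF C(2)], simp)
  moreover have "(%x. indicator (cbox a b) x *R u x) = u" using K(2) ab by (auto simp: fun_eq_iff indicator_def)
  ultimately show ?thesis by simp
 qed
 have ush: "integrable lborel (%x. u (x + c)) & (LINT x|lborel. u (x + c)) = (LINT x|lborel. u x)" for c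
  using lborel_integral_shift[OF um, of c] ui by simp
 have D0: "(LINT x|lborel. D n x) = 0" for n unfolding D_def using ush[of "(1 / real (Suc n)) *R ?e"] ui by simp
 have "(%n. LINT x|lborel. D n x) ----> (LINT x|lborel. partial i u x)"
 proof (rule integral_dominated_convergence[where w="%x. indicator (cbox (a - 1) (b + 1)) x * max L 0"])
  show "partial i u : bmeas lborel" using C(3) by (simp add: borel_contI)
  show "D n : bmeas lborel" for n unfolding D_def using um by (simp)
  show "integrable lborel (%x. indicator (cbox (a - 1) (b + 1)) x * max L 0 :: real)"
   by (auto intro!: integrable_mult_left integrable_real_indicator emeasure_lborel_cbox_finite)
  show "AE x in lborel. (%n. D n x) ----> partial i u x"
  proof (intro AE_I2)
   fix x
   have "((%h. (u (x + h *R ?e) - u x) / h) \<longlongrightarrow> partial i u x) (at 0)"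
    using line[of x 0] by (simp add: DERIV_def)
   moreover have "filterlim (%n. 1 / real (Suc n)) (at 0) sequentially"
    unfolding filterlim_at using LIMSEQ_inverse_real_of_nat by (auto simp: inverse_eq_divide)
   ultimately show "(%n. D n x) ----> partial i u x" unfolding D_def by (rule filterlim_compose)
  qed
  have "norm (D n x) <= indicator (cbox (a - 1) (b + 1)) x * max L 0" for n x
  proof (cases "x : cbox (a - 1) (b + 1)")
   case True
   let ?t = "1 / real (Suc n)"
   have t: "?t > 0" by simp
   obtain z where "u (x + ?t *R ?e) - u (x + 0 *R ?e) = (?t - 0) * partial i u (x + z *R ?e)"
    using MVT2[of 0 ?t "%t. u (x + t *R ?e)" "%t. partial i u (x + t *R ?e)"] line t by blast
   hence "D n x = partial i u (x + z *R ?e)" unfolding D_def using t by simp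
   thus ?thesis using True L[of "x + z *R ?e"] by simp
  next
   case False
   have t: "0 <= 1 / real (Suc n)" "1 / real (Suc n) <= 1" by simp_all
   have "x ~: cbox a b"
   proof
    assume m: "x : cbox a b"
    have "x : cbox (a - 1) (b + 1)" unfolding mem_box_cart
    proof
     fix j
     have "a $ j <= x $ j" "x $ j <= b $ j" using m by (auto simp: mem_box_cart)
     thus "(a - 1) $ j <= x $ j & x $ j <= (b + 1) $ j" by simp
    qed
    with False show False by simp
   qed
   moreover have "x + (1 / real (Suc n)) *R ?e ~: cbox a b"
   proof
    assume m: "x + (1 / real (Suc n)) *R ?e : cbox a b"
    have "x : cbox (a - 1) (b + 1)" unfolding mem_box_cart
    proof
     fix j
     have "a $ j <= x $ j + (1 / real (Suc n)) * ?e $ j" "x $ j + (1 / real (Suc n)) * ?e $ j <= b $ j"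
      using m by (auto simp: mem_box_cart)
     moreover have "0 <= (1 / real (Suc n)) * ?e $ j" "(1 / real (Suc n)) * ?e $ j <= 1" using t by (auto simp: axis_def)
     ultimately have "a $ j - 1 <= x $ j & x $ j <= b $ j + 1" by linarith
     thus "(a - 1) $ j <= x $ j & x $ j <= (b + 1) $ j" by simp
    qed
    with False show False by simp
   qed
   moreover have "u y = 0" if "y ~: cbox a b" for y using K(2) ab that by blast
   ultimately have "D n x = 0" by (simp add: D_def)
   thus ?thesis using False by simp
  qed
  thus "AE x in lborel. norm (D n x) <= indicator (cbox (a - 1) (b + 1)) x * max L 0" for n by simp
 qed
 thus ?thesis unfolding D0 by (simp add: LIMSEQ_const_iff)
qed

lemma locally_integrable_continuous:
 fixes f :: "R3 => 'b::euclidean_space"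
 assumes "continuous_on UNIV f"
 shows "locally_integrable U f" unfolding locally_integrable_def
proof (intro conjI allI impI)
 show "f : bmeas (lebesgue_on U)"
  by (intro measurable_restrict_space1 measurable_completion) (simp add: borel_contI assms)
 fix K assume "compact K & K <= U"
 hence K: "compact K" by simp
 have "integrable lborel (%x. indicator K x *R f x)"
  by (rule borel_integrable_compact[OF K continuous_on_subset[OF assms]]) simp
 hence "integrable lebesgue (%x. indicator K x *R f x)"
  by (subst integrable_completion) (auto dest: borel_measurable_integrable)
 thus "integrable (lebesgue_on K) f"
  using K by (subst integrable_restrict_space) (simp_all add: fmeasurableD lmeasurable_compact)
qed

lemma weak_gradient_C1:
 assumes U: "open U" and f: "Ck_R3 1 f"
 shows "is_weak_gradient U f (%x. \<chi> i. partial i f x)"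
proof -
 note C = C1_D[OF f]
 have cG: "continuous_on UNIV (%x. \<chi> i. partial i f x)" by (intro continuous_on_vec_lambda C)
 have "(LINT x|lebesgue_on U. f x * partial i ph x) = - (LINT x|lebesgue_on U. (\<chi> i. partial i f x) $ i * ph x)"
  if ph: "ph : test_functions U" for ph i
 proof -
  note T = test_functionsD[OF ph]
  define K where "K = closure {x. ph x ~= 0}"
  have K: "compact K" "K <= U" using T by (auto simp: K_def)
  have ph0: "ph x = 0" if "x ~: K" for x using that closure_subset[of "{x. ph x ~= 0}"] by (auto simp: K_def)
  have ph1: "partial i ph x = 0" if "x ~: K" for x
   using partial_support[OF smooth_differentiable[OF T(1)]] that by (simp add: K_def)
  have "Ck_R3 1 (%x. f x * ph x)" using f smooth_C1[OF T(1)] by (rule Ck_R3_mult)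
  hence "(LINT x|lborel. partial i (%x. f x * ph x) x) = 0" by (rule integral_partial_eq_0[OF _ K(1)]) (simp add: ph0)
  also have "partial i (%x. f x * ph x) = (%x. f x * partial i ph x + ph x * partial i f x)"
   by (rule ext, subst partial_mult[OF C(1) smooth_differentiable[OF T(1)]]) simp
  finally have 0: "(LINT x|lborel. f x * partial i ph x + partial i f x * ph x) = 0"
   by (simp add: mult.commute[of _ "partial i f _"])
  have c: "continuous_on UNIV (%x. f x * partial i ph x + partial i f x * ph x)"
   using C smooth_cont[OF T(1)] smooth_cont[OF smooth_partial[OF T(1)]] by (intro continuous_intros) auto
  have "0 = (LINT x|lebesgue. f x * partial i ph x + partial i f x * ph x)"
   using 0 by (subst integral_completion) (simp_all add: borel_contI c)
  also have "... = (LINT x|lebesgue. indicator U x *R (f x * partial i ph x + partial i f x * ph x))"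
  proof (intro Bochner_Integration.integral_cong refl)
   fix x show "f x * partial i ph x + partial i f x * ph x = indicat_real U x *R (f x * partial i ph x + partial i f x * ph x)"
   proof (cases "x : U")
    case False
    hence "x ~: K" using K(2) by blast
    thus ?thesis using ph0[of x] ph1[of x] False by simp
   qed simp
  qed
  also have "... = (LINT x|lebesgue_on U. f x * partial i ph x + partial i f x * ph x)"
   using U by (subst integral_restrict_space) auto
  also have "... = (LINT x|lebesgue_on U. f x * partial i ph x) + (LINT x|lebesgue_on U. partial i f x * ph x)"
   by (intro Bochner_Integration.integral_add integrable_test[OF _ U] locally_integrable_continuous C partial_test_function ph)
  finally show ?thesis by simp
 qed
 thus ?thesis using C cG by (auto simp: is_weak_gradient_def intro: locally_integrable_continuous)
qed

section \<open>Sobolev spaces on bounded open sets\<close>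

lemma finite_measure_lebesgue_on:
 assumes "open U" "bounded (U :: R3 set)"
 shows "finite_measure (lebesgue_on U)"
proof (rule finite_measureI)
 have "emeasure lebesgue U ~= \<infinity>" using fmeasurableD2[OF lmeasurable_open[OF assms(2,1)]] by simp
 thus "emeasure (lebesgue_on U) (space (lebesgue_on U)) ~= \<infinity>"
  using assms by (simp add: emeasure_restrict_space)
qed

locale bounded_domain =
 fixes U :: "R3 set"
 assumes open_U: "open U" and bounded_U: "bounded U"
begin

abbreviation \<L> :: "R3 measure" where "\<L> \<equiv> lebesgue_on U"

sublocale finite_measure "\<L>" by (rule finite_measure_lebesgue_on[OF open_U bounded_U])

lemma finite_U: "finite_measure \<L>" by (rule finite_measure_lebesgue_on[OF open_U bounded_U])

lemma sets_U: "U : sets lebesgue" using open_U by simp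

lemma Lp_integrable:
 assumes "f : Lp \<L> p" "p >= 1"
 shows "integrable \<L> f"
proof -
 have "f : Lp \<L> 1" using Lp_mono_exponent(1)[OF finite_U order_refl assms(2,1)] .
 thus ?thesis unfolding Lp_def by (auto simp: integrable_norm_iff)
qed

lemma Lp_locally_integrable:
 assumes "f : Lp \<L> p" "p >= 1"
 shows "locally_integrable U f" unfolding locally_integrable_def
proof (intro conjI allI impI)
 show "f : bmeas \<L>" using LpD(1)[OF assms(1)] .
 fix K assume K: "compact K & K <= U"
 hence Km: "K : sets lebesgue" by (simp add: fmeasurableD lmeasurable_compact)
 have Km': "K : sets \<L>" using K Km sets_U by (simp add: sets_restrict_space_iff)
 show "integrable (lebesgue_on K) f" unfolding lebesgue_on_restrict[OF conjunct2[OF K] Km sets_U]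
  using integrable_mult_indicator[OF Km' Lp_integrable[OF assms]] Km' K
  by (subst integrable_restrict_space) (auto simp: Int_absorb2)
qed

lemma continuous_bounded_Lp:
 fixes f :: "R3 => 'b::euclidean_space"
 assumes "continuous_on UNIV f" "p > 0"
 shows "f : Lp \<L> p"
proof -
 have "compact (f ` closure U)"
  using bounded_U by (intro compact_continuous_image continuous_on_subset[OF assms(1)]) (auto simp: compact_closure)
 then obtain C where C: "!!x. x : closure U ==> norm (f x) <= C"
  using compact_imp_bounded bounded_iff by (metis image_eqI)
 have m: "f : bmeas \<L>" by (intro measurable_restrict_space1 measurable_completion) (simp add: borel_contI assms)
 have c: "(%_. C) : Lp \<L> p" by (auto simp: Lp_def)
 have "AE x in \<L>. norm (f x) <= norm C"
  using C closure_subset[of U] by (intro AE_I2) (auto simp: subset_iff intro: order_trans[OF _ abs_ge_self])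
 thus ?thesis using Lp_dominated(1)[OF c m _ assms(2)] by auto
qed

lemma wgrad_eq:
 assumes "is_weak_gradient U f G"
 shows "is_weak_gradient U f (wgrad U f)" "AE x in \<L>. wgrad U f x = G x"
proof -
 show w: "is_weak_gradient U f (wgrad U f)" unfolding wgrad_def by (rule someI[where P="is_weak_gradient U f", OF assms])
 show "AE x in \<L>. wgrad U f x = G x" by (rule weak_gradient_unique[OF open_U w assms]) simp
qed

lemma W1pD:
 assumes "f : W1p U p"
 shows "f : Lp \<L> p" "is_weak_gradient U f (wgrad U f)" "wgrad U f : Lp \<L> p"
proof -
 obtain G where G: "G : Lp \<L> p" "is_weak_gradient U f G" and f: "f : Lp \<L> p" using assms by (auto simp: W1p_def)
 show "f : Lp \<L> p" by fact
 note w = wgrad_eq[OF G(2)]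
 show "is_weak_gradient U f (wgrad U f)" by (rule w)
 have "wgrad U f : bmeas \<L>" using weak_gradientD(2)[OF w(1)] by (simp add: locally_integrable_def)
 thus "wgrad U f : Lp \<L> p" using Lp_AE_cong(2)[OF w(2)] G(1) LpD(1)[OF G(1)] by blast
qed

lemma W1pI:
 assumes "f : Lp \<L> p" "G : Lp \<L> p" "is_weak_gradient U f G"
 shows "f : W1p U p" "Lp_norm \<L> p (wgrad U f) = Lp_norm \<L> p G"
proof -
 show f: "f : W1p U p" using assms by (auto simp: W1p_def)
 show "Lp_norm \<L> p (wgrad U f) = Lp_norm \<L> p G"
  by (rule Lp_AE_cong(1)[OF wgrad_eq(2)[OF assms(3)]]) (use LpD(1)[OF W1pD(3)[OF f]] LpD(1)[OF assms(2)] in auto)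
qed

lemma W1p_add:
 assumes f: "f : W1p U p" and g: "g : W1p U p" and p: "p >= 1"
 shows "f + g : W1p U p" "AE x in \<L>. wgrad U (f + g) x = wgrad U f x + wgrad U g x"
proof -
 have w: "is_weak_gradient U (f + g) (%x. wgrad U f x + wgrad U g x)"
  using weak_gradient_add[OF open_U W1pD(2)[OF f] W1pD(2)[OF g]] by (simp add: plus_fun_def)
 show "f + g : W1p U p" by (rule W1pI(1)[OF _ _ w])
    (use Lp_add(1)[OF W1pD(1)[OF f] W1pD(1)[OF g] p] Lp_add(1)[OF W1pD(3)[OF f] W1pD(3)[OF g] p] in \<open>simp_all add: plus_fun_def\<close>)
 show "AE x in \<L>. wgrad U (f + g) x = wgrad U f x + wgrad U g x" by (rule wgrad_eq(2)[OF w])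
qed

lemma W1p_scale:
 assumes f: "f : W1p U p" and p: "p >= 1"
 shows "c *R f : W1p U p" "AE x in \<L>. wgrad U (c *R f) x = c *R wgrad U f x"
proof -
 have w: "is_weak_gradient U (c *R f) (%x. c *R wgrad U f x)"
  using weak_gradient_scale[OF W1pD(2)[OF f]] by (simp add: scaleR_fun_def)
 show "c *R f : W1p U p" by (rule W1pI(1)[OF _ _ w])
    (use Lp_scale(1)[OF W1pD(1)[OF f]] Lp_scale(1)[OF W1pD(3)[OF f]] p in \<open>simp_all add: scaleR_fun_def\<close>)
 show "AE x in \<L>. wgrad U (c *R f) x = c *R wgrad U f x" by (rule wgrad_eq(2)[OF w])
qed

lemma W1p_norm_ge:
 assumes "p > 0"
 shows "Lp_norm \<L> p f <= W1p_norm U p f" "Lp_norm \<L> p (wgrad U f) <= W1p_norm U p f"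
proof -
 let ?a = "Lp_norm \<L> p f" and ?b = "Lp_norm \<L> p (wgrad U f)"
 have "(?a powr p) powr (1 / p) <= (?a powr p + ?b powr p) powr (1 / p)" using assms by (intro powr_mono2) auto
 thus "?a <= W1p_norm U p f" using assms by (simp add: W1p_norm_def powr_powr Lp_norm_nonneg)
 have "(?b powr p) powr (1 / p) <= (?a powr p + ?b powr p) powr (1 / p)" using assms by (intro powr_mono2) auto
 thus "?b <= W1p_norm U p f" using assms by (simp add: W1p_norm_def powr_powr Lp_norm_nonneg)
qed

lemma W1p_norm_nonneg: "0 <= W1p_norm U p f" by (simp add: W1p_norm_def)

lemma H1_norm_eq: "H1_norm U f = sqrt ((Lp_norm \<L> 2 f)^2 + (Lp_norm \<L> 2 (wgrad U f))^2)"
 by (simp add: W1p_norm_def Lp_norm_nonneg powr_half_sqrt)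

lemma H1_norm_le: "H1_norm U f <= Lp_norm \<L> 2 f + Lp_norm \<L> 2 (wgrad U f)"
 unfolding H1_norm_eq by (rule sqrt_sum_squares_le_sum) (auto simp: Lp_norm_nonneg)

lemma Lp_norm_wgrad_scale:
 assumes f: "f : W1p U p" and p: "p >= 1"
 shows "Lp_norm \<L> p (wgrad U (c *R f)) = \<bar>c\<bar> * Lp_norm \<L> p (wgrad U f)"
 using Lp_AE_cong(1)[OF W1p_scale(2)[OF f p, of c], of p] Lp_scale[OF W1pD(3)[OF f], of c] p
  LpD(1)[OF W1pD(3)[OF W1p_scale(1)[OF f p]]] LpD(1)[OF Lp_scale(1)[OF W1pD(3)[OF f]]] by simp

lemma Lp_norm_wgrad_add:
 assumes f: "f : W1p U p" and g: "g : W1p U p" and p: "p >= 1"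
 shows "Lp_norm \<L> p (wgrad U (f + g)) <= Lp_norm \<L> p (wgrad U f) + Lp_norm \<L> p (wgrad U g)"
proof -
 note A = Lp_add[OF W1pD(3)[OF f] W1pD(3)[OF g] p]
 show ?thesis
  using Lp_AE_cong(1)[OF W1p_add(2)[OF f g p], of p] A LpD(1)[OF W1pD(3)[OF W1p_add(1)[OF f g p]]] LpD(1)[OF A(1)]
  by simp
qed

lemma W1p_zero: "p >= 1 ==> 0 : W1p U p"
proof -
 have "is_weak_gradient U 0 (%_. 0)"
  using weak_gradient_C1[OF open_U Ck_R3_const[of 1 0]] by (simp add: partial_const zero_fun_def zero_vec_def)
 thus "0 : W1p U p" if "p >= 1" using W1pI(1)[of "%_. 0" p "%_. 0", OF Lp_zero Lp_zero] by (simp add: zero_fun_def)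
qed

lemma W1p_homogeneous:
 assumes p: "p >= 1"
 shows "homogeneous (W1p U p) (W1p_norm U p)"
proof -
 have "W1p_norm U p (c *R f) = \<bar>c\<bar> * W1p_norm U p f" if f: "f : W1p U p" for c f
 proof -
  have "Lp_norm \<L> p (c *R f) = \<bar>c\<bar> * Lp_norm \<L> p f"
   using Lp_scale(2)[OF W1pD(1)[OF f], of c] p by (simp add: scaleR_fun_def)
  thus ?thesis using p Lp_norm_wgrad_scale[OF f p, of c]
   by (simp add: W1p_norm_def powr_mult Lp_norm_nonneg powr_powr flip: distrib_left)
 qed
 thus ?thesis using W1p_add(1)[OF _ _ p] W1p_scale(1)[OF _ p] W1p_norm_nonneg W1p_zero[OF p]
  by (auto simp: homogeneous_def gauged_def simp del: plus_fun_apply)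
qed

lemma seminormed_H1: "seminormed (H1 U) (H1_norm U)"
proof
 have h: "homogeneous (H1 U) (H1_norm U)" by (rule W1p_homogeneous) simp
 show "x + y : H1 U" if "x : H1 U" "y : H1 U" for x y :: "R3 => real"
  using h that unfolding homogeneous_def gauged_def by blast
 show "c *R x : H1 U" "H1_norm U (c *R x) = \<bar>c\<bar> * H1_norm U x" if "x : H1 U" for x :: "R3 => real" and c
  using h that unfolding homogeneous_def gauged_def by blast+
 show "0 : H1 U" using h unfolding homogeneous_def by blast
 fix f g assume f: "f : H1 U" and g: "g : H1 U"
 let ?n = "Lp_norm \<L> 2"
 have "?n (f + g) <= ?n f + ?n g" using Lp_add(2)[OF W1pD(1)[OF f] W1pD(1)[OF g]] by (simp add: plus_fun_def)
 moreover have "Lp_norm \<L> 2 (wgrad U (f + g)) <= Lp_norm \<L> 2 (wgrad U f) + Lp_norm \<L> 2 (wgrad U g)"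
  by (rule Lp_norm_wgrad_add[OF f g]) simp
 ultimately have "H1_norm U (f + g) <= sqrt ((?n f + ?n g)^2 + (Lp_norm \<L> 2 (wgrad U f) + Lp_norm \<L> 2 (wgrad U g))^2)"
  unfolding H1_norm_eq by (intro real_sqrt_le_mono add_mono power_mono) (auto simp: Lp_norm_nonneg)
 also have "... <= H1_norm U f + H1_norm U g" unfolding H1_norm_eq by (rule real_sqrt_sum_squares_triangle_ineq)
 finally show "H1_norm U (f + g) <= H1_norm U f + H1_norm U g" .
qed

sublocale H: seminormed "H1 U" "H1_norm U" by (rule seminormed_H1)
sublocale I: seminormed "Linf \<L>" "Linf_norm \<L>" by (rule seminormed_Linf)

lemma bl_wgrad:
 assumes p: "p >= 1"
 shows "bounded_linear_btw (W1p U p) (W1p_norm U p) (Lp \<L> p) (Lp_norm \<L> p) (wgrad U)"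
proof -
 have z: "Lp_norm \<L> p h = 0" if "AE x in \<L>. h x = 0" "h : bmeas \<L>"
  for h :: "R3 => R3" using Lp_AE_cong(1)[OF that(1,2), of p] by (simp add: Lp_norm_def)
 have m: "wgrad U f : bmeas \<L>" if "f : W1p U p" for f using LpD(1)[OF W1pD(3)[OF that]] .
 show ?thesis unfolding bounded_linear_btw_def
 proof (intro conjI ballI allI)
  show "wgrad U x : Lp \<L> p" if "x : W1p U p" for x using W1pD(3)[OF that] .
  show "Lp_norm \<L> p (wgrad U (x + y) - wgrad U x - wgrad U y) = 0"
   if "x : W1p U p" "y : W1p U p" for x y
   by (rule z) (use W1p_add[OF that p] m that in \<open>auto simp: fun_diff_def elim!: eventually_mono\<close>)
  show "Lp_norm \<L> p (wgrad U (c *R x) - c *R wgrad U x) = 0" if "x : W1p U p" for c x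
   by (rule z) (use W1p_scale[OF that p, of c] m that in \<open>auto simp: fun_diff_def scaleR_fun_def elim!: eventually_mono\<close>)
  show "EX C. ALL x:W1p U p. Lp_norm \<L> p (wgrad U x) <= C * W1p_norm U p x"
   using W1p_norm_ge(2)[of p] p by (intro exI[of _ 1]) auto
 qed
qed

lemma bl_W1p_Lp:
 assumes p: "p >= 1"
 shows "bounded_linear_btw (W1p U p) (W1p_norm U p) (Lp \<L> p) (Lp_norm \<L> p) (%f. f)" by (rule bl_exactI[where C=1])
   (use p W1p_norm_ge(1)[of p] W1pD(1) seminormed.n_zero[OF seminormed_Lp[OF p]] in auto)

lemma C1_H1:
 assumes f: "Ck_R3 1 f"
 shows "f : H1 U" "AE x in \<L>. wgrad U f x = (\<chi> i. partial i f x)"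
proof -
 note C = C1_D[OF f] and w = weak_gradient_C1[OF open_U f]
 show "f : H1 U" by (rule W1pI(1)[OF _ _ w]) (auto intro!: continuous_bounded_Lp C continuous_on_vec_lambda)
 show "AE x in \<L>. wgrad U f x = (\<chi> i. partial i f x)" by (rule wgrad_eq(2)[OF w])
qed

end

section \<open>Translation and mollification in \<open>L\<^sup>2\<close>\<close>

lemma nn_integral_shift:
 fixes f :: "R3 => ennreal"
 assumes [measurable]: "f : bmeas borel"
 shows "(NN x. f (x + c)) = (NN x. f x)"
proof -
 have "(NN x. f x) = (\<integral>\<^sup>+x. f x \<partial>distr lborel borel ((+) c))" by (simp add: lborel_distr_plus)
 also have "... = (NN x. f (c + x))" by (rule nn_integral_distr) auto
 finally show ?thesis by (simp add: add.commute)
qed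

definition translation_continuous :: "(R3 => real) => bool" where
 "translation_continuous g \<longleftrightarrow> (ALL e>0. EX d>0. ALL y. norm y < d -->
   (sqn (%x. g (x + y) - g x)) <= ennreal e)"

lemma sq_add_le: "((a::real) + b)^2 <= 2 * a^2 + 2 * b^2"
 using zero_le_power2[of "a - b"] by (simp add: power2_eq_square algebra_simps)

lemma ennreal_sq_add_le: "ennreal ((a + b)^2) <= 2 * ennreal (a^2) + 2 * ennreal (b^2)"
proof -
 have "ennreal ((a + b)^2) <= ennreal (2 * a^2 + 2 * b^2)" by (intro ennreal_leI sq_add_le)
 also have "... = 2 * ennreal (a^2) + 2 * ennreal (b^2)" by (simp add: ennreal_plus ennreal_mult)
 finally show ?thesis .
qed

lemma nn_integral_sq_add_le:
 fixes f g :: "R3 => real"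
 assumes [measurable]: "f : bmeas borel" "g : bmeas borel"
 shows "(sqn (%x. f x + g x)) \<le>
   2 * (sqn f) + 2 * (sqn g)"
proof -
 have "(sqn (%x. f x + g x)) <= (NN x. 2 * ennreal ((f x)^2) + 2 * ennreal ((g x)^2))"
  by (intro nn_integral_mono ennreal_sq_add_le)
 also have "... = 2 * (sqn f) + 2 * (sqn g)" by (simp add: nn_integral_add nn_integral_cmult)
 finally show ?thesis .
qed

lemma ennreal_two_two: "0 <= a ==> 0 <= b ==> 2 * ennreal a + 2 * ennreal b = ennreal (2 * a + 2 * b)"
 by (simp add: ennreal_mult)

lemma integral_abs_le:
 fixes f g :: "'a => real"
 assumes "integrable M f" "integrable M g" "!!x. \<bar>f x\<bar> <= g x"
 shows "\<bar>LINT x|M. f x\<bar> <= (LINT x|M. g x)"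
 by (rule order_trans[OF integral_abs_bound integral_mono]) (use assms in auto)

lemma translation_continuous_add:
 assumes [measurable]: "f : bmeas borel" "g : bmeas borel"
  and f: "translation_continuous f" and g: "translation_continuous g"
 shows "translation_continuous (%x. f x + g x)" unfolding translation_continuous_def
proof (intro allI impI)
 fix e :: real assume e: "e > 0"
 obtain d1 where d1: "d1 > 0" "!!y. norm y < d1 ==> (sqn (%x. f (x + y) - f x)) <= ennreal (e/4)"
  using f e unfolding translation_continuous_def by (meson divide_pos_pos zero_less_numeral)
 obtain d2 where d2: "d2 > 0" "!!y. norm y < d2 ==> (sqn (%x. g (x + y) - g x)) <= ennreal (e/4)"
  using g e unfolding translation_continuous_def by (meson divide_pos_pos zero_less_numeral)
 have "(sqn (%x. f (x + y) + g (x + y) - (f x + g x))) <= ennreal e" if y: "norm y < min d1 d2" for y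
 proof -
  have "(sqn (%x. f (x + y) + g (x + y) - (f x + g x)))
    = (sqn (%x. (f (x + y) - f x) + (g (x + y) - g x)))" by (simp add: algebra_simps)
  also have "... <= 2 * (sqn (%x. f (x + y) - f x)) + 2 * (sqn (%x. g (x + y) - g x))"
   by (rule nn_integral_sq_add_le) measurable
  also have "... <= 2 * ennreal (e/4) + 2 * ennreal (e/4)"
   using d1(2)[of y] d2(2)[of y] y by (intro add_mono mult_left_mono) auto
  also have "... = ennreal (2 * (e/4) + 2 * (e/4))" using e by (intro ennreal_two_two) auto
  finally show ?thesis by simp
 qed
 thus "EX d>0. ALL y. norm y < d --> (sqn (%x. f (x + y) + g (x + y) - (f x + g x))) <= ennreal e"
  using d1(1) d2(1) by (intro exI[of _ "min d1 d2"]) auto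
qed

lemma translation_continuous_scale:
 assumes [measurable]: "f : bmeas borel" and f: "translation_continuous f"
 shows "translation_continuous (%x. c * f x)" unfolding translation_continuous_def
proof (intro allI impI)
 fix e :: real assume e: "e > 0"
 have "e / (c^2 + 1) > 0" using e by (simp add: add_nonneg_pos)
 then obtain d where d: "d > 0" "!!y. norm y < d ==> (sqn (%x. f (x + y) - f x)) <= ennreal (e / (c^2 + 1))"
  using f unfolding translation_continuous_def by meson
 have "(sqn (%x. c * f (x + y) - c * f x)) <= ennreal e" if y: "norm y < d" for y
 proof -
  have "(sqn (%x. c * f (x + y) - c * f x)) = (NN x. ennreal (c^2) * ennreal ((f (x + y) - f x)^2))"
   by (simp add: ennreal_mult[symmetric] power_mult_distrib[symmetric] right_diff_distrib)
  also have "... = ennreal (c^2) * (sqn (%x. f (x + y) - f x))" by (simp add: nn_integral_cmult)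
  also have "... <= ennreal (c^2) * ennreal (e / (c^2 + 1))" by (intro mult_left_mono d y) auto
  also have "... = ennreal (c^2 * (e / (c^2 + 1)))" using e by (intro ennreal_mult[symmetric]) auto
  also have "... <= ennreal e"
  proof (intro ennreal_leI)
   have "c^2 / (c^2 + 1) <= 1" by (simp add: divide_le_eq_1 add_nonneg_pos)
   hence "e * (c^2 / (c^2 + 1)) <= e * 1" using e by (intro mult_left_mono) auto
   thus "c^2 * (e / (c^2 + 1)) <= e" by (simp add: mult.commute)
  qed
  finally show ?thesis .
 qed
 thus "EX d>0. ALL y. norm y < d --> (sqn (%x. c * f (x + y) - c * f x)) <= ennreal e" using d(1) by blast
qed

lemma translation_continuous_limit:
 assumes [measurable]: "f : bmeas borel"
  and lim: "!!e. e > 0 ==> EX g. g : bmeas borel & translation_continuous g \<and>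
    (sqn (%x. f x - g x)) <= ennreal e"
 shows "translation_continuous f" unfolding translation_continuous_def
proof (intro allI impI)
 fix e :: real assume e: "e > 0"
 obtain g where [measurable]: "g : bmeas borel" and tg: "translation_continuous g"
  and g: "(sqn (%x. f x - g x)) <= ennreal (e/10)" using lim[of "e/10"] e by auto
 obtain d where d: "d > 0" "!!y. norm y < d ==> (sqn (%x. g (x + y) - g x)) <= ennreal (e/10)"
  using tg e unfolding translation_continuous_def by (meson divide_pos_pos zero_less_numeral)
 have "(sqn (%x. f (x + y) - f x)) <= ennreal e" if y: "norm y < d" for y
 proof -
  let ?a = "%x. f (x + y) - g (x + y)" and ?b = "%x. g (x + y) - g x" and ?c = "%x. - (f x - g x)"
  have 1: "(sqn (%x. ?a x)) <= ennreal (e/10)" using nn_integral_shift[of "%x. ennreal ((f x - g x)^2)" y] g by simp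
  have 3: "(sqn (%x. ?c x)) <= ennreal (e/10)" using g by (simp only: power2_minus)
  have "(sqn (%x. f (x + y) - f x)) = (sqn (%x. (?a x + ?b x) + ?c x))" by simp
  also have "... <= 2 * (sqn (%x. ?a x + ?b x)) + 2 * (sqn (%x. ?c x))" by (rule nn_integral_sq_add_le) measurable
  also have "(sqn (%x. ?a x + ?b x)) <= 2 * (sqn (%x. ?a x)) + 2 * (sqn (%x. ?b x))"
   by (rule nn_integral_sq_add_le) measurable
  also have "2 * (2 * (sqn (%x. ?a x)) + 2 * (sqn (%x. ?b x))) + 2 * (sqn (%x. ?c x))
    <= 2 * (2 * ennreal (e/10) + 2 * ennreal (e/10)) + 2 * ennreal (e/10)"
   by (intro add_mono mult_left_mono 1 3 d(2) y) auto
  also have "... = ennreal (2 * (2 * (e/10) + 2 * (e/10)) + 2 * (e/10))"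
   using e by (subst ennreal_two_two, simp, simp, subst ennreal_two_two) auto
  also have "2 * (2 * (e/10) + 2 * (e/10)) + 2 * (e/10) = e" by simp
  finally show ?thesis by (simp add: mult_left_mono)
 qed
 thus "EX d>0. ALL y. norm y < d --> (sqn (%x. f (x + y) - f x)) <= ennreal e" using d(1) by blast
qed

text \<open>For an open set the indicator at \<open>x + y\<close> is eventually one wherever it is one at \<open>x\<close>, so
  dominated convergence applies; the rest of the symmetric difference is a translate.\<close>

lemma translation_continuous_open:
 assumes UU: "open UU" and fin: "emeasure lborel UU < \<infinity>"
 shows "translation_continuous (indicator UU)"
proof -
 have [measurable]: "UU : sets borel" using UU by simp
 define h where "h = (%y. (NN x. ennreal (indicator UU x * (1 - indicator UU (x + y)))))"
 have eq: "(sqn (%x. indicator UU (x + y) - indicator UU x)) = h y + h (- y)" for y :: R3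
 proof -
  have "(sqn (%x. indicator UU (x + y) - indicator UU x)) =
   (NN x. ennreal (indicator UU x * (1 - indicator UU (x + y))) + ennreal (indicator UU (x + y) * (1 - indicator UU x)))"
   by (intro nn_integral_cong) (auto simp: indicator_def)
  also have "... = h y + (NN x. ennreal (indicator UU (x + y) * (1 - indicator UU x)))"
   unfolding h_def by (rule nn_integral_add) measurable
  also have "(NN x. ennreal (indicator UU (x + y) * (1 - indicator UU x))) = h (- y)"
   using nn_integral_shift[of "%x. ennreal (indicator UU x * (1 - indicator UU (x - y)))" y] by (simp add: h_def)
  finally show ?thesis .
 qed
 have lim: "(%n. h (y n)) ----> 0" if y: "y ----> 0" for y :: "nat => R3"
 proof -
  have "(%n. h (y n)) ----> (\<integral>\<^sup>+x. 0 \<partial>(lborel :: R3 measure))" unfolding h_def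
  proof (rule nn_integral_dominated_convergence[where w="indicator UU"])
   show "AE x in lborel. ennreal (indicator UU x * (1 - indicator UU (x + y n))) <= indicator UU x" for n
    by (auto simp: indicator_def)
   show "(NN x. indicator UU x) < \<infinity>" using fin by simp
   show "AE x in lborel. (%n. ennreal (indicator UU x * (1 - indicator UU (x + y n)))) ----> 0"
   proof (intro AE_I2)
    fix x
    show "(%n. ennreal (indicator UU x * (1 - indicator UU (x + y n)))) ----> 0"
    proof (cases "x : UU")
     case True
     have "(%n. x + y n) ----> x + 0" by (intro tendsto_intros y)
     hence "\<forall>\<^sub>F n in sequentially. x + y n : UU" using UU True by (simp add: topological_tendstoD)
     hence "\<forall>\<^sub>F n in sequentially. ennreal (indicator UU x * (1 - indicator UU (x + y n))) = 0"
      by eventually_elim simp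
     thus ?thesis by (rule tendsto_eventually)
    qed simp
   qed
  qed measurable
  thus ?thesis by simp
 qed
 show ?thesis unfolding translation_continuous_def
 proof (rule ccontr)
  assume "\<not> (ALL e>0. EX d>0. ALL y. norm y < d --> (sqn (%x. indicator UU (x + y) - indicator UU x)) <= ennreal e)"
  then obtain e where e: "e > 0" and ex: "!!d. d > 0 ==> EX y. norm y < d & ennreal e < h y + h (- y)"
   unfolding eq by (auto simp: not_le)
  have "EX y. norm y < 1 / real (Suc n) & ennreal e < h y + h (- y)" for n by (rule ex) simp
  then obtain y where y: "!!n. norm (y n) < 1 / real (Suc n)" "!!n. ennreal e < h (y n) + h (- y n)" by metis
  have "y ----> 0" by (rule Lim_null_comparison[OF _ LIMSEQ_inverse_real_of_nat])
     (use y(1) in \<open>auto intro!: always_eventually less_imp_le simp: inverse_eq_divide\<close>)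
  hence "(%n. h (y n) + h (- y n)) ----> 0 + 0"
   by (intro tendsto_add lim) (auto intro: tendsto_minus_cancel_left[THEN iffD1] tendsto_eq_intros)
  hence "\<forall>\<^sub>F n in sequentially. h (y n) + h (- y n) < ennreal e" using e by (intro order_tendstoD(2)) auto
  then obtain n where "h (y n) + h (- y n) < ennreal e" by (auto simp: eventually_sequentially)
  with y(2)[of n] show False by simp
 qed
qed

lemma translation_continuous_indicator:
 assumes A[measurable]: "A : sets borel" and fin: "emeasure lborel A < \<infinity>"
 shows "translation_continuous (indicator A)"
proof (rule translation_continuous_limit)
 fix e :: real assume e: "e > 0"
 obtain UU where UU: "open UU" "A <= UU" "emeasure lborel (UU - A) < e" using outer_regular_lborel[OF A e] .
 have [measurable]: "UU : sets borel" using UU by simp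
 have "emeasure lborel UU = emeasure lborel A + emeasure lborel (UU - A)"
  using UU(2) by (subst plus_emeasure) (auto simp: Un_absorb1)
 also have "... < \<infinity>" using fin UU(3) by (auto simp: less_top[symmetric] ennreal_add_eq_top intro: less_trans)
 finally have "translation_continuous (indicator UU)" by (rule translation_continuous_open[OF UU(1)])
 moreover have "(sqn (%x. indicator A x - indicator UU x)) = (NN x. indicator (UU - A) x)"
  using UU(2) by (intro nn_integral_cong) (auto simp: indicator_def)
 hence "(sqn (%x. indicator A x - indicator UU x)) <= ennreal e" using UU(3) by simp
 ultimately show "EX g. g : bmeas borel & translation_continuous g \<and>
    (sqn (%x. indicator A x - g x)) <= ennreal e" by (intro exI[of _ "indicator UU"]) auto
qed simp

lemma translation_continuous_nonneg:
 fixes u :: "R3 => real"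
 assumes "u : bmeas borel" "!!x. 0 <= u x"
 shows "(sqn u) < \<infinity> --> translation_continuous u" using assms
proof (induction u rule: borel_measurable_induct_real)
 case (set A)
 have "(sqn (%x. indicator A x)) = (NN x. indicator A x)" by (intro nn_integral_cong) (auto simp: indicator_def)
 thus ?case using translation_continuous_indicator[of A] set by auto
next
 case (mult u c)
 show ?case
 proof
  assume f: "(sqn (%x. c * u x)) < \<infinity>"
  show "translation_continuous (%x. c * u x)"
  proof (cases "c = 0")
   case True
   thus ?thesis by (auto simp: translation_continuous_def intro: exI[of _ 1])
  next
   case False
   have [measurable]: "u : bmeas borel" by fact
   have "(sqn (%x. c * u x)) = ennreal (c^2) * (sqn u)" by (simp add: power_mult_distrib ennreal_mult nn_integral_cmult)
   hence "(sqn u) < \<infinity>" using f False by (auto simp: ennreal_mult_less_top)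
   thus ?thesis using mult by (intro translation_continuous_scale) auto
  qed
 qed
next
 case (add u v)
 show ?case
 proof
  assume f: "(sqn (%x. v x + u x)) < \<infinity>"
  have "(sqn v) <= (sqn (%x. v x + u x))"
     "(sqn u) <= (sqn (%x. v x + u x))" using add by (auto intro!: nn_integral_mono ennreal_leI power_mono)
  thus "translation_continuous (%x. v x + u x)" using f add by (intro translation_continuous_add) auto
 qed
next
 case (seq UU)
 note [measurable] = seq(1) \<open>u : bmeas borel\<close>
 have le: "UU i x <= u x" for i x using seq(3,4) by (intro incseq_le) (auto simp: incseq_def le_fun_def)
 show ?case
 proof
  assume f: "(sqn u) < \<infinity>"
  have t: "translation_continuous (UU i)" for i
  proof -
   have "(sqn (%x. UU i x)) <= (sqn u)" using le seq(2) by (auto intro!: nn_integral_mono ennreal_leI power_mono)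
   thus ?thesis using f seq(5)[of i] by auto
  qed
  have "(%i. (sqn (%x. u x - UU i x))) ----> (\<integral>\<^sup>+x. 0 \<partial>(lborel :: R3 measure))"
  proof (rule nn_integral_dominated_convergence[where w="%x. ennreal ((u x)^2)"])
   show "AE x in lborel. ennreal ((u x - UU i x)^2) <= ennreal ((u x)^2)" for i
    using le seq(2) by (auto intro!: AE_I2 ennreal_leI power_mono)
   show "AE x in lborel. (%i. ennreal ((u x - UU i x)^2)) ----> 0"
   proof (intro AE_I2)
    fix x
    have "(%i. ennreal ((u x - UU i x)^2)) ----> ennreal ((u x - u x)^2)"
     using seq(4)[of x] by (intro tendsto_intros) auto
    thus "(%i. ennreal ((u x - UU i x)^2)) ----> 0" by simp
   qed
  qed (use f in auto)
  hence lim: "(%i. (sqn (%x. u x - UU i x))) ----> 0" by simp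
  show "translation_continuous u"
  proof (rule translation_continuous_limit)
   fix e :: real assume e: "e > 0"
   hence "\<forall>\<^sub>F i in sequentially. (sqn (%x. u x - UU i x)) < ennreal e"
    by (intro order_tendstoD(2)[OF lim]) auto
   then obtain i where "(sqn (%x. u x - UU i x)) < ennreal e" by (auto simp: eventually_sequentially)
   thus "EX g. g : bmeas borel & translation_continuous g \<and>
    (sqn (%x. u x - g x)) <= ennreal e" using t by (intro exI[of _ "UU i"]) auto
  qed simp
 qed
qed

lemma translation_continuous_L2:
 assumes [measurable]: "g : bmeas borel" and f: "(sqn g) < \<infinity>"
 shows "translation_continuous g"
proof -
 have "(sqn (%x. max (g x) 0)) <= (sqn g)" by (intro nn_integral_mono ennreal_leI) (auto simp: max_def)
 hence 1: "translation_continuous (%x. max (g x) 0)" using f translation_continuous_nonneg[of "%x. max (g x) 0"] by auto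
 have "(sqn (%x. max (- g x) 0)) <= (sqn g)" by (intro nn_integral_mono ennreal_leI) (auto simp: max_def)
 hence "translation_continuous (%x. max (- g x) 0)"
  using f translation_continuous_nonneg[of "%x. max (- g x) 0"] by auto
 hence 2: "translation_continuous (%x. - 1 * max (- g x) 0)" by (intro translation_continuous_scale) auto
 have "translation_continuous (%x. max (g x) 0 + - 1 * max (- g x) 0)" by (intro translation_continuous_add 1 2) auto
 moreover have "(%x. max (g x) 0 + - 1 * max (- g x) 0) = g" by (auto simp: fun_eq_iff max_def)
 ultimately show ?thesis by simp
qed

text \<open>Averages of translates are close to \<open>g\<close> in \<open>L\<^sup>2\<close> because each translate is (Jensen and
  Tonelli).\<close>

lemma mollification_L2_close:
 fixes g K :: "R3 => real"
 assumes g[measurable]: "g : bmeas borel" and gi: "integrable lborel g"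
  and K[measurable]: "K : bmeas borel" and K0: "!!y. 0 <= K y" "!!y. K y <= B"
  and K1: "(NN y. ennreal (K y)) = 1"
  and close: "!!y. K y ~= 0 ==> (sqn (%x. g (x + y) - g x)) <= ennreal e"
 shows "(sqn (%x. (LINT z|lborel. K (z - x) * g z) - g x)) <= ennreal e"
proof -
 have Ki: "integrable lborel K" "(LINT y|lborel. K y) = 1"
 proof -
  show i: "integrable lborel K" using K1 K0 by (intro integrableI_nonneg) auto
  have "ennreal (LINT y|lborel. K y) = 1" using nn_integral_eq_integral[OF i] K0 K1 by simp
  thus "(LINT y|lborel. K y) = 1" by simp
 qed
 have pw: "ennreal (((LINT z|lborel. K (z - x) * g z) - g x)^2) <= (NN y. ennreal (K y * (g (x + y) - g x)^2))" for x
 proof -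
  have "integrable lborel (%z. g (z + x))" using gi lborel_integral_shift(2)[OF g, of x] by simp
  hence "integrable lborel (%y. g (x + y))" by (simp add: add.commute)
  hence "integrable lborel (%y. B * norm (g (x + y)))" by simp
  hence I1: "integrable lborel (%y. K y * g (x + y))"
  proof (rule Bochner_Integration.integrable_bound)
   show "AE y in lborel. norm (K y * g (x + y)) <= norm (B * norm (g (x + y)))"
   proof (intro AE_I2)
    fix y
    have "0 <= B" using K0[of y] by linarith
    thus "norm (K y * g (x + y)) <= norm (B * norm (g (x + y)))"
     using K0[of y] by (auto simp: abs_mult intro!: mult_right_mono)
   qed
  qed measurable
  have I2: "integrable lborel (%y. K y * g x)" using Ki by simp
  have "(LINT z|lborel. K (z - x) * g z) = (LINT y|lborel. K (y + x - x) * g (y + x))"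
   by (rule lborel_integral_shift(1)[symmetric]) measurable
  also have "... = (LINT y|lborel. K y * g (x + y))" by (simp add: add.commute)
  finally have "(LINT z|lborel. K (z - x) * g z) - g x = (LINT y|lborel. K y * g (x + y)) - (LINT y|lborel. K y * g x)"
   using Ki by simp
  also have "... = (LINT y|lborel. K y * (g (x + y) - g x))" using I1 I2 by (simp add: right_diff_distrib)
  finally have eq: "(LINT z|lborel. K (z - x) * g z) - g x = (LINT y|lborel. K y * (g (x + y) - g x))" .
  have I3: "integrable lborel (%y. K y * (g (x + y) - g x))" using I1 I2 by (simp add: right_diff_distrib)
  have "ennreal \<bar>LINT y|lborel. K y * (g (x + y) - g x)\<bar> <= (NN y. ennreal \<bar>K y * (g (x + y) - g x)\<bar>)"
   using integral_norm_bound_ennreal[OF I3] by simp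
  also have "... = (NN y. ennreal (sqrt (K y)) * ennreal (sqrt (K y) * \<bar>g (x + y) - g x\<bar>))"
   using K0 by (intro nn_integral_cong) (simp add: ennreal_mult[symmetric] abs_mult flip: mult.assoc)
  finally have 1: "ennreal \<bar>LINT y|lborel. K y * (g (x + y) - g x)\<bar> <= ..." .
  have "ennreal (((LINT z|lborel. K (z - x) * g z) - g x)^2) = (ennreal \<bar>LINT y|lborel. K y * (g (x + y) - g x)\<bar>)^2"
   unfolding eq by (simp add: ennreal_power)
  also have "... <= (NN y. ennreal (sqrt (K y)) * ennreal (sqrt (K y) * \<bar>g (x + y) - g x\<bar>))^2"
   by (intro power_mono 1) auto
  also have "... <= (NN y. (ennreal (sqrt (K y)))^2) * (NN y. (ennreal (sqrt (K y) * \<bar>g (x + y) - g x\<bar>))^2)"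
   by (rule Cauchy_Schwarz_nn_integral) measurable
  also have "(NN y. (ennreal (sqrt (K y)))^2) = 1" using K0 K1 by (simp add: ennreal_power)
  also have "(NN y. (ennreal (sqrt (K y) * \<bar>g (x + y) - g x\<bar>))^2) = (NN y. ennreal (K y * (g (x + y) - g x)^2))"
   using K0 by (simp add: ennreal_power power_mult_distrib)
  finally show ?thesis by simp
 qed
 have "(sqn (%x. (LINT z|lborel. K (z - x) * g z) - g x)) \<le>
   (NN x. (NN y. ennreal (K y * (g (x + y) - g x)^2)))" by (intro nn_integral_mono pw)
 also have "... = (NN y. (NN x. ennreal (K y * (g (x + y) - g x)^2)))"
  by (rule lborel_pair.Fubini'[symmetric]) measurable
 also have "... <= (NN y. ennreal (K y) * ennreal e)"
 proof (intro nn_integral_mono)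
  fix y
  have "(NN x. ennreal (K y * (g (x + y) - g x)^2)) = ennreal (K y) * (sqn (%x. g (x + y) - g x))"
   using K0 by (simp add: ennreal_mult nn_integral_cmult)
  also have "... <= ennreal (K y) * ennreal e" using close[of y] by (cases "K y = 0") (auto intro: mult_left_mono)
  finally show "(NN x. ennreal (K y * (g (x + y) - g x)^2)) <= ennreal (K y) * ennreal e" .
 qed
 also have "... = ennreal e" using K1 by (simp add: nn_integral_multc)
 finally show ?thesis .
qed

text \<open>A smooth function with compact support is Lipschitz, and so are its partial derivatives;
  this bounds the remainder when differentiating under the integral.\<close>

lemma smooth_compact_support_lipschitz:
 assumes F: "smooth F" and K: "compact K" "!!x. x ~: K ==> F x = 0"
 shows "EX L>=0. ALL x y. \<bar>F x - F y\<bar> <= L * norm (x - y)"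
proof -
 have p0: "partial i F x = 0" if "x ~: K" for i x
 proof -
  have "closure {x. F x ~= 0} <= K" using K by (intro closure_minimal) (auto intro: compact_imp_closed)
  thus ?thesis using that partial_support[OF smooth_differentiable[OF F]] by blast
 qed
 have "EX L. ALL x. \<bar>partial i F x\<bar> <= L" for i
 proof -
  have "compact (partial i F ` K)"
   by (intro compact_continuous_image continuous_on_subset[OF smooth_cont[OF smooth_partial[OF F]]] K) auto
  then obtain L where "!!x. x : K ==> \<bar>partial i F x\<bar> <= L"
   using compact_imp_bounded bounded_iff by (metis image_eqI real_norm_def)
  hence "\<bar>partial i F x\<bar> <= max L 0" for x using p0[of x i] by (cases "x : K") fastforce+
  thus ?thesis by blast
 qed
 then obtain L where L: "!!i x. \<bar>partial i F x\<bar> <= L i" by metis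
 have L0: "0 <= L i" for i using L[of i 0] by linarith
 have "\<bar>F x - F y\<bar> <= (\<Sum>i\<in>UNIV. L i) * norm (x - y)" for x y
 proof -
  have "norm (F x - F y) <= (\<Sum>i\<in>UNIV. L i) * norm (x - y)"
  proof (rule differentiable_bound[OF convex_UNIV])
   fix z :: R3
   show "(F has_derivative (%h. \<Sum>i\<in>UNIV. h $ i * partial i F z)) (at z within UNIV)"
    using differentiable_has_derivative_partial[OF smooth_differentiable[OF F]] by simp
   show "onorm (%h::R3. \<Sum>i\<in>UNIV. h $ i * partial i F z) <= (\<Sum>i\<in>UNIV. L i)"
   proof (rule onorm_bound)
    fix h :: R3
    have "norm (\<Sum>i\<in>UNIV. h $ i * partial i F z) <= (\<Sum>i\<in>UNIV. L i * norm h)"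
    proof (intro sum_norm_le)
     fix i :: 3
     have "\<bar>partial i F z\<bar> * \<bar>h $ i\<bar> <= L i * norm h"
      by (intro mult_mono L component_le_norm_cart L0) auto
     thus "norm (h $ i * partial i F z) <= L i * norm h" by (simp add: abs_mult mult.commute)
    qed
    thus "norm (\<Sum>i\<in>UNIV. h $ i * partial i F z) <= (\<Sum>i\<in>UNIV. L i) * norm h" by (simp add: sum_distrib_right)
   qed (auto intro: sum_nonneg L0)
  qed auto
  thus ?thesis by simp
 qed
 thus ?thesis using L0 by (intro exI[of _ "\<Sum>i\<in>UNIV. L i"]) (auto intro: sum_nonneg)
qed

lemma convolution_C1:
 assumes K: "smooth K" and S: "compact S" "!!x. x ~: S ==> K x = 0"
  and g: "integrable lborel g" and gm[measurable]: "g : bmeas borel"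
 shows "Ck_R3 1 (%x. LINT z|lborel. K (z - x) * g z)"
  "partial i (%x. LINT z|lborel. K (z - x) * g z) x = - (LINT z|lborel. partial i K (z - x) * g z)"
proof -
 have S': "partial i K x = 0" if "x ~: S" for i x
 proof -
  have "closure {x. K x ~= 0} <= S" using S by (intro closure_minimal) (auto intro: compact_imp_closed)
  thus ?thesis using that partial_support[OF smooth_differentiable[OF K]] by blast
 qed
 have int: "integrable lborel (%z. F (z - x) * g z)" if F: "smooth F" "!!x. x ~: S ==> F x = 0" for F x
 proof -
  have "compact (F ` S)" by (intro compact_continuous_image continuous_on_subset[OF smooth_cont[OF F(1)]] S) auto
  then obtain B where "!!x. x : S ==> \<bar>F x\<bar> <= B"
   using compact_imp_bounded bounded_iff by (metis image_eqI real_norm_def)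
  hence B: "\<bar>F x\<bar> <= \<bar>B\<bar>" for x using F(2)[of x] by (cases "x : S") fastforce+
  have Fm: "F : bmeas borel" using smooth_cont[OF F(1)] by (rule borel_contI)
  have "integrable lborel (%z. \<bar>B\<bar> * g z)" using g by simp
  thus ?thesis by (rule Bochner_Integration.integrable_bound)
     (use B Fm in \<open>auto simp: abs_mult intro!: mult_right_mono\<close>)
 qed
 define N where "N = (LINT z|lborel. \<bar>g z\<bar>)"
 have N: "N >= 0" by (simp add: N_def)
 have gi: "integrable lborel (%z. c * \<bar>g z\<bar>)" for c using g by simp
 have "EX L>=0. ALL x y. \<bar>partial i K x - partial i K y\<bar> <= L * norm (x - y)" for i
  by (rule smooth_compact_support_lipschitz[OF smooth_partial[OF K] S(1) S'])
 then obtain L where L0: "!!i. L i >= 0" and L: "!!i x y. \<bar>partial i K x - partial i K y\<bar> <= L i * norm (x - y)" by metis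
 define C where "C = (\<Sum>i\<in>UNIV. L i)"
 have C0: "C >= 0" unfolding C_def by (auto intro: sum_nonneg L0)
 have rem: "\<bar>K (w - h) - K w + (\<Sum>i\<in>UNIV. h $ i * partial i K w)\<bar> <= C * (norm h)^2" for w h
 proof -
  let ?K' = "%x h. \<Sum>i\<in>UNIV. h $ i * partial i K x"
  have "norm (K (w - h) - K w - ?K' w ((w - h) - w)) <= norm ((w - h) - w) * (C * norm h)"
  proof (rule differentiable_bound_linearization[where S="cball w (norm h)"])
   show "w + t *R ((w - h) - w) : cball w (norm h)" if "t : {0..1}" for t
    using that by (auto simp: dist_norm mult_left_le_one_le)
   show "(K has_derivative ?K' x) (at x within cball w (norm h))" for x
    using differentiable_has_derivative_partial[OF smooth_differentiable[OF K]] by (rule has_derivative_at_withinI)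
   show "w : cball w (norm h)" by simp
   fix x assume x: "x : cball w (norm h)"
   show "onorm (?K' x - ?K' w) <= C * norm h"
   proof (rule onorm_bound)
    fix k :: R3
    have "norm ((?K' x - ?K' w) k) = \<bar>\<Sum>i\<in>UNIV. k $ i * (partial i K x - partial i K w)\<bar>"
     by (simp add: fun_diff_def sum_subtractf right_diff_distrib)
    also have "... <= (\<Sum>i\<in>UNIV. \<bar>k $ i * (partial i K x - partial i K w)\<bar>)" by (rule sum_abs)
    also have "... <= (\<Sum>i\<in>UNIV. norm k * (L i * norm h))"
    proof (rule sum_mono)
     fix i :: 3
     have "\<bar>partial i K x - partial i K w\<bar> <= L i * norm (x - w)" by (rule L)
     also have "... <= L i * norm h" using x L0 by (intro mult_left_mono) (auto simp: dist_norm norm_minus_commute)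
     finally show "\<bar>k $ i * (partial i K x - partial i K w)\<bar> <= norm k * (L i * norm h)"
      unfolding abs_mult by (intro mult_mono component_le_norm_cart) (auto)
    qed
    also have "... = (C * norm h) * norm k" by (simp add: C_def sum_distrib_left sum_distrib_right mult_ac)
    finally show "norm ((?K' x - ?K' w) k) <= C * norm h * norm k" .
   qed (use C0 in simp)
  qed
  thus ?thesis by (simp add: sum_negf power2_eq_square mult_ac)
 qed
 let ?ps = "%x. LINT z|lborel. K (z - x) * g z"
 let ?P = "%i x. LINT z|lborel. partial i K (z - x) * g z"
 note iK = int[OF K S(2)] and iP = int[OF smooth_partial[OF K] S']
 have der: "(?ps has_derivative (%h. \<Sum>i\<in>UNIV. h $ i * (- ?P i x))) (at x)" for x
 proof (rule has_derivativeI_sandwich[of 1 _ _ _ _ "%y. C * N * norm (y - x)"])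
  show "bounded_linear (%h::R3. \<Sum>i\<in>UNIV. h $ i * (- ?P i x))"
   by (intro bounded_linear_sum bounded_linear_mult_const bounded_linear_vec_nth)
  show "((%y. C * N * norm (y - x)) \<longlongrightarrow> 0) (at x)" by (auto intro!: tendsto_eq_intros)
  fix y :: R3 assume "y ~= x"
  define h where "h = y - x"
  have h: "norm h > 0" using \<open>y ~= x\<close> by (simp add: h_def)
  have e1: "z - y = (z - x) - h" for z by (simp add: h_def)
  have "?ps y - ?ps x - (\<Sum>i\<in>UNIV. (y - x) $ i * (- ?P i x)) = ?ps y - ?ps x + (\<Sum>i\<in>UNIV. h $ i * ?P i x)"
   by (simp add: h_def sum_negf)
  also have "... = (LINT z|lborel. K (z - y) * g z - K (z - x) * g z + (\<Sum>i\<in>UNIV. h $ i * (partial i K (z - x) * g z)))"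
   using iK iP by (simp add: Bochner_Integration.integral_add Bochner_Integration.integral_diff Bochner_Integration.integral_sum)
  also have "... = (LINT z|lborel. (K ((z - x) - h) - K (z - x) + (\<Sum>i\<in>UNIV. h $ i * partial i K (z - x))) * g z)"
   unfolding e1 by (simp add: algebra_simps sum_distrib_left sum_distrib_right)
  finally have eq: "?ps y - ?ps x - (\<Sum>i\<in>UNIV. (y - x) $ i * (- ?P i x)) =
    (LINT z|lborel. (K ((z - x) - h) - K (z - x) + (\<Sum>i\<in>UNIV. h $ i * partial i K (z - x))) * g z)" .
  have Ri: "integrable lborel (%z. (K ((z - x) - h) - K (z - x) + (\<Sum>i\<in>UNIV. h $ i * partial i K (z - x))) * g z)"
  proof -
   have "integrable lborel (%z. K (z - y) * g z - K (z - x) * g z + (\<Sum>i\<in>UNIV. h $ i * (partial i K (z - x) * g z)))"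
    using iK iP by (intro Bochner_Integration.integrable_add Bochner_Integration.integrable_diff Bochner_Integration.integrable_sum integrable_mult_right) auto
   thus ?thesis unfolding e1 by (simp add: algebra_simps sum_distrib_left sum_distrib_right)
  qed
  have "\<bar>LINT z|lborel. (K ((z - x) - h) - K (z - x) + (\<Sum>i\<in>UNIV. h $ i * partial i K (z - x))) * g z\<bar>
    <= (LINT z|lborel. C * (norm h)^2 * \<bar>g z\<bar>)"
   by (rule integral_abs_le[OF Ri gi]) (auto simp: abs_mult intro!: mult_right_mono rem)
  also have "... = C * N * norm h * norm h" by (simp add: N_def power2_eq_square)
  finally have "norm (?ps y - ?ps x - (\<Sum>i\<in>UNIV. (y - x) $ i * (- ?P i x))) <= C * N * norm h * norm h"
   unfolding eq real_norm_def .
  thus "norm (?ps y - ?ps x - (\<Sum>i\<in>UNIV. (y - x) $ i * (- ?P i x))) / norm (y - x) <= C * N * norm (y - x)"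
   using h unfolding h_def by (subst pos_divide_le_eq) auto
 qed simp
 show P: "partial i ?ps x = - ?P i x" for i x
 proof -
  have "partial i ?ps x = (\<Sum>j\<in>UNIV. axis i 1 $ j * (- ?P j x))" by (rule partial_eq[OF der])
  also have "... = (\<Sum>j\<in>UNIV. if j = i then - ?P j x else 0)" by (intro sum.cong) (auto simp: axis_def)
  finally show ?thesis by simp
 qed
 have "continuous_on UNIV (partial i ?ps)" for i
 proof -
  have lip: "\<bar>?P i x - ?P i y\<bar> <= L i * N * norm (x - y)" for x y
  proof -
   have "?P i x - ?P i y = (LINT z|lborel. (partial i K (z - x) - partial i K (z - y)) * g z)"
    using iP by (simp add: left_diff_distrib)
   also have "\<bar>...\<bar> <= (LINT z|lborel. L i * norm (x - y) * \<bar>g z\<bar>)"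
   proof (rule integral_abs_le[OF _ gi])
    show "integrable lborel (%z. (partial i K (z - x) - partial i K (z - y)) * g z)"
     using iP by (simp add: left_diff_distrib)
    fix z
    have "\<bar>partial i K (z - x) - partial i K (z - y)\<bar> <= L i * norm (x - y)"
     using L[of i "z - x" "z - y"] by (simp add: norm_minus_commute)
    thus "\<bar>(partial i K (z - x) - partial i K (z - y)) * g z\<bar> <= L i * norm (x - y) * \<bar>g z\<bar>"
     by (simp add: abs_mult mult_right_mono)
   qed
   also have "... = L i * N * norm (x - y)" by (simp add: N_def)
   finally show ?thesis .
  qed
  have "(L i * N)-lipschitz_on UNIV (partial i ?ps)"
   by (rule lipschitz_onI) (use lip L0 N in \<open>auto simp: P dist_norm abs_minus_commute\<close>)
  thus ?thesis by (rule lipschitz_on_continuous_on)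
 qed
 thus "Ck_R3 1 ?ps" using der by (intro C1_I) (auto simp: differentiable_def)
qed

section \<open>Density of smooth functions up to the boundary\<close>

lemma bump_shift: "bump n a b (z - x) = bump n (a + x) (b + x) z" by (simp add: bump_def algebra_simps)

lemma partial_translate:
 assumes "!!x. f differentiable (at x)"
 shows "partial i (%z. f (z - x)) z = partial i f (z - x)"
proof -
 obtain f' where f': "(f has_derivative f') (at (z - x))" using assms by (auto simp: differentiable_def)
 have "((%z. z - x) has_derivative (%h. h)) (at z)" by (auto intro!: derivative_eq_intros)
 from has_derivative_compose[OF this f'] have "((%z. f (z - x)) has_derivative f') (at z)" by simp
 thus ?thesis using partial_eq f' by metis
qed

text \<open>A normalised bump in the cube of half-width \<open>s\<close> around \<open>a\<close>.\<close>

definition mollifier :: "R3 => real => R3 => real" where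
 "mollifier a s y = (1 / (LINT y|lborel. bump 1 (a - vec s) (a + vec s) y)) * bump 1 (a - vec s) (a + vec s) y"

lemma integrable_bump: "integrable lborel (bump 1 a b)"
proof -
 have "integrable lborel (%x. indicator (cbox a b) x *R bump 1 a b x)"
  by (rule borel_integrable_compact[OF compact_cbox]) (rule continuous_on_subset[OF smooth_cont[OF smooth_bump]], simp)
 moreover have "(%x. indicator (cbox a b) x *R bump 1 a b x) = bump 1 a b"
 proof
  fix x show "indicator (cbox a b) x *R bump 1 a b x = bump 1 a b x"
   using bump_eq_0[of 1 x a b] box_subset_cbox[of a b] by (cases "x : cbox a b") (simp, simp, blast)
 qed
 ultimately show ?thesis by simp
qed

lemma integral_bump_pos:
 assumes "s > 0" shows "0 < (LINT y|lborel. bump 1 (a - vec s) (a + vec s) y)"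
proof -
 let ?b = "bump 1 (a - vec s) (a + vec s)"
 have "(LINT y|lborel. ?b y) ~= 0"
 proof
  assume "(LINT y|lborel. ?b y) = 0"
  hence "AE y in lborel. ?b y = 0"
   by (subst (asm) integral_nonneg_eq_0_iff_AE[OF integrable_bump]) (auto simp: bump_range)
  hence "AE y in lborel. y ~: box (a - vec s) (a + vec s)" by eventually_elim (metis bump_pos less_irrefl zero_less_one)
  hence "box (a - vec s) (a + vec s) : null_sets lborel"
   using AE_iff_null_sets[of "box (a - vec s) (a + vec s)" lborel] by simp
  hence "negligible (box (a - vec s) (a + vec s))" by (simp add: negligible_iff_null_sets null_sets_completionI)
  moreover have "a : box (a - vec s) (a + vec s)" using assms by (simp add: mem_box_cart)
  ultimately show False using open_not_negligible[OF open_box] by blast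
 qed
 moreover have "0 <= (LINT y|lborel. ?b y)" by (simp add: bump_range)
 ultimately show ?thesis by simp
qed

lemma mollifier:
 assumes s: "s > 0"
 shows "smooth (mollifier a s)" "0 <= mollifier a s y"
  "mollifier a s y <= 1 / (LINT y|lborel. bump 1 (a - vec s) (a + vec s) y)"
  "y ~: cube a s ==> mollifier a s y = 0"
  "(NN y. ennreal (mollifier a s y)) = 1" "integrable lborel (mollifier a s)" "(LINT y|lborel. mollifier a s y) = 1"
proof -
 let ?I = "LINT y|lborel. bump 1 (a - vec s) (a + vec s) y"
 note I = integral_bump_pos[OF s, of a]
 show "smooth (mollifier a s)" unfolding mollifier_def[abs_def] using smooth_bump by (intro allI Ck_R3_cmult) blast
 show 0: "0 <= mollifier a s y" for y using I bump_range by (simp add: mollifier_def)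
 show "mollifier a s y <= 1 / ?I"
  unfolding mollifier_def using I bump_range(2)[of 1 "a - vec s" "a + vec s" y] by (intro mult_left_le) auto
 show "y ~: cube a s ==> mollifier a s y = 0"
  using bump_eq_0[of 1 y "a - vec s" "a + vec s"] box_subset_cbox by (auto simp: mollifier_def)
 show i: "integrable lborel (mollifier a s)" unfolding mollifier_def[abs_def] using integrable_bump by simp
 show i1: "(LINT y|lborel. mollifier a s y) = 1" unfolding mollifier_def using I by simp
 show "(NN y. ennreal (mollifier a s y)) = 1" using nn_integral_eq_integral[OF i] 0 i1 by simp
qed

context bounded_domain
begin

lemma continuous_Linf:
 assumes k: "continuous_on UNIV k"
 shows "k : Linf \<L>" "c >= 0 ==> (!!x. x : U ==> \<bar>k x\<bar> <= c) ==> Linf_norm \<L> k <= c"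
proof -
 have "compact (k ` closure U)"
  using bounded_U by (intro compact_continuous_image continuous_on_subset[OF k]) (auto simp: compact_closure)
 then obtain C where "!!x. x : closure U ==> norm (k x) <= C" using compact_imp_bounded bounded_iff by (metis image_eqI)
 hence "!!x. x : U ==> \<bar>k x\<bar> <= \<bar>C\<bar>" using closure_subset[of U] by (fastforce simp: subset_iff)
 thus "k : Linf \<L>"
  using continuous_measurable_lebesgue_on[OF k] by (intro LinfI(1)[where c="\<bar>C\<bar>"]) (auto intro!: AE_I2)
 show "Linf_norm \<L> k <= c" if "c >= 0" "!!x. x : U ==> \<bar>k x\<bar> <= c"
  using continuous_measurable_lebesgue_on[OF k] that by (intro LinfI(2)) (auto intro!: AE_I2)
qed

lemma smooth_mult_H1:
 assumes f: "f : H1 U" and s: "smooth th"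
 defines "G \<equiv> %x. th x *R wgrad U f x + f x *R (\<chi> i. partial i th x)"
 shows "(%x. th x * f x) : H1 U" "is_weak_gradient U (%x. th x * f x) G" "G : Lp \<L> 2"
  "(%x. th x * f x) : Lp \<L> 2"
  "[|a >= 0; b >= 0; !!x. x : U ==> \<bar>th x\<bar> <= a; !!i x. x : U ==> \<bar>partial i th x\<bar> <= b|] ==>
    H1_norm U (%x. th x * f x) <= (2 * a + 3 * b) * H1_norm U f"
proof -
 let ?L = "\<L>"
 note W = W1pD[OF f]
 note c0 = continuous_Linf[OF smooth_cont[OF s]] and c1 = continuous_Linf[OF smooth_cont[OF smooth_partial[OF s]]]
 have m: "(%x. th x * f x) : Lp ?L 2" "Lp_norm ?L 2 (%x. th x * f x) <= Linf_norm ?L th * Lp_norm ?L 2 f"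
  using Linf_times_Lp[OF c0(1) W(1)] by auto
 thus "(%x. th x * f x) : Lp ?L 2" by simp
 have g1: "(%x. th x *R wgrad U f x) : Lp ?L 2" "Lp_norm ?L 2 (%x. th x *R wgrad U f x) <= Linf_norm ?L th * Lp_norm ?L 2 (wgrad U f)"
  using Linf_times_Lp[OF c0(1) W(3)] by auto
 have gc: "(%x. f x * partial i th x) : Lp ?L 2" "Lp_norm ?L 2 (%x. f x * partial i th x) <= Linf_norm ?L (partial i th) * Lp_norm ?L 2 f" for i
  using Linf_times_Lp[OF c1(1) W(1), of i] by (auto simp: mult.commute)
 have g2: "(%x. f x *R (\<chi> i. partial i th x)) : Lp ?L 2"
  "Lp_norm ?L 2 (%x. f x *R (\<chi> i. partial i th x)) <= (\<Sum>i\<in>UNIV. Lp_norm ?L 2 (%x. f x * partial i th x))"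
  using Lp_componentsI[of "%x. f x *R (\<chi> i. partial i th x)" ?L 2] gc by auto
 show G: "G : Lp ?L 2" unfolding G_def by (rule Lp_add(1)[OF g1(1) g2(1)]) simp
 show w: "is_weak_gradient U (%x. th x * f x) G" unfolding G_def
  by (rule weak_gradient_smooth_mult[OF open_U W(2) s]) (use Lp_locally_integrable[OF m(1)] Lp_locally_integrable[OF G] in \<open>auto simp: G_def\<close>)
 show "(%x. th x * f x) : H1 U" by (rule W1pI(1)[OF m(1) G w])
 assume ab: "a >= 0" "b >= 0" "!!x. x : U ==> \<bar>th x\<bar> <= a" "!!i x. x : U ==> \<bar>partial i th x\<bar> <= b"
 let ?F = "Lp_norm ?L 2 f" and ?D = "Lp_norm ?L 2 (wgrad U f)" and ?H = "H1_norm U f"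
 have le: "?F <= ?H" "?D <= ?H" "0 <= ?F" "0 <= ?D" using W1p_norm_ge[of 2 f] by (auto simp: Lp_norm_nonneg)
 have n0: "Linf_norm ?L th <= a" using c0(2)[of a] ab by auto
 have n1: "Linf_norm ?L (partial i th) <= b" for i using c1(2)[of b i] ab by auto
 have "H1_norm U (%x. th x * f x) <= Lp_norm ?L 2 (%x. th x * f x) + Lp_norm ?L 2 G"
  using H1_norm_le[of "%x. th x * f x"] W1pI(2)[OF m(1) G w] by simp
 also have "Lp_norm ?L 2 G <= Lp_norm ?L 2 (%x. th x *R wgrad U f x) + Lp_norm ?L 2 (%x. f x *R (\<chi> i. partial i th x))"
  unfolding G_def by (rule Lp_add(2)[OF g1(1) g2(1)]) simp
 also have "Lp_norm ?L 2 (%x. f x *R (\<chi> i. partial i th x)) <= (\<Sum>i\<in>(UNIV :: 3 set). b * ?H)"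
  by (rule order_trans[OF g2(2)], rule sum_mono, rule order_trans[OF gc(2)], rule mult_mono) (use n1 ab le in auto)
 also have "Lp_norm ?L 2 (%x. th x *R wgrad U f x) <= a * ?H"
  by (rule order_trans[OF g1(2)], rule mult_mono) (use n0 ab le in auto)
 also have "Lp_norm ?L 2 (%x. th x * f x) <= a * ?H"
  by (rule order_trans[OF m(2)], rule mult_mono) (use n0 ab le in auto)
 finally show "H1_norm U (%x. th x * f x) <= (2 * a + 3 * b) * ?H" by (simp add: algebra_simps)
qed

text \<open>The bound \<open>M\<close> may be infinite. It records that the approximants of an essentially bounded
  function stay uniformly bounded, which is what bounds traces.\<close>

definition approximable :: "ereal => (R3 => real) => bool" where
 "approximable M f \<longleftrightarrow> f : H1 U \<and>
   (ALL e>0. EX ps. Ck_R3 1 ps & H1_norm U (ps - f) < e & (ALL x. ereal \<bar>ps x\<bar> <= M))"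

lemma approximable_zero: "approximable 0 0"
proof -
 have "Ck_R3 1 (0 :: R3 => real)" using Ck_R3_const[of 1 0] by (simp add: zero_fun_def)
 thus ?thesis using H.zero_mem by (auto simp: approximable_def intro!: exI[of _ 0])
qed

lemma approximable_add:
 assumes f: "approximable M f" and g: "approximable N g"
 shows "approximable (M + N) (f + g)"
proof -
 have fg: "f : H1 U" "g : H1 U" using f g by (auto simp: approximable_def)
 have "EX ps. Ck_R3 1 ps & H1_norm U (ps - (f + g)) < e & (ALL x. ereal \<bar>ps x\<bar> <= M + N)" if e: "e > 0" for e
 proof -
  obtain p where p: "Ck_R3 1 p" "H1_norm U (p - f) < e/2" "!!x. ereal \<bar>p x\<bar> <= M"
   using f e unfolding approximable_def by (meson half_gt_zero)
  obtain q where q: "Ck_R3 1 q" "H1_norm U (q - g) < e/2" "!!x. ereal \<bar>q x\<bar> <= N"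
   using g e unfolding approximable_def by (meson half_gt_zero)
  have m: "p - f : H1 U" "q - g : H1 U" using p q fg C1_H1(1) by (auto intro!: H.diff_mem)
  have "H1_norm U ((p - f) + (q - g)) < e" using H.triangle[OF m] p q by simp
  moreover have "(p - f) + (q - g) = (p + q) - (f + g)" by simp
  moreover have "Ck_R3 1 (p + q)" using Ck_R3_add[OF p(1) q(1)] by (simp add: plus_fun_def)
  moreover have "ereal \<bar>(p + q) x\<bar> <= M + N" for x
  proof -
   have "ereal \<bar>(p + q) x\<bar> <= ereal \<bar>p x\<bar> + ereal \<bar>q x\<bar>" by simp
   also have "... <= M + N" by (intro add_mono p q)
   finally show ?thesis .
  qed
  ultimately show ?thesis by (intro exI[of _ "p + q"]) auto
 qed
 thus ?thesis using H.add_mem[OF fg] by (simp add: approximable_def)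
qed

lemma approximable_sum:
 assumes "finite I" "!!i. i : I ==> approximable M (f i)"
 shows "approximable (ereal (real (card I)) * M) (sum f I)" using assms
proof (induction I rule: finite_induct)
 case empty
 thus ?case using approximable_zero by (simp flip: zero_ereal_def zero_fun_def)
next
 case (insert i I)
 hence "approximable (M + ereal (real (card I)) * M) (f i + sum f I)" by (intro approximable_add) auto
 moreover have "ereal (real (card (insert i I))) * M = M + ereal (real (card I)) * M"
 proof -
  have eq: "ereal (real (card (insert i I))) = 1 + ereal (real (card I))" using insert by (simp add: one_ereal_def)
  show ?thesis unfolding eq by (subst ereal_left_distrib) auto
 qed
 moreover have "sum f (insert i I) = f i + sum f I" using insert(1,2) by (rule sum.insert)
 ultimately show ?case by (simp only:)
qed

lemma approximable_limit:
 assumes f: "f : H1 U" and lim: "!!e. e > 0 ==> EX g. approximable M g & H1_norm U (g - f) < e"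
 shows "approximable M f"
proof -
 have "EX ps. Ck_R3 1 ps & H1_norm U (ps - f) < e & (ALL x. ereal \<bar>ps x\<bar> <= M)" if e: "e > 0" for e
 proof -
  obtain g where g: "approximable M g" "H1_norm U (g - f) < e/2" using lim[of "e/2"] e by auto
  obtain p where p: "Ck_R3 1 p" "H1_norm U (p - g) < e/2" "!!x. ereal \<bar>p x\<bar> <= M"
   using g e unfolding approximable_def by (meson half_gt_zero)
  have gH: "g : H1 U" using g by (simp add: approximable_def)
  have "H1_norm U ((p - g) + (g - f)) <= H1_norm U (p - g) + H1_norm U (g - f)"
   using C1_H1(1)[OF p(1)] gH f by (intro H.triangle H.diff_mem)
  hence "H1_norm U (p - f) < e" using p g by simp
  thus ?thesis using p by blast
 qed
 thus ?thesis using f by (simp add: approximable_def)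
qed

text \<open>Convolution is taken with Borel functions on the whole space, so a function on \<open>U\<close> is
  extended by zero and changed on a null set.\<close>

lemma borel_representative:
 fixes h :: "R3 => real"
 assumes h: "h : Lp \<L> 2"
 obtains h' where "h' : bmeas borel" "AE x in lebesgue. indicator U x * h x = h' x"
  "integrable lborel h'" "(sqn h') < \<infinity>"
proof -
 have i0: "integrable \<L> h" by (rule Lp_integrable[OF h]) simp
 hence i: "integrable lebesgue (%x. indicator U x * h x)" using sets_U by (subst (asm) integrable_restrict_space) auto
 obtain h' where m: "h' : bmeas lborel" and ae: "AE x in lborel. indicator U x * h x = h' x"
  using completion_ex_borel_measurable_real[OF borel_measurable_integrable[OF i]] by auto
 have ae': "AE x in lebesgue. indicator U x * h x = h' x" using ae by (rule AE_completion)
 have "integrable lebesgue h'"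
  by (rule integrable_cong_AE[THEN iffD1, OF _ _ ae' i]) (use m i in \<open>auto intro: measurable_completion\<close>)
 hence 1: "integrable lborel h'" using m by (simp add: integrable_completion)
 have "integrable \<L> (%x. (h x)^2)" using h by (simp add: L2_integrable_sq)
 hence i2: "integrable lebesgue (%x. indicator U x * (h x)^2)"
  using sets_U by (subst (asm) integrable_restrict_space) auto
 have "AE x in lebesgue. indicator U x * (h x)^2 = (h' x)^2"
  using ae' by eventually_elim (auto simp: indicator_def split: if_splits)
 hence "integrable lebesgue (%x. (h' x)^2)"
  by (rule integrable_cong_AE[THEN iffD1, OF _ _ _ i2, rotated 2]) (use m i2 in \<open>auto intro: measurable_completion\<close>)
 hence "integrable lborel (%x. (h' x)^2)" using m by (simp add: integrable_completion)
 hence "(sqn h') < \<infinity>" by (simp add: nn_integral_eq_integral)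
 thus ?thesis using that m ae' 1 by auto
qed

lemma representative_integral:
 fixes h h' k :: "R3 => real"
 assumes h: "h : Lp \<L> 2" and h': "h' : bmeas borel" "AE x in lebesgue. indicator U x * h x = h' x"
  and k: "k : bmeas borel"
 shows "(LINT x|\<L>. h x * k x) = (LINT x|lborel. k x * h' x)"
proof -
 have hm: "(%x. indicator U x * h x) : bmeas lebesgue"
  using LpD(1)[OF h] sets_U by (simp add: borel_measurable_restrict_space_iff mult.commute)
 have km: "k : bmeas lebesgue" using k by (intro measurable_completion) simp
 have "(LINT x|\<L>. h x * k x) = (LINT x|lebesgue. indicator U x *R (h x * k x))"
  using sets_U by (subst integral_restrict_space) auto
 also have "... = (LINT x|lebesgue. (indicator U x * h x) * k x)" by (simp add: mult.assoc)
 also have "... = (LINT x|lebesgue. k x * h' x)"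
 proof (rule integral_cong_AE)
  show "(%x. (indicator U x * h x) * k x) : bmeas lebesgue" by (rule borel_measurable_times[OF hm km])
  show "(%x. k x * h' x) : bmeas lebesgue" using k h' by (intro measurable_completion) simp
  show "AE x in lebesgue. (indicator U x * h x) * k x = k x * h' x" using h'(2) by eventually_elim simp
 qed
 also have "... = (LINT x|lborel. k x * h' x)" using k h' by (subst integral_completion) auto
 finally show ?thesis .
qed

lemma representative_dist:
 fixes h h' p :: "R3 => real"
 assumes h: "h : Lp \<L> 2" and h': "h' : bmeas borel" "AE x in lebesgue. indicator U x * h x = h' x"
  and p: "continuous_on UNIV p" and e: "(sqn (%x. p x - h' x)) <= ennreal (e^2)" "e >= 0"
 shows "Lp_norm \<L> 2 (%x. p x - h x) <= e"
proof -
 have pm: "p : bmeas borel" using p by (rule borel_contI)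
 have d: "(%x. p x - h x) : Lp \<L> 2" using Lp_diff(1)[OF continuous_bounded_Lp[OF p] h] by simp
 hence i: "integrable \<L> (%x. (p x - h x)^2)" by (simp add: L2_integrable_sq)
 have "ennreal ((Lp_norm \<L> 2 (%x. p x - h x))^2) = (\<integral>\<^sup>+x. ennreal ((p x - h x)^2) \<partial>\<L>)"
  using nn_integral_eq_integral[OF i] by (simp add: L2_norm_sq)
 also have "... = (\<integral>\<^sup>+x. ennreal ((p x - h x)^2) * indicator U x \<partial>lebesgue)"
  using sets_U by (subst nn_integral_restrict_space) auto
 also have "... <= (\<integral>\<^sup>+x. ennreal ((p x - h' x)^2) \<partial>lebesgue)"
  by (rule nn_integral_mono_AE) (use h'(2) in \<open>eventually_elim, auto simp: indicator_def split: if_splits\<close>)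
 also have "... = (sqn (%x. p x - h' x))" using pm h' by (subst nn_integral_completion) auto
 finally have "ennreal ((Lp_norm \<L> 2 (%x. p x - h x))^2) <= ennreal (e^2)" using e(1) by (rule order_trans)
 hence "(Lp_norm \<L> 2 (%x. p x - h x))^2 <= e^2" by simp
 thus ?thesis by (rule power2_le_imp_le) (rule e)
qed

end

lemma half_cancel: "w > 0 ==> r / (2 * w) * w = r / (2::real)" by (simp add: field_simps)

lemma cube_norm_le:
 assumes "z : cbox (a - vec r) (a + vec r :: R3)"
 shows "norm (z - a) <= 3 * r"
proof -
 have "norm (z - a) <= (\<Sum>i\<in>UNIV. \<bar>(z - a) $ i\<bar>)" by (rule norm_le_l1_cart)
 also have "... <= (\<Sum>i\<in>(UNIV :: 3 set). r)"
 proof (rule sum_mono)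
  fix i
  have "(a - vec r) $ i <= z $ i & z $ i <= (a + vec r) $ i" using assms by (simp add: mem_box_cart)
  thus "\<bar>(z - a) $ i\<bar> <= r" by (simp add: abs_le_iff)
 qed
 finally show ?thesis by simp
qed

context bounded_domain
begin

text \<open>If the shifted cubes stay inside \<open>U\<close>, the mollifier in each of them is an admissible test
  function, so derivatives of the average are averages of the weak derivatives.\<close>

lemma mollified_approximation:
 assumes f: "f : H1 U" and s: "smooth th" and M: "AE x in \<L>. ereal \<bar>th x * f x\<bar> <= M" "0 <= M"
  and c: "0 < c" and t0: "0 < t0" and S: "closed S" "!!x. x ~: S ==> th x = 0"
  and geo: "!!t x. 0 < t ==> t < t0 ==> x : U ==>
    cube (x + t *R d) (c * t) <= U \<or>
    (x ~: S & cube (x + t *R d) (c * t) \<inter> S = {})"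
 shows "approximable M (%x. th x * f x)"
proof -
 let ?L = "\<L>"
 define h where "h = (%x. th x * f x)"
 define G where "G = (%x. th x *R wgrad U f x + f x *R (\<chi> i. partial i th x))"
 have hH: "h : H1 U" and hG: "is_weak_gradient U h G" and GL: "G : Lp ?L 2" and hL: "h : Lp ?L 2"
  using smooth_mult_H1[OF f s] by (auto simp: h_def G_def)
 have GiL: "(%x. G x $ i) : Lp ?L 2" for i using Lp_component(1)[OF GL] by simp
 have dth: "partial i th x = 0" if "x ~: S" for i x
 proof -
  have "closure {x. th x ~= 0} <= S" using S by (intro closure_minimal) auto
  thus ?thesis using that partial_support[OF smooth_differentiable[OF s]] by blast
 qed
 have h0: "h x = 0" "G x = 0" if "x ~: S" for x using S(2)[OF that] dth[OF that] by (auto simp: h_def G_def vec_eq_iff)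
 obtain h' where h': "h' : bmeas borel" "AE x in lebesgue. indicator U x * h x = h' x"
  "integrable lborel h'" "(sqn h') < \<infinity>" by (rule borel_representative[OF hL])
 have "ALL i. EX g. g : bmeas borel & (AE x in lebesgue. indicator U x * G x $ i = g x) \<and>
  integrable lborel g & (sqn g) < \<infinity>" by (intro allI, rule borel_representative[OF GiL]) blast
 from choice[OF this] obtain G' where G': "!!i. G' i : bmeas borel" "!!i. AE x in lebesgue. indicator U x * G x $ i = G' i x"
  "!!i. integrable lborel (G' i)" "!!i. (sqn (%x. G' i x)) < \<infinity>" by blast
 have tch: "translation_continuous h'" by (rule translation_continuous_L2[OF h'(1,4)])
 have tcG: "translation_continuous (G' i)" for i by (rule translation_continuous_L2[OF G'(1,4)])
 have "EX ps. Ck_R3 1 ps & H1_norm U (ps - h) < e & (ALL x. ereal \<bar>ps x\<bar> <= M)" if e: "e > 0" for e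
 proof -
  (* four errors are to be added, that of the function and those of its three derivatives *)
  define e' where "e' = e / 5"
  have e': "e' > 0" "e' >= 0" "e'^2 > 0" using e by (auto simp: e'_def)
  obtain de0 where de0: "de0 > 0" "!!y. norm y < de0 ==> (sqn (%x. h' (x + y) - h' x)) <= ennreal (e'^2)"
   using tch e'(3) unfolding translation_continuous_def by meson
  have "ALL i. EX de. de > 0 & (ALL y. norm y < de --> (sqn (%x. G' i (x + y) - G' i x)) <= ennreal (e'^2))"
   using tcG e'(3) unfolding translation_continuous_def by meson
  from choice[OF this] obtain de1 where de1: "!!i. de1 i > 0" "!!i y. norm y < de1 i ==> (sqn (%x. G' i (x + y) - G' i x)) <= ennreal (e'^2)"
   by blast
  define de where "de = Min (insert de0 (range de1))"
  have de: "de > 0" "de <= de0" "de <= de1 i" for i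
  proof -
   show "de > 0" using de0(1) de1(1) unfolding de_def by (subst Min_gr_iff) auto
   show "de <= de0" unfolding de_def by (rule Min_le) auto
   show "de <= de1 i" unfolding de_def by (rule Min_le) auto
  qed
  define t where "t = min (t0 / 2) (de / (2 * (norm d + 3 * c)))"
  have nd: "norm d + 3 * c > 0" using c by (simp add: add_nonneg_pos)
  have t: "t > 0" "t < t0"
  proof -
   have "0 < de / (2 * (norm d + 3 * c))" using de(1) nd by simp
   thus "t > 0" using t0 by (simp add: t_def)
   have "t <= t0 / 2" unfolding t_def by (rule min.cobounded1)
   thus "t < t0" using t0 by linarith
  qed
  have tb: "t * (norm d + 3 * c) < de"
  proof -
   have "t * (norm d + 3 * c) <= de / (2 * (norm d + 3 * c)) * (norm d + 3 * c)"
    using nd by (intro mult_right_mono) (auto simp: t_def)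
   also have "... = de / 2" by (rule half_cancel[OF nd])
   finally show ?thesis using de(1) by simp
  qed
  have ct: "c * t > 0" using c t by simp
  define K where "K = mollifier (t *R d) (c * t)"
  define Q where "Q = cube (t *R d) (c * t)"
  note K = mollifier[OF ct, where a="t *R d", folded K_def Q_def]
  have Qc: "compact Q" by (simp add: Q_def)
  have K0: "K y = 0" if "y ~: Q" for y using K(4) that by blast
  have Kc: "continuous_on UNIV K" by (rule smooth_cont[OF K(1)])
  have Km: "K : bmeas borel" using Kc by (rule borel_contI)
  have Qn: "norm y < de" if "y : Q" for y
  proof -
   have "norm (y - t *R d) <= 3 * (c * t)" using cube_norm_le that unfolding Q_def by blast
   moreover have "norm y <= norm (y - t *R d) + norm (t *R d)" using norm_triangle_ineq[of "y - t *R d" "t *R d"] by simp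
   ultimately show ?thesis using tb t(1) by (simp add: algebra_simps)
  qed
  define ps where "ps = (%x. LINT z|lborel. K (z - x) * h' z)"
  define p where "p = (%i x. LINT z|lborel. K (z - x) * G' i z)"
  have C1: "Ck_R3 1 ps" and dC1: "partial i ps x = - (LINT z|lborel. partial i K (z - x) * h' z)" for i x
   unfolding ps_def using convolution_C1[OF K(1) Qc K0 h'(3,1)] by auto
  have pc: "continuous_on UNIV (p i)" for i unfolding p_def using C1_D(2)[OF convolution_C1(1)[OF K(1) Qc K0 G'(3,1)]] .
  have dist0: "Lp_norm ?L 2 (%x. ps x - h x) <= e'"
  proof (rule representative_dist[OF hL h'(1,2) C1_D(2)[OF C1] _ e'(2)])
   show "(sqn (%x. ps x - h' x)) <= ennreal (e'^2)" unfolding ps_def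
    by (rule mollification_L2_close[OF h'(1,3) Km K(2,3,5)]) (use K0 Qn de(2) de0(2) in \<open>meson less_le_trans\<close>)
  qed
  have disti: "Lp_norm ?L 2 (%x. p i x - G x $ i) <= e'" for i
  proof (rule representative_dist[OF GiL G'(1,2) pc _ e'(2)])
   show "(sqn (%x. p i x - G' i x)) <= ennreal (e'^2)" unfolding p_def
    by (rule mollification_L2_close[OF G'(1,3) Km K(2,3,5)]) (use K0 Qn de(3) de1(2) in \<open>meson less_le_trans\<close>)
  qed
  have grad: "partial i ps x = p i x" if x: "x : U" for i x
  proof -
   define B where "B = cube (x + t *R d) (c * t)"
   have BQ: "z - x : Q \<longleftrightarrow> z : B" for z by (auto simp: Q_def B_def mem_box_cart algebra_simps)
   have dK: "partial i K (z - x) = partial i (%z. K (z - x)) z" for z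
    by (rule partial_translate[symmetric]) (rule smooth_differentiable[OF K(1)])
   have dKm: "(%z. partial i K (z - x)) : bmeas borel"
    by (intro borel_contI continuous_on_compose2[OF smooth_cont[OF smooth_partial[OF K(1)]]] continuous_intros) auto
   have Ksm: "(%z. K (z - x)) : bmeas borel" by (intro borel_contI continuous_on_compose2[OF Kc] continuous_intros) auto
   have r1: "(LINT z|?L. h z * partial i K (z - x)) = (LINT z|lborel. partial i K (z - x) * h' z)"
    by (rule representative_integral[OF hL h'(1,2) dKm])
   have r2: "(LINT z|?L. G z $ i * K (z - x)) = p i x"
    unfolding p_def by (rule representative_integral[OF GiL G'(1,2) Ksm])
   from geo[OF t x] show ?thesis
   proof
    assume sub: "cube (x + t *R d) (c * t) <= U"
    have kt: "(%z. K (z - x)) : test_functions U"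
    proof -
     have "bump 1 (t *R d - vec (c * t) + x) (t *R d + vec (c * t) + x) : test_functions U"
      using sub by (intro bump_test_function) (auto simp: algebra_simps)
     hence "(%z. (1 / (LINT y|lborel. bump 1 (t *R d - vec (c * t)) (t *R d + vec (c * t)) y)) *
       bump 1 (t *R d - vec (c * t) + x) (t *R d + vec (c * t) + x) z) : test_functions U"
      by (intro smooth_mult_test_function) (auto intro: Ck_R3_const)
     thus ?thesis by (simp add: K_def mollifier_def bump_shift)
    qed
    have "(LINT z|?L. h z * partial i (%z. K (z - x)) z) = - (LINT z|?L. G z $ i * K (z - x))"
     by (rule weak_gradientD(3)[OF hG kt])
    also have "(LINT z|?L. h z * partial i (%z. K (z - x)) z) = (LINT z|lborel. partial i K (z - x) * h' z)"
     unfolding dK[symmetric] by (rule r1)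
    also note r2
    finally show ?thesis unfolding dC1 by simp
   next
    assume "x ~: S & cube (x + t *R d) (c * t) \<inter> S = {}"
    hence BS: "B \<inter> S = {}" by (simp add: B_def)
    have z1: "G z $ i * K (z - x) = 0" for z
    proof (cases "z : B")
     case True
     hence "z ~: S" using BS by blast
     thus ?thesis by (simp add: h0)
    next
     case False
     hence "z - x ~: Q" using BQ by blast
     thus ?thesis by (simp add: K0)
    qed
    have dK0: "partial i K y = 0" if "y ~: Q" for y
    proof -
     have "closure {x. K x ~= 0} <= Q" using K0 Qc by (intro closure_minimal) (auto intro: compact_imp_closed)
     thus ?thesis using that partial_support[OF smooth_differentiable[OF K(1)]] by blast
    qed
    have z2: "h z * partial i K (z - x) = 0" for z
    proof (cases "z : B")
     case True
     hence "z ~: S" using BS by blast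
     thus ?thesis by (simp add: h0)
    next
     case False
     hence "z - x ~: Q" using BQ by blast
     thus ?thesis by (simp add: dK0)
    qed
    have "p i x = 0" unfolding r2[symmetric] by (simp only: z1) simp
    moreover have "partial i ps x = 0" unfolding dC1 r1[symmetric] by (simp only: z2) simp
    ultimately show ?thesis by simp
   qed
  qed
  have w: "is_weak_gradient U (ps - h) (%x. (\<chi> i. partial i ps x) - G x)"
   using weak_gradient_add[OF open_U weak_gradient_C1[OF open_U C1] weak_gradient_scale[OF hG, of "-1"]]
   by (simp add: fun_diff_def)
  have dL: "(ps - h) : Lp ?L 2"
   using Lp_diff(1)[OF continuous_bounded_Lp[OF C1_D(2)[OF C1]] hL] by (simp add: fun_diff_def)
  have comp: "(%x. ((\<chi> i. partial i ps x) - G x) $ i) : Lp ?L 2 & Lp_norm ?L 2 (%x. ((\<chi> i. partial i ps x) - G x) $ i) <= e'" for i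
  proof -
   have L: "(%x. partial i ps x - G x $ i) : Lp ?L 2"
    using Lp_diff(1)[OF continuous_bounded_Lp[OF C1_D(3)[OF C1]] GiL] by simp
   have L': "(%x. p i x - G x $ i) : Lp ?L 2" using Lp_diff(1)[OF continuous_bounded_Lp[OF pc] GiL] by simp
   have "Lp_norm ?L 2 (%x. partial i ps x - G x $ i) = Lp_norm ?L 2 (%x. p i x - G x $ i)"
    by (rule Lp_AE_cong(1)) (use LpD(1)[OF L] LpD(1)[OF L'] grad in \<open>auto intro!: AE_I2\<close>)
   thus ?thesis using L disti[of i] by simp
  qed
  have GL'1: "(%x. (\<chi> i. partial i ps x) - G x) : Lp ?L 2" by (rule Lp_componentsI(1)) (use comp in auto)
  have "Lp_norm ?L 2 (%x. (\<chi> i. partial i ps x) - G x) <= (\<Sum>i\<in>UNIV. Lp_norm ?L 2 (%x. ((\<chi> i. partial i ps x) - G x) $ i))"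
   by (rule Lp_componentsI(2)) (use comp in auto)
  also have "... <= (\<Sum>i\<in>(UNIV::3 set). e')" by (rule sum_mono) (use comp in blast)
  finally have GL'2: "Lp_norm ?L 2 (%x. (\<chi> i. partial i ps x) - G x) <= 3 * e'" by simp
  have "H1_norm U (ps - h) <= Lp_norm ?L 2 (ps - h) + Lp_norm ?L 2 (wgrad U (ps - h))" by (rule H1_norm_le)
  also have "Lp_norm ?L 2 (wgrad U (ps - h)) = Lp_norm ?L 2 (%x. (\<chi> i. partial i ps x) - G x)"
   by (rule W1pI(2)[OF dL GL'1 w])
  also have "Lp_norm ?L 2 (ps - h) <= e'" using dist0 by (simp only: fun_diff_def)
  finally have "H1_norm U (ps - h) <= e' + 3 * e'" using GL'2 by linarith
  also have "... < e" using e by (simp add: e'_def)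
  finally have 1: "H1_norm U (ps - h) < e" .
  have "ereal \<bar>ps x\<bar> <= M" for x
  proof (cases M)
   case (real m)
   have m0: "m >= 0" using M(2) real by simp
   have "AE z in lebesgue. z : U --> \<bar>h z\<bar> <= m"
    using M(1) sets_U real by (simp add: AE_restrict_space_iff h_def)
   hence "AE z in lebesgue. \<bar>h' z\<bar> <= m" using h'(2)
   proof eventually_elim
    case (elim z)
    show ?case
    proof (cases "z : U")
     case True
     thus ?thesis using elim by simp
    next
     case False
     hence "h' z = 0" using elim(2) by simp
     thus ?thesis using m0 by simp
    qed
   qed
   hence ae: "AE z in lborel. \<bar>h' z\<bar> <= m" using h'(1) by (subst (asm) AE_completion_iff) auto
   have sh: "(LINT z|lborel. K (z - x)) = 1" "integrable lborel (%z. K (z - x))"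
    using lborel_integral_shift[OF Km, of "- x"] K(6,7) by auto
   have "\<bar>ps x\<bar> <= (LINT z|lborel. \<bar>K (z - x) * h' z\<bar>)" unfolding ps_def by (rule integral_abs_bound)
   also have "... <= (LINT z|lborel. m * K (z - x))"
   proof (rule integral_mono_AE)
    have b: "AE z in lborel. \<bar>K (z - x) * h' z\<bar> <= m * K (z - x)"
     using ae by eventually_elim (use K(2) in \<open>auto simp: abs_mult mult.commute[of m] intro!: mult_left_mono\<close>)
    thus "AE z in lborel. \<bar>K (z - x) * h' z\<bar> <= m * K (z - x)" .
    show i: "integrable lborel (%z. m * K (z - x))" using sh by simp
    show "integrable lborel (%z. \<bar>K (z - x) * h' z\<bar>)" by (rule Bochner_Integration.integrable_bound[OF i])
       (use Km h'(1) b in \<open>auto elim!: eventually_mono intro!: order_trans[OF _ abs_ge_self]\<close>)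
   qed
   also have "... = m" using sh by simp
   finally show ?thesis using real by simp
  qed (use M(2) in auto)
  thus ?thesis using C1 1 by blast
 qed
 thus ?thesis using hH unfolding approximable_def h_def[symmetric] by simp
qed

text \<open>Smooth multipliers \<open>th\<close> with \<open>th f\<close> approximable for every
  \<open>f\<close> form an ideal; it contains a sum \<open>S\<close> of bumps that is positive on the closure, hence
  \<open>1 - (1 - S / N) ^ n\<close>, and \<open>(1 - S / N) ^ n f\<close> tends to zero in \<open>H\<^sup>1\<close>.\<close>

lemma H1_approximable:
 assumes chart: "!!p. p : closure U ==> EX \<rho>>0. EX d. EX c>0. EX t0>0. ALL t x. 0 < t --> t < t0 --> x : U \<inter> ball p \<rho> -->
    cube (x + t *R d) (c * t) <= U"
  and ne: "U ~= {}"
 shows "EX C>0. ALL f:H1 U. ALL m>=0. (AE x in \<L>. ereal \<bar>f x\<bar> <= m) --> approximable (ereal C * m) f"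
proof -
 let ?L = "\<L>"
 have comp: "compact (closure U)" using bounded_U by (simp add: compact_closure)
 obtain \<rho> where \<rho>: "!!p. p : closure U ==> \<rho> p > 0"
  and ch: "!!p. p : closure U ==> EX d. EX c>0. EX t0>0. ALL t x. 0 < t --> t < t0 --> x : U \<inter> ball p (\<rho> p) -->
    cube (x + t *R d) (c * t) <= U" using chart by metis
 define s where "s = (%p. vec (\<rho> p / 8) :: R3)"
 define b where "b = (%p. bump 1 (p - s p) (p + s p))"
 have sb: "smooth (b p)" for p unfolding b_def by (rule smooth_bump)
 have bpos: "b p x > 0 \<longleftrightarrow> x : box (p - s p) (p + s p)" for p x by (simp add: b_def bump_pos)
 have supp: "cbox (p - s p) (p + s p) <= ball p (\<rho> p / 2)" if p: "p : closure U" for p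
 proof
  fix x assume x: "x : cbox (p - s p) (p + s p)"
  have "norm (x - p) <= 3 * (\<rho> p / 8)" using x unfolding s_def by (rule cube_norm_le)
  also have "... < \<rho> p / 2" using \<rho>[OF p] by simp
  finally show "x : ball p (\<rho> p / 2)" by (simp add: dist_norm norm_minus_commute)
 qed
 have local: "approximable M (%x. (b p x * th x) * f x)"
  if p: "p : closure U" and sth: "smooth th" and f: "f : H1 U"
   and M: "AE x in ?L. ereal \<bar>(b p x * th x) * f x\<bar> <= M" "0 <= M" for p th f M
 proof -
  obtain d c t0 where c: "c > 0" and t0: "t0 > 0" and geo: "!!t x. 0 < t ==> t < t0 ==> x : U \<inter> ball p (\<rho> p) ==>
    cube (x + t *R d) (c * t) <= U" using ch[OF p] by blast
  have nd: "norm d + 3 * c > 0" using c by (simp add: add_nonneg_pos)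
  (* for such t the shifted cubes of points outside the chart miss the support of the bump *)
  define t1 where "t1 = min t0 (\<rho> p / (2 * (norm d + 3 * c)))"
  have t1: "t1 > 0" using t0 \<rho>[OF p] nd by (simp add: t1_def)
  let ?S = "cbox (p - s p) (p + s p)"
  show ?thesis
  proof (rule mollified_approximation[OF f _ M c t1])
   show "smooth (%x. b p x * th x)" using sb sth by (intro allI Ck_R3_mult) blast+
   show "closed ?S" by (rule closed_cbox)
   show "b p x * th x = 0" if "x ~: ?S" for x
    using that bump_eq_0[of 1 x "p - s p" "p + s p"] box_subset_cbox[of "p - s p" "p + s p"] by (auto simp: b_def)
   fix t x assume t: "0 < t" "t < t1" and x: "x : U"
   let ?B = "cube (x + t *R d) (c * t)"
   show "?B <= U \<or> (x ~: ?S & ?B \<inter> ?S = {})"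
   proof (cases "x : ball p (\<rho> p)")
    case True
    thus ?thesis using geo[of t x] t x by (auto simp: t1_def)
   next
    case False
    hence far: "\<rho> p <= norm (x - p)" by (simp add: dist_norm norm_minus_commute)
    have "x ~: ?S" using supp[OF p] False \<rho>[OF p] by fastforce
    moreover have "z ~: ?S" if z: "z : ?B" for z
    proof
     assume "z : ?S"
     hence zp: "norm (z - p) < \<rho> p / 2" using supp[OF p] by (auto simp: dist_norm norm_minus_commute)
     have 1: "norm (z - (x + t *R d)) <= 3 * (c * t)" using z by (rule cube_norm_le)
     have "x - p = (z - p) - (z - (x + t *R d)) - t *R d" by simp
     hence "norm (x - p) <= norm (z - p) + norm (z - (x + t *R d)) + norm (t *R d)"
      by (metis (no_types, lifting) add_right_mono norm_triangle_ineq4 order_trans)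
     also have "... < \<rho> p / 2 + 3 * (c * t) + t * norm d" using zp 1 t by simp
     also have "... = \<rho> p / 2 + t * (norm d + 3 * c)" by (simp add: algebra_simps)
     also have "t * (norm d + 3 * c) <= \<rho> p / (2 * (norm d + 3 * c)) * (norm d + 3 * c)"
      using nd t by (intro mult_right_mono) (auto simp: t1_def)
     also have "\<rho> p / (2 * (norm d + 3 * c)) * (norm d + 3 * c) = \<rho> p / 2" by (rule half_cancel[OF nd])
     finally show False using far by simp
    qed
    ultimately show ?thesis by blast
   qed
  qed
 qed
 have cov: "closure U <= (\<Union>p\<in>closure U. box (p - s p) (p + s p))"
 proof
  fix p assume p: "p : closure U"
  hence "p : box (p - s p) (p + s p)" using \<rho>[OF p] by (simp add: s_def mem_box_cart)
  with p show "p : (\<Union>p\<in>closure U. box (p - s p) (p + s p))" by blast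
 qed
 obtain F where F: "F <= closure U" "finite F" "closure U <= (\<Union>p\<in>F. box (p - s p) (p + s p))"
  by (rule compactE_image[where f="%p. box (p - s p) (p + s p)", OF comp open_box cov])
 define S where "S = (%x. \<Sum>p\<in>F. b p x)"
 have sS: "smooth S" unfolding S_def using sb F(2) by (intro allI Ck_R3_sum) blast+
 have b01: "0 <= b p x" "b p x <= 1" for p x by (auto simp: b_def bump_range)
 have Spos: "S x > 0" if x: "x : closure U" for x
 proof -
  obtain p where p: "p : F" "x : box (p - s p) (p + s p)" using F(3) x by blast
  have "0 < b p x" using p bpos by blast
  also have "b p x <= S x" unfolding S_def by (rule member_le_sum) (use p F b01 in auto)
  finally show ?thesis .
 qed
 have cne: "closure U ~= {}" using ne by simp
 obtain x0 where x0: "x0 : closure U" "!!x. x : closure U ==> S x0 <= S x"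
  using continuous_attains_inf[OF comp cne continuous_on_subset[OF smooth_cont[OF sS]]] by auto
 define c0 where "c0 = S x0"
 have c0: "c0 > 0" using Spos x0 by (simp add: c0_def)
 define N where "N = real (card F)"
 have SN: "S x <= N" for x unfolding S_def N_def using sum_mono[of F "%p. b p x" "%_. 1"] b01 by simp
 have N0: "N > 0" using c0 SN[of x0] by (simp add: c0_def)
 define q where "q = (%x. 1 - S x / N)"
 define kp where "kp = 1 - c0 / N"
 have kp: "0 <= kp" "kp < 1" using c0 SN[of x0] N0 by (auto simp: kp_def c0_def)
 have q: "0 <= q x" "q x <= kp" if "x : U" for x
 proof -
  show "0 <= q x" using SN[of x] N0 by (simp add: q_def)
  have "c0 <= S x" using x0(2)[of x] that closure_subset[of U] by (auto simp: c0_def)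
  thus "q x <= kp" using N0 by (simp add: q_def kp_def divide_right_mono)
 qed
 have sq: "smooth q"
 proof
  fix k
  have "Ck_R3 k (%x. 1 + (- 1 / N) * S x)" using sS by (intro Ck_R3_add Ck_R3_const Ck_R3_cmult) blast
  thus "Ck_R3 k q" by (simp add: q_def[abs_def])
 qed
 have spow: "smooth (%x. q x ^ n)" for n using sq by (intro allI Ck_R3_power) blast
 have dpow: "partial i (%x. q x ^ n) x = real n * q x ^ (n - 1) * partial i q x" for i n x
 proof -
  obtain q' where q': "(q has_derivative q') (at x)" using smooth_differentiable[OF sq] by (auto simp: differentiable_def)
  have "((%x. q x ^ n) has_derivative (%h. of_nat n * q' h * q x ^ (n - 1))) (at x)"
   by (rule has_derivative_power[OF q'])
  from partial_eq[OF this] partial_eq[OF q'] show ?thesis by simp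
 qed
 have "EX D>=0. ALL i. ALL x:U. \<bar>partial i q x\<bar> <= D"
 proof -
  have "EX D>=0. ALL x:U. \<bar>partial i q x\<bar> <= D" for i
  proof -
   have "compact (partial i q ` closure U)"
    by (intro compact_continuous_image continuous_on_subset[OF smooth_cont[OF smooth_partial[OF sq]]] comp) auto
   then obtain D where "!!x. x : closure U ==> norm (partial i q x) <= D"
    using compact_imp_bounded bounded_iff by (metis image_eqI)
   hence "ALL x:U. \<bar>partial i q x\<bar> <= \<bar>D\<bar>" using closure_subset[of U] by (fastforce simp: subset_iff)
   thus ?thesis by (intro exI[of _ "\<bar>D\<bar>"]) auto
  qed
  then obtain D where D: "!!i. D i >= 0" "!!i x. x : U ==> \<bar>partial i q x\<bar> <= D i" by metis
  have "\<bar>partial i q x\<bar> <= (\<Sum>j\<in>UNIV. D j)" if "x : U" for i x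
  proof -
   have "\<bar>partial i q x\<bar> <= D i" by (rule D(2)[OF that])
   also have "D i <= (\<Sum>j\<in>UNIV. D j)" by (rule member_le_sum) (auto simp: D)
   finally show ?thesis .
  qed
  thus ?thesis using D(1) by (intro exI[of _ "\<Sum>j\<in>UNIV. D j"]) (auto intro: sum_nonneg)
 qed
 then obtain D where D: "D >= 0" "!!i x. x : U ==> \<bar>partial i q x\<bar> <= D" by blast
 (* a sum of N localised pieces, each bounded by 1 / c0 times the supremum *)
 define C where "C = N / c0 + 1"
 have C: "C > 0" using N0 c0 by (simp add: C_def add_pos_pos)
 have "approximable (ereal C * m) f" if f: "f : H1 U" and m: "m >= 0" "AE x in ?L. ereal \<bar>f x\<bar> <= m" for f m
 proof (rule approximable_limit[OF f])
  fix e :: real assume e: "e > 0"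
  have k1: "(%n. kp ^ n) ----> 0" using kp by (intro LIMSEQ_power_zero) auto
  have k2: "(%n. real n * kp ^ (n - 1)) ----> 0"
  proof (rule LIMSEQ_imp_Suc)
   have "(%n. real n * kp ^ n) ----> 0" using kp by (intro powser_times_n_limit_0) auto
   hence "(%n. real n * kp ^ n + kp ^ n) ----> 0 + 0" using k1 by (rule tendsto_add)
   thus "(%n. real (Suc n) * kp ^ (Suc n - 1)) ----> 0" by (simp add: algebra_simps)
  qed
  have "(%n. (2 * kp ^ n + 3 * (real n * kp ^ (n - 1) * D)) * H1_norm U f) ----> (2 * 0 + 3 * (0 * D)) * H1_norm U f"
   by (rule tendsto_mult[OF tendsto_add[OF tendsto_mult[OF tendsto_const k1]
      tendsto_mult[OF tendsto_const tendsto_mult[OF k2 tendsto_const]]] tendsto_const])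
  hence "\<forall>\<^sub>F n in sequentially. (2 * kp ^ n + 3 * (real n * kp ^ (n - 1) * D)) * H1_norm U f < e"
   using e by (intro order_tendstoD(2)) auto
  then obtain n where n: "(2 * kp ^ n + 3 * (real n * kp ^ (n - 1) * D)) * H1_norm U f < e"
   by (auto simp: eventually_sequentially)
  have small: "H1_norm U (%x. q x ^ n * f x) < e"
  proof -
   have "H1_norm U (%x. q x ^ n * f x) <= (2 * kp ^ n + 3 * (real n * kp ^ (n - 1) * D)) * H1_norm U f"
   proof (rule smooth_mult_H1(5)[OF f spow])
    show "\<bar>q x ^ n\<bar> <= kp ^ n" if "x : U" for x using q[OF that] by (simp add: power_abs power_mono)
    show "\<bar>partial i (%x. q x ^ n) x\<bar> <= real n * kp ^ (n - 1) * D" if "x : U" for i x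
     unfolding dpow abs_mult using q[OF that] D(2)[OF that, of i] D(1) kp
     by (intro mult_mono) (auto simp: power_abs power_mono)
   qed (use kp D in auto)
   thus ?thesis using n by simp
  qed
  define th where "th = (%x. (1 / N) * (\<Sum>j<n. q x ^ j))"
  have sth: "smooth th" unfolding th_def using sq by (intro allI Ck_R3_cmult Ck_R3_sum Ck_R3_power) auto
  have thb: "\<bar>th x\<bar> <= 1 / c0" if "x : U" for x
  proof -
   have "(\<Sum>j<n. q x ^ j) * (1 - q x) = 1 - q x ^ n" by (simp add: sum_gp_strict one_diff_power_eq mult.commute)
   also have "... <= 1" using q[OF that] by simp
   finally have "(\<Sum>j<n. q x ^ j) * (S x / N) <= 1" by (simp add: q_def)
   moreover have "c0 <= S x" using x0(2)[of x] that closure_subset[of U] by (auto simp: c0_def)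
   moreover have nn: "0 <= (\<Sum>j<n. q x ^ j)" using q[OF that] by (intro sum_nonneg) auto
   ultimately have "(\<Sum>j<n. q x ^ j) * (c0 / N) <= 1"
    using N0 by (meson divide_right_mono less_imp_le mult_left_mono order_trans)
   thus ?thesis using nn N0 c0 by (simp add: th_def abs_mult field_simps)
  qed
  have loc: "approximable (ereal (1 / c0) * m) (%x. (b p x * th x) * f x)" if p: "p : F" for p
  proof (rule local)
   show "p : closure U" using p F by blast
   show "AE x in ?L. ereal \<bar>(b p x * th x) * f x\<bar> <= ereal (1 / c0) * m" using m(2) AE_space
   proof eventually_elim
    case (elim x)
    hence x: "x : U" by simp
    have "\<bar>b p x * th x\<bar> <= 1 * (1 / c0)" unfolding abs_mult
     using b01[where p=p and x=x] thb[OF x] by (intro mult_mono) auto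
    hence "ereal \<bar>(b p x * th x) * f x\<bar> <= ereal ((1 / c0) * \<bar>f x\<bar>)"
     using mult_right_mono[of "\<bar>b p x * th x\<bar>" "1 / c0" "\<bar>f x\<bar>"] by (simp add: abs_mult[of _ "f x"])
    also have "... = ereal (1 / c0) * ereal \<bar>f x\<bar>" by simp
    also have "... <= ereal (1 / c0) * m" using elim c0 by (intro ereal_mult_left_mono) auto
    finally show ?case .
   qed
   show "0 <= ereal (1 / c0) * m" using m c0 by simp
  qed (use sth f in auto)
  let ?g = "\<Sum>p\<in>F. (%x. (b p x * th x) * f x)"
  have "approximable (ereal (real (card F)) * (ereal (1 / c0) * m)) ?g" by (rule approximable_sum[OF F(2) loc])
  moreover have "ereal (real (card F)) * (ereal (1 / c0) * m) <= ereal C * m"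
  proof -
   have "ereal (real (card F)) * (ereal (1 / c0) * m) = ereal (N / c0) * m" by (simp add: N_def mult.assoc[symmetric])
   also have "... <= ereal C * m" using m by (intro ereal_mult_right_mono) (auto simp: C_def)
   finally show ?thesis .
  qed
  ultimately have ag: "approximable (ereal C * m) ?g" unfolding approximable_def by (meson order_trans)
  have geq: "?g = f - (%x. q x ^ n * f x)"
  proof
   fix x
   have "?g x = (\<Sum>p\<in>F. (b p x * th x) * f x)" by (induction F rule: infinite_finite_induct) auto
   also have "... = S x * th x * f x" by (simp add: S_def sum_distrib_right)
   also have "S x * th x = (1 - q x) * (\<Sum>j<n. q x ^ j)" using N0 by (simp add: th_def q_def)
   also have "... = 1 - q x ^ n" by (simp add: one_diff_power_eq)
   finally show "?g x = (f - (%x. q x ^ n * f x)) x" by (simp add: algebra_simps)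
  qed
  have "?g - f = - (%x. q x ^ n * f x)" unfolding geq by simp
  hence "H1_norm U (?g - f) = H1_norm U (%x. q x ^ n * f x)" using H.n_minus[OF smooth_mult_H1(1)[OF f spow]] by simp
  thus "EX g. approximable (ereal C * m) g & H1_norm U (g - f) < e" using ag small by auto
 qed
 thus ?thesis using C by blast
qed

end

section \<open>Surface measure of Lipschitz graphs\<close>

text \<open>A set function that fails to be a measure is turned into the zero measure, so only this inequality
  is immediate; bounds from above are what the trace inequality consumes.\<close>

lemma emeasure_surface_measure_le:
 assumes "A : sets (surface_measure U)"
 shows "emeasure (surface_measure U) A <= hausdorff2 A"
proof -
 let ?N = "measure_of UNIV (sets borel) hausdorff2 :: R3 measure"
 have sN: "sets ?N = sets borel" by (metis sets.sigma_sets_eq sets_measure_of space_borel sets.space_closed)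
 have F: "frontier U : sets ?N" unfolding sN by (simp add: frontier_closed)
 have A: "A : sets ?N" "A <= frontier U" using assms F by (auto simp: surface_measure_def sets_restrict_space_iff)
 have "emeasure (surface_measure U) A = emeasure ?N A"
  unfolding surface_measure_def using A F by (subst emeasure_restrict_space) auto
 also have "... <= hausdorff2 A" by (simp add: emeasure_measure_of_conv)
 finally show ?thesis .
qed

lemma sets_surface_measure: "A : sets (surface_measure U) \<longleftrightarrow> A : sets borel & A <= frontier U"
proof -
 let ?N = "measure_of UNIV (sets borel) hausdorff2 :: R3 measure"
 have sN: "sets ?N = sets borel" by (metis sets.sigma_sets_eq sets_measure_of space_borel sets.space_closed)
 have F: "frontier U \<inter> space ?N : sets ?N" unfolding sN by (simp add: frontier_closed)
 show ?thesis unfolding surface_measure_def using sN by (subst sets_restrict_space_iff[OF F]) auto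
qed

lemma space_surface_measure [simp]: "space (surface_measure U) = frontier U"
 by (simp add: surface_measure_def space_restrict_space)

lemma borel_measurable_surface: "f : bmeas borel ==> f : bmeas (surface_measure U)"
 unfolding measurable_def by (auto simp: sets_surface_measure frontier_closed)

text \<open>For a unit vector \<open>d\<close> this is the orthogonal projection to the plane with normal \<open>d\<close>.\<close>

abbreviation foot :: "R3 => R3 => R3" where
 "foot d x \<equiv> x - (x \<bullet> d) *R d"

lemma foot_diff: "foot d x - foot d y = foot d (x - y)" by (simp add: inner_diff_left algebra_simps)

lemma foot_norm_le:
 assumes "norm d = 1" shows "norm (foot d x) <= norm x"
proof -
 have dd: "d \<bullet> d = 1" using assms by (simp add: norm_eq_1)
 have "(norm (foot d x))^2 = (norm x)^2 - (x \<bullet> d)^2"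
  unfolding power2_norm_eq_inner by (simp add: inner_diff_left inner_diff_right dd inner_commute power2_eq_square algebra_simps)
 hence "(norm (foot d x))^2 <= (norm x)^2" by simp
 thus ?thesis by (simp add: abs_le_square_iff[symmetric])
qed

lemma orthonormal_frame:
 assumes "norm (d :: R3) = 1"
 obtains a b where "norm a = 1" "norm b = 1" "!!x. foot d x = (x \<bullet> a) *R a + (x \<bullet> b) *R b"
proof -
 obtain S where S: "d : S" "pairwise orthogonal S" "!!x. x : S ==> norm x = 1"
  "independent S" "card S = DIM(R3)" "span S = UNIV" by (rule vector_in_orthonormal_basis[OF assms]) blast
 have fin: "finite S" using S(4) by (simp add: independent_bound)
 have "card (S - {d}) = 2" using S(1,5) fin by simp
 then obtain a b where ab: "S - {d} = {a, b}" "a ~= b" by (meson card_2_iff)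
 hence Seq: "S = {d, a, b}" using S(1) by blast
 have dn: "d ~: {a, b}" using ab by blast
 have "foot d x = (x \<bullet> a) *R a + (x \<bullet> b) *R b" for x
 proof -
  have "(\<Sum>i\<in>S. (x \<bullet> i) *R i) = x"
   by (rule orthonormal_basis_expand[OF S(2,3) _ fin]) (use S(6) in auto)
  hence "(x \<bullet> d) *R d + ((x \<bullet> a) *R a + (x \<bullet> b) *R b) = x" unfolding Seq using dn ab(2) by simp
  thus ?thesis by (metis add_diff_cancel_left')
 qed
 moreover have "norm a = 1" "norm b = 1" using S(3) Seq by auto
 ultimately show ?thesis using that by blast
qed

text \<open>Slicing the projection into \<open>N\<^sup>2\<close> squares cuts the graph into pieces of diameter
  proportional to \<open>r / N\<close>, whatever \<open>N\<close> is.\<close>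

lemma hausdorff2_graph_le:
 assumes d: "norm (d :: R3) = 1" and L: "L-lipschitz_on UNIV ps" and r: "r > 0"
  and A: "!!x. x : A ==> x \<bullet> d = ps (foot d x)" "!!x. x : A ==> norm (foot d x - y) < r"
 shows "hausdorff2 A <= ennreal (4 * pi * (1 + L)^2 * r^2)"
proof -
 have L0: "L >= 0" using L by (simp add: lipschitz_on_def)
 obtain a b where ab: "norm a = 1" "norm b = 1" and fr: "!!x. foot d x = (x \<bullet> a) *R a + (x \<bullet> b) *R b"
  by (rule orthonormal_frame[OF d]) blast
 have pre: "hausdorff2_pre de A <= ennreal (4 * pi * (1 + L)^2 * r^2)" if de: "de > 0" for de
 proof -
  obtain N0 where N0: "4 * (1 + L) * r / de < real N0" using reals_Archimedean2 by blast
  define N where "N = Suc N0"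
  have N: "N > 0" "4 * (1 + L) * r / de <= real N" using N0 by (auto simp: N_def)
  define D where "D = (1 + L) * (4 * r / real N)"
  have D0: "D >= 0" using L0 r by (simp add: D_def)
  have Dde: "D <= de"
  proof -
   have "4 * (1 + L) * r <= real N * de" using N(2) de by (simp add: pos_divide_le_eq)
   thus ?thesis using N(1) by (simp add: D_def field_simps)
  qed
  define k where "k = (%e (x::R3). nat \<lfloor>((foot d x - y) \<bullet> e + r) / (2 * r) * real N\<rfloor>)"
  have kb: "k e x < N" "\<bar>((foot d x - y) \<bullet> e + r) / (2 * r) * real N - real (k e x)\<bar> < 1 & 0 <= ((foot d x - y) \<bullet> e + r) / (2 * r) * real N - real (k e x)"
   if x: "x : A" and e: "norm e = 1" for e x
  proof -
   have "\<bar>(foot d x - y) \<bullet> e\<bar> <= norm (foot d x - y) * norm e" by (rule Cauchy_Schwarz_ineq2)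
   hence l: "\<bar>(foot d x - y) \<bullet> e\<bar> < r" using A(2)[OF x] e by simp
   define u where "u = ((foot d x - y) \<bullet> e + r) / (2 * r) * real N"
   have u0: "0 <= u" unfolding u_def using l r by (intro mult_nonneg_nonneg divide_nonneg_pos) auto
   have "((foot d x - y) \<bullet> e + r) / (2 * r) < 1" using l r by (simp add: divide_less_eq)
   hence "((foot d x - y) \<bullet> e + r) / (2 * r) * real N < 1 * real N"
    using N(1) by (intro mult_strict_right_mono) auto
   hence u1: "u < real N" by (simp only: u_def mult_1)
   have ku: "k e x = nat \<lfloor>u\<rfloor>" by (simp add: k_def u_def)
   have "\<lfloor>u\<rfloor> < int N" using u1 by (simp add: floor_less_iff)
   thus "k e x < N" using u0 N(1) unfolding ku by (simp add: nat_less_iff)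
   have "real (k e x) = of_int \<lfloor>u\<rfloor>" using u0 unfolding ku by simp
   thus "\<bar>((foot d x - y) \<bullet> e + r) / (2 * r) * real N - real (k e x)\<bar> < 1 & 0 <= ((foot d x - y) \<bullet> e + r) / (2 * r) * real N - real (k e x)"
    unfolding u_def[symmetric] by linarith
  qed
  define C where "C = (%n. if n < N * N then {x : A. k a x = n div N & k b x = n mod N} else {})"
  have near: "norm (x - x') <= D" if x: "x : A" "x' : A" and kk: "k a x = k a x'" "k b x = k b x'" for x x'
  proof -
   have comp: "\<bar>(x - x') \<bullet> e\<bar> <= 2 * r / real N" if e: "norm e = 1" "k e x = k e x'" and fe: "d \<bullet> e = 0" for e
   proof -
    let ?u = "%x. ((foot d x - y) \<bullet> e + r) / (2 * r) * real N"
    have "\<bar>?u x - ?u x'\<bar> < 1" using kb(2)[OF x(1) e(1)] kb(2)[OF x(2) e(1)] e(2) by linarith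
    moreover have "?u x - ?u x' = (x - x') \<bullet> e * (real N / (2 * r))"
     by (simp add: inner_diff_left fe diff_divide_distrib add_divide_distrib algebra_simps)
    ultimately have "\<bar>(x - x') \<bullet> e\<bar> * (real N / (2 * r)) < 1" using N r by (simp add: abs_mult)
    thus ?thesis using N r by (simp add: field_simps)
   qed
   have dd: "d \<bullet> d = 1" using d by (simp add: norm_eq_1)
   have aa: "a \<bullet> a = 1" "b \<bullet> b = 1" using ab by (auto simp: norm_eq_1)
   have fd: "foot d d = 0" using dd by simp
   have "(d \<bullet> a) *R a + (d \<bullet> b) *R b = 0" using fr[of d] fd by simp
   hence "d \<bullet> ((d \<bullet> a) *R a + (d \<bullet> b) *R b) = 0" by simp
   hence "(d \<bullet> a)^2 + (d \<bullet> b)^2 = 0" by (simp add: inner_add_right power2_eq_square)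
   hence da: "d \<bullet> a = 0" "d \<bullet> b = 0" by (auto simp: sum_power2_eq_zero_iff)
   have "norm (foot d (x - x')) = norm (((x - x') \<bullet> a) *R a + ((x - x') \<bullet> b) *R b)" by (simp only: fr)
   also have "... <= \<bar>(x - x') \<bullet> a\<bar> + \<bar>(x - x') \<bullet> b\<bar>"
    using norm_triangle_ineq[of "((x - x') \<bullet> a) *R a" "((x - x') \<bullet> b) *R b"] ab by simp
   also have "... <= 2 * r / real N + 2 * r / real N" by (intro add_mono comp ab kk da)
   finally have f: "norm (foot d (x - x')) <= 4 * r / real N" by simp
   have eq: "foot d (x - x') + (ps (foot d x) - ps (foot d x')) *R d = x - x'"
    using A(1)[OF x(1)] A(1)[OF x(2)] by (simp add: inner_diff_left)
   have "norm (foot d (x - x') + (ps (foot d x) - ps (foot d x')) *R d)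
     <= norm (foot d (x - x')) + norm ((ps (foot d x) - ps (foot d x')) *R d)" by (rule norm_triangle_ineq)
   hence "norm (x - x') <= norm (foot d (x - x')) + \<bar>ps (foot d x) - ps (foot d x')\<bar>"
    by (simp only: eq norm_scaleR d mult_1_right real_norm_def)
   also have "\<bar>ps (foot d x) - ps (foot d x')\<bar> <= L * norm (foot d (x - x'))"
    using lipschitz_onD[OF L, of "foot d x" "foot d x'"] by (simp add: dist_norm foot_diff[symmetric])
   also have "norm (foot d (x - x')) + L * norm (foot d (x - x')) = (1 + L) * norm (foot d (x - x'))"
    by (simp add: algebra_simps)
   also have "... <= D" unfolding D_def using f L0 by (intro mult_left_mono) auto
   finally show ?thesis by simp
  qed
  have nearC: "norm (x - x') <= D" if "x : C n" "x' : C n" for n x x'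
   using that near by (auto simp: C_def split: if_splits)
  have dC: "diameter (C n) <= D" for n using D0 nearC by (intro diameter_le) auto
  have bC: "bounded (C n)" for n
  proof (cases "C n = {}")
   case False
   then obtain x0 where "x0 : C n" by blast
   hence "C n <= cball x0 D" using nearC by (auto simp: dist_norm)
   thus ?thesis using bounded_subset bounded_cball by blast
  qed simp
  have cov: "A <= (\<Union>n. C n)"
  proof
   fix x assume x: "x : A"
   define n where "n = k a x * N + k b x"
   have ka: "k a x < N" "k b x < N" using kb(1)[OF x] ab by auto
   have "n < N * N"
   proof -
    have "n < k a x * N + N" using ka by (simp add: n_def)
    also have "... = Suc (k a x) * N" by simp
    also have "... <= N * N" using ka by (intro mult_right_mono) auto
    finally show ?thesis .
   qed
   hence "x : C n" using x ka by (simp add: C_def n_def)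
   thus "x : (\<Union>n. C n)" by blast
  qed
  have "hausdorff2_pre de A <= (\<Sum>n. ennreal (pi / 4 * (diameter (C n))^2))" unfolding hausdorff2_pre_def
   by (rule Inf_lower) (use cov bC order_trans[OF dC Dde] in auto)
  also have "... = (\<Sum>n<N * N. ennreal (pi / 4 * (diameter (C n))^2))" by (rule suminf_finite) (auto simp: C_def)
  also have "... <= (\<Sum>n<N * N. ennreal (pi / 4 * D^2))"
   by (intro sum_mono ennreal_leI mult_left_mono power_mono dC diameter_ge_0 bC) auto
  also have "... = ennreal (real (N * N) * (pi / 4 * D^2))"
   by (simp add: ennreal_of_nat_eq_real_of_nat ennreal_mult[symmetric])
  also have "real (N * N) * (pi / 4 * D^2) = 4 * pi * (1 + L)^2 * r^2"
   using N by (simp add: D_def power2_eq_square field_simps)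
  finally show ?thesis .
 qed
 show ?thesis unfolding hausdorff2_def by (rule SUP_least) (use pre in auto)
qed

section \<open>Lipschitz domains\<close>

locale lipschitz_domain = bounded_domain +
 assumes lipschitz: "lipschitz_boundary U" and nonempty: "U ~= {}"
begin

abbreviation Ga :: "R3 measure" where "Ga \<equiv> surface_measure U"

text \<open>Three consequences of a local graph: the boundary lies on the graph, points above it are inside,
  and a shift upwards leaves room for a perturbation of proportional size.\<close>

lemma boundary_chart:
 assumes p: "p : frontier U"
 shows "EX ep d ps L. ep > 0 & norm d = 1 & L-lipschitz_on UNIV ps \<and>
  (ALL x. x : frontier U --> x : ball p ep --> x \<bullet> d = ps (foot d x)) \<and>
  (ALL x s. x : frontier U --> x : ball p (ep / 2) --> 0 < s --> s < ep / 2 --> x + s *R d : U) \<and>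
  (ALL x h t. x : U --> x : ball p (ep / 2) --> norm h * (1 + L) <= t --> 0 < t --> t < ep / 4 --> x + t *R d + h : U)"
proof -
 obtain ep d ps L where e: "ep > 0" and d: "norm d = 1" and L: "L-lipschitz_on UNIV ps"
  and eq: "U \<inter> ball p ep = {x : ball p ep. ps (foot d x) < x \<bullet> d}"
  using lipschitz p unfolding lipschitz_boundary_def by blast
 have L0: "L >= 0" using L by (simp add: lipschitz_on_def)
 have iff: "x : U \<longleftrightarrow> ps (foot d x) < x \<bullet> d" if "x : ball p ep" for x using eq that by blast
 have dd: "d \<bullet> d = 1" using d by (simp add: norm_eq_1)
 have ft: "foot d (x + s *R d) = foot d x" for x s by (simp add: inner_add_left dd algebra_simps)
 have cps: "continuous_on UNIV ps" using L by (rule lipschitz_on_continuous_on)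
 have gr: "x \<bullet> d = ps (foot d x)" if x: "x : frontier U" "x : ball p ep" for x
 proof (rule ccontr)
  assume ne: "x \<bullet> d ~= ps (foot d x)"
  have "x ~: U" using x(1) open_U frontier_disjoint_eq by blast
  hence lt: "x \<bullet> d < ps (foot d x)" using iff[OF x(2)] ne by simp
  have "open {x. x \<bullet> d < ps (foot d x)}"
   by (intro open_Collect_less continuous_intros continuous_on_compose2[OF cps]) auto
  hence o: "open ({x. x \<bullet> d < ps (foot d x)} \<inter> ball p ep)" by (simp add: open_Int)
  have "{x. x \<bullet> d < ps (foot d x)} \<inter> ball p ep \<inter> U = {}" using iff by force
  hence "({x. x \<bullet> d < ps (foot d x)} \<inter> ball p ep) \<inter> closure U = {}"
   using open_Int_closure_eq_empty[OF o] by blast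
  thus False using x lt by (auto simp: frontier_def)
 qed
 have up: "x + s *R d : U" if x: "x : frontier U" "x : ball p (ep / 2)" and s: "0 < s" "s < ep / 2" for x s
 proof -
  have xb: "x : ball p ep" using x(2) e by simp
  have "dist p (x + s *R d) <= dist p x + dist x (x + s *R d)" by (rule dist_triangle)
  hence "x + s *R d : ball p ep" using x(2) s d by (simp add: dist_norm)
  thus ?thesis using iff gr[OF x(1) xb] s by (simp only: ft) (simp add: inner_add_left dd)
 qed
 have sh: "x + t *R d + h : U" if x: "x : U" "x : ball p (ep / 2)" and h: "norm h * (1 + L) <= t" and t: "0 < t" "t < ep / 4" for x h t
 proof -
  have xb: "x : ball p ep" using x(2) e by simp
  have hn: "norm h <= t"
  proof -
   have "norm h * 1 <= norm h * (1 + L)" using L0 by (intro mult_left_mono) auto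
   thus ?thesis using h by simp
  qed
  have "dist p (x + t *R d + h) <= dist p x + dist x (x + t *R d + h)" by (rule dist_triangle)
  also have "dist x (x + t *R d + h) <= t + norm h"
   using norm_triangle_ineq[of "t *R d" h] t d by (simp add: dist_norm norm_minus_commute) (metis add.commute diff_add_cancel add_diff_cancel_left' norm_minus_commute norm_minus_cancel minus_add_distrib)
  finally have zb: "x + t *R d + h : ball p ep" using x(2) t hn by simp
  have feq: "foot d (x + t *R d + h) = foot d x + foot d h" by (simp add: inner_add_left dd algebra_simps)
  have "ps (foot d (x + t *R d + h)) <= ps (foot d x) + L * norm (foot d h)"
   unfolding feq using lipschitz_onD[OF L, of "foot d x + foot d h" "foot d x"] by (simp add: dist_norm abs_le_iff)
  also have "... <= ps (foot d x) + L * norm h" using foot_norm_le[OF d] L0 by (simp add: mult_left_mono)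
  also have "... < x \<bullet> d + L * norm h" using iff[OF xb] x(1) by simp
  also have "... <= x \<bullet> d + t - norm h" using h by (simp add: algebra_simps)
  also have "... <= (x + t *R d + h) \<bullet> d"
  proof -
   have "\<bar>h \<bullet> d\<bar> <= norm h" using Cauchy_Schwarz_ineq2[of h d] d by simp
   thus ?thesis by (simp add: inner_add_left dd)
  qed
  finally show ?thesis using iff[OF zb] by simp
 qed
 show ?thesis using e d L gr up sh by (intro exI[of _ ep] exI[of _ d] exI[of _ ps] exI[of _ L]) simp
qed

text \<open>The room left by an upward shift contains a cube, in which a mollifier can be supported.\<close>

lemma mollification_chart:
 assumes p: "p : closure U"
 shows "EX \<rho>>0. EX d. EX c>0. EX t0>0. ALL t x. 0 < t --> t < t0 --> x : U \<inter> ball p \<rho> -->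
    cube (x + t *R d) (c * t) <= U"
proof (cases "p : U")
 case True
 then obtain \<rho> where \<rho>: "\<rho> > 0" "ball p \<rho> <= U" using open_U by (auto simp: open_contains_ball)
 have "cube (x + t *R 0) (1 * t) <= U"
  if t: "0 < t" "t < \<rho> / 6" and x: "x : U \<inter> ball p (\<rho> / 2)" for t x
 proof
  fix z assume "z : cube (x + t *R 0) (1 * t)"
  hence "norm (z - x) <= 3 * t" using cube_norm_le[of z x t] by simp
  moreover have "dist p z <= dist p x + dist x z" by (rule dist_triangle)
  ultimately have "dist p z < \<rho>" using x t by (simp add: dist_norm norm_minus_commute)
  thus "z : U" using \<rho>(2) by auto
 qed
 thus ?thesis using \<rho>(1)
  by (intro exI[of _ "\<rho> / 2"] conjI exI[of _ 0] exI[of _ 1] exI[of _ "\<rho> / 6"]) auto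
next
 case False
 hence pf: "p : frontier U" using p open_U by (simp add: frontier_def interior_open)
 obtain ep d ps L where e: "ep > 0" and d: "norm d = 1" and L: "L-lipschitz_on UNIV (ps :: R3 => real)"
  and sh: "!!x h t. x : U ==> x : ball p (ep / 2) ==> norm h * (1 + L) <= t ==> 0 < t ==> t < ep / 4 ==> x + t *R d + h : U"
  using boundary_chart[OF pf] by blast
 have L0: "L >= 0" using L by (simp add: lipschitz_on_def)
 (* points of a cube of half-width c t are within 3 c t of its centre *)
 define c where "c = 1 / (3 * (1 + L))"
 have c: "c > 0" using L0 by (simp add: c_def)
 have "cube (x + t *R d) (c * t) <= U"
  if t: "0 < t" "t < ep / 4" and x: "x : U \<inter> ball p (ep / 2)" for t x
 proof
  fix z assume "z : cube (x + t *R d) (c * t)"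
  hence n: "norm (z - (x + t *R d)) <= 3 * (c * t)" by (rule cube_norm_le)
  have "norm (z - (x + t *R d)) * (1 + L) <= 3 * (c * t) * (1 + L)" using n L0 by (intro mult_right_mono) auto
  also have "... = (3 * (1 + L) * c) * t" by (simp only: ac_simps)
  also have "3 * (1 + L) * c = 1" using L0 unfolding c_def by (intro nonzero_mult_div_cancel_left[of _ 1, simplified mult_1_right] | simp)+
  finally have "norm (z - (x + t *R d)) * (1 + L) <= t" by simp
  hence "x + t *R d + (z - (x + t *R d)) : U" using x t by (intro sh) auto
  thus "z : U" by simp
 qed
 thus ?thesis using e c by (intro exI[of _ "ep / 2"] conjI exI[of _ d] exI[of _ c] exI[of _ "ep / 4"]) auto
qed

lemma H1_approximable_bound:
 "EX C>0. ALL f:H1 U. ALL m>=0. (AE x in \<L>. ereal \<bar>f x\<bar> <= m) --> approximable (ereal C * m) f"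
 by (rule H1_approximable[OF mollification_chart nonempty])

end

section \<open>The trace inequality\<close>

text \<open>Cubes determine whether a Borel measure is dominated by a multiple of the Lebesgue measure,
  because a set is covered by non-overlapping dyadic cubes of total volume as close to its measure as one
  wishes.\<close>

lemma measure_le_lborel_if_cubes:
 fixes N :: "R3 measure"
 assumes N: "sets N = sets borel" and kp: "kp >= 0"
  and cube: "!!c d l. l > 0 ==> (!!i. d $ i - c $ i = l) ==> emeasure N (cbox c d) <= ennreal (kp * l ^ 3)"
  and A: "A : sets borel"
 shows "emeasure N A <= ennreal kp * emeasure lborel A"
proof -
 have bdd: "emeasure N S <= ennreal kp * emeasure lborel S"
  if S: "S : sets borel" and k: "k > 0" and sub: "S <= cbox (vec (- k)) (vec k)" for S :: "R3 set" and k :: real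
 proof -
  have Sl: "S : lmeasurable" using S by (intro bounded_set_imp_lmeasurable bounded_subset[OF bounded_cbox sub]) auto
  have fin: "emeasure lborel S < \<infinity>" using sub by (meson bounded_cbox bounded_subset emeasure_bounded_finite)
  have approx: "emeasure N S <= ennreal kp * (emeasure lborel S + ennreal e)" if e: "e > 0" for e
  proof -
   obtain \<D> where D: "countable \<D>"
    "!!K. K : \<D> ==> K <= cbox (vec (- k)) (vec k) & K ~= {} & (EX c d. K = cbox c d)"
    "pairwise (%A B. interior A \<inter> interior B = {}) \<D>"
    "!!u v. cbox u v : \<D> ==> EX n. ALL i:Basis. v \<bullet> i - u \<bullet> i = (vec k \<bullet> i - (vec (- k) :: R3) \<bullet> i)/2^n"
    "S <= \<Union>\<D>" "\<Union>\<D> : lmeasurable" "measure lebesgue (\<Union>\<D>) <= measure lebesgue S + e"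
    using measurable_outer_intervals_bounded[OF Sl sub e] by metis
   define Q where "Q = (%n. if n : to_nat_on \<D> ` \<D> then from_nat_into \<D> n else {})"
   have Qin: "Q n = {} \<or> Q n : \<D>" for n using D(1) by (auto simp: Q_def)
   have UQ: "(\<Union>n. Q n) = \<Union>\<D>"
   proof
    show "\<Union>\<D> <= (\<Union>n. Q n)"
    proof
     fix x assume "x : \<Union>\<D>"
     then obtain K where K: "K : \<D>" "x : K" by blast
     hence "x : Q (to_nat_on \<D> K)" using D(1) by (simp add: Q_def)
     thus "x : (\<Union>n. Q n)" by blast
    qed
   qed (use Qin in blast)
   have Qcube: "EX c d l. l > 0 & Q n = cbox c d & (ALL i. d $ i - c $ i = l)" if qn: "Q n : \<D>" for n
   proof -
    obtain c d where cd: "Q n = cbox c d" using D(2)[OF qn] by blast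
    obtain j where j: "ALL i:Basis. d \<bullet> i - c \<bullet> i = (vec k \<bullet> i - (vec (- k) :: R3) \<bullet> i)/2^j"
     using D(4)[of c d] qn cd by auto
    have "d $ i - c $ i = 2 * k / 2 ^ j" for i
    proof -
     have "axis i 1 : (Basis :: R3 set)" by simp
     thus ?thesis using j[rule_format, of "axis i 1"] by (simp add: inner_axis)
    qed
    thus ?thesis using k cd by (intro exI[of _ c] exI[of _ d] exI[of _ "2 * k / 2 ^ j"]) auto
   qed
   have Qle: "emeasure N (Q n) <= ennreal kp * emeasure lborel (interior (Q n))" for n
   proof (cases "Q n : \<D>")
    case True
    then obtain c d l where q: "l > 0" "Q n = cbox c d" "!!i. d $ i - c $ i = l" using Qcube by blast
    have dc: "d - c = vec l" using q(3) by (simp add: vec_eq_iff)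
    have le: "c \<bullet> b <= d \<bullet> b" if b: "b : Basis" for b
    proof -
     obtain i where "b = axis i 1" using b by (auto simp: Basis_vec_def)
     thus ?thesis using q(1) q(3)[of i] by (simp add: inner_axis)
    qed
    have one: "(d - c) \<bullet> b = l" if "b : Basis" for b
     using that unfolding dc by (auto simp: Basis_vec_def inner_axis)
    have "emeasure lborel (interior (Q n)) = ennreal (\<Prod>b\<in>Basis. (d - c) \<bullet> b)"
     unfolding q(2) interior_cbox by (rule emeasure_lborel_box[OF le])
    also have "(\<Prod>b\<in>(Basis :: R3 set). (d - c) \<bullet> b) = l ^ 3" using one by simp
    finally show ?thesis using cube[OF q(1) q(3)] kp q(1,2) by (simp add: ennreal_mult)
   next
    case False
    thus ?thesis using Qin[of n] by auto
   qed
   have Qs: "Q n : sets borel" for n using Qin[of n] D(2) by (metis borel_closed closed_cbox closed_empty)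
   have disj: "disjoint_family (%n. interior (Q n))" unfolding disjoint_family_on_def
   proof (intro ballI impI)
    fix m n :: nat assume mn: "m ~= n"
    show "interior (Q m) \<inter> interior (Q n) = {}"
    proof (cases "m : to_nat_on \<D> ` \<D> & n : to_nat_on \<D> ` \<D>")
     case True
     then obtain K K' where K: "K : \<D>" "m = to_nat_on \<D> K" "K' : \<D>" "n = to_nat_on \<D> K'" by blast
     hence "Q m = K" "Q n = K'" "K ~= K'" using D(1) mn by (auto simp: Q_def)
     thus ?thesis using D(3) K(1,3) unfolding pairwise_def by blast
    qed (auto simp: Q_def)
   qed
   have Ul: "\<Union>\<D> : sets borel" unfolding UQ[symmetric] by (intro sets.countable_UN) (use Qs in auto)
   have "emeasure N S <= emeasure N (\<Union>n. Q n)" unfolding UQ by (rule emeasure_mono[OF D(5)]) (simp add: N Ul)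
   also have "... <= (\<Sum>n. emeasure N (Q n))" using Qs N by (intro emeasure_subadditive_countably) auto
   also have "... <= (\<Sum>n. ennreal kp * emeasure lborel (interior (Q n)))" by (intro suminf_le Qle) auto
   also have "... = ennreal kp * (\<Sum>n. emeasure lborel (interior (Q n)))" by (rule ennreal_suminf_cmult)
   also have "(\<Sum>n. emeasure lborel (interior (Q n))) = emeasure lborel (\<Union>n. interior (Q n))"
    using disj by (intro suminf_emeasure) auto
   also have "... <= emeasure lborel (\<Union>\<D>)" unfolding UQ[symmetric]
    by (intro emeasure_mono UN_mono interior_subset order_refl) (use Qs in auto)
   also have "... = ennreal (measure lebesgue (\<Union>\<D>))"
   proof -
    have "emeasure lborel (\<Union>\<D>) = emeasure lebesgue (\<Union>\<D>)" using Ul by simp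
    also have "... = ennreal (measure lebesgue (\<Union>\<D>))" by (rule emeasure_eq_measure2[OF D(6)])
    finally show ?thesis .
   qed
   also have "... <= ennreal (measure lebesgue S + e)" using D(7) by (rule ennreal_leI)
   also have "... = emeasure lborel S + ennreal e"
   proof -
    have "emeasure lborel S = emeasure lebesgue S" using S by simp
    also have "... = ennreal (measure lebesgue S)" by (rule emeasure_eq_measure2[OF Sl])
    finally show ?thesis using e by simp
   qed
   finally show ?thesis by (simp add: mult_left_mono)
  qed
  have le: "emeasure N S <= ennreal kp * emeasure lborel S + ennreal e'" if e': "e' > 0" for e'
  proof -
   have "emeasure N S <= ennreal kp * (emeasure lborel S + ennreal (e' / (kp + 1)))"
    by (rule approx) (use e' kp in auto)
   also have "... = ennreal kp * emeasure lborel S + ennreal (kp * (e' / (kp + 1)))"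
    by (subst ennreal_mult) (use kp e' in \<open>auto simp: distrib_left\<close>)
   also have "... <= ennreal kp * emeasure lborel S + ennreal e'"
    using kp e' by (intro add_left_mono ennreal_leI) (simp add: field_simps)
   finally show ?thesis .
  qed
  show ?thesis by (rule ennreal_le_epsilon) (use le in auto)
 qed
 define K where "K = (%n. A \<inter> cbox (vec (- real (Suc n))) (vec (real (Suc n))))"
 have Ks: "K n : sets borel" for n using A by (simp add: K_def)
 have inc: "incseq K"
 proof (rule monoI)
  fix m n :: nat assume mn: "m <= n"
  have "cbox (vec (- real (Suc m))) (vec (real (Suc m))) <= (cbox (vec (- real (Suc n))) (vec (real (Suc n))) :: R3 set)"
  proof
   fix x :: R3 assume x: "x : cbox (vec (- real (Suc m))) (vec (real (Suc m)))"
   have "real (Suc m) <= real (Suc n)" using mn by simp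
   moreover have "- real (Suc m) <= x $ i & x $ i <= real (Suc m)" for i using x unfolding mem_box_cart vec_component by blast
   ultimately have "- real (Suc n) <= x $ i & x $ i <= real (Suc n)" for i by (meson neg_le_iff_le order_trans)
   thus "x : cbox (vec (- real (Suc n))) (vec (real (Suc n)))" unfolding mem_box_cart vec_component by blast
  qed
  thus "K m <= K n" unfolding K_def by blast
 qed
 have UK: "(\<Union>n. K n) = A"
 proof
  show "A <= (\<Union>n. K n)"
  proof
   fix x assume x: "x : A"
   obtain n :: nat where n: "norm x <= real n" using real_arch_simple by blast
   have "\<bar>x $ i\<bar> <= real (Suc n)" for i using component_le_norm_cart[of x i] n by simp
   hence "- real (Suc n) <= x $ i & x $ i <= real (Suc n)" for i unfolding abs_le_iff by (meson minus_le_iff)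
   hence "x : K n" using x unfolding K_def Int_iff mem_box_cart vec_component by blast
   thus "x : (\<Union>n. K n)" by blast
  qed
 qed (use K_def in blast)
 have "range K <= sets N" using Ks N by blast
 from SUP_emeasure_incseq[OF this inc] have "emeasure N A = (SUP n. emeasure N (K n))" by (simp only: UK)
 also have "... <= ennreal kp * emeasure lborel A"
 proof (rule SUP_least)
  fix n
  have "emeasure N (K n) <= ennreal kp * emeasure lborel (K n)"
   by (rule bdd[OF Ks, of "real (Suc n)"]) (use K_def in \<open>auto simp del: of_nat_Suc\<close>)
  also have "... <= ennreal kp * emeasure lborel A" by (intro mult_left_mono emeasure_mono) (use A K_def in auto)
  finally show "emeasure N (K n) <= ennreal kp * emeasure lborel A" .
 qed
 finally show ?thesis .
qed

text \<open>Integrating the derivative of \<open>(s\<^sub>0 - s) u(s)\<^sup>2\<close> expresses the boundary value by the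
  values and slopes inside.\<close>

lemma boundary_value_le_integral:
 fixes u u' :: "real => real"
 assumes s0: "s0 > 0" and der: "!!s. (u has_real_derivative u' s) (at s)" and cu': "continuous_on UNIV u'"
 shows "ennreal (s0 * (u 0)^2) <= (NN s. ennreal (2 * (u s)^2 + s0^2 * (u' s)^2) * indicator {0<..<s0} s)"
proof -
 have cu: "continuous_on UNIV u" using der by (meson DERIV_isCont continuous_at_imp_continuous_on)
 define f where "f = (%s. (u s)^2 - 2 * (s0 - s) * u s * u' s)"
 define G where "G = (%s. 2 * (u s)^2 + s0^2 * (u' s)^2)"
 have "has_bochner_integral lborel (%s. f s * indicator {0..s0} s) (- ((s0 - s0) * (u s0)^2) - (- ((s0 - 0) * (u 0)^2)))"
 proof (rule has_bochner_integral_FTC_Icc_real[where F="%s. - ((s0 - s) * (u s)^2)"])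
  show "((%s. - ((s0 - s) * (u s)^2)) has_real_derivative f s) (at s)" for s
   unfolding f_def by (rule derivative_eq_intros der refl | simp)+
  have "continuous_on UNIV f" unfolding f_def by (intro continuous_intros cu cu')
  thus "isCont f s" for s by (simp add: continuous_on_eq_continuous_at)
 qed (use s0 in auto)
 hence fi: "integrable lborel (%s. f s * indicator {0..s0} s)" "(LINT s|lborel. f s * indicator {0..s0} s) = s0 * (u 0)^2"
  by (auto simp: has_bochner_integral_iff)
 have "continuous_on {0..s0} G" unfolding G_def by (intro continuous_intros continuous_on_subset[OF cu] continuous_on_subset[OF cu']) auto
 hence Gi: "integrable lborel (%s. G s * indicator {0..s0} s)"
  using borel_integrable_atLeastAtMost'[of 0 s0 G] by (simp add: set_integrable_def mult.commute)
 have fG: "f s * indicator {0..s0} s <= G s * indicator {0..s0} s" for s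
 proof (cases "s : {0..s0}")
  case True
  have "0 <= (u s + (s0 - s) * u' s)^2" by simp
  hence "f s <= 2 * (u s)^2 + (s0 - s)^2 * (u' s)^2" by (simp add: f_def power2_eq_square algebra_simps)
  also have "(s0 - s)^2 * (u' s)^2 <= s0^2 * (u' s)^2" using True by (intro mult_right_mono power_mono) auto
  finally show ?thesis using True by (simp add: G_def)
 qed simp
 have "s0 * (u 0)^2 <= (LINT s|lborel. G s * indicator {0..s0} s)"
  unfolding fi(2)[symmetric] by (intro integral_mono fi(1) Gi fG)
 hence "ennreal (s0 * (u 0)^2) <= ennreal (LINT s|lborel. G s * indicator {0..s0} s)" by (rule ennreal_leI)
 also have "... = (NN s. ennreal (G s * indicator {0..s0} s))"
  using Gi by (intro nn_integral_eq_integral[symmetric]) (auto simp: G_def indicator_def)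
 also have "... = (NN s. ennreal (G s) * indicator {0<..<s0} s)"
 proof (rule nn_integral_cong_AE)
  have "AE s in lborel. s ~= (0::real)" "AE s in lborel. s ~= s0" by (auto intro: AE_lborel_singleton)
  thus "AE s in lborel. ennreal (G s * indicator {0..s0} s) = ennreal (G s) * indicator {0<..<s0} s"
   by eventually_elim (auto simp: indicator_def)
 qed
 finally show ?thesis by (simp add: G_def)
qed

context lipschitz_domain
begin

text \<open>A boundary patch swept along its direction \<open>d\<close> stays inside the domain, and by the area bound for
  Lipschitz graphs the sweep multiplies volumes by at most a constant. The boundary value is
  then bounded by the integral along each swept segment.\<close>

lemma local_trace_inequality:
 assumes p: "p : frontier U"
 shows "EX r>0. EX C>=0. emeasure Ga (frontier U \<inter> ball p r) < \<infinity> \<and>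
  (ALL f. Ck_R3 1 f --> (\<integral>\<^sup>+x. ennreal ((f x)^2) * indicator (frontier U \<inter> ball p r) x \<partial>Ga) <= ennreal (C * (H1_norm U f)^2))"
proof -
 obtain ep d ps L where e: "ep > 0" and d: "norm d = 1" and L: "L-lipschitz_on UNIV (ps :: R3 => real)"
  and gr: "!!x. x : frontier U ==> x : ball p ep ==> x \<bullet> d = ps (foot d x)"
  and up: "!!x s. x : frontier U ==> x : ball p (ep / 2) ==> 0 < s ==> s < ep / 2 ==> x + s *R d : U"
  using boundary_chart[OF p] by blast
 have dd: "d \<bullet> d = 1" using d by (simp add: norm_eq_1)
 define s0 where "s0 = ep / 2"
 have s0: "s0 > 0" using e by (simp add: s0_def)
 define S where "S = frontier U \<inter> ball p s0"
 have Sb[measurable]: "S : sets Ga" by (auto simp: sets_surface_measure S_def frontier_closed)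
 have Sgr: "x \<bullet> d = ps (foot d x)" if "x : S" for x using that e by (intro gr) (auto simp: S_def s0_def)
 have Sup: "x + s *R d : U" if "x : S" "0 < s" "s < s0" for x s using that up by (auto simp: S_def s0_def)
 have area: "emeasure Ga A <= ennreal (4 * pi * (1 + L)^2 * \<rho>^2)"
  if A: "A : sets Ga" "A <= S" "!!x. x : A ==> norm (foot d x - y) < \<rho>" "\<rho> > 0" for A y \<rho>
  by (rule order_trans[OF emeasure_surface_measure_le[OF A(1)] hausdorff2_graph_le[OF d L A(4)]]) (use A Sgr in auto)
 have fin: "emeasure Ga S < \<infinity>"
 proof -
  have "norm (foot d x - foot d p) < s0" if "x : S" for x
  proof -
   have "norm (foot d x - foot d p) <= norm (x - p)" unfolding foot_diff by (rule foot_norm_le[OF d])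
   also have "... < s0" using that by (simp add: S_def dist_norm norm_minus_commute)
   finally show ?thesis .
  qed
  hence "emeasure Ga S <= ennreal (4 * pi * (1 + L)^2 * s0^2)" by (intro area[OF Sb]) (use s0 in auto)
  thus ?thesis by (rule le_less_trans) simp
 qed
 define M where "M = density (Ga OM lborel) (%z. indicator S (fst z) * indicator {0<..<s0} (snd z) :: ennreal)"
 define N where "N = distr M borel (%z. fst z + snd z *R d)"
 have idm[measurable]: "(%x. x) : bmeas Ga" by (rule borel_measurable_surface) simp
 have [measurable]: "(%z. fst z + snd z *R d) : bmeas (Ga OM lborel)"
  by (intro borel_measurable_add borel_measurable_scaleR measurable_compose[OF measurable_fst idm] measurable_compose[OF measurable_snd]) auto
 have [measurable]: "indicator S : bmeas Ga" by (rule borel_measurable_indicator[OF Sb])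
 have Nint: "nn_integral N h = (\<integral>\<^sup>+x. (NN s. h (x + s *R d) * indicator {0<..<s0} s) * indicator S x \<partial>Ga)"
  if h[measurable]: "h : bmeas borel" for h
 proof -
  have "nn_integral N h = (\<integral>\<^sup>+z. (indicator S (fst z) * indicator {0<..<s0} (snd z)) * h (fst z + snd z *R d) \<partial>(Ga OM lborel))"
   unfolding N_def M_def by (subst nn_integral_distr, simp_all, subst nn_integral_density) auto
  also have "... = (\<integral>\<^sup>+x. (NN s. (indicator S x * indicator {0<..<s0} s) * h (x + s *R d)) \<partial>Ga)"
   by (subst lborel.nn_integral_fst[symmetric]) auto
  also have "... = (\<integral>\<^sup>+x. (NN s. h (x + s *R d) * indicator {0<..<s0} s) * indicator S x \<partial>Ga)"
   by (intro nn_integral_cong) (auto simp: indicator_def mult.commute)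
  finally show ?thesis .
 qed
 have sN: "sets N = sets borel" by (simp add: N_def)
 (* segments of length 2 R times an area of 4 pi (1 + L)^2 R^2, with R = 2 l *)
 define kp where "kp = 256 * pi * (1 + L)^2"
 have kp: "kp >= 0" by (simp add: kp_def)
 have cube: "emeasure N (cbox a b) <= ennreal (kp * l ^ 3)" if l: "l > 0" and ab: "!!i. b $ i - a $ i = l" for a b :: R3 and l
 proof -
  (* a cube of side l lies in the ball of radius 2 l about each of its corners *)
  define R where "R = 2 * l"
  have R: "R > 0" using l by (simp add: R_def)
  have near: "norm (z - a) < R" if z: "z : cbox a b" for z
  proof -
   have "\<bar>(z - a) $ i\<bar> <= l" for i using z ab[of i] by (simp add: mem_box_cart) (smt (verit))
   hence "((z - a) $ i)^2 <= l^2" for i using l by (metis abs_le_square_iff abs_of_pos)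
   hence "(norm (z - a))^2 <= 3 * l^2"
    unfolding norm_vec_def L2_set_def using sum_mono[of "UNIV :: 3 set" "%i. ((z - a) $ i)^2" "%_. l^2"]
    by (simp add: sum_nonneg)
   also have "... < R^2" using l by (simp add: R_def power2_eq_square)
   finally show ?thesis using R by (simp add: power2_less_imp_less)
  qed
  define A where "A = {x : S. norm (foot d x - foot d a) < R}"
  have "A = S \<inter> {x. norm (foot d x - foot d a) < R}" by (auto simp: A_def)
  moreover have "open {x. norm (foot d x - foot d a) < R}" by (intro open_Collect_less continuous_intros)
  ultimately have As: "A : sets Ga" using Sb by (auto simp: sets_surface_measure)
  have inner: "(NN s. indicator (cbox a b) (x + s *R d) * indicator {0<..<s0} s) * indicator S x
    <= ennreal (2 * R) * indicator A x" for x
  proof (cases "x : A")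
   case True
   have "(NN s. indicator (cbox a b) (x + s *R d) * indicator {0<..<s0} s)
     <= (\<integral>\<^sup>+s. indicator {(a - x) \<bullet> d - R..(a - x) \<bullet> d + R} s \<partial>(lborel :: real measure))"
   proof (rule nn_integral_mono)
    fix s :: real
    show "indicator (cbox a b) (x + s *R d) * indicator {0<..<s0} s <= (indicator {(a - x) \<bullet> d - R..(a - x) \<bullet> d + R} s :: ennreal)"
    proof (cases "x + s *R d : cbox a b")
     case True
     have "\<bar>(x + s *R d - a) \<bullet> d\<bar> <= norm (x + s *R d - a) * norm d" by (rule Cauchy_Schwarz_ineq2)
     hence "\<bar>(x + s *R d - a) \<bullet> d\<bar> <= R" using near[OF True] d by simp
     moreover have "(x + s *R d - a) \<bullet> d = s - (a - x) \<bullet> d" by (simp add: inner_diff_left inner_add_left dd)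
     ultimately have "s : {(a - x) \<bullet> d - R..(a - x) \<bullet> d + R}" by (simp only: atLeastAtMost_iff) linarith
     thus ?thesis by (simp add: indicator_def)
    qed simp
   qed
   also have "... = ennreal (2 * R)" using R by simp
   finally show ?thesis using True by (simp add: A_def)
  next
   case False
   show ?thesis
   proof (cases "x : S")
    case True
    have "x + s *R d ~: cbox a b" for s
    proof
     assume "x + s *R d : cbox a b"
     hence n: "norm (x + s *R d - a) < R" by (rule near)
     have "foot d x - foot d a = foot d (x + s *R d - a)" by (simp add: inner_diff_left inner_add_left dd algebra_simps)
     hence "norm (foot d x - foot d a) <= norm (x + s *R d - a)" using foot_norm_le[OF d] by metis
     thus False using n False True by (simp add: A_def)
    qed
    thus ?thesis by simp
   qed simp
  qed
  have "emeasure N (cbox a b) = nn_integral N (indicator (cbox a b))" using sN by simp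
  also have "... = (\<integral>\<^sup>+x. (NN s. indicator (cbox a b) (x + s *R d) * indicator {0<..<s0} s) * indicator S x \<partial>Ga)"
   by (rule Nint) simp
  also have "... <= (\<integral>\<^sup>+x. ennreal (2 * R) * indicator A x \<partial>Ga)" by (rule nn_integral_mono) (rule inner)
  also have "... = ennreal (2 * R) * emeasure Ga A" using As by (simp add: nn_integral_cmult_indicator)
  also have "... <= ennreal (2 * R) * ennreal (4 * pi * (1 + L)^2 * R^2)"
   by (intro mult_left_mono area[OF As, of "foot d a"]) (use R in \<open>auto simp: A_def\<close>)
  also have "... = ennreal ((2 * R) * (4 * pi * (1 + L)^2 * R^2))" by (rule ennreal_mult[symmetric]) (use R in auto)
  also have "(2 * R) * (4 * pi * (1 + L)^2 * R^2) = 8 * pi * (1 + L)^2 * R ^ 3" by (simp add: power3_eq_cube power2_eq_square)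
  also have "... <= kp * l ^ 3" unfolding kp_def R_def using l by (simp add: power_mult_distrib)
  finally show ?thesis by (simp add: ennreal_leI)
 qed
 have sub: "N <= scale_measure (ennreal kp) lborel"
 proof (rule le_measure[THEN iffD2, rule_format])
  show "sets N = sets (scale_measure (ennreal kp) lborel)" by (simp only: sN sets_scale_measure sets_lborel)
  show "emeasure N A <= emeasure (scale_measure (ennreal kp) lborel) A" if "A : sets N" for A
   unfolding emeasure_scale_measure
   by (rule measure_le_lborel_if_cubes[OF sN kp]) (use that sN in \<open>auto intro: cube\<close>)
 qed
 define C where "C = kp * (2 + s0^2) / s0"
 have C: "C >= 0" using kp s0 by (simp add: C_def)
 have "(\<integral>\<^sup>+x. ennreal ((f x)^2) * indicator S x \<partial>Ga) <= ennreal (C * (H1_norm U f)^2)" if f: "Ck_R3 1 f" for f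
 proof -
  note Cf = C1_D[OF f]
  define g where "g = (%x. \<chi> i. partial i f x)"
  have cg: "continuous_on UNIV g" unfolding g_def by (intro continuous_on_vec_lambda Cf)
  define G where "G = (%x. 2 * (f x)^2 + s0^2 * (norm (g x))^2)"
  have cG: "continuous_on UNIV G" unfolding G_def by (intro continuous_intros Cf cg)
  have G0: "G x >= 0" for x by (simp add: G_def)
  define h where "h = (%x. ennreal (G x) * indicator U x)"
  have [measurable]: "G : bmeas borel" using cG by (rule borel_contI)
  have [measurable]: "U : sets borel" using open_U by simp
  have hm: "h : bmeas borel" unfolding h_def by measurable
  have fm[measurable]: "f : bmeas Ga" by (intro borel_measurable_surface borel_contI Cf)
  have "ennreal s0 * (\<integral>\<^sup>+x. ennreal ((f x)^2) * indicator S x \<partial>Ga) = (\<integral>\<^sup>+x. ennreal (s0 * (f x)^2) * indicator S x \<partial>Ga)"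
   using s0 by (subst nn_integral_cmult[symmetric]) (auto simp: ennreal_mult mult.assoc)
  also have "... <= (\<integral>\<^sup>+x. (NN s. h (x + s *R d) * indicator {0<..<s0} s) * indicator S x \<partial>Ga)"
  proof (rule nn_integral_mono)
   fix x
   show "ennreal (s0 * (f x)^2) * indicator S x <= (NN s. h (x + s *R d) * indicator {0<..<s0} s) * indicator S x"
   proof (cases "x : S")
    case True
    have "ennreal (s0 * (f (x + 0 *R d))^2) <= (NN s. ennreal (2 * (f (x + s *R d))^2 + s0^2 * (g (x + s *R d) \<bullet> d)^2) * indicator {0<..<s0} s)"
    proof (rule boundary_value_le_integral[OF s0])
     show "((%s. f (x + s *R d)) has_real_derivative g (x + s *R d) \<bullet> d) (at s)" for s
      unfolding g_def by (rule partial_along_line[OF f])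
     show "continuous_on UNIV (%s. g (x + s *R d) \<bullet> d)"
      by (intro continuous_intros continuous_on_compose2[OF cg]) auto
    qed
    also have "... <= (NN s. h (x + s *R d) * indicator {0<..<s0} s)"
    proof (rule nn_integral_mono)
     fix s :: real
     have "\<bar>g (x + s *R d) \<bullet> d\<bar> <= norm (g (x + s *R d))" using Cauchy_Schwarz_ineq2[of "g (x + s *R d)" d] d by simp
     hence "(g (x + s *R d) \<bullet> d)^2 <= (norm (g (x + s *R d)))^2" by (simp add: abs_le_square_iff[symmetric])
     hence "2 * (f (x + s *R d))^2 + s0^2 * (g (x + s *R d) \<bullet> d)^2 <= G (x + s *R d)"
      unfolding G_def by (intro add_left_mono mult_left_mono) auto
     thus "ennreal (2 * (f (x + s *R d))^2 + s0^2 * (g (x + s *R d) \<bullet> d)^2) * indicator {0<..<s0} s <= h (x + s *R d) * indicator {0<..<s0} s"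
      using Sup[OF True, of s] ennreal_leI[of _ "G (x + s *R d)"]
      by (cases "s : {0<..<s0}") (auto simp: h_def simp del: ennreal_plus)
    qed
    finally show ?thesis using True by simp
   qed simp
  qed
  also have "... = nn_integral N h" by (rule Nint[OF hm, symmetric])
  also have "... <= nn_integral (scale_measure (ennreal kp) lborel) h" by (rule nn_integral_mono_measure[OF _ sub]) (simp add: sN)
  also have "... = ennreal kp * (NN x. h x)" using hm by (intro nn_integral_scale_measure) auto
  also have "(NN x. h x) = (\<integral>\<^sup>+x. ennreal (G x) \<partial>\<L>)"
   unfolding h_def by (subst nn_integral_restrict_space) (auto simp: nn_integral_completion)
  also have "... = ennreal (2 * (Lp_norm \<L> 2 f)^2 + s0^2 * (Lp_norm \<L> 2 g)^2)"
  proof -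
   have fL: "f : Lp \<L> 2" "g : Lp \<L> 2" by (auto intro: continuous_bounded_Lp Cf cg)
   hence "integrable \<L> (%x. (f x)^2)" "integrable \<L> (%x. (norm (g x))^2)" unfolding L2_integrable_sq by auto
   thus ?thesis unfolding G_def L2_norm_sq by (subst nn_integral_eq_integral) auto
  qed
  also have "Lp_norm \<L> 2 g = Lp_norm \<L> 2 (wgrad U f)" using C1_H1[OF f] W1pD(3)[OF C1_H1(1)[OF f]] cg
   by (intro Lp_AE_cong(1)) (auto simp: g_def eq_commute dest: LpD intro: continuous_measurable_lebesgue_on)
  also have "ennreal kp * ennreal (2 * (Lp_norm \<L> 2 f)^2 + s0^2 * (Lp_norm \<L> 2 (wgrad U f))^2)
    <= ennreal kp * ennreal ((2 + s0^2) * (H1_norm U f)^2)"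
   unfolding H1_norm_eq by (intro mult_left_mono ennreal_leI) (auto simp: algebra_simps)
  also have "... = ennreal s0 * ennreal (C * (H1_norm U f)^2)"
   using kp s0 C by (simp add: ennreal_mult[symmetric] C_def)
  finally show ?thesis using s0 by (subst (asm) ennreal_mult_le_mult_iff) auto
 qed
 thus ?thesis using s0 C fin unfolding S_def by (intro exI[of _ s0] exI[of _ C]) auto
qed

end

section \<open>The trace operator\<close>

context lipschitz_domain
begin

text \<open>Finitely many boundary patches suffice by compactness; their areas also bound the total
  area.\<close>

lemma trace_inequality_ex:
 "emeasure Ga (space Ga) ~= \<infinity> \<and>
  (EX C>=0. ALL f. Ck_R3 1 f --> (\<integral>\<^sup>+x. ennreal ((f x)^2) \<partial>Ga) <= ennreal (C * (H1_norm U f)^2))"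
proof -
 have "ALL p. EX r. p : frontier U --> r > 0 & (EX C>=0. emeasure Ga (frontier U \<inter> ball p r) < \<infinity> \<and>
  (ALL f. Ck_R3 1 f --> (\<integral>\<^sup>+x. ennreal ((f x)^2) * indicator (frontier U \<inter> ball p r) x \<partial>Ga) <= ennreal (C * (H1_norm U f)^2)))"
  using local_trace_inequality by blast
 from choice[OF this] obtain r where r: "!!p. p : frontier U ==> r p > 0"
  and ex: "!!p. p : frontier U ==> EX C>=0. emeasure Ga (frontier U \<inter> ball p (r p)) < \<infinity> \<and>
  (ALL f. Ck_R3 1 f --> (\<integral>\<^sup>+x. ennreal ((f x)^2) * indicator (frontier U \<inter> ball p (r p)) x \<partial>Ga) <= ennreal (C * (H1_norm U f)^2))"
  by blast
 have "ALL p. EX C. p : frontier U --> C >= 0 & emeasure Ga (frontier U \<inter> ball p (r p)) < \<infinity> \<and>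
  (ALL f. Ck_R3 1 f --> (\<integral>\<^sup>+x. ennreal ((f x)^2) * indicator (frontier U \<inter> ball p (r p)) x \<partial>Ga) <= ennreal (C * (H1_norm U f)^2))"
  using ex by blast
 from choice[OF this] obtain C where C: "!!p. p : frontier U ==> C p >= 0"
  and fin: "!!p. p : frontier U ==> emeasure Ga (frontier U \<inter> ball p (r p)) < \<infinity>"
  and loc: "!!p f. p : frontier U ==> Ck_R3 1 f ==>
    (\<integral>\<^sup>+x. ennreal ((f x)^2) * indicator (frontier U \<inter> ball p (r p)) x \<partial>Ga) <= ennreal (C p * (H1_norm U f)^2)"
  by blast
 have comp: "compact (frontier U)" using bounded_U by (simp add: compact_frontier_bounded)
 have cov0: "frontier U <= (\<Union>p\<in>frontier U. ball p (r p))" using r by force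
 obtain D where D: "D <= frontier U" "finite D" "frontier U <= (\<Union>p\<in>D. ball p (r p))"
  by (rule compactE_image[OF comp _ cov0]) auto
 have Bs: "frontier U \<inter> ball p (r p) : sets Ga" for p by (auto simp: sets_surface_measure frontier_closed)
 have UU: "(\<Union>p\<in>D. frontier U \<inter> ball p (r p)) : sets Ga" by (rule sets.finite_UN[OF D(2) Bs])
 have "space Ga <= (\<Union>p\<in>D. frontier U \<inter> ball p (r p))" using D(3) unfolding space_surface_measure by blast
 hence "emeasure Ga (space Ga) <= emeasure Ga (\<Union>p\<in>D. frontier U \<inter> ball p (r p))"
  by (rule emeasure_mono[OF _ UU])
 also have "... <= (\<Sum>p\<in>D. emeasure Ga (frontier U \<inter> ball p (r p)))"
  by (rule emeasure_subadditive_finite) (use D Bs in auto)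
 also have "... < \<infinity>" using fin D(1) unfolding infinity_ennreal_def ennreal_sum_less_top[OF D(2)] by blast
 finally have f1: "emeasure Ga (space Ga) ~= \<infinity>" by simp
 have "(\<integral>\<^sup>+x. ennreal ((f x)^2) \<partial>Ga) <= ennreal ((\<Sum>p\<in>D. C p) * (H1_norm U f)^2)" if f: "Ck_R3 1 f" for f
 proof -
  have [measurable]: "f : bmeas Ga" by (intro borel_measurable_surface borel_contI C1_D[OF f])
  have "(\<integral>\<^sup>+x. ennreal ((f x)^2) \<partial>Ga) <= (\<integral>\<^sup>+x. (\<Sum>p\<in>D. ennreal ((f x)^2) * indicator (frontier U \<inter> ball p (r p)) x) \<partial>Ga)"
  proof (rule nn_integral_mono)
   fix x assume x: "x : space Ga"
   then obtain p where p: "p : D" "x : frontier U \<inter> ball p (r p)" using D(3) by auto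
   have "ennreal ((f x)^2) = ennreal ((f x)^2) * indicator (frontier U \<inter> ball p (r p)) x" using p by simp
   also have "... <= (\<Sum>p\<in>D. ennreal ((f x)^2) * indicator (frontier U \<inter> ball p (r p)) x)"
    by (rule member_le_sum) (use p D in auto)
   finally show "ennreal ((f x)^2) <= (\<Sum>p\<in>D. ennreal ((f x)^2) * indicator (frontier U \<inter> ball p (r p)) x)" .
  qed
  also have "... = (\<Sum>p\<in>D. \<integral>\<^sup>+x. ennreal ((f x)^2) * indicator (frontier U \<inter> ball p (r p)) x \<partial>Ga)"
   by (rule nn_integral_sum) (use Bs in measurable)
  also have "... <= (\<Sum>p\<in>D. ennreal (C p * (H1_norm U f)^2))" using D by (intro sum_mono loc f) auto
  also have "... = ennreal ((\<Sum>p\<in>D. C p) * (H1_norm U f)^2)"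
   using C D by (subst sum_ennreal) (auto simp: sum_distrib_right)
  finally show ?thesis .
 qed
 moreover have "(\<Sum>p\<in>D. C p) >= 0" using C D by (intro sum_nonneg) auto
 ultimately show ?thesis using f1 by blast
qed

sublocale Ga: finite_measure Ga using trace_inequality_ex by (intro finite_measureI) blast

lemma trace_inequality:
 "EX C>=0. ALL f. Ck_R3 1 f --> f : Lp Ga 2 & Lp_norm Ga 2 f <= C * H1_norm U f"
proof -
 obtain C where C: "C >= 0" "!!f. Ck_R3 1 f ==> (\<integral>\<^sup>+x. ennreal ((f x)^2) \<partial>Ga) <= ennreal (C * (H1_norm U f)^2)"
  using trace_inequality_ex by blast
 have "f : Lp Ga 2 & Lp_norm Ga 2 f <= sqrt C * H1_norm U f" if f: "Ck_R3 1 f" for f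
 proof -
  have fm[measurable]: "f : bmeas Ga" by (intro borel_measurable_surface borel_contI C1_D[OF f])
  have i: "integrable Ga (%x. (f x)^2)"
  proof (rule integrableI_bounded)
   have "(\<integral>\<^sup>+x. ennreal (norm ((f x)^2)) \<partial>Ga) <= ennreal (C * (H1_norm U f)^2)" using C(2)[OF f] by simp
   also have "... < \<infinity>" by simp
   finally show "(\<integral>\<^sup>+x. ennreal (norm ((f x)^2)) \<partial>Ga) < \<infinity>" .
  qed simp
  have "ennreal ((Lp_norm Ga 2 f)^2) <= ennreal (C * (H1_norm U f)^2)"
   using C(2)[OF f] i by (simp add: L2_norm_sq nn_integral_eq_integral)
  hence "(Lp_norm Ga 2 f)^2 <= C * (H1_norm U f)^2" using C(1) by (simp add: ennreal_le_iff)
  also have "... = (sqrt C * H1_norm U f)^2" using C(1) by (simp add: power_mult_distrib)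
  finally have sq: "(Lp_norm Ga 2 f)^2 <= (sqrt C * H1_norm U f)^2" .
  have "Lp_norm Ga 2 f <= sqrt C * H1_norm U f"
   by (rule power2_le_imp_le[OF sq]) (use C(1) H.nonneg[OF C1_H1(1)[OF f]] in simp)
  thus ?thesis using i fm by (simp add: L2_integrable_sq)
 qed
 thus ?thesis using C(1) by (intro exI[of _ "sqrt C"]) auto
qed

sublocale G: seminormed "Lp Ga 2 :: (R3 => real) set" "Lp_norm Ga 2" by (rule seminormed_Lp) simp

lemma is_trace_add:
 assumes "is_trace U f h" "is_trace U g k" "f : H1 U" "g : H1 U"
 shows "is_trace U (f + g) (h + k)"
proof -
 have C1L: "a : Lp Ga 2" if "Ck_R3 1 a" for a using trace_inequality that by blast
 obtain a where a: "!!n. Ck_R3 1 (a n)" "(%n. H1_norm U (a n - f)) ----> 0" "(%n. Lp_norm Ga 2 (a n - h)) ----> 0" "h : Lp Ga 2"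
  using assms(1) unfolding is_trace_def by blast
 obtain b where b: "!!n. Ck_R3 1 (b n)" "(%n. H1_norm U (b n - g)) ----> 0" "(%n. Lp_norm Ga 2 (b n - k)) ----> 0" "k : Lp Ga 2"
  using assms(2) unfolding is_trace_def by blast
 have c1: "Ck_R3 1 (a n + b n)" for n using Ck_R3_add[OF a(1) b(1)] by (simp only: plus_fun_def)
 have eq: "a n + b n - (f + g) = (a n - f) + (b n - g)" "a n + b n - (h + k) = (a n - h) + (b n - k)" for n by simp_all
 have mem: "a n - f : H1 U" "b n - g : H1 U" "a n - h : Lp Ga 2" "b n - k : Lp Ga 2" for n
  by (rule H.diff_mem[OF C1_H1(1)[OF a(1)] assms(3)] H.diff_mem[OF C1_H1(1)[OF b(1)] assms(4)]
    G.diff_mem[OF C1L[OF a(1)] a(4)] G.diff_mem[OF C1L[OF b(1)] b(4)])+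
 have 1: "(%n. H1_norm U (a n + b n - (f + g))) ----> 0"
 proof (rule tendsto_sandwich[OF _ _ tendsto_const])
  show "(%n. H1_norm U (a n - f) + H1_norm U (b n - g)) ----> 0" using tendsto_add[OF a(2) b(2)] by simp
  show "\<forall>\<^sub>F n in sequentially. H1_norm U (a n + b n - (f + g)) <= H1_norm U (a n - f) + H1_norm U (b n - g)"
   unfolding eq by (intro always_eventually allI H.triangle mem)
  show "\<forall>\<^sub>F n in sequentially. 0 <= H1_norm U (a n + b n - (f + g))"
   unfolding eq by (intro always_eventually allI H.nonneg H.add_mem mem)
 qed
 have 2: "(%n. Lp_norm Ga 2 (a n + b n - (h + k))) ----> 0"
 proof (rule tendsto_sandwich[OF _ _ tendsto_const])
  show "(%n. Lp_norm Ga 2 (a n - h) + Lp_norm Ga 2 (b n - k)) ----> 0" using tendsto_add[OF a(3) b(3)] by simp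
  show "\<forall>\<^sub>F n in sequentially. Lp_norm Ga 2 (a n + b n - (h + k)) <= Lp_norm Ga 2 (a n - h) + Lp_norm Ga 2 (b n - k)"
   unfolding eq by (intro always_eventually allI G.triangle mem)
  show "\<forall>\<^sub>F n in sequentially. 0 <= Lp_norm Ga 2 (a n + b n - (h + k))"
   by (intro always_eventually allI Lp_norm_nonneg)
 qed
 show ?thesis unfolding is_trace_def using c1 1 2 G.add_mem[OF a(4) b(4)] by (intro conjI exI[of _ "%n. a n + b n"]) auto
qed

lemma is_trace_scale:
 assumes "is_trace U f h" "f : H1 U"
 shows "is_trace U (c *R f) (c *R h)"
proof -
 have C1L: "a : Lp Ga 2" if "Ck_R3 1 a" for a using trace_inequality that by blast
 obtain a where a: "!!n. Ck_R3 1 (a n)" "(%n. H1_norm U (a n - f)) ----> 0" "(%n. Lp_norm Ga 2 (a n - h)) ----> 0" "h : Lp Ga 2"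
  using assms(1) unfolding is_trace_def by blast
 have mem: "a n - f : H1 U" "a n - h : Lp Ga 2" for n
  by (rule H.diff_mem[OF C1_H1(1)[OF a(1)] assms(2)] G.diff_mem[OF C1L[OF a(1)] a(4)])+
 have c1: "Ck_R3 1 (c *R a n)" for n using Ck_R3_cmult[OF a(1), of c] by (simp add: scaleR_fun_def)
 have "(%n. H1_norm U (c *R a n - c *R f)) ----> 0"
  using tendsto_mult_left[OF a(2), of "\<bar>c\<bar>"] by (simp add: H.scale[OF mem(1)] flip: scaleR_diff_right)
 moreover have "(%n. Lp_norm Ga 2 (c *R a n - c *R h)) ----> 0"
  using tendsto_mult_left[OF a(3), of "\<bar>c\<bar>"] by (simp add: G.scale[OF mem(2)] flip: scaleR_diff_right)
 ultimately show ?thesis unfolding is_trace_def using c1 G.scale_mem[OF a(4)] by (intro conjI exI[of _ "%n. c *R a n"]) auto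
qed

lemma is_trace_bound:
 "EX C>=0. ALL f h. f : H1 U --> is_trace U f h --> Lp_norm Ga 2 h <= C * H1_norm U f"
proof -
 obtain C where C: "C >= 0" "!!f. Ck_R3 1 f ==> f : Lp Ga 2 & Lp_norm Ga 2 f <= C * H1_norm U f"
  using trace_inequality by blast
 have "Lp_norm Ga 2 h <= C * H1_norm U f" if f: "f : H1 U" and t: "is_trace U f h" for f h
 proof -
  obtain a where a: "!!n. Ck_R3 1 (a n)" "(%n. H1_norm U (a n - f)) ----> 0" "(%n. Lp_norm Ga 2 (a n - h)) ----> 0" "h : Lp Ga 2"
   using t unfolding is_trace_def by blast
  have le: "Lp_norm Ga 2 h <= C * (H1_norm U f + H1_norm U (a n - f)) + Lp_norm Ga 2 (a n - h)" for n
  proof -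
   have aL: "a n : Lp Ga 2" "Lp_norm Ga 2 (a n) <= C * H1_norm U (a n)" using C(2)[OF a(1)] by auto
   have aH: "a n : H1 U" by (rule C1_H1[OF a(1)])
   have "Lp_norm Ga 2 h <= Lp_norm Ga 2 (a n) + Lp_norm Ga 2 (a n - h)"
    using G.triangle_sub[OF a(4) aL(1)] G.n_commute[OF a(4) aL(1)] by simp
   moreover have "H1_norm U (a n) <= H1_norm U f + H1_norm U (a n - f)" by (rule H.triangle_sub[OF aH f])
   ultimately show ?thesis using aL(2) C(1) mult_left_mono[of "H1_norm U (a n)" _ C] by (meson add_right_mono order_trans)
  qed
  have lim: "(%n. C * (H1_norm U f + H1_norm U (a n - f)) + Lp_norm Ga 2 (a n - h)) ----> C * (H1_norm U f + 0) + 0"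
   by (intro tendsto_intros a)
  have "Lp_norm Ga 2 h <= C * (H1_norm U f + 0) + 0" by (rule LIMSEQ_le_const[OF lim]) (use le in auto)
  thus ?thesis by simp
 qed
 thus ?thesis using C(1) by blast
qed

text \<open>By the trace inequality the restrictions of an approximating sequence form a Cauchy sequence on
  the boundary.\<close>

lemma is_trace_btrace:
 assumes f: "f : H1 U" shows "is_trace U f (btrace U f)"
proof -
 obtain C where C: "C >= 0" "!!f. Ck_R3 1 f ==> f : Lp Ga 2 & Lp_norm Ga 2 f <= C * H1_norm U f"
  using trace_inequality by blast
 obtain K where K: "K > 0" "ALL f:H1 U. ALL m>=0. (AE x in \<L>. ereal \<bar>f x\<bar> <= m) --> approximable (ereal K * m) f"
  using H1_approximable_bound by (elim exE conjE) (rule that)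
 have "approximable (ereal K * \<infinity>) f" by (rule K(2)[rule_format, OF f]) auto
 hence "EX ps. Ck_R3 1 ps & H1_norm U (ps - f) < 1 / real (Suc n)" for n
  unfolding approximable_def by (meson of_nat_0_less_iff zero_less_Suc zero_less_divide_1_iff)
 hence "ALL n. EX ps. Ck_R3 1 ps & H1_norm U (ps - f) < 1 / real (Suc n)" by blast
 from choice[OF this] obtain a where a: "!!n. Ck_R3 1 (a n)" "!!n. H1_norm U (a n - f) < 1 / real (Suc n)" by blast
 have aH: "a n : H1 U" for n by (rule C1_H1[OF a(1)])
 have lim: "(%n. H1_norm U (a n - f)) ----> 0"
 proof (rule tendsto_sandwich[OF _ _ tendsto_const LIMSEQ_inverse_real_of_nat])
  show "\<forall>\<^sub>F n in sequentially. 0 <= H1_norm U (a n - f)" by (intro always_eventually allI H.nonneg H.diff_mem aH f)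
  show "\<forall>\<^sub>F n in sequentially. H1_norm U (a n - f) <= inverse (real (Suc n))"
   using a(2) by (intro always_eventually allI) (simp only: inverse_eq_divide less_imp_le)
 qed
 have cauchy: "EX N. ALL m>=N. ALL n>=N. Lp_norm Ga 2 (a m - a n) < e" if e: "e > 0" for e
 proof -
  have "e / (2 * (C + 1)) > 0" using e C(1) by simp
  from order_tendstoD(2)[OF lim this] obtain N where N: "!!n. n >= N ==> H1_norm U (a n - f) < e / (2 * (C + 1))"
   by (auto simp: eventually_sequentially)
  have "Lp_norm Ga 2 (a m - a n) < e" if mn: "m >= N" "n >= N" for m n
  proof -
   have "Ck_R3 1 (%x. a m x + (-1) * a n x)" by (intro Ck_R3_add Ck_R3_cmult a)
   moreover have "(%x. a m x + (-1) * a n x) = a m - a n" by (simp add: fun_diff_def)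
   ultimately have c1: "Ck_R3 1 (a m - a n)" by simp
   have "a m - a n = (a m - f) - (a n - f)" by simp
   hence "H1_norm U (a m - a n) <= H1_norm U (a m - f) + H1_norm U (a n - f)"
    using H.triangle_diff[OF H.diff_mem[OF aH f] H.diff_mem[OF aH f], of m n] by metis
   also have "... <= e / (2 * (C + 1)) + e / (2 * (C + 1))" using N mn by (intro add_mono less_imp_le) auto
   also have "... = e / (C + 1)" using field_sum_of_halves[of "e / (C + 1)"] by (simp add: mult.commute)
   finally have tri: "H1_norm U (a m - a n) <= e / (C + 1)" .
   have "Lp_norm Ga 2 (a m - a n) <= C * H1_norm U (a m - a n)" using C(2)[OF c1] by simp
   also have "... <= C * (e / (C + 1))" by (rule mult_left_mono[OF tri C(1)])
   also have "C * (e / (C + 1)) < e" using C(1) e by (simp add: field_simps)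
   finally show ?thesis .
  qed
  thus ?thesis by blast
 qed
 have aL: "a n : Lp Ga 2" for n using C(2)[OF a(1)] by blast
 obtain h where "h : Lp Ga 2" "(%n. Lp_norm Ga 2 (a n - h)) ----> 0" using L2_complete[OF aL cauchy] by blast
 hence "is_trace U f h" unfolding is_trace_def using a(1) lim by blast
 thus ?thesis unfolding btrace_def by (rule someI[where P="is_trace U f"])
qed

lemma trace_unique:
 assumes "f : H1 U" "is_trace U f h" "is_trace U f k" shows "Lp_norm Ga 2 (h - k) = 0"
proof -
 obtain C where C: "C >= 0" "!!f h. f : H1 U ==> is_trace U f h ==> Lp_norm Ga 2 h <= C * H1_norm U f"
  using is_trace_bound by blast
 have "is_trace U (f + (-1) *R f) (h + (-1) *R k)"
  by (rule is_trace_add[OF assms(2) is_trace_scale[OF assms(3,1)] assms(1) H.scale_mem[OF assms(1)]])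
 hence "is_trace U 0 (h - k)" by simp
 from C(2)[OF H.zero_mem this] show ?thesis by (simp add: order_antisym Lp_norm_nonneg)
qed

lemma btrace_L2: "f : H1 U ==> btrace U f : Lp Ga 2" using is_trace_btrace by (auto simp: is_trace_def)

lemma btrace_add: "f : H1 U ==> g : H1 U ==> Lp_norm Ga 2 (btrace U (f + g) - btrace U f - btrace U g) = 0"
proof -
 assume fg: "f : H1 U" "g : H1 U"
 have "Lp_norm Ga 2 (btrace U (f + g) - (btrace U f + btrace U g)) = 0"
  by (rule trace_unique[OF H.add_mem[OF fg]]) (intro is_trace_btrace is_trace_add H.add_mem fg)+
 thus ?thesis by (simp only: diff_diff_eq)
qed

lemma btrace_scale: "f : H1 U ==> Lp_norm Ga 2 (btrace U (c *R f) - c *R btrace U f) = 0"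
proof -
 assume f: "f : H1 U"
 show ?thesis by (rule trace_unique[OF H.scale_mem[OF f, of c]]) (intro is_trace_btrace is_trace_scale H.scale_mem f)+
qed

lemma bl_btrace_L2: "bounded_linear_btw (H1 U) (H1_norm U) (Lp Ga 2) (Lp_norm Ga 2) (btrace U)"
proof -
 obtain C where "!!f h. f : H1 U ==> is_trace U f h ==> Lp_norm Ga 2 h <= C * H1_norm U f" using is_trace_bound by blast
 thus ?thesis unfolding bounded_linear_btw_def
  using btrace_L2 btrace_add btrace_scale is_trace_btrace by (intro conjI exI[of _ C]) auto
qed

text \<open>The approximating \<open>C\<^sup>1\<close> functions may be chosen bounded by a multiple of the supremum of the
  function, and that bound passes to their limit on the boundary.\<close>

lemma btrace_Linf_bound:
 "EX C>=0. ALL f. f : H1 U --> f : Linf \<L> -->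
   btrace U f : Linf Ga & Linf_norm Ga (btrace U f) <= C * Linf_norm \<L> f"
proof -
 obtain C where C: "C >= 0" "!!f. Ck_R3 1 f ==> f : Lp Ga 2 & Lp_norm Ga 2 f <= C * H1_norm U f"
  using trace_inequality by blast
 obtain K where K: "K > 0" "ALL f:H1 U. ALL m>=0. (AE x in \<L>. ereal \<bar>f x\<bar> <= m) --> approximable (ereal K * m) f"
  using H1_approximable_bound by (elim exE conjE) (rule that)
 have "btrace U f : Linf Ga & Linf_norm Ga (btrace U f) <= K * Linf_norm \<L> f"
  if f: "f : H1 U" "f : Linf \<L>" for f
 proof -
  define B where "B = K * Linf_norm \<L> f"
  have B: "B >= 0" unfolding B_def using K(1) Linf_norm_nonneg[OF f(2)] by simp
  have "approximable (ereal K * ereal (Linf_norm \<L> f)) f"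
   using Linf_bound[OF f(2)] by (intro K(2)[rule_format, OF f(1)]) (auto simp: Linf_norm_nonneg[OF f(2)])
  hence ap: "approximable (ereal B) f" by (simp add: B_def)
  define h where "h = btrace U f"
  have h: "h : Lp Ga 2" unfolding h_def by (rule btrace_L2[OF f(1)])
  have hm[measurable]: "h : bmeas Ga" by (rule LpD(1)[OF h])
  obtain a where a: "!!n. Ck_R3 1 (a n)" "(%n. H1_norm U (a n - f)) ----> 0" "(%n. Lp_norm Ga 2 (a n - h)) ----> 0"
   using is_trace_btrace[OF f(1)] unfolding is_trace_def h_def by blast
  define g where "g = (%x. max 0 (\<bar>h x\<bar> - B))"
  have gm: "g : bmeas Ga" unfolding g_def by measurable
  have gL: "g : Lp Ga 2" by (rule Lp_dominated(1)[OF h gm]) (use B in \<open>auto simp: g_def\<close>)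
  have small: "Lp_norm Ga 2 g <= e" if e: "e > 0" for e
  proof -
   define e' where "e' = e / (3 * (C + 1))"
   have e': "e' > 0" using e C(1) by (simp add: e'_def)
   have "e / 3 > 0" using e by simp
   from eventually_conj[OF order_tendstoD(2)[OF a(2) e'] order_tendstoD(2)[OF a(3) this]]
   obtain n where n: "H1_norm U (a n - f) < e'" "Lp_norm Ga 2 (a n - h) < e / 3"
    unfolding eventually_sequentially by blast
   obtain q where q: "Ck_R3 1 q" "H1_norm U (q - f) < e'" "!!x. \<bar>q x\<bar> <= B"
    using ap e' unfolding approximable_def by (metis ereal_less_eq(3))
   have qL: "q : Lp Ga 2" "a n : Lp Ga 2" using C(2) q(1) a(1) by blast+
   have qH: "q : H1 U" "a n : H1 U" using C1_H1 q(1) a(1) by blast+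
   have "Ck_R3 1 (%x. q x + (-1) * a n x)" by (intro Ck_R3_add Ck_R3_cmult a q)
   moreover have "(%x. q x + (-1) * a n x) = q - a n" by (simp add: fun_diff_def)
   ultimately have c1: "Ck_R3 1 (q - a n)" by simp
   have "q - a n = (q - f) - (a n - f)" by simp
   hence "H1_norm U (q - a n) <= H1_norm U (q - f) + H1_norm U (a n - f)"
    using H.triangle_diff[OF H.diff_mem[OF qH(1) f(1)] H.diff_mem[OF qH(2) f(1)]] by metis
   also have "... <= e' + e'" using n q by simp
   finally have tri: "H1_norm U (q - a n) <= e' + e'" .
   have "Lp_norm Ga 2 (q - a n) <= C * H1_norm U (q - a n)" using C(2)[OF c1] by simp
   also have "... <= C * (e' + e')" by (rule mult_left_mono[OF tri C(1)])
   also have "... <= (C + 1) * (e' + e')" using e' by (intro mult_right_mono) auto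
   also have "... = (C + 1) * e' + (C + 1) * e'" by (rule distrib_left)
   also have "(C + 1) * e' = e / 3" unfolding e'_def using C(1) by (simp add: divide_simps)
   also have "e / 3 + e / 3 = 2 * e / 3" by simp
   finally have qa: "Lp_norm Ga 2 (q - a n) <= 2 * e / 3" .
   have "Lp_norm Ga 2 g <= Lp_norm Ga 2 (q - h)"
   proof (rule Lp_dominated(2)[OF G.diff_mem[OF qL(1) h] gm])
    show "AE x in Ga. norm (g x) <= norm ((q - h) x)"
    proof (intro always_eventually allI)
     fix x
     have "\<bar>h x\<bar> - B <= \<bar>h x\<bar> - \<bar>q x\<bar>" using q(3)[of x] by simp
     thus "norm (g x) <= norm ((q - h) x)" by (simp add: g_def)
    qed
   qed simp
   also have "q - h = (q - a n) + (a n - h)" by simp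
   also have "Lp_norm Ga 2 ((q - a n) + (a n - h)) <= Lp_norm Ga 2 (q - a n) + Lp_norm Ga 2 (a n - h)"
    by (intro G.triangle G.diff_mem qL h)
   finally show ?thesis using qa n(2) by linarith
  qed
  have "Lp_norm Ga 2 g <= 0" by (rule field_le_epsilon) (simp add: small)
  hence "Lp_norm Ga 2 g = 0" by (simp add: order_antisym Lp_norm_nonneg)
  hence "AE x in Ga. g x = 0" using Lp_norm_eq_0[OF gL] by simp
  hence "AE x in Ga. \<bar>h x\<bar> <= B" by eventually_elim (auto simp: g_def max_def split: if_splits)
  from LinfI[OF hm this B] show ?thesis by (simp add: h_def B_def)
 qed
 thus ?thesis using K(1) by (intro exI[of _ K]) auto
qed

lemma Linf_norm_null:
 assumes "h : Lp M 2" "Lp_norm M 2 h = 0" "h : Linf M" shows "Linf_norm M h = 0"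
proof -
 have "AE x in M. \<bar>h x\<bar> <= 0" using Lp_norm_eq_0[OF assms(1)] assms(2) by simp
 from LinfI(2)[OF LpD(1)[OF assms(1)] this] show ?thesis using Linf_norm_nonneg[OF assms(3)] by simp
qed

lemma bl_btrace_Linf:
 "bounded_linear_btw (H1 U \<inter> Linf \<L>) (%f. H1_norm U f + Linf_norm \<L> f)
   (Linf Ga) (Linf_norm Ga) (btrace U)"
proof -
 let ?X = "H1 U \<inter> Linf \<L>"
 interpret J: seminormed "Linf Ga" "Linf_norm Ga" by (rule seminormed_Linf)
 obtain C where C: "C >= 0" "!!f. f : ?X ==> btrace U f : Linf Ga"
   "!!f. f : ?X ==> Linf_norm Ga (btrace U f) <= C * Linf_norm \<L> f" using btrace_Linf_bound by blast
 have add: "f + g : ?X" if "f : ?X" "g : ?X" for f g using that H.add_mem I.add_mem by blast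
 have scl: "c *R f : ?X" if "f : ?X" for c f using that H.scale_mem I.scale_mem by blast
 have "Linf_norm Ga (btrace U (f + g) - btrace U f - btrace U g) = 0" if fg: "f : ?X" "g : ?X" for f g
  by (rule Linf_norm_null) (use fg in \<open>auto intro!: G.diff_mem J.diff_mem btrace_L2 btrace_add C(2) add H.add_mem I.add_mem\<close>)
 moreover have "Linf_norm Ga (btrace U (c *R f) - c *R btrace U f) = 0" if f: "f : ?X" for c f
  by (rule Linf_norm_null) (use f in \<open>auto intro!: G.diff_mem J.diff_mem btrace_L2 btrace_scale C(2) H.scale_mem I.scale_mem G.scale_mem J.scale_mem\<close>)
 moreover have "Linf_norm Ga (btrace U f) <= C * (H1_norm U f + Linf_norm \<L> f)" if f: "f : ?X" for f
 proof -
  have "C * Linf_norm \<L> f <= C * (H1_norm U f + Linf_norm \<L> f)"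
   using C(1) H.nonneg[of f] f by (intro mult_left_mono) auto
  thus ?thesis using C(3)[OF f] by linarith
 qed
 ultimately show ?thesis unfolding bounded_linear_btw_def using C(2) by (intro conjI exI[of _ C]) auto
qed

end

section \<open>The Sobolev embedding of \<open>H\<^sup>1\<^sub>0\<close> into \<open>L\<^sup>6\<close>\<close>

text \<open>Stated for any order of the coordinates, so that the line integrals in the three directions need
  no change of the order of integration.\<close>

lemma nn_integral_R3_iterated:
 fixes i j k :: 3 and f :: "R3 => ennreal"
 assumes ijk: "i ~= j" "i ~= k" "j ~= k" and f: "f : bmeas borel"
 shows "(NN p. f p) =
  (NN x. (NN y. (NN z. f (\<chi> m. if m = i then x else if m = j then y else z))))"
proof -
 define T :: "real \<times> real \<times> real => R3" where
  "T = (%p. \<chi> m. if m = i then fst p else if m = j then fst (snd p) else snd (snd p))"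
 have UU: "UNIV = {i, j, k}" by (rule card_subset_eq[symmetric]) (use ijk in auto)
 have "continuous_on UNIV (%p::real \<times> real \<times> real. if m = i then fst p else if m = j then fst (snd p) else snd (snd p))" for m
  by (cases "m = i"; cases "m = j") (auto intro!: continuous_on_fst continuous_on_snd continuous_on_id)
 hence "continuous_on UNIV T" unfolding T_def by (intro continuous_on_vec_lambda)
 hence Tb[measurable]: "T : bmeas borel" by (rule borel_contI)
 have mea: "T : bmeas (lborel OM (lborel OM lborel))" using Tb by (simp add: lborel_prod)
 have lb: "lborel = distr (lborel OM (lborel OM lborel)) borel T"
 proof (rule lborel_eqI)
  fix l u :: R3 assume le: "!!b. b : Basis ==> l \<bullet> b <= u \<bullet> b"
  have lu: "l $ m <= u $ m" for m using le[of "axis m 1"] by (simp add: inner_axis)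
  have pre: "T -` box l u \<inter> space (lborel OM (lborel OM lborel)) = {l $ i<..<u $ i} \<times> ({l $ j<..<u $ j} \<times> {l $ k<..<u $ k})"
  proof -
   have all: "(ALL m. Q m) \<longleftrightarrow> Q i & Q j & Q k" for Q :: "3 => bool" using UU by (metis UNIV_I empty_iff insertE)
   show ?thesis using ijk by (auto simp: T_def mem_box_cart all space_pair_measure)
  qed
  have "emeasure (distr (lborel OM (lborel OM lborel)) borel T) (box l u)
    = emeasure (lborel OM (lborel OM lborel)) ({l $ i<..<u $ i} \<times> ({l $ j<..<u $ j} \<times> {l $ k<..<u $ k}))"
   unfolding pre[symmetric] by (rule emeasure_distr[OF mea]) simp
  also have "... = emeasure lborel {l $ i<..<u $ i} * emeasure (lborel OM lborel) ({l $ j<..<u $ j} \<times> {l $ k<..<u $ k})"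
   unfolding lborel_prod by (subst lborel_prod[symmetric], rule lborel.emeasure_pair_measure_Times) (simp_all add: borel_prod[symmetric])
  also have "emeasure (lborel OM lborel) ({l $ j<..<u $ j} \<times> {l $ k<..<u $ k}) = emeasure lborel {l $ j<..<u $ j} * emeasure lborel {l $ k<..<u $ k}"
   by (rule lborel.emeasure_pair_measure_Times) auto
  also have "emeasure lborel {l $ i<..<u $ i} * (emeasure lborel {l $ j<..<u $ j} * emeasure lborel {l $ k<..<u $ k})
    = ennreal ((u $ i - l $ i) * ((u $ j - l $ j) * (u $ k - l $ k)))" using lu by (simp add: ennreal_mult)
  also have "(u $ i - l $ i) * ((u $ j - l $ j) * (u $ k - l $ k)) = (\<Prod>m\<in>UNIV. u $ m - l $ m)"
   unfolding UU using ijk by simp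
  also have "... = (\<Prod>b\<in>Basis. (u - l) \<bullet> b)" unfolding Basis_vec_def
   by (simp add: UNION_singleton_eq_range)
     (subst prod.reindex, auto simp: inj_on_def axis_eq_axis inner_axis inner_diff_left)
  finally show "emeasure (distr (lborel OM (lborel OM lborel)) borel T) (box l u) = ennreal (\<Prod>b\<in>Basis. (u - l) \<bullet> b)" .
 qed simp
 have fT: "(%p. f (T p)) : bmeas (lborel OM (lborel OM lborel))" by (rule measurable_compose[OF mea f])
 have "(NN p. f p) = (\<integral>\<^sup>+p. f (T p) \<partial>(lborel OM (lborel OM lborel)))"
  by (subst lb, rule nn_integral_distr[OF mea]) (simp add: f)
 also have "... = (\<integral>\<^sup>+x. \<integral>\<^sup>+q. f (T (x, q)) \<partial>(lborel OM lborel) \<partial>lborel)"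
  using fT unfolding lborel_prod by (subst (asm) lborel_prod[symmetric], subst lborel_prod[symmetric], subst lborel.nn_integral_fst[symmetric]) auto
 also have "... = (NN x. (NN y. (NN z. f (T (x, (y, z))))))"
 proof (rule nn_integral_cong)
  fix x :: real
  have "(%q. f (T (x, q))) : bmeas (lborel OM lborel)" by (rule measurable_compose[OF _ fT]) simp
  thus "(\<integral>\<^sup>+q. f (T (x, q)) \<partial>(lborel OM lborel)) = (NN y. (NN z. f (T (x, (y, z)))))"
   by (subst lborel.nn_integral_fst[symmetric]) auto
 qed
 finally show ?thesis unfolding T_def fst_conv snd_conv .
qed

text \<open>Two applications of the Cauchy-Schwarz inequality, first in the variable shared by \<open>F\<close> and
  \<open>G\<close> and then in the other two.\<close>

lemma Loomis_Whitney:
 fixes F G H :: "real \<times> real => ennreal"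
 assumes [measurable]: "F : bmeas (borel OM borel)" "G : bmeas (borel OM borel)"
  "H : bmeas (borel OM borel)"
 shows "(NN x. (NN y. (NN z. F (y, z) * G (x, z) * H (x, y))))^2
  <= (NN y. (NN z. (F (y, z))^2)) * (NN x. (NN z. (G (x, z))^2)) * (NN x. (NN y. (H (x, y))^2))"
proof -
 define a where "a = (%y. (NN z. (F (y, z))^2))"
 define b where "b = (%x. (NN z. (G (x, z))^2))"
 define I where "I = (%p. (NN z. F (snd p, z) * G (fst p, z)))"
 have [measurable]: "a : bmeas borel" unfolding a_def by measurable
 have [measurable]: "b : bmeas borel" unfolding b_def by measurable
 have Im[measurable]: "I : bmeas (borel OM borel)" unfolding I_def by measurable
 have Isq: "(I (x, y))^2 <= b x * a y" for x y
  unfolding I_def a_def b_def fst_conv snd_conv by (subst mult.commute, rule Cauchy_Schwarz_nn_integral) measurable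
 have "(NN x. (NN y. (NN z. F (y, z) * G (x, z) * H (x, y)))) = (NN x. (NN y. I (x, y) * H (x, y)))"
  unfolding I_def by (simp add: nn_integral_multc)
 also have "... = (\<integral>\<^sup>+p. I p * H p \<partial>(lborel OM lborel))"
  by (rule lborel.nn_integral_fst) measurable
 finally have "(NN x. (NN y. (NN z. F (y, z) * G (x, z) * H (x, y))))^2 = (\<integral>\<^sup>+p. I p * H p \<partial>(lborel OM lborel))^2" by simp
 also have "... <= (\<integral>\<^sup>+p. (I p)^2 \<partial>(lborel OM lborel)) * (\<integral>\<^sup>+p. (H p)^2 \<partial>(lborel OM lborel))"
  by (rule Cauchy_Schwarz_nn_integral) measurable
 also have "(\<integral>\<^sup>+p. (H p)^2 \<partial>(lborel OM lborel)) = (NN x. (NN y. (H (x, y))^2))"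
  by (rule lborel.nn_integral_fst[symmetric]) measurable
 also have "(\<integral>\<^sup>+p. (I p)^2 \<partial>(lborel OM lborel)) = (NN x. (NN y. (I (x, y))^2))"
  by (rule lborel.nn_integral_fst[symmetric]) measurable
 also have "... <= (NN x. (NN y. b x * a y))" by (intro nn_integral_mono Isq)
 also have "... = (NN y. a y) * (NN x. b x)" by (simp add: nn_integral_cmult nn_integral_multc mult.commute)
 finally show ?thesis by (simp add: a_def b_def mult_right_mono)
qed

lemma le_line_integral_partial:
 assumes v: "Ck_R3 1 v" and supp: "!!x. R <= norm x ==> v x = 0"
 shows "ennreal \<bar>v x\<bar> <= (NN t. ennreal \<bar>partial i v (\<chi> m. if m = i then t else x $ m)\<bar>)"
proof -
 define b where "b = x - (x $ i) *R axis i 1"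
 have upd: "b + t *R axis i 1 = (\<chi> m. if m = i then t else x $ m)" for t by (simp add: b_def vec_eq_iff axis_def)
 have xb: "b + (x $ i) *R axis i 1 = x" by (simp add: b_def)
 define f where "f = (%t. partial i v (b + t *R axis i 1))"
 have der: "((%t. v (b + t *R axis i 1)) has_real_derivative f t) (at t)" for t
  using partial_along_line[OF v, of b "axis i 1" t] by (simp add: f_def inner_axis)
 have cf: "continuous_on UNIV f" unfolding f_def
  by (intro continuous_on_compose2[OF C1_D(3)[OF v]] continuous_intros) auto
 (* a parameter below x $ i at which the line is outside the support *)
 define s where "s = - \<bar>R\<bar> - \<bar>x $ i\<bar>"
 have "\<bar>(b + s *R axis i 1) $ i\<bar> <= norm (b + s *R axis i 1)" by (rule component_le_norm_cart)
 moreover have "(b + s *R axis i 1) $ i = s" by (simp add: b_def)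
 ultimately have "v (b + s *R axis i 1) = 0" by (intro supp) (simp add: s_def)
 moreover have sx: "s <= x $ i" by (simp add: s_def)
 ultimately have "has_bochner_integral lborel (%t. f t * indicator {s..x $ i} t) (v x)"
  using has_bochner_integral_FTC_Icc_real[OF sx, of "%t. v (b + t *R axis i 1)" f] der cf xb
  by (simp add: continuous_on_eq_continuous_at)
 hence h: "integrable lborel (%t. f t * indicator {s..x $ i} t)" "(LINT t|lborel. f t * indicator {s..x $ i} t) = v x"
  by (auto simp: has_bochner_integral_iff)
 have "ennreal \<bar>v x\<bar> <= (NN t. ennreal (norm (f t * indicator {s..x $ i} t)))"
  using integral_norm_bound_ennreal[OF h(1)] by (simp add: h(2))
 also have "... <= (NN t. ennreal \<bar>f t\<bar>)" by (intro nn_integral_mono) (auto simp: indicator_def)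
 finally show ?thesis by (simp add: f_def upd)
qed

text \<open>The sixth power arises by applying the inequality for \<open>W\<^sup>1\<^sup>,\<^sup>1\<close> to \<open>u\<^sup>4\<close>: each
  factor \<open>u\<^sup>2\<close> of \<open>u\<^sup>6\<close> is bounded by the square root of a line integral of
  \<open>4 |u|\<^sup>3 |\<nabla>u|\<close> in one of the three coordinate directions.\<close>

lemma Sobolev_inequality_test:
 assumes u: "u : test_functions U"
 shows "(NN x. ennreal (u x ^ 6)) <= ennreal (4096 * (LINT x|lborel. (norm (\<chi> i. partial i u x))^2) ^ 3)"
  "integrable lborel (%x. (norm (\<chi> i. partial i u x))^2)"
proof -
 note T = test_functionsD[OF u]
 have C1: "Ck_R3 1 u" using T(1) by blast
 define K where "K = closure {x. u x ~= 0}"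
 have K: "compact K" using T(2) by (simp add: K_def)
 have u0: "u x = 0" if "x ~: K" for x using that closure_subset[of "{x. u x ~= 0}"] unfolding K_def by blast
 have p0: "partial i u x = 0" if "x ~: K" for i x
  using that unfolding K_def by (rule partial_support[OF smooth_differentiable[OF T(1)]])
 define N where "N = (%x. norm (\<chi> i. partial i u x))"
 have N0: "N x = 0" if "x ~: K" for x using p0[OF that] by (simp add: N_def zero_vec_def[symmetric])
 have cu: "continuous_on UNIV u" by (rule C1_D(2)[OF C1])
 have cN: "continuous_on UNIV N" unfolding N_def by (intro continuous_on_norm continuous_on_vec_lambda C1_D(3)[OF C1])
 have int: "integrable lborel h" if "continuous_on UNIV h" "!!x. x ~: K ==> h x = 0" for h :: "R3 => real"
 proof -
  have "integrable lborel (%x. indicator K x *R h x)"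
   using borel_integrable_compact[OF K continuous_on_subset[OF that(1)]] by simp
  moreover have "(%x. indicator K x *R h x) = h" using that(2) by (auto simp: indicator_def fun_eq_iff)
  ultimately show ?thesis by simp
 qed
 have iA: "integrable lborel (%x. u x ^ 6)" by (rule int) (use u0 in \<open>auto intro!: continuous_intros cu\<close>)
 have iB: "integrable lborel (%x. \<bar>u x\<bar> ^ 3 * N x)" by (rule int) (use u0 in \<open>auto intro!: continuous_intros cu cN\<close>)
 have iD: "integrable lborel (%x. (N x)^2)" by (rule int) (use N0 in \<open>auto intro!: continuous_intros cN\<close>)
 define \<alpha> \<beta> de where "\<alpha> = (LINT x|lborel. u x ^ 6)" and "\<beta> = (LINT x|lborel. \<bar>u x\<bar> ^ 3 * N x)" and "de = (LINT x|lborel. (N x)^2)"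
 have nn: "\<alpha> >= 0" "\<beta> >= 0" "de >= 0" by (auto simp: \<alpha>_def \<beta>_def de_def N_def intro!: integral_nonneg_AE)
 have A: "(NN x. ennreal (u x ^ 6)) = ennreal \<alpha>" unfolding \<alpha>_def by (rule nn_integral_eq_integral[OF iA]) simp
 have B: "(NN x. ennreal (\<bar>u x\<bar> ^ 3 * N x)) = ennreal \<beta>" unfolding \<beta>_def by (rule nn_integral_eq_integral[OF iB]) (simp add: N_def)
 have D: "(sqn N) = ennreal de" unfolding de_def by (rule nn_integral_eq_integral[OF iD]) simp
 have [measurable]: "u : bmeas borel" "N : bmeas borel" using cu cN borel_contI by auto
 have CS: "\<beta>^2 <= \<alpha> * de"
 proof -
  have "(NN x. ennreal (\<bar>u x\<bar> ^ 3) * ennreal (N x))^2 <= (NN x. (ennreal (\<bar>u x\<bar> ^ 3))^2) * (NN x. (ennreal (N x))^2)"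
   by (rule Cauchy_Schwarz_nn_integral) measurable
  also have "(%x. ennreal (\<bar>u x\<bar> ^ 3) * ennreal (N x)) = (%x. ennreal (\<bar>u x\<bar> ^ 3 * N x))" by (simp add: ennreal_mult N_def)
  also have "(%x. (ennreal (\<bar>u x\<bar> ^ 3))^2) = (%x. ennreal (u x ^ 6))" by (simp add: ennreal_power flip: power_mult)
  also have "(%x. (ennreal (N x))^2) = (%x. ennreal ((N x)^2))" by (simp add: ennreal_power N_def)
  finally show ?thesis unfolding A B D using nn by (simp add: ennreal_power ennreal_le_iff flip: ennreal_mult)
 qed
 define v where "v = (%x. u x ^ 4)"
 have v1: "Ck_R3 1 v" unfolding v_def by (rule Ck_R3_power[OF C1])
 have pv: "partial i v x = 4 * u x ^ 3 * partial i u x" for i x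
 proof -
  have d: "(u has_derivative (%h. \<Sum>i\<in>UNIV. h $ i * partial i u x)) (at x)"
   by (rule differentiable_has_derivative_partial[OF C1_D(1)[OF C1]])
  have ax: "(\<Sum>m\<in>UNIV. axis i (1::real) $ m * partial m u x) = partial i u x"
  proof -
   have "axis i (1::real) $ m * partial m u x = (if m = i then partial m u x else 0)" for m by (simp add: axis_def)
   thus ?thesis by simp
  qed
  show ?thesis unfolding v_def using partial_eq[OF has_derivative_power[OF d, of 4], of i] ax by (simp add: mult_ac)
 qed
 obtain R where R: "!!x. x : K ==> norm x < R" using compact_imp_bounded[OF K] unfolding bounded_pos_less by blast
 have vR: "v x = 0" if "R <= norm x" for x using R[of x] u0[of x] that by (auto simp: v_def)
 define P :: "real => real => real => R3" where "P = (%x y z. \<chi> m. if m = 1 then x else if m = 2 then y else z)"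
 have [simp]: "P x y z $ 1 = x" "P x y z $ 2 = y" "P x y z $ 3 = z" for x y z by (simp_all add: P_def)
 define d where "d = (%i x. ennreal \<bar>partial i v x\<bar>)"
 have dm[measurable]: "d i : bmeas borel" for i using borel_contI[OF C1_D(3)[OF v1, of i]] unfolding d_def by measurable
 have "continuous_on UNIV (%p. if m = 1 then fst p else if m = 2 then fst (snd p) else snd (snd p))" for m :: 3 and p :: "real \<times> real \<times> real"
  by (cases "m = 1"; cases "m = 2") (auto intro!: continuous_on_fst continuous_on_snd continuous_on_id)
 hence "continuous_on UNIV (%p::real \<times> real \<times> real. P (fst p) (fst (snd p)) (snd (snd p)))"
  unfolding P_def by (intro continuous_on_vec_lambda)
 hence "(%p::real \<times> real \<times> real. P (fst p) (fst (snd p)) (snd (snd p))) : bmeas borel"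
  by (rule borel_contI)
 hence Pm: "(%p. P (fst p) (fst (snd p)) (snd (snd p))) : bmeas (borel OM (borel OM borel))" by (simp add: borel_prod)
 have Pm': "(%w. P (a w) (b w) (c w)) : bmeas Q" if "a : bmeas Q" "b : bmeas Q" "c : bmeas Q"
  for a b c :: "_ => real" and Q using measurable_compose[OF _ Pm, of "%w. (a w, b w, c w)" Q] that by simp
 define g1 g2 g3 where "g1 = (%p. (NN t. d 1 (P t (fst p) (snd p))))"
  and "g2 = (%p. (NN t. d 2 (P (fst p) t (snd p))))"
  and "g3 = (%p. (NN t. d 3 (P (fst p) (snd p) t)))"
 have Pmd: "(%w. d i (P (a w) (b w) (c w))) : bmeas Q"
  if "a : bmeas Q" "b : bmeas Q" "c : bmeas Q" for a b c :: "_ => real" and Q i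
  by (rule measurable_compose[OF Pm'[OF that] dm])
 have mm: "fst \<circ> fst : bmeas ((borel OM borel) OM lborel)" "snd \<circ> fst : bmeas ((borel OM borel) OM lborel)"
   "snd : bmeas ((borel OM borel) OM (lborel :: real measure))" by measurable
 have gm[measurable]: "g1 : bmeas (borel OM borel)" "g2 : bmeas (borel OM borel)" "g3 : bmeas (borel OM borel)"
  using lborel.borel_measurable_nn_integral_fst[OF Pmd[OF mm(3) mm(1) mm(2), of 1]]
   lborel.borel_measurable_nn_integral_fst[OF Pmd[OF mm(1) mm(3) mm(2), of 2]]
   lborel.borel_measurable_nn_integral_fst[OF Pmd[OF mm(1) mm(2) mm(3), of 3]] by (simp_all add: g1_def g2_def g3_def)
 define F :: "(real \<times> real => ennreal) => real \<times> real => ennreal" where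
  "F = (%g p. ennreal (sqrt (enn2real (g p))))"
 have Fm: "F g : bmeas (borel OM borel)" if [measurable]: "g : bmeas (borel OM borel)" for g
  unfolding F_def by measurable
 have Fsq: "(F g p)^2 <= g p" for g p unfolding F_def by (cases "g p") (simp_all add: ennreal_power)
 obtain Kv where Kv: "!!i x. \<bar>partial i v x\<bar> <= Kv"
 proof -
  have "EX k. ALL x. \<bar>partial i v x\<bar> <= k" for i
  proof -
   have "compact (partial i v ` K)" by (intro compact_continuous_image continuous_on_subset[OF C1_D(3)[OF v1]] K) auto
   hence "bounded (partial i v ` K)" by (rule compact_imp_bounded)
   then obtain k where k': "ALL y:partial i v ` K. norm y <= k" unfolding bounded_iff by blast
   have k: "\<bar>partial i v x\<bar> <= k" if "x : K" for x using k' that by simp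
   have "\<bar>partial i v x\<bar> <= \<bar>k\<bar>" for x using k[of x] u0[of x] by (cases "x : K") (auto simp: pv)
   thus ?thesis by blast
  qed
  then obtain k where k: "!!i x. \<bar>partial i v x\<bar> <= k i" by metis
  have "\<bar>partial i v x\<bar> <= \<bar>k 1\<bar> + \<bar>k 2\<bar> + \<bar>k 3\<bar>" for i x using k[of i x] exhaust_3[of i] by auto
  thus ?thesis using that by blast
 qed
 have line: "(NN t. d i (q t)) < \<infinity>" if q: "!!t. q t $ i = t" for i and q :: "real => R3"
 proof -
  have "d i (q t) <= ennreal Kv * indicator {- R..R} t" for t
  proof (cases "t : {- R..R}")
   case True
   thus ?thesis using Kv[of i "q t"] by (simp add: d_def ennreal_leI)
  next
   case False
   have "\<bar>t\<bar> <= norm (q t)" using component_le_norm_cart[of "q t" i] q by simp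
   hence "q t ~: K" using False R[of "q t"] by auto
   thus ?thesis using u0[of "q t"] by (simp add: d_def pv)
  qed
  hence "(NN t. d i (q t)) <= (NN t. ennreal Kv * indicator {- R..R} t)" by (rule nn_integral_mono)
  also have "... = ennreal Kv * emeasure lborel {- R..R}" by (simp add: nn_integral_cmult_indicator)
  also have "... < \<infinity>" by (cases "- R <= R") (simp_all add: ennreal_mult_less_top)
  finally show ?thesis .
 qed
 have sq: "ennreal ((u x)^2) <= F g p" if le: "ennreal \<bar>v x\<bar> <= g p" and fin: "g p < \<infinity>" for x p and g :: "real \<times> real => ennreal"
 proof -
  obtain r where r: "g p = ennreal r" "r >= 0" using fin by (cases "g p") auto
  have "u x ^ 4 <= r" using le r by (simp add: v_def ennreal_le_iff)
  hence "((u x)^2)^2 <= r" by (simp flip: power_mult)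
  hence "(u x)^2 <= sqrt r" by (rule real_le_rsqrt)
  thus ?thesis using r by (simp add: F_def ennreal_leI)
 qed
 have e3: "(\<chi> m. if m = 1 then t else P x y z $ m) = P t y z" "(\<chi> m. if m = 2 then t else P x y z $ m) = P x t z"
   "(\<chi> m. if m = 3 then t else P x y z $ m) = P x y t" for x y z t by (auto simp: vec_eq_iff forall_3)
 have pt: "ennreal (u (P x y z) ^ 6) <= F g1 (y, z) * F g2 (x, z) * F g3 (x, y)" for x y z
 proof -
  have l: "ennreal \<bar>v (P x y z)\<bar> <= g1 (y, z)" "ennreal \<bar>v (P x y z)\<bar> <= g2 (x, z)" "ennreal \<bar>v (P x y z)\<bar> <= g3 (x, y)"
   using le_line_integral_partial[OF v1 vR, where x="P x y z" and i=1] le_line_integral_partial[OF v1 vR, where x="P x y z" and i=2]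
    le_line_integral_partial[OF v1 vR, where x="P x y z" and i=3] by (simp_all only: e3 g1_def g2_def g3_def d_def fst_conv snd_conv)
  have f: "g1 (y, z) < \<infinity>" "g2 (x, z) < \<infinity>" "g3 (x, y) < \<infinity>" unfolding g1_def g2_def g3_def by (rule line; simp)+
  have "ennreal (u (P x y z) ^ 6) = ennreal ((u (P x y z))^2) * ennreal ((u (P x y z))^2) * ennreal ((u (P x y z))^2)"
   by (simp flip: ennreal_mult power_add)
  also have "... <= F g1 (y, z) * F g2 (x, z) * F g3 (x, y)" by (intro mult_mono sq l f) auto
  finally show ?thesis .
 qed
 have dB: "(NN x. d i x) <= ennreal (4 * \<beta>)" for i
 proof -
  have "\<bar>partial i u x\<bar> <= N x" for x using component_le_norm_cart[of "\<chi> i. partial i u x" i] by (simp add: N_def)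
  hence "d i x <= ennreal (4 * (\<bar>u x\<bar> ^ 3 * N x))" for x
   unfolding d_def pv by (intro ennreal_leI) (simp add: abs_mult power_abs mult_left_mono)
  hence "(NN x. d i x) <= (NN x. ennreal (4 * (\<bar>u x\<bar> ^ 3 * N x)))" by (rule nn_integral_mono)
  also have "... = (NN x. ennreal 4 * ennreal (\<bar>u x\<bar> ^ 3 * N x))" by (intro nn_integral_cong ennreal_mult) (simp_all add: N_def)
  also have "... = ennreal 4 * ennreal \<beta>" unfolding B[symmetric] by (rule nn_integral_cmult) measurable
  also have "... = ennreal (4 * \<beta>)" using nn by (simp add: ennreal_mult)
  finally show ?thesis .
 qed
 have P1: "(\<chi> m. if m = 2 then y else if m = 3 then z else t) = P t y z" "(\<chi> m. if m = 1 then x else if m = 3 then z else t) = P x t z"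
  "(\<chi> m. if m = 1 then x else if m = 2 then y else t) = P x y t" for x y z t by (auto simp: vec_eq_iff forall_3)
 have G1: "(NN y. (NN z. (F g1 (y, z))^2)) <= ennreal (4 * \<beta>)"
 proof (rule order_trans[OF _ dB[of 1]])
  have "(NN y. (NN z. (F g1 (y, z))^2)) <= (NN y. (NN z. g1 (y, z)))" by (intro nn_integral_mono Fsq)
  also have "... = (NN x. d 1 x)" using nn_integral_R3_iterated[of 2 3 1 "d 1"] dm by (simp add: P1 g1_def)
  finally show "(NN y. (NN z. (F g1 (y, z))^2)) <= (NN x. d 1 x)" .
 qed
 have G2: "(NN x. (NN z. (F g2 (x, z))^2)) <= ennreal (4 * \<beta>)"
 proof (rule order_trans[OF _ dB[of 2]])
  have "(NN x. (NN z. (F g2 (x, z))^2)) <= (NN x. (NN z. g2 (x, z)))" by (intro nn_integral_mono Fsq)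
  also have "... = (NN x. d 2 x)" using nn_integral_R3_iterated[of 1 3 2 "d 2"] dm by (simp add: P1 g2_def)
  finally show "(NN x. (NN z. (F g2 (x, z))^2)) <= (NN x. d 2 x)" .
 qed
 have G3: "(NN x. (NN y. (F g3 (x, y))^2)) <= ennreal (4 * \<beta>)"
 proof (rule order_trans[OF _ dB[of 3]])
  have "(NN x. (NN y. (F g3 (x, y))^2)) <= (NN x. (NN y. g3 (x, y)))" by (intro nn_integral_mono Fsq)
  also have "... = (NN x. d 3 x)" using nn_integral_R3_iterated[of 1 2 3 "d 3"] dm by (simp add: P1 g3_def)
  finally show "(NN x. (NN y. (F g3 (x, y))^2)) <= (NN x. d 3 x)" .
 qed
 have "(NN p. ennreal (u p ^ 6)) = (NN x. (NN y. (NN z. ennreal (u (P x y z) ^ 6))))"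
  using nn_integral_R3_iterated[of 1 2 3 "%p. ennreal (u p ^ 6)"] by (simp add: P1)
 hence "(ennreal \<alpha>)^2 <= (NN x. (NN y. (NN z. F g1 (y, z) * F g2 (x, z) * F g3 (x, y))))^2"
  unfolding A[symmetric] by (simp only:) (intro power_mono nn_integral_mono pt; simp)
 also have "... <= (NN y. (NN z. (F g1 (y, z))^2)) * (NN x. (NN z. (F g2 (x, z))^2)) * (NN x. (NN y. (F g3 (x, y))^2))"
  by (rule Loomis_Whitney[OF Fm[OF gm(1)] Fm[OF gm(2)] Fm[OF gm(3)]])
 also have "... <= ennreal (4 * \<beta>) * ennreal (4 * \<beta>) * ennreal (4 * \<beta>)" by (intro mult_mono G1 G2 G3) auto
 also have "... = ennreal ((4 * \<beta>) * (4 * \<beta>) * (4 * \<beta>))" using nn by (simp flip: ennreal_mult)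
 finally have "\<alpha>^2 <= (4 * \<beta>) * (4 * \<beta>) * (4 * \<beta>)" using nn by (simp add: ennreal_power ennreal_le_iff)
 hence LW: "\<alpha>^2 <= 64 * \<beta> ^ 3" by (simp add: power3_eq_cube)
 have "\<alpha> <= 4096 * de ^ 3"
 proof (cases "\<alpha> = 0")
  case False
  have "\<alpha> ^ 3 * \<alpha> = (\<alpha>^2)^2" by (simp add: power2_eq_square power3_eq_cube)
  also have "... <= (64 * \<beta> ^ 3)^2" by (rule power_mono[OF LW]) simp
  also have "... = 4096 * (\<beta>^2) ^ 3" by (simp add: power_mult_distrib flip: power_mult)
  also have "... <= 4096 * (\<alpha> * de) ^ 3" by (intro mult_left_mono power_mono CS) auto
  also have "... = \<alpha> ^ 3 * (4096 * de ^ 3)" by (simp add: power_mult_distrib)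
  finally show ?thesis using False nn by (simp add: mult_le_cancel_left_pos)
 qed (use nn in simp)
 thus "(NN x. ennreal (u x ^ 6)) <= ennreal (4096 * (LINT x|lborel. (norm (\<chi> i. partial i u x))^2) ^ 3)"
  unfolding A using de_def unfolding N_def by (simp add: ennreal_leI)
 show "integrable lborel (%x. (norm (\<chi> i. partial i u x))^2)" using iD by (simp add: N_def)
qed

context bounded_domain
begin

text \<open>Fatou along an almost everywhere convergent subsequence of test functions. Choosing all of them
  within \<open>e\<close> of \<open>f\<close> keeps the constant, up to \<open>e\<close>.\<close>

lemma Sobolev_embedding:
 assumes f: "f : H1_0 U"
 shows "f : Lp \<L> 6" "Lp_norm \<L> 6 f <= 4 * H1_norm U f"
proof -
 let ?L = "\<L>"
 have fH: "f : H1 U" and ap: "!!e. e > 0 ==> EX ph:test_functions U. H1_norm U (f - ph) < e"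
  using f by (auto simp: H1_0_def)
 have fL: "f : Lp ?L 2" by (rule W1pD(1)[OF fH])
 have fm[measurable]: "f : borel_measurable ?L" by (rule LpD(1)[OF fL])
 have test: "(\<integral>\<^sup>+x. ennreal (ph x ^ 6) \<partial>?L) <= ennreal (4096 * (H1_norm U ph) ^ 6)" if p: "ph : test_functions U" for ph
 proof -
  note T = test_functionsD[OF p]
  have C1: "Ck_R3 1 ph" using T(1) by blast
  define g where "g = (%x. \<chi> i. partial i ph x)"
  have cg: "continuous_on UNIV g" unfolding g_def by (intro continuous_on_vec_lambda C1_D(3)[OF C1])
  have [measurable]: "ph : bmeas borel" using C1_D(2)[OF C1] by (rule borel_contI)
  have g0: "g x = 0" if "x ~: U" for x
  proof -
   have "partial i ph x = 0" for i using partial_support[OF smooth_differentiable[OF T(1)]] T(3) that by blast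
   thus ?thesis by (simp add: g_def vec_eq_iff)
  qed
  have gi: "integrable lborel (%x. (norm (g x))^2)" unfolding g_def by (rule Sobolev_inequality_test(2)[OF p])
  have gL: "g : Lp ?L 2" by (rule continuous_bounded_Lp[OF cg]) simp
  have "(LINT x|lborel. (norm (g x))^2) = (LINT x|lebesgue. indicator U x *R (norm (g x))^2)"
   using g0 gi by (subst integral_completion[symmetric]) (auto intro!: Bochner_Integration.integral_cong simp: indicator_def)
  also have "... = (LINT x|?L. (norm (g x))^2)" by (rule integral_restrict_space[symmetric]) (simp add: sets_U)
  also have "... = (Lp_norm ?L 2 g)^2" by (rule L2_norm_sq[symmetric])
  also have "Lp_norm ?L 2 g = Lp_norm ?L 2 (wgrad U ph)"
   by (rule Lp_AE_cong(1)[symmetric]) (use C1_H1[OF C1] W1pD(3)[OF C1_H1(1)[OF C1]] cg in \<open>auto simp: g_def dest: LpD intro: continuous_measurable_lebesgue_on\<close>)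
  also have "(Lp_norm ?L 2 (wgrad U ph))^2 <= (H1_norm U ph)^2" by (simp add: H1_norm_eq)
  finally have D: "(LINT x|lborel. (norm (g x))^2) <= (H1_norm U ph)^2" .
  have "(\<integral>\<^sup>+x. ennreal (ph x ^ 6) \<partial>?L) = (\<integral>\<^sup>+x. ennreal (ph x ^ 6) * indicator U x \<partial>lebesgue)"
   by (rule nn_integral_restrict_space) (simp add: sets_U)
  also have "... <= (\<integral>\<^sup>+x. ennreal (ph x ^ 6) \<partial>lebesgue)" by (intro nn_integral_mono) (auto simp: indicator_def)
  also have "... = (NN x. ennreal (ph x ^ 6))" by (rule nn_integral_completion)
  also have "... <= ennreal (4096 * (LINT x|lborel. (norm (g x))^2) ^ 3)" unfolding g_def by (rule Sobolev_inequality_test(1)[OF p])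
  also have "... <= ennreal (4096 * ((H1_norm U ph)^2) ^ 3)" by (intro ennreal_leI mult_left_mono power_mono D) auto
  finally show ?thesis by (simp flip: power_mult)
 qed
 have main: "(\<integral>\<^sup>+x. ennreal (f x ^ 6) \<partial>?L) <= ennreal (4096 * (H1_norm U f + e) ^ 6)" if e: "e > 0" for e
 proof -
  have "ALL n. EX ph. ph : test_functions U & H1_norm U (f - ph) < e / real (Suc n)" using ap e by (meson divide_pos_pos of_nat_0_less_iff zero_less_Suc)
  from choice[OF this] obtain ph where ph: "!!n. ph n : test_functions U" "!!n. H1_norm U (f - ph n) < e / real (Suc n)" by blast
  have pH: "ph n : H1 U" for n by (rule C1_H1(1)) (use test_functionsD(1)[OF ph(1)[of n]] in blast)
  have le: "H1_norm U (ph n) <= H1_norm U f + e" for n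
  proof -
   have "H1_norm U (ph n) <= H1_norm U f + H1_norm U (ph n - f)" by (rule H.triangle_sub[OF pH fH])
   also have "H1_norm U (ph n - f) = H1_norm U (f - ph n)" by (rule H.n_commute[OF pH fH])
   also have "... <= e / real (Suc n)" using ph(2)[of n] by simp
   also have "... <= e" using e by (simp add: divide_le_eq mult_le_cancel_left1 del: of_nat_Suc)
   finally show ?thesis by simp
  qed
  have dL: "f - ph n : Lp ?L 2" for n by (rule W1pD(1)[OF H.diff_mem[OF fH pH]])
  have di: "integrable ?L (%x. (norm ((f - ph n) x))^2)" for n using dL unfolding L2_integrable_sq by blast
  have "(%n. LINT x|?L. norm ((norm ((f - ph n) x))^2)) ----> 0"
  proof (rule tendsto_sandwich[OF _ _ tendsto_const])
   have "(%n. (e * inverse (real (Suc n)))^2) ----> (e * 0)^2" by (intro tendsto_intros LIMSEQ_inverse_real_of_nat)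
   thus "(%n. (e / real (Suc n))^2) ----> 0" by (simp add: divide_inverse)
   have "(LINT x|?L. norm ((norm ((f - ph n) x))^2)) <= (e / real (Suc n))^2" for n
   proof -
    have "(LINT x|?L. norm ((norm ((f - ph n) x))^2)) = (Lp_norm ?L 2 (f - ph n))^2" by (simp add: L2_norm_sq)
    also have "... <= (H1_norm U (f - ph n))^2" by (simp add: H1_norm_eq)
    also have "... <= (e / real (Suc n))^2" using ph(2)[of n] H.nonneg[OF H.diff_mem[OF fH pH]] by (intro power_mono) auto
    finally show ?thesis .
   qed
   thus "\<forall>\<^sub>F n in sequentially. (LINT x|?L. norm ((norm ((f - ph n) x))^2)) <= (e / real (Suc n))^2" by simp
  qed simp
  from tendsto_L1_AE_subseq[OF di this] obtain r :: "nat => nat" where r: "strict_mono r"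
   "AE x in ?L. (%n. (norm ((f - ph (r n)) x))^2) ----> 0" by blast
  have ae: "AE x in ?L. ennreal (f x ^ 6) <= liminf (%n. ennreal (ph (r n) x ^ 6))" using r(2)
  proof eventually_elim
   case (elim x)
   from tendsto_real_sqrt[OF elim] have "(%n. norm (ph (r n) x - f x)) ----> 0" by (simp add: norm_minus_commute abs_minus_commute)
   hence "(%n. ph (r n) x - f x) ----> 0" by (rule tendsto_norm_zero_cancel)
   hence "(%n. ph (r n) x) ----> f x" by (simp add: LIM_zero_iff)
   hence "(%n. ennreal (ph (r n) x ^ 6)) ----> ennreal (f x ^ 6)" by (intro tendsto_intros tendsto_ennrealI)
   from lim_imp_Liminf[OF sequentially_bot this] show ?case by (simp only: order_refl)
  qed
  have pm[measurable]: "ph n : borel_measurable ?L" for n using LpD(1)[OF W1pD(1)[OF pH]] .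
  have "(\<integral>\<^sup>+x. ennreal (f x ^ 6) \<partial>?L) <= (\<integral>\<^sup>+x. liminf (%n. ennreal (ph (r n) x ^ 6)) \<partial>?L)" by (rule nn_integral_mono_AE[OF ae])
  also have "... <= liminf (%n. \<integral>\<^sup>+x. ennreal (ph (r n) x ^ 6) \<partial>?L)" by (rule nn_integral_liminf) measurable
  also have "... <= liminf (%n::nat. ennreal (4096 * (H1_norm U f + e) ^ 6))"
  proof (rule Liminf_mono, intro always_eventually allI)
   fix n
   have "ennreal (4096 * (H1_norm U (ph (r n))) ^ 6) <= ennreal (4096 * (H1_norm U f + e) ^ 6)"
    using le[of "r n"] H.nonneg[OF pH] by (intro ennreal_leI mult_left_mono power_mono) auto
   thus "(\<integral>\<^sup>+x. ennreal (ph (r n) x ^ 6) \<partial>?L) <= ennreal (4096 * (H1_norm U f + e) ^ 6)"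
    using test[OF ph(1)] by (rule order_trans[rotated])
  qed
  also have "... = ennreal (4096 * (H1_norm U f + e) ^ 6)" by (simp add: Liminf_const)
  finally show ?thesis .
 qed
 have p6: "norm (f x) powr 6 = f x ^ 6" for x by (simp add: power_even_abs)
 have i: "integrable ?L (%x. f x ^ 6)"
 proof (rule integrableI_bounded)
  have "(\<integral>\<^sup>+x. ennreal (norm (f x ^ 6)) \<partial>?L) = (\<integral>\<^sup>+x. ennreal (f x ^ 6) \<partial>?L)" by (simp add: power_even_abs)
  also have "... <= ennreal (4096 * (H1_norm U f + 1) ^ 6)" by (rule main) simp
  also have "... < \<infinity>" by simp
  finally show "(\<integral>\<^sup>+x. ennreal (norm (f x ^ 6)) \<partial>?L) < \<infinity>" .
 qed measurable
 show "f : Lp ?L 6" using i fm by (simp add: Lp_def p6)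
 have "Lp_norm ?L 6 f <= 4 * (H1_norm U f + e)" if e: "e > 0" for e
 proof (rule Lp_norm_leI)
  have H0: "0 <= H1_norm U f + e" using H.nonneg[OF fH] e by simp
  thus "4 * (H1_norm U f + e) >= 0" by simp
  have "ennreal (LINT x|?L. f x ^ 6) <= ennreal (4096 * (H1_norm U f + e) ^ 6)"
   using main[OF e] i by (simp add: nn_integral_eq_integral)
  hence "(LINT x|?L. f x ^ 6) <= 4096 * (H1_norm U f + e) ^ 6" using H0 by (simp add: ennreal_le_iff)
  also have "... = (4 * (H1_norm U f + e)) ^ 6" by (simp only: power_mult_distrib) simp
  also have "... = (4 * (H1_norm U f + e)) powr 6" using H0 by (simp add: power_even_abs)
  finally show "(LINT x|?L. norm (f x) powr 6) <= (4 * (H1_norm U f + e)) powr 6" by (simp only: p6)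
 qed simp
 hence "Lp_norm ?L 6 f <= 4 * H1_norm U f + e" if "e > 0" for e
  using that[THEN half_gt_zero, THEN half_gt_zero] by (smt (verit) field_sum_of_halves)
 thus "Lp_norm ?L 6 f <= 4 * H1_norm U f" by (rule field_le_epsilon)
qed

end

section \<open>Functionals on a test space\<close>

text \<open>For the coordinate projections of product spaces, which are linear on the nose.\<close>

lemma bl_pullback:
 assumes L: "bounded_linear_btw A nA B nB L" and A: "!!a. a : A ==> 0 <= nA a"
  and mem: "!!y. y : Y ==> p y : A" and le: "!!y. y : Y ==> nA (p y) <= nY y"
  and add: "!!y y'. p (y + y') = p y + p y'" and scale: "!!c y. p (c *R y) = c *R p y"
 shows "bounded_linear_btw Y nY B nB (%y. L (p y))"
proof -
 obtain C where C: "C > 0" "!!a. a : A ==> nB (L a) <= C * nA a" using bl_bound[OF L A] by blast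
 have "nB (L (p y)) <= C * nY y" if "y : Y" for y
  using C(2)[OF mem[OF that]] mult_left_mono[OF le[OF that], of C] C(1) by linarith
 thus ?thesis unfolding bounded_linear_btw_def
  using bl_mem[OF L] bl_add[OF L] bl_scale[OF L] mem by (auto simp: add scale)
qed

text \<open>A form that is linear on the nose annihilates null elements, so composing it with a map that is linear
  only modulo null elements still yields genuinely linear functionals.\<close>

lemma linear_on_quotient:
 assumes C: "seminormed C nC" and X: "homogeneous X nX" and T: "bounded_linear_btw X nX C nC T"
  and add: "!!c c'. c : C ==> c' : C ==> l (c + c') = l c + l c'" and scale: "!!k c. c : C ==> l (k *R c) = k * l c"
  and bd: "!!c. c : C ==> \<bar>l c\<bar> <= K * nC c" and x: "x : X"
 shows "x' : X ==> l (T (x + x')) = l (T x) + l (T x')" "l (T (k *R x)) = k * l (T x)"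
proof -
 interpret C: seminormed C nC by fact
 have null: "l c = 0" if "c : C" "nC c = 0" for c using bd[OF that(1)] that(2) by simp
 have diff: "l (c - c') = l c - l c'" if "c : C" "c' : C" for c c' using add[OF C.diff_mem[OF that] that(2)] by simp
 note Tm = bl_mem[OF T]
 show "l (T (x + x')) = l (T x) + l (T x')" if x': "x' : X"
 proof -
  have xx: "x + x' : X" using X x x' by (auto simp: homogeneous_def gauged_def)
  have "l (T (x + x') - T x - T x') = 0"
   by (rule null) (use Tm x x' xx bl_add[OF T x x'] in \<open>auto intro!: C.diff_mem\<close>)
  thus ?thesis using Tm x x' xx by (simp add: diff C.diff_mem)
 qed
 have kx: "k *R x : X" using X x by (auto simp: homogeneous_def gauged_def)
 have "l (T (k *R x) - k *R T x) = 0"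
  by (rule null) (use Tm x kx bl_scale[OF T x] in \<open>auto intro!: C.diff_mem C.scale_mem\<close>)
 thus "l (T (k *R x)) = k * l (T x)" using Tm x kx by (simp add: diff scale C.scale_mem)
qed

lemma bipairing_along:
 assumes A: "seminormed A nA" and E: "seminormed E nE" and C: "seminormed C nC" and X: "homogeneous X nX" and T: "bounded_linear_btw X nX C nC T"
  and l1: "!!a a' e c. a : A ==> a' : A ==> e : E ==> c : C ==> b (a + a') e c = b a e c + b a' e c"
  and l2: "!!k a e c. a : A ==> e : E ==> c : C ==> b (k *R a) e c = k * b a e c"
  and m1: "!!a e e' c. a : A ==> e : E ==> e' : E ==> c : C ==> b a (e + e') c = b a e c + b a e' c"
  and m2: "!!k a e c. a : A ==> e : E ==> c : C ==> b a (k *R e) c = k * b a e c"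
  and r1: "!!a e c c'. a : A ==> e : E ==> c : C ==> c' : C ==> b a e (c + c') = b a e c + b a e c'"
  and r2: "!!k a e c. a : A ==> e : E ==> c : C ==> b a e (k *R c) = k * b a e c"
  and bd: "!!a e c. a : A ==> e : E ==> c : C ==> \<bar>b a e c\<bar> <= K * nA a * nE e * nC c" and K: "K >= 0"
 shows "bounded_bilinear_btw A nA E nE (dual_space X nX) (dual_norm X nX) (%a e x. b a e (T x))"
proof -
 interpret A: seminormed A nA by fact
 interpret E: seminormed E nE by fact
 interpret C: seminormed C nC by fact
 have X0: "!!x. x : X ==> 0 <= nX x" using X by (auto simp: homogeneous_def gauged_def)
 obtain D where D: "D > 0" "!!x. x : X ==> nC (T x) <= D * nX x" using bl_bound[OF T X0] by blast
 note Tm = bl_mem[OF T]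
 show ?thesis
 proof (rule pairing_bounded_bilinear[OF X A.nonneg E.nonneg, where C="K * D"])
  fix a e x assume a: "a : A" and e: "e : E" and x: "x : X"
  show "b (a + a') e (T x) = b a e (T x) + b a' e (T x)" if "a' : A" for a' using l1 a e x Tm that by blast
  show "b (k *R a) e (T x) = k * b a e (T x)" for k using l2 a e x Tm by blast
  show "b a (e + e') (T x) = b a e (T x) + b a e' (T x)" if "e' : E" for e' using m1 a e x Tm that by blast
  show "b a (k *R e) (T x) = k * b a e (T x)" for k using m2 a e x Tm by blast
  show "b a e (T (x + x')) = b a e (T x) + b a e (T x')" if "x' : X" for x'
   by (rule linear_on_quotient(1)[OF C X T r1 r2 bd x that]) (use a e in auto)
  show "b a e (T (k *R x)) = k * b a e (T x)" for k
   by (rule linear_on_quotient(2)[OF C X T r1 r2 bd x]) (use a e in auto)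
  have "\<bar>b a e (T x)\<bar> <= K * nA a * nE e * nC (T x)" by (rule bd[OF a e Tm[OF x]])
  also have "... <= K * nA a * nE e * (D * nX x)" using D(2)[OF x] K A.nonneg[OF a] E.nonneg[OF e] by (intro mult_left_mono) auto
  finally show "\<bar>b a e (T x)\<bar> <= K * D * nA a * nE e * nX x" by (simp add: mult_ac)
 qed (use K D in auto)
qed

lemma L2_inner_add_left:
 assumes "f : Lp M 2" "f' : Lp M 2" "g : Lp M 2" shows "L2_inner M (f + f') g = L2_inner M f g + L2_inner M f' g"
 unfolding L2_inner_def using L2_inner(1)[OF assms(1,3)] L2_inner(1)[OF assms(2,3)] by (simp add: inner_add_left)

lemma L2_inner_add_right:
 assumes "f : Lp M 2" "g' : Lp M 2" "g : Lp M 2" shows "L2_inner M f (g + g') = L2_inner M f g + L2_inner M f g'"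
 unfolding L2_inner_def using L2_inner(1)[OF assms(1,3)] L2_inner(1)[OF assms(1,2)] by (simp add: inner_add_right)

lemma L2_inner_scale: "L2_inner M (k *R f) g = k * L2_inner M f g" "L2_inner M f (k *R g) = k * L2_inner M f g"
 by (simp_all add: L2_inner_def scaleR_fun_def)

text \<open>The scalar \<open>k\<close> makes the pairing a special case of the cubic one; it is set to one at
  the end.\<close>

lemma fd_L2_functional:
 assumes X: "homogeneous X nX" and T: "bounded_linear_btw X nX (Lp M 2) (Lp_norm M 2) T" and Y: "gauged Y nY"
  and F: "frechet_differentiable Y nY (Lp M 2) (Lp_norm M 2) (F :: _ => _ => 'b::euclidean_space)"
 shows "frechet_differentiable Y nY (dual_space X nX) (dual_norm X nX) (%y x. L2_inner M (F y) (T x))"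
proof -
 have S: "seminormed (Lp M 2 :: (_ => 'b) set) (Lp_norm M 2)" by (rule seminormed_Lp) simp
 have D: "seminormed (dual_space X nX) (dual_norm X nX)" by (rule seminormed_dual[OF X])
 have R: "seminormed (UNIV :: real set) abs" by standard (auto simp: abs_mult)
 have bd: "\<bar>k * L2_inner M f g\<bar> <= 1 * (\<bar>k\<bar> * (Lp_norm M 2 f * Lp_norm M 2 g))" if "f : Lp M 2" "g : Lp M 2" for f g :: "_ => 'b" and k
  using mult_left_mono[OF L2_inner(2)[OF that], of "\<bar>k\<bar>"] by (simp add: abs_mult mult_ac)
 have "bounded_bilinear_btw (Lp M 2) (Lp_norm M 2) UNIV abs (dual_space X nX) (dual_norm X nX) (%f k x. k * L2_inner M f (T x))"
  by (rule bipairing_along[OF S R S X T, where K=1 and b="%f k g. k * L2_inner M f g"])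
    (simp_all only: L2_inner_add_left L2_inner_add_right L2_inner_scale distrib_left distrib_right real_scaleR_def mult.left_commute mult.assoc bd zero_le_one)
 from fd_bilinear[OF S R D Y this F fd_const[OF R Y, of 1]] show ?thesis by (simp only: mult_1 UNIV_I)
qed

text \<open>The cubic form behind the convective term, bounded by Hoelder's inequality with exponents 3, 2 and 6.\<close>

definition convection :: "R3 measure => (R3 => R3) => (R3 => real^3^3) => (R3 => R3) => real" where
 "convection M a g w = (LINT x|M. (g x *v a x) \<bullet> w x)"

lemma norm_matrix_vector_le: "norm ((A :: real^3^3) *v x) <= norm A * norm x"
proof -
 have "norm (A *v x) = L2_set (%i. \<bar>A $ i \<bullet> x\<bar>) UNIV" by (simp add: norm_vec_def matrix_vector_mul_component)
 also have "... <= L2_set (%i. norm (A $ i) * norm x) UNIV" by (rule L2_set_mono) (simp_all add: Cauchy_Schwarz_ineq2)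
 also have "... = norm A * norm x" by (simp add: norm_vec_def L2_set_left_distrib)
 finally show ?thesis .
qed

lemma convection_integrable:
 assumes a: "a : Lp M 3" and g: "g : Lp M 2" and w: "w : Lp M 6"
 shows "integrable M (%x. (g x *v a x) \<bullet> w x)" "\<bar>convection M a g w\<bar> <= 3 * (Lp_norm M 3 a * Lp_norm M 2 g * Lp_norm M 6 w)"
proof -
 have [measurable]: "(%x. a x $ j) : bmeas M" "(%x. g x $ i $ j) : bmeas M" "(%x. w x $ j) : bmeas M" for i j
  using LpD(1)[OF Lp_component(1)[OF a]] LpD(1)[OF Lp_component(1)[OF Lp_component(1)[OF g]]] LpD(1)[OF Lp_component(1)[OF w]] by simp_all
 have mm: "(%x. (g x *v a x) \<bullet> w x) : bmeas M" unfolding inner_vec_def matrix_vector_mult_def by simp measurable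
 have le: "norm ((g x *v a x) \<bullet> w x) <= norm (a x) * norm (g x) * norm (w x)" for x
 proof -
  have "norm ((g x *v a x) \<bullet> w x) <= norm (g x *v a x) * norm (w x)" using Cauchy_Schwarz_ineq2 by simp
  also have "... <= norm (g x) * norm (a x) * norm (w x)" by (intro mult_right_mono norm_matrix_vector_le) simp
  finally show ?thesis by (simp add: mult_ac)
 qed
 show i: "integrable M (%x. (g x *v a x) \<bullet> w x)"
  by (rule Bochner_Integration.integrable_bound[OF Holder_3_2_6(1)[OF a g w] mm]) (use le in auto)
 have "\<bar>convection M a g w\<bar> <= (LINT x|M. norm (a x) * norm (g x) * norm (w x))"
  unfolding convection_def by (rule integral_abs_le[OF i Holder_3_2_6(1)[OF a g w]]) (use le in simp)
 thus "\<bar>convection M a g w\<bar> <= 3 * (Lp_norm M 3 a * Lp_norm M 2 g * Lp_norm M 6 w)"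
  using Holder_3_2_6(2)[OF a g w] by linarith
qed

lemma convection_bound:
 assumes "a : Lp M 3" "g : Lp M 2" "w : Lp M 6"
 shows "\<bar>convection M a g w\<bar> <= 3 * Lp_norm M 3 a * Lp_norm M 2 g * Lp_norm M 6 w"
  "\<bar>convection M a g w\<bar> <= 3 * Lp_norm M 3 a * Lp_norm M 6 w * Lp_norm M 2 g"
 using convection_integrable(2)[OF assms] by (simp_all add: mult_ac)

lemma convection_add:
 assumes "a : Lp M 3" "g : Lp M 2" "w : Lp M 6"
 shows "a' : Lp M 3 ==> convection M (a + a') g w = convection M a g w + convection M a' g w"
  "g' : Lp M 2 ==> convection M a (g + g') w = convection M a g w + convection M a g' w"
  "w' : Lp M 6 ==> convection M a g (w + w') = convection M a g w + convection M a g w'"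
 using convection_integrable(1)[OF assms]
  convection_integrable(1)[OF _ assms(2,3), of a'] convection_integrable(1)[OF assms(1) _ assms(3), of g'] convection_integrable(1)[OF assms(1,2), of w']
 by (auto simp: convection_def matrix_vector_right_distrib matrix_vector_mult_add_rdistrib inner_add_left inner_add_right)

lemma convection_scale:
 "convection M (k *R a) g w = k * convection M a g w" "convection M a (k *R g) w = k * convection M a g w"
 "convection M a g (k *R w) = k * convection M a g w"
 by (simp_all add: convection_def scaleR_fun_def matrix_vector_mult_scaleR scaleR_matrix_vector_assoc[symmetric])

lemma fd_convection:
 assumes X: "homogeneous X nX" and Y: "gauged Y nY" and F: "frechet_differentiable Y nY (Lp M 3) (Lp_norm M 3) F"
 shows "bounded_linear_btw X nX (Lp M 6) (Lp_norm M 6) T ==> frechet_differentiable Y nY (Lp M 2) (Lp_norm M 2) G ==>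
   frechet_differentiable Y nY (dual_space X nX) (dual_norm X nX) (%y x. convection M (F y) (G y) (T x))"
  "bounded_linear_btw X nX (Lp M 2) (Lp_norm M 2) S ==> frechet_differentiable Y nY (Lp M 6) (Lp_norm M 6) H ==>
   frechet_differentiable Y nY (dual_space X nX) (dual_norm X nX) (%y x. convection M (F y) (S x) (H y))"
proof -
 have S3: "seminormed (Lp M 3 :: (R3 => R3) set) (Lp_norm M 3)" and S6: "seminormed (Lp M 6 :: (R3 => R3) set) (Lp_norm M 6)"
  and S2: "seminormed (Lp M 2 :: (R3 => real^3^3) set) (Lp_norm M 2)" by (rule seminormed_Lp; simp)+
 have D: "seminormed (dual_space X nX) (dual_norm X nX)" by (rule seminormed_dual[OF X])
 show "frechet_differentiable Y nY (dual_space X nX) (dual_norm X nX) (%y x. convection M (F y) (G y) (T x))"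
  if T: "bounded_linear_btw X nX (Lp M 6) (Lp_norm M 6) T" and G: "frechet_differentiable Y nY (Lp M 2) (Lp_norm M 2) G"
 proof -
  have "bounded_bilinear_btw (Lp M 3) (Lp_norm M 3) (Lp M 2) (Lp_norm M 2) (dual_space X nX) (dual_norm X nX)
    (%a g x. convection M a g (T x))" by (rule bipairing_along[OF S3 S2 S6 X T, where K=3])
     (simp_all only: convection_add convection_scale convection_bound zero_le_numeral)
  from fd_bilinear[OF S3 S2 D Y this F G] show ?thesis .
 qed
 show "frechet_differentiable Y nY (dual_space X nX) (dual_norm X nX) (%y x. convection M (F y) (S x) (H y))"
  if S: "bounded_linear_btw X nX (Lp M 2) (Lp_norm M 2) S" and H: "frechet_differentiable Y nY (Lp M 6) (Lp_norm M 6) H"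
 proof -
  have "bounded_bilinear_btw (Lp M 3) (Lp_norm M 3) (Lp M 6) (Lp_norm M 6) (dual_space X nX) (dual_norm X nX)
    (%a w x. convection M a (S x) w)"
   by (rule bipairing_along[OF S3 S6 S2 X S, where K=3 and b="%a w g. convection M a g w"])
     (simp_all only: convection_add convection_scale convection_bound zero_le_numeral)
  from fd_bilinear[OF S3 S6 D Y this F H] show ?thesis .
 qed
qed

lemma Max_image_le_iff:
 fixes c :: real
 assumes "finite I" "I ~= {}" shows "(MAX m\<in>I. f m) <= c \<longleftrightarrow> (ALL m:I. f m <= c)"
 using assms by simp

text \<open>The norm of the image is a maximum over finitely many components, so the smallest of their radii
  works for all.\<close>

lemma fd_components:
 assumes D: "seminormed D nD" and I: "finite I" "I ~= {}" and Y: "gauged Y nY"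
  and F: "!!m. m : I ==> frechet_differentiable Y nY D nD (%y. F y m)"
 shows "frechet_differentiable Y nY {z. ALL m:I. z m : D} (%z. MAX m\<in>I. nD (z m)) F"
proof (rule fdI)
 interpret D: seminormed D nD by fact
 show "F y : {z. ALL m:I. z m : D}" if "y : Y" for y using fd_memD[OF F that] by blast
 fix y assume y: "y : Y"
 have "ALL m. EX A. m : I --> fderiv Y nY D nD (%y. F y m) y A" using fd_deriv[OF F y] by blast
 from choice[OF this] obtain A where A: "!!m. m : I ==> fderiv Y nY D nD (%y. F y m) y (A m)" by blast
 have bl: "bounded_linear_btw Y nY D nD (A m)" if "m : I" for m using A[OF that] by blast
 have zero: "(MAX m\<in>I. f m) = 0" if "!!m. m : I ==> f m = (0::real)" for f
 proof -
  have "f ` I = {0}" using that I(2) by force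
  thus ?thesis by simp
 qed
 have "ALL m. EX C. m : I --> C > 0 & (ALL h:Y. nD (A m h) <= C * nY h)" using bl_bound[OF bl gauged_nonneg[OF Y]] by blast
 from choice[OF this] obtain C where C: "!!m. m : I ==> C m > 0" "!!m h. m : I ==> h : Y ==> nD (A m h) <= C m * nY h" by blast
 have "bounded_linear_btw Y nY {z. ALL m:I. z m : D} (%z. MAX m\<in>I. nD (z m)) (%h m. A m h)"
  unfolding bounded_linear_btw_def
 proof (intro conjI ballI allI)
  fix h assume h: "h : Y"
  show "(%m. A m h) : {z. ALL m:I. z m : D}" using bl_mem[OF bl h] by blast
  show "(MAX m\<in>I. nD (((%m. A m (h + h')) - (%m. A m h) - (%m. A m h')) m)) = 0" if h': "h' : Y" for h'
   by (rule zero) (simp only: fun_diff_def bl_add[OF bl h h'])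
  show "(MAX m\<in>I. nD (((%m. A m (c *R h)) - c *R (%m. A m h)) m)) = 0" for c
   by (rule zero) (simp only: fun_diff_def scaleR_fun_def bl_scale[OF bl h])
 next
  have "(MAX m\<in>I. nD (A m h)) <= (\<Sum>m\<in>I. C m) * nY h" if h: "h : Y" for h unfolding Max_image_le_iff[OF I]
  proof
   fix m assume m: "m : I"
   have "C m <= (\<Sum>m\<in>I. C m)" using I(1) C(1) m by (intro member_le_sum) (auto intro: less_imp_le)
   hence "C m * nY h <= (\<Sum>m\<in>I. C m) * nY h" using gauged_nonneg[OF Y h] by (rule mult_right_mono)
   thus "nD (A m h) <= (\<Sum>m\<in>I. C m) * nY h" using C(2)[OF m h] by linarith
  qed
  thus "EX C. ALL x:Y. (MAX m\<in>I. nD (A m x)) <= C * nY x" by blast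
 qed
 moreover have "EX de>0. ALL h:Y. nY h < de --> (MAX m\<in>I. nD ((F (y + h) - F y - (%m. A m h)) m)) <= ep * nY h" if e: "ep > 0" for ep
 proof -
  have "ALL m. EX de. m : I --> de > 0 & (ALL h:Y. nY h < de --> nD (F (y + h) m - F y m - A m h) <= ep * nY h)"
   using A e by blast
  from choice[OF this] obtain de where d: "!!m. m : I ==> de m > 0"
   "!!m h. m : I ==> h : Y ==> nY h < de m ==> nD (F (y + h) m - F y m - A m h) <= ep * nY h" by blast
  have "Min (de ` I) > 0" using I d(1) by (simp add: Min_gr_iff)
  moreover have "(MAX m\<in>I. nD ((F (y + h) - F y - (%m. A m h)) m)) <= ep * nY h" if h: "h : Y" "nY h < Min (de ` I)" for h
   unfolding Max_image_le_iff[OF I] fun_diff_def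
  proof
   fix m assume m: "m : I"
   have "nY h < de m" using h(2) m I by simp
   thus "nD (F (y + h) m - F y m - A m h) <= ep * nY h" by (rule d(2)[OF m h(1)])
  qed
  ultimately show ?thesis by blast
 qed
 ultimately show "EX A. fderiv Y nY {z. ALL m:I. z m : D} (%z. MAX m\<in>I. nD (z m)) F y A" by blast
qed

section \<open>Vector fields and solenoidal fields\<close>

lemma test_functions_add:
 assumes f: "f : test_functions U" and g: "g : test_functions U" shows "f + g : test_functions U"
proof -
 note F = test_functionsD[OF f] and G = test_functionsD[OF g]
 have sub: "closure {x. (f + g) x ~= 0} <= closure {x. f x ~= 0} \<union> closure {x. g x ~= 0}"
  unfolding closure_Un[symmetric] by (rule closure_mono) auto
 have "(closure {x. f x ~= 0} \<union> closure {x. g x ~= 0}) \<inter> closure {x. (f + g) x ~= 0} = closure {x. (f + g) x ~= 0}" using sub by blast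
 hence k: "compact (closure {x. (f + g) x ~= 0})" using compact_Int_closed[OF compact_Un[OF F(2) G(2)] closed_closure] by metis
 have "Ck_R3 k (f + g)" for k using Ck_R3_add[of k f g] F(1) G(1) by (simp only: plus_fun_def)
 thus ?thesis using sub F(3) G(3) k unfolding test_functions_def by blast
qed

lemma test_functions_scale:
 assumes f: "f : test_functions U" shows "c *R f : test_functions U"
proof -
 note F = test_functionsD[OF f]
 have sub: "closure {x. (c *R f) x ~= 0} <= closure {x. f x ~= 0}" by (rule closure_mono) (auto simp: scaleR_fun_def)
 have "closure {x. f x ~= 0} \<inter> closure {x. (c *R f) x ~= 0} = closure {x. (c *R f) x ~= 0}" using sub by blast
 hence k: "compact (closure {x. (c *R f) x ~= 0})" using compact_Int_closed[OF F(2) closed_closure] by metis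
 have "Ck_R3 k (c *R f)" for k using Ck_R3_cmult[of k f c] F(1) by (simp add: scaleR_fun_def)
 thus ?thesis using sub F(3) k unfolding test_functions_def by blast
qed

lemma bl_subset: "bounded_linear_btw X nX Y nY A ==> X' <= X ==> bounded_linear_btw X' nX Y nY A"
 unfolding bounded_linear_btw_def by blast

context bounded_domain
begin

definition H1_vec :: "(R3 => R3) set" where "H1_vec = {v. ALL i. (%x. v x $ i) : H1 U}"

lemma component_add: "(%x. (v + w) x $ i) = (%x. (v x :: R3) $ i) + (%x. w x $ i)"
 and component_scale: "(%x. (c *R v) x $ i) = c *R (%x. (v x :: R3) $ i)" by (simp_all add: fun_eq_iff scaleR_fun_def)

lemma seminormed_H1_vec: "seminormed H1_vec (H1v_norm U)"
proof -
 show ?thesis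
 proof
  show "x + y : H1_vec" if "x : H1_vec" "y : H1_vec" for x y :: "R3 => R3"
   using that unfolding H1_vec_def mem_Collect_eq component_add by (blast intro: H.add_mem)
  show "c *R x : H1_vec" if "x : H1_vec" for x :: "R3 => R3" and c
   using that unfolding H1_vec_def mem_Collect_eq component_scale by (blast intro: H.scale_mem)
  have "(%x. (0 :: R3 => R3) x $ i) = 0" for i by (simp add: fun_eq_iff)
  thus "0 : H1_vec" unfolding H1_vec_def using H.zero_mem by simp
  fix x y :: "R3 => R3" and c :: real assume x: "x : H1_vec"
  have xi: "(%p. x p $ i) : H1 U" for i using x by (simp add: H1_vec_def)
  show "H1v_norm U (c *R x) = \<bar>c\<bar> * H1v_norm U x"
   unfolding H1v_norm_def component_scale H.scale[OF xi] by (simp add: L2_set_right_distrib)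
  assume y: "y : H1_vec"
  have yi: "(%p. y p $ i) : H1 U" for i using y by (simp add: H1_vec_def)
  have "H1v_norm U (x + y) <= L2_set (%i. H1_norm U (%p. x p $ i) + H1_norm U (%p. y p $ i)) UNIV"
   unfolding H1v_norm_def component_add by (rule L2_set_mono) (auto intro!: H.triangle H.nonneg H.add_mem xi yi)
  also have "... <= H1v_norm U x + H1v_norm U y" unfolding H1v_norm_def by (rule L2_set_triangle_ineq)
  finally show "H1v_norm U (x + y) <= H1v_norm U x + H1v_norm U y" .
 qed
qed

lemma component_le_H1v: "H1_norm U (%x. v x $ i) <= H1v_norm U v" unfolding H1v_norm_def by (rule member_le_L2_set) auto

lemma bl_H1_vec_L2: "bounded_linear_btw H1_vec (H1v_norm U) (Lp \<L> 2) (Lp_norm \<L> 2) (%v. v)"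
proof (rule bl_exactI[where C=3])
 fix v :: "R3 => R3" assume v: "v : H1_vec"
 have vi: "(%x. v x $ i) : Lp \<L> 2" for i using v by (intro W1pD(1)) (simp add: H1_vec_def)
 show "v : Lp \<L> 2" by (rule Lp_componentsI(1)[OF vi]) simp
 have "Lp_norm \<L> 2 v <= (\<Sum>i\<in>UNIV. Lp_norm \<L> 2 (%x. v x $ i))" by (rule Lp_componentsI(2)[OF vi]) simp
 also have "... <= (\<Sum>i\<in>(UNIV :: 3 set). H1v_norm U v)"
  by (intro sum_mono order_trans[OF W1p_norm_ge(1) component_le_H1v]) simp
 finally show "Lp_norm \<L> 2 v <= 3 * H1v_norm U v" by simp
qed (auto simp: seminormed.n_zero[OF seminormed_Lp])

lemma wjac_L2:
 assumes v: "v : H1_vec"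
 shows "wjac U v : Lp \<L> 2" "Lp_norm \<L> 2 (wjac U v) <= 3 * H1v_norm U v"
proof -
 have eq: "(%x. wjac U v x $ i) = wgrad U (%x. v x $ i)" for i by (simp add: wjac_def fun_eq_iff)
 have vi: "(%x. wjac U v x $ i) : Lp \<L> 2" for i unfolding eq using v by (intro W1pD(3)) (simp add: H1_vec_def)
 show "wjac U v : Lp \<L> 2" by (rule Lp_componentsI(1)[OF vi]) simp
 have "Lp_norm \<L> 2 (wjac U v) <= (\<Sum>i\<in>UNIV. Lp_norm \<L> 2 (%x. wjac U v x $ i))" by (rule Lp_componentsI(2)[OF vi]) simp
 also have "... <= (\<Sum>i\<in>(UNIV :: 3 set). H1v_norm U v)"
  unfolding eq by (intro sum_mono order_trans[OF W1p_norm_ge(2) component_le_H1v]) simp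
 finally show "Lp_norm \<L> 2 (wjac U v) <= 3 * H1v_norm U v" by simp
qed

lemma AE_all_3: "(!!i::3. AE x in M. Q i x) ==> AE x in M. ALL i. Q i x"
 by (simp add: AE_finite_all[of "UNIV :: 3 set", simplified])

lemma bl_wjac: "bounded_linear_btw H1_vec (H1v_norm U) (Lp \<L> 2) (Lp_norm \<L> 2) (wjac U)"
proof -
 interpret V: seminormed H1_vec "H1v_norm U" by (rule seminormed_H1_vec)
 interpret L: seminormed "Lp \<L> 2 :: (R3 => real^3^3) set" "Lp_norm \<L> 2" by (rule seminormed_Lp) simp
 have c: "(%x. v x $ i) : H1 U" if "v : H1_vec" for v :: "R3 => R3" and i using that by (simp add: H1_vec_def)
 have "Lp_norm \<L> 2 (wjac U (v + w) - wjac U v - wjac U w) = 0" if v: "v : H1_vec" and w: "w : H1_vec" for v w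
 proof -
  have m: "wjac U (v + w) - wjac U v - wjac U w : Lp \<L> 2" using v w by (intro L.diff_mem wjac_L2 V.add_mem)
  have "AE x in \<L>. ALL i. wgrad U (%p. (v + w) p $ i) x = wgrad U (%p. v p $ i) x + wgrad U (%p. w p $ i) x"
   unfolding component_add by (intro AE_all_3 W1p_add(2)[where p=2] c v w) simp
  hence "AE x in \<L>. (wjac U (v + w) - wjac U v - wjac U w) x = 0" by eventually_elim (simp add: wjac_def vec_eq_iff)
  thus ?thesis using Lp_norm_eq_0[OF m] by simp
 qed
 moreover have "Lp_norm \<L> 2 (wjac U (k *R v) - k *R wjac U v) = 0" if v: "v : H1_vec" for v k
 proof -
  have m: "wjac U (k *R v) - k *R wjac U v : Lp \<L> 2" using v by (intro L.diff_mem L.scale_mem wjac_L2 V.scale_mem)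
  have "AE x in \<L>. ALL i. wgrad U (%p. (k *R v) p $ i) x = k *R wgrad U (%p. v p $ i) x"
   unfolding component_scale by (intro AE_all_3 W1p_scale(2)[where p=2] c v) simp
  hence "AE x in \<L>. (wjac U (k *R v) - k *R wjac U v) x = 0"
   by eventually_elim (simp add: wjac_def vec_eq_iff scaleR_fun_def)
  thus ?thesis using Lp_norm_eq_0[OF m] by simp
 qed
 ultimately show ?thesis unfolding bounded_linear_btw_def using wjac_L2 by blast
qed

lemma bl_wjac_image:
 assumes T: "bounded_linear T"
 shows "bounded_linear_btw H1_vec (H1v_norm U) (Lp \<L> 2) (Lp_norm \<L> 2) (%v x. T (wjac U v x) :: 'b::euclidean_space)"
proof (rule bl_compose[OF _ _ _ bl_wjac])
 show "bounded_linear_btw (Lp \<L> 2) (Lp_norm \<L> 2) (Lp \<L> 2) (Lp_norm \<L> 2) (%f x. T (f x))"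
  by (rule bl_Lp_linear_image[OF T]) simp
 show "gauged H1_vec (H1v_norm U)" by (rule seminormed.gauged[OF seminormed_H1_vec])
qed (auto intro: seminormed_Lp)

lemma bl_sym_grad: "bounded_linear_btw H1_vec (H1v_norm U) (Lp \<L> 2) (Lp_norm \<L> 2) (sym_grad U)"
proof -
 have "linear (%A::real^3^3. (1 / 2) *R (A + transpose A))"
  by (rule linearI) (simp_all add: vec_eq_iff transpose_def algebra_simps)
 hence "bounded_linear (%A::real^3^3. (1 / 2) *R (A + transpose A))" by (simp add: linear_conv_bounded_linear)
 from bl_wjac_image[OF this] show ?thesis by (simp only: sym_grad_def[abs_def])
qed

lemma bl_wdiv: "bounded_linear_btw H1_vec (H1v_norm U) (Lp \<L> 2) (Lp_norm \<L> 2) (wdiv U)"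
proof -
 have "linear (%A::real^3^3. \<Sum>i\<in>UNIV. A $ i $ i)"
  by (rule linearI) (simp_all add: sum.distrib sum_distrib_left)
 hence "bounded_linear (%A::real^3^3. \<Sum>i\<in>UNIV. A $ i $ i)" by (simp add: linear_conv_bounded_linear)
 from bl_wjac_image[OF this] show ?thesis by (simp only: wdiv_def[abs_def])
qed

lemma H1_0_add: "f : H1_0 U ==> g : H1_0 U ==> f + g : H1_0 U"
proof -
 assume f: "f : H1_0 U" and g: "g : H1_0 U"
 have fg: "f : H1 U" "g : H1 U" using f g by (auto simp: H1_0_def)
 have "EX ph:test_functions U. H1_norm U (f + g - ph) < e" if e: "e > 0" for e
 proof -
  obtain p where p: "p : test_functions U" "H1_norm U (f - p) < e / 2" using f e by (auto simp: H1_0_def dest: spec[of _ "e / 2"])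
  obtain q where q: "q : test_functions U" "H1_norm U (g - q) < e / 2" using g e by (auto simp: H1_0_def dest: spec[of _ "e / 2"])
  have pq: "p : H1 U" "q : H1 U" using C1_H1(1) test_functionsD(1) p(1) q(1) by blast+
  have "f + g - (p + q) = (f - p) + (g - q)" by simp
  hence "H1_norm U (f + g - (p + q)) <= H1_norm U (f - p) + H1_norm U (g - q)"
   using H.triangle[OF H.diff_mem[OF fg(1) pq(1)] H.diff_mem[OF fg(2) pq(2)]] by metis
  hence "H1_norm U (f + g - (p + q)) < e" using p(2) q(2) by linarith
  thus ?thesis using test_functions_add[OF p(1) q(1)] by blast
 qed
 thus ?thesis using H.add_mem[OF fg] by (simp add: H1_0_def)
qed

lemma H1_0_scale: "f : H1_0 U ==> c *R f : H1_0 U"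
proof -
 assume f: "f : H1_0 U"
 have fH: "f : H1 U" using f by (auto simp: H1_0_def)
 have "EX ph:test_functions U. H1_norm U (c *R f - ph) < e" if e: "e > 0" for e
 proof -
  have e': "e / (\<bar>c\<bar> + 1) > 0" using e by simp
  obtain p where p: "p : test_functions U" "H1_norm U (f - p) < e / (\<bar>c\<bar> + 1)" using f e' unfolding H1_0_def by blast
  have pH: "p : H1 U" using C1_H1(1) test_functionsD(1) p(1) by blast
  have "H1_norm U (c *R f - c *R p) = \<bar>c\<bar> * H1_norm U (f - p)"
   using H.scale[OF H.diff_mem[OF fH pH], of c] by (simp only: scaleR_diff_right)
  also have "... <= (\<bar>c\<bar> + 1) * H1_norm U (f - p)" using H.nonneg[OF H.diff_mem[OF fH pH]] by (intro mult_right_mono) auto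
  also have "... < e" using p(2) by (simp add: pos_less_divide_eq mult.commute)
  finally show ?thesis using test_functions_scale[OF p(1)] by blast
 qed
 thus ?thesis using H.scale_mem[OF fH] by (simp add: H1_0_def)
qed

lemma H_sigma_subset: "H_sigma U <= H1_vec" by (auto simp: H_sigma_def H1_vec_def H1_0_def)

text \<open>The divergence constraint is preserved although the weak divergence is linear only almost
  everywhere, since its pairing with \<open>q\<close> ignores null sets.\<close>

lemma seminormed_H_sigma: "seminormed (H_sigma U) (H1v_norm U)"
proof -
 interpret V: seminormed H1_vec "H1v_norm U" by (rule seminormed_H1_vec)
 have L2: "seminormed (Lp \<L> 2 :: (R3 => real) set) (Lp_norm \<L> 2)" by (rule seminormed_Lp) simp
 note lin = linear_on_quotient[OF L2 V.homogeneous bl_wdiv, where l="%c. L2_inner \<L> c q" and K="Lp_norm \<L> 2 q" for q]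
 have q_lin: "L2_inner \<L> (wdiv U (v + w)) q = L2_inner \<L> (wdiv U v) q + L2_inner \<L> (wdiv U w) q"
  "L2_inner \<L> (wdiv U (k *R v)) q = k * L2_inner \<L> (wdiv U v) q"
  if q: "q : Lp \<L> 2" and vw: "v : H1_vec" "w : H1_vec" for q v w k
 proof -
  have bd: "\<bar>L2_inner \<L> c q\<bar> <= Lp_norm \<L> 2 q * Lp_norm \<L> 2 c" if "c : Lp \<L> 2" for c
   using L2_inner(2)[OF that q] by (simp only: mult.commute)
  show "L2_inner \<L> (wdiv U (v + w)) q = L2_inner \<L> (wdiv U v) q + L2_inner \<L> (wdiv U w) q"
   by (rule lin(1)[OF L2_inner_add_left[OF _ _ q] L2_inner_scale(1) bd vw])
  show "L2_inner \<L> (wdiv U (k *R v)) q = k * L2_inner \<L> (wdiv U v) q"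
   by (rule lin(2)[OF L2_inner_add_left[OF _ _ q] L2_inner_scale(1) bd vw(1)])
 qed
 have mem: "v : H1_vec" if "v : H_sigma U" for v using that H_sigma_subset by blast
 show ?thesis
 proof
  show "x + y : H_sigma U" if x: "x : H_sigma U" and y: "y : H_sigma U" for x y
  proof -
   have "(%p. (x + y) p $ i) : H1_0 U" for i unfolding component_add by (rule H1_0_add) (use x y in \<open>auto simp: H_sigma_def\<close>)
   moreover have "L2_inner \<L> (wdiv U (x + y)) q = 0" if q: "q : Lp \<L> 2" "(LINT x|\<L>. q x) = 0" for q
    unfolding q_lin(1)[OF q(1) mem[OF x] mem[OF y]] using x y q by (simp add: H_sigma_def)
   ultimately show ?thesis by (simp add: H_sigma_def)
  qed
  show sc: "c *R x : H_sigma U" if x: "x : H_sigma U" for x c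
  proof -
   have "(%p. (c *R x) p $ i) : H1_0 U" for i unfolding component_scale by (rule H1_0_scale) (use x in \<open>auto simp: H_sigma_def\<close>)
   moreover have "L2_inner \<L> (wdiv U (c *R x)) q = 0" if q: "q : Lp \<L> 2" "(LINT x|\<L>. q x) = 0" for q
    unfolding q_lin(2)[OF q(1) mem[OF x] mem[OF x]] using x q by (simp add: H_sigma_def)
   ultimately show ?thesis by (simp add: H_sigma_def)
  qed
  have zt: "(0 :: R3 => real) : test_functions U"
   using Ck_R3_const[of _ 0] by (simp add: test_functions_def zero_fun_def)
  have "(0 :: R3 => real) : H1_0 U" using zt H.zero_mem by (auto simp: H1_0_def intro!: bexI[of _ 0])
  moreover have "(%x. (0 :: R3 => R3) x $ i) = 0" for i by (simp add: fun_eq_iff)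
  moreover have "L2_inner \<L> (wdiv U 0) q = 0" if q: "q : Lp \<L> 2" for q
   using q_lin(2)[OF q V.zero_mem V.zero_mem, of 0] by simp
  ultimately show "0 : H_sigma U" by (simp add: H_sigma_def)
 qed (auto intro: V.triangle V.scale mem)
qed

sublocale V: seminormed "H_sigma U" "H1v_norm U" by (rule seminormed_H_sigma)

text \<open>Vanishing boundary values enter here, through the Sobolev embedding.\<close>

lemma bl_H_sigma_L6: "bounded_linear_btw (H_sigma U) (H1v_norm U) (Lp \<L> 6) (Lp_norm \<L> 6) (%v. v)"
proof (rule bl_exactI[where C=12])
 fix v :: "R3 => R3" assume v: "v : H_sigma U"
 have v0: "(%x. v x $ i) : H1_0 U" for i using v by (simp add: H_sigma_def)
 show "v : Lp \<L> 6" by (rule Lp_componentsI(1)[OF Sobolev_embedding(1)[OF v0]]) simp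
 have "Lp_norm \<L> 6 v <= (\<Sum>i\<in>UNIV. Lp_norm \<L> 6 (%x. v x $ i))" by (rule Lp_componentsI(2)[OF Sobolev_embedding(1)[OF v0]]) simp
 also have "... <= (\<Sum>i\<in>(UNIV :: 3 set). 4 * H1v_norm U v)"
  by (intro sum_mono order_trans[OF Sobolev_embedding(2)[OF v0]] mult_left_mono component_le_H1v) simp
 finally show "Lp_norm \<L> 6 v <= 12 * H1v_norm U v" by simp
qed (auto simp: seminormed.n_zero[OF seminormed_Lp])

end

section \<open>State and test spaces of the time-discrete system\<close>

lemma Ck_real_derivative:
 assumes "Ck_real (Suc k) f"
 shows "(f has_real_derivative deriv f x) (at x)" "continuous_on UNIV (deriv f)"
proof -
 show "(f has_real_derivative deriv f x) (at x)" using assms by (simp add: DERIV_deriv_iff_real_differentiable)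
 have "Ck_real k (deriv f)" using assms by simp
 thus "continuous_on UNIV (deriv f)"
 proof (cases k)
  case (Suc j)
  hence "deriv f differentiable (at x)" for x using assms by simp
  thus ?thesis using differentiable_imp_continuous_within continuous_at_imp_continuous_on by blast
 qed simp
qed

locale time_step = lipschitz_domain "Dom P" for P :: model +
 fixes m :: nat
 assumes model: "admissible_model P" and m: "m : {1..steps P}"
begin

abbreviation phase_space :: "(R3 => real) set" where "phase_space \<equiv> H1 (Dom P) \<inter> Linf \<L>"
abbreviation phase_norm :: "(R3 => real) => real" where "phase_norm \<equiv> %f. H1_norm (Dom P) f + Linf_norm \<L> f"
abbreviation velocity :: "state => R3 => R3" where "velocity y \<equiv> fst y m"
abbreviation phase :: "state => R3 => real" where "phase y \<equiv> fst (snd y) m"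
abbreviation potential :: "state => R3 => real" where "potential y \<equiv> snd (snd y) m"

definition old_velocity :: "state => R3 => R3" where
 "old_velocity y = (if m = 1 then v_init P else fst y (m - 1))"
definition old_phase :: "state => R3 => real" where
 "old_phase y = (if m = 1 then phi_init P else fst (snd y) (m - 1))"

lemma seminormed_phase: "seminormed phase_space phase_norm"
proof -
 show ?thesis
 proof
  show "phase_norm (x + y) <= phase_norm x + phase_norm y" if "x : phase_space" "y : phase_space" for x y
   using H.triangle[OF IntD1[OF that(1)] IntD1[OF that(2)]] I.triangle[OF IntD2[OF that(1)] IntD2[OF that(2)]] by linarith
  show "phase_norm (c *R x) = \<bar>c\<bar> * phase_norm x" if "x : phase_space" for x c
   using H.scale[OF IntD1[OF that]] I.scale[OF IntD2[OF that]] by (simp only: distrib_left)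
 qed (auto intro: H.add_mem I.add_mem H.scale_mem I.scale_mem H.zero_mem I.zero_mem)
qed

lemma Y_iff: "y : Y_space P \<longleftrightarrow> (ALL k:{1..steps P}. fst y k : H_sigma (Dom P) & fst (snd y) k : phase_space & snd (snd y) k : W1p (Dom P) 3)"
 by (simp add: Y_space_def split_beta)

lemma Y_memD:
 assumes "y : Y_space P" "k : {1..steps P}"
 shows "fst y k : H_sigma (Dom P)" "fst (snd y) k : phase_space" "snd (snd y) k : W1p (Dom P) 3"
 using assms by (auto simp: Y_space_def)

lemma W13: "homogeneous (W1p (Dom P) 3) (W1p_norm (Dom P) 3)" by (rule W1p_homogeneous) simp

lemma Y_norm_bounds:
 assumes y: "y : Y_space P" and k: "k : {1..steps P}"
 shows "H1v_norm (Dom P) (fst y k) <= Y_norm P y" "phase_norm (fst (snd y) k) <= Y_norm P y"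
  "W1p_norm (Dom P) 3 (snd (snd y) k) <= Y_norm P y" "0 <= Y_norm P y"
proof -
 let ?I = "{1..steps P}"
 define a where "a = (MAX j\<in>?I. H1v_norm (Dom P) (fst y j))"
 define b where "b = (MAX j\<in>?I. H1_norm (Dom P) (fst (snd y) j))"
 define c where "c = (MAX j\<in>?I. Linf_norm \<L> (fst (snd y) j))"
 define d where "d = (MAX j\<in>?I. W1p_norm (Dom P) 3 (snd (snd y) j))"
 have Y: "Y_norm P y = a + b + c + d" by (simp add: Y_norm_def a_def b_def c_def d_def split_beta)
 have le: "f k <= (MAX j\<in>?I. f j)" for f :: "nat => real" using k by (intro Max_ge) auto
 have 0: "0 <= H1v_norm (Dom P) (fst y k)" "0 <= H1_norm (Dom P) (fst (snd y) k)" "0 <= Linf_norm \<L> (fst (snd y) k)"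
  "0 <= W1p_norm (Dom P) 3 (snd (snd y) k)"
  using V.nonneg H.nonneg I.nonneg Y_memD[OF y k] W13 by (auto simp: homogeneous_def gauged_def)
 have 1: "H1v_norm (Dom P) (fst y k) <= a" "H1_norm (Dom P) (fst (snd y) k) <= b" "Linf_norm \<L> (fst (snd y) k) <= c"
  "W1p_norm (Dom P) 3 (snd (snd y) k) <= d" unfolding a_def b_def c_def d_def by (rule le)+
 show "H1v_norm (Dom P) (fst y k) <= Y_norm P y" "phase_norm (fst (snd y) k) <= Y_norm P y"
  "W1p_norm (Dom P) 3 (snd (snd y) k) <= Y_norm P y" "0 <= Y_norm P y" using 0 1 unfolding Y by linarith+
qed

lemma gauged_Y: "gauged (Y_space P) (Y_norm P)"
proof -
 interpret H: seminormed phase_space phase_norm by (rule seminormed_phase)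
 have W: "f + g : W1p (Dom P) 3" "c *R f : W1p (Dom P) 3" if "f : W1p (Dom P) 3" "g : W1p (Dom P) 3" for f g c
  using W13 that by (auto simp: homogeneous_def gauged_def)
 show ?thesis unfolding gauged_def
 proof (intro conjI ballI allI)
  fix x assume x: "x : Y_space P"
  show "0 <= Y_norm P x" by (rule Y_norm_bounds(4)[OF x m])
  show "c *R x : Y_space P" for c unfolding Y_iff fst_scaleR snd_scaleR scaleR_fun_def[of _ "_ :: nat => _"]
   by (intro ballI conjI V.scale_mem H.scale_mem W(2)[OF _ Y_memD(3)[OF x]] Y_memD[OF x])
  show "x + y : Y_space P" if y: "y : Y_space P" for y
   unfolding Y_iff fst_add snd_add plus_fun_apply[of "_ :: nat => _"]
   by (intro ballI conjI V.add_mem H.add_mem W(1) Y_memD[OF x] Y_memD[OF y])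
 qed
qed

lemma homogeneous_test: "homogeneous (test_space P) (test_norm P)"
 and test_norm_bounds: "z : test_space P ==> H1v_norm (Dom P) (fst z) <= test_norm P z"
  "z : test_space P ==> H1_norm (Dom P) (fst (snd z)) <= test_norm P z"
  "z : test_space P ==> H1_norm (Dom P) (snd (snd z)) <= test_norm P z"
proof -
 have T: "test_norm P z = sqrt ((H1v_norm (Dom P) (fst z))^2 + (H1_norm (Dom P) (fst (snd z)))^2 + (H1_norm (Dom P) (snd (snd z)))^2)" for z
  by (simp add: test_norm_def split_beta)
 have le: "a <= sqrt (a^2 + b^2 + c^2)" "b <= sqrt (a^2 + b^2 + c^2)" "c <= sqrt (a^2 + b^2 + c^2)" for a b c :: real
  by (rule real_le_rsqrt; simp)+
 show "z : test_space P ==> H1v_norm (Dom P) (fst z) <= test_norm P z"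
  "z : test_space P ==> H1_norm (Dom P) (fst (snd z)) <= test_norm P z"
  "z : test_space P ==> H1_norm (Dom P) (snd (snd z)) <= test_norm P z" unfolding T by (rule le)+
 have "test_norm P (c *R z) = \<bar>c\<bar> * test_norm P z" if z: "z : test_space P" for c z
 proof -
  have zz: "fst z : H_sigma (Dom P)" "fst (snd z) : H1 (Dom P)" "snd (snd z) : H1 (Dom P)" using z by (auto simp: test_space_def)
  have "test_norm P (c *R z) = sqrt (c^2 * ((H1v_norm (Dom P) (fst z))^2 + (H1_norm (Dom P) (fst (snd z)))^2 + (H1_norm (Dom P) (snd (snd z)))^2))"
   unfolding T fst_scaleR snd_scaleR V.scale[OF zz(1)] H.scale[OF zz(2)] H.scale[OF zz(3)]
   by (simp only: power_mult_distrib power2_abs distrib_left)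
  thus ?thesis by (simp only: real_sqrt_mult real_sqrt_abs T)
 qed
 thus "homogeneous (test_space P) (test_norm P)" unfolding homogeneous_def gauged_def
  using V.add_mem V.scale_mem V.zero_mem H.add_mem H.scale_mem H.zero_mem by (auto simp: test_space_def T zero_prod_def)
qed

lemma bl_test:
 shows "bounded_linear_btw (H_sigma (Dom P)) (H1v_norm (Dom P)) B nB S ==> bounded_linear_btw (test_space P) (test_norm P) B nB (%z. S (fst z))"
  "bounded_linear_btw (H1 (Dom P)) (H1_norm (Dom P)) B nB S' ==> bounded_linear_btw (test_space P) (test_norm P) B nB (%z. S' (fst (snd z)))"
  "bounded_linear_btw (H1 (Dom P)) (H1_norm (Dom P)) B nB S' ==> bounded_linear_btw (test_space P) (test_norm P) B nB (%z. S' (snd (snd z)))"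
proof -
 note mem = test_space_def
 show "bounded_linear_btw (test_space P) (test_norm P) B nB (%z. S (fst z))" if L: "bounded_linear_btw (H_sigma (Dom P)) (H1v_norm (Dom P)) B nB S"
  by (rule bl_pullback[where p="fst" and Y="test_space P" and nY="test_norm P", OF L V.nonneg _ test_norm_bounds(1)]) (auto simp: mem)
 show "bounded_linear_btw (test_space P) (test_norm P) B nB (%z. S' (fst (snd z)))" if L: "bounded_linear_btw (H1 (Dom P)) (H1_norm (Dom P)) B nB S'"
  by (rule bl_pullback[where p="%z. fst (snd z)" and Y="test_space P" and nY="test_norm P", OF L H.nonneg _ test_norm_bounds(2)]) (auto simp: mem)
 show "bounded_linear_btw (test_space P) (test_norm P) B nB (%z. S' (snd (snd z)))" if L: "bounded_linear_btw (H1 (Dom P)) (H1_norm (Dom P)) B nB S'"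
  by (rule bl_pullback[where p="%z. snd (snd z)" and Y="test_space P" and nY="test_norm P", OF L H.nonneg _ test_norm_bounds(3)]) (auto simp: mem)
qed

section \<open>Dependence of the coefficients on the state\<close>

abbreviation differentiable_into :: "'b::real_vector set => ('b => real) => (state => 'b) => bool" where
 "differentiable_into \<equiv> frechet_differentiable (Y_space P) (Y_norm P)"

lemma old_index: "m ~= 1 ==> m - 1 : {1..steps P}" using m by auto

lemma initial_values: "v_init P : H_sigma (Dom P)" "phi_init P : phase_space"
 using model by (auto simp: admissible_model_def)

text \<open>In the first step the old velocity is the initial value, a constant with derivative zero.\<close>

lemma fd_velocity:
 assumes B: "seminormed B nB" and L: "bounded_linear_btw (H_sigma (Dom P)) (H1v_norm (Dom P)) B nB S"
 shows "differentiable_into B nB (%y. S (velocity y))" "differentiable_into B nB (%y. S (old_velocity y))"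
proof -
 have k: "differentiable_into B nB (%y. S (fst y k))" if k: "k : {1..steps P}" for k
  by (rule fd_linear[OF B gauged_Y bl_pullback[where p="%y. fst y k" and Y="Y_space P" and nY="Y_norm P", OF L V.nonneg Y_memD(1)[OF _ k] Y_norm_bounds(1)[OF _ k]]])
    (auto simp: scaleR_fun_def[of _ "_ :: nat => _"])
 show "differentiable_into B nB (%y. S (velocity y))" by (rule k[OF m])
 show "differentiable_into B nB (%y. S (old_velocity y))"
 proof (cases "m = 1")
  case True
  have "old_velocity y = v_init P" for y using True unfolding old_velocity_def by (rule if_P)
  thus ?thesis using fd_const[OF B gauged_Y bl_mem[OF L initial_values(1)]] by (simp only:)
 next
  case False
  show ?thesis using k[OF old_index[OF False]] False by (simp add: old_velocity_def)
 qed
qed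

lemma fd_phase:
 assumes B: "seminormed B nB" and L: "bounded_linear_btw phase_space phase_norm B nB S"
 shows "differentiable_into B nB (%y. S (phase y))" "differentiable_into B nB (%y. S (old_phase y))"
proof -
 interpret H: seminormed phase_space phase_norm by (rule seminormed_phase)
 have k: "differentiable_into B nB (%y. S (fst (snd y) k))" if k: "k : {1..steps P}" for k
  by (rule fd_linear[OF B gauged_Y bl_pullback[where p="%y. fst (snd y) k" and Y="Y_space P" and nY="Y_norm P", OF L H.nonneg Y_memD(2)[OF _ k] Y_norm_bounds(2)[OF _ k]]])
    (auto simp: scaleR_fun_def[of _ "_ :: nat => _"])
 show "differentiable_into B nB (%y. S (phase y))" by (rule k[OF m])
 show "differentiable_into B nB (%y. S (old_phase y))"
 proof (cases "m = 1")
  case True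
  have "old_phase y = phi_init P" for y using True unfolding old_phase_def by (rule if_P)
  thus ?thesis using fd_const[OF B gauged_Y bl_mem[OF L initial_values(2)]] by (simp only:)
 next
  case False
  show ?thesis using k[OF old_index[OF False]] False by (simp add: old_phase_def)
 qed
qed

lemma fd_potential:
 assumes B: "seminormed B nB" and L: "bounded_linear_btw (W1p (Dom P) 3) (W1p_norm (Dom P) 3) B nB S"
 shows "differentiable_into B nB (%y. S (potential y))"
proof -
 have W0: "0 <= W1p_norm (Dom P) 3 f" if "f : W1p (Dom P) 3" for f using W13 that by (auto simp: homogeneous_def gauged_def)
 show ?thesis
  by (rule fd_linear[OF B gauged_Y bl_pullback[where p="%y. snd (snd y) m" and Y="Y_space P" and nY="Y_norm P", OF L W0 Y_memD(3)[OF _ m] Y_norm_bounds(3)[OF _ m]]])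
    (auto simp: scaleR_fun_def[of _ "_ :: nat => _"])
qed

lemma bl_phase_H1:
 assumes "bounded_linear_btw (H1 (Dom P)) (H1_norm (Dom P)) B nB S" shows "bounded_linear_btw phase_space phase_norm B nB S"
proof -
 show ?thesis by (rule bl_pullback[OF assms H.nonneg, where p="%f. f"]) (auto simp: Linf_norm_nonneg)
qed

lemma bl_phase_Linf: "bounded_linear_btw phase_space phase_norm (Linf \<L>) (Linf_norm \<L>) (%f. f)"
proof -
 show ?thesis by (rule bl_exactI[where C=1]) (auto simp: H.nonneg)
qed

lemma seminorms:
 "seminormed (Linf M) (Linf_norm M)" "seminormed (Lp M 2) (Lp_norm M 2)" "seminormed (Lp M 3) (Lp_norm M 3)" "seminormed (Lp M 6) (Lp_norm M 6)"
 by (auto intro: seminormed_Linf seminormed_Lp)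

lemma bl_H_sigma_L3: "bounded_linear_btw (H_sigma (Dom P)) (H1v_norm (Dom P)) (Lp \<L> 3) (Lp_norm \<L> 3) (%v. v)"
 by (rule bl_compose[OF seminorms(4,3) seminormed.gauged[OF seminormed_H_sigma] bl_H_sigma_L6 bl_Lp_mono_exponent])
   (auto intro: finite_U)

lemma bl_H_sigma_L2: "bounded_linear_btw (H_sigma (Dom P)) (H1v_norm (Dom P)) (Lp \<L> 2) (Lp_norm \<L> 2) (%v. v)"
 by (rule bl_subset[OF bl_H1_vec_L2 H_sigma_subset])

lemma bl_wgrad_L2: "bounded_linear_btw (W1p (Dom P) 3) (W1p_norm (Dom P) 3) (Lp \<L> 2) (Lp_norm \<L> 2) (wgrad (Dom P))"
 and bl_W13_L2: "bounded_linear_btw (W1p (Dom P) 3) (W1p_norm (Dom P) 3) (Lp \<L> 2) (Lp_norm \<L> 2) (%f. f)"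
proof -
 have g: "gauged (W1p (Dom P) 3) (W1p_norm (Dom P) 3)" using W13 by (simp add: homogeneous_def)
 show "bounded_linear_btw (W1p (Dom P) 3) (W1p_norm (Dom P) 3) (Lp \<L> 2) (Lp_norm \<L> 2) (wgrad (Dom P))"
  by (rule bl_compose[OF seminorms(3,2) g bl_wgrad bl_Lp_mono_exponent]) (auto intro: finite_U)
 show "bounded_linear_btw (W1p (Dom P) 3) (W1p_norm (Dom P) 3) (Lp \<L> 2) (Lp_norm \<L> 2) (%f. f)"
  by (rule bl_compose[OF seminorms(3,2) g bl_W1p_Lp bl_Lp_mono_exponent]) (auto intro: finite_U)
qed

lemma fd_phase_Linf: "differentiable_into (Linf \<L>) (Linf_norm \<L>) (%y. phase y)" "differentiable_into (Linf \<L>) (Linf_norm \<L>) (%y. old_phase y)"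
 by (rule fd_phase[OF seminorms(1) bl_phase_Linf])+

lemma fd_superposition_phase:
 assumes "!!x. (g has_real_derivative g' x) (at x)" "continuous_on UNIV g'"
 shows "differentiable_into (Linf \<L>) (Linf_norm \<L>) (%y x. g (phase y x))" "differentiable_into (Linf \<L>) (Linf_norm \<L>) (%y x. g (old_phase y x))"
 by (rule fd_chain[OF seminorms(1,1) gauged_Y fd_phase_Linf(1) fd_superposition_Linf[OF assms]]
   fd_chain[OF seminorms(1,1) gauged_Y fd_phase_Linf(2) fd_superposition_Linf[OF assms]])+

lemma fd_times:
 assumes "p >= 1" and f: "differentiable_into (Linf M) (Linf_norm M) F" and g: "differentiable_into (Lp M p) (Lp_norm M p) G"
 shows "differentiable_into (Lp M p) (Lp_norm M p) (%y x. F y x *R G y x)"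
 using fd_bilinear[OF seminorms(1) seminormed_Lp[OF assms(1)] seminormed_Lp[OF assms(1)] gauged_Y bb_Linf_Lp[OF assms(1)] f g] .

lemma density: "(rho P has_real_derivative deriv (rho P) x) (at x)" "continuous_on UNIV (deriv (rho P))"
  "(deriv (rho P) has_real_derivative deriv (deriv (rho P)) x) (at x)" "continuous_on UNIV (deriv (deriv (rho P)))"
 and viscosity: "(eta P has_real_derivative deriv (eta P) x) (at x)" "continuous_on UNIV (deriv (eta P))"
proof -
 have r: "Ck_real (Suc (Suc 0)) (rho P)" and e: "Ck_real (Suc 0) (eta P)"
  using model by (simp_all add: admissible_model_def admissible_coefficient_def numeral_2_eq_2)
 hence r': "Ck_real (Suc 0) (deriv (rho P))" by simp
 show "(rho P has_real_derivative deriv (rho P) x) (at x)" "continuous_on UNIV (deriv (rho P))" by (rule Ck_real_derivative[OF r])+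
 show "(deriv (rho P) has_real_derivative deriv (deriv (rho P)) x) (at x)" "continuous_on UNIV (deriv (deriv (rho P)))" by (rule Ck_real_derivative[OF r'])+
 show "(eta P has_real_derivative deriv (eta P) x) (at x)" "continuous_on UNIV (deriv (eta P))" by (rule Ck_real_derivative[OF e])+
qed

text \<open>The summands of the potential are only twice differentiable. Their derivatives still act differentiably
  from bounded functions into \<open>L\<^sup>2\<close>, because there pointwise convergence of difference quotients
  suffices once these are dominated, and the growth condition dominates them.\<close>

lemma fd_double_well:
 "differentiable_into (Lp \<L> 2) (Lp_norm \<L> 2) (%y x. deriv (W_plus P) (phase y x) + deriv (W_minus P) (old_phase y x))"
proof -
 have A: "admissible_potential (W P) (W_plus P) (W_minus P)" using model by (simp add: admissible_model_def)
 obtain C where C: "C > 0" "ALL F:{W P, W_plus P, W_minus P}. ALL t. F t <= C * (1 + \<bar>t\<bar> ^ 4) \<and>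
    \<bar>deriv F t\<bar> <= C * (1 + \<bar>t\<bar> ^ 3) & \<bar>deriv (deriv F) t\<bar> <= C * (1 + \<bar>t\<bar>^2)"
  using A unfolding admissible_potential_def by blast
 have loc: "EX K. ALL x. \<bar>x\<bar> <= R --> \<bar>deriv (deriv F) x\<bar> <= K" if F: "F : {W P, W_plus P, W_minus P}" for F R
 proof (intro exI allI impI)
  fix x :: real assume x: "\<bar>x\<bar> <= R"
  have "\<bar>deriv (deriv F) x\<bar> <= C * (1 + \<bar>x\<bar>^2)" using C(2) F by blast
  also have "... <= C * (1 + R^2)" using C(1) x by (intro mult_left_mono add_left_mono power_mono) auto
  finally show "\<bar>deriv (deriv F) x\<bar> <= C * (1 + R^2)" .
 qed
 have der: "(deriv F has_real_derivative deriv (deriv F) x) (at x)" if "twice_differentiable F" for F x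
  using that by (simp add: twice_differentiable_def DERIV_deriv_iff_real_differentiable)
 have t: "twice_differentiable (W_plus P)" "twice_differentiable (W_minus P)" using A by (auto simp: admissible_potential_def)
 have s: "frechet_differentiable (Linf \<L>) (Linf_norm \<L>) (Lp \<L> 2) (Lp_norm \<L> 2) (%f x. deriv F (f x))"
  if "twice_differentiable F" "F : {W P, W_plus P, W_minus P}" for F
  by (rule fd_superposition_L2[OF finite_U der[OF that(1)] loc[OF that(2)]])
 have "differentiable_into (Lp \<L> 2) (Lp_norm \<L> 2) (%y. (%x. deriv (W_plus P) (phase y x)) + (%x. deriv (W_minus P) (old_phase y x)))"
  by (rule fd_add[OF seminorms(2) gauged_Y fd_chain[OF seminorms(1,2) gauged_Y fd_phase_Linf(1) s] fd_chain[OF seminorms(1,2) gauged_Y fd_phase_Linf(2) s]])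
    (use t in auto)
 thus ?thesis by (simp only: plus_fun_def)
qed

lemma fd_momentum:
 "differentiable_into (Lp \<L> 2) (Lp_norm \<L> 2)
   (%y x. ((rho P (phase y x) + rho P (old_phase y x)) / 2) *R velocity y x - rho P (old_phase y x) *R old_velocity y x)"
proof -
 have r: "differentiable_into (Linf \<L>) (Linf_norm \<L>) (%y. (1 / 2) *R ((%x. rho P (phase y x)) + (%x. rho P (old_phase y x))))"
  by (intro fd_scale[OF seminorms(1) gauged_Y] fd_add[OF seminorms(1) gauged_Y] fd_superposition_phase[OF density(1,2)])
 have "differentiable_into (Lp \<L> 2) (Lp_norm \<L> 2)
  (%y. (%x. ((1 / 2) *R ((%x. rho P (phase y x)) + (%x. rho P (old_phase y x)))) x *R velocity y x) - (%x. rho P (old_phase y x) *R old_velocity y x))"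
  by (rule fd_diff[OF seminorms(2) gauged_Y fd_times[OF _ r fd_velocity(1)[OF seminorms(2) bl_H_sigma_L2]]
    fd_times[OF _ fd_superposition_phase(2)[OF density(1,2)] fd_velocity(2)[OF seminorms(2) bl_H_sigma_L2]]]) auto
 thus ?thesis by (rule fd_cong[OF _ gauged_Y, rotated]) (simp add: fun_eq_iff scaleR_fun_def)
qed

text \<open>The exponent 3 is that of the gradient of the chemical potential; the other part is
  better.\<close>

lemma fd_transport:
 "differentiable_into (Lp \<L> 3) (Lp_norm \<L> 3)
   (%y x. rho P (old_phase y x) *R old_velocity y x + - (mobility P * deriv (rho P) (phase y x)) *R wgrad (Dom P) (potential y) x)"
proof -
 have p: "(3::real) >= 1" by simp
 have "differentiable_into (Lp \<L> 3) (Lp_norm \<L> 3)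
   (%y. (%x. rho P (old_phase y x) *R old_velocity y x) + (- mobility P) *R (%x. deriv (rho P) (phase y x) *R wgrad (Dom P) (potential y) x))"
  by (intro fd_add[OF seminorms(3) gauged_Y] fd_scale[OF seminorms(3) gauged_Y] fd_times[OF p] fd_superposition_phase[OF density(1,2)]
    fd_superposition_phase[OF density(3,4)] fd_velocity[OF seminorms(3) bl_H_sigma_L3] fd_potential[OF seminorms(3) bl_wgrad[OF p]])
 thus ?thesis by (rule fd_cong[OF _ gauged_Y, rotated]) (simp add: fun_eq_iff scaleR_fun_def)
qed

lemma fd_viscous: "differentiable_into (Lp \<L> 2) (Lp_norm \<L> 2) (%y x. (2 * eta P (phase y x)) *R sym_grad (Dom P) (velocity y) x)"
proof -
 have p: "(2::real) >= 1" by simp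
 have "differentiable_into (Lp \<L> 2) (Lp_norm \<L> 2) (%y. 2 *R (%x. eta P (phase y x) *R sym_grad (Dom P) (velocity y) x))"
  by (intro fd_scale[OF seminorms(2) gauged_Y] fd_times[OF p] fd_superposition_phase[OF viscosity]
    fd_velocity[OF seminorms(2) bl_subset[OF bl_sym_grad H_sigma_subset]])
 thus ?thesis by (rule fd_cong[OF _ gauged_Y, rotated]) (simp add: fun_eq_iff scaleR_fun_def)
qed

lemma fd_capillary: "differentiable_into (Lp \<L> 2) (Lp_norm \<L> 2) (%y x. old_phase y x *R wgrad (Dom P) (potential y) x)"
 by (rule fd_times[OF _ fd_phase_Linf(2) fd_potential[OF seminorms(2) bl_wgrad_L2]]) simp

lemma fd_gravity: "differentiable_into (Lp \<L> 2) (Lp_norm \<L> 2) (%y x. rho P (phase y x) *R gravity P)"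
 by (rule fd_chain[OF seminorms(1,2) gauged_Y fd_superposition_phase(1)[OF density(1,2)] fd_linear[OF seminorms(2) seminormed.gauged[OF seminorms(1)] bl_Linf_Lp[OF finite_U]]]) simp

lemma bl_H1_L2: "bounded_linear_btw (H1 (Dom P)) (H1_norm (Dom P)) (Lp \<L> 2) (Lp_norm \<L> 2) (%f. f)"
 by (rule bl_W1p_Lp) simp

lemma fd_phase_increment: "differentiable_into (Lp \<L> 2) (Lp_norm \<L> 2) (%y x. phase y x - old_phase y x)"
 using fd_diff[OF seminorms(2) gauged_Y fd_phase[OF seminorms(2) bl_phase_H1[OF bl_H1_L2]]] by (simp only: fun_diff_def)

lemma fd_phase_flux: "differentiable_into (Lp \<L> 2) (Lp_norm \<L> 2) (%y x. old_phase y x *R old_velocity y x)"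
 by (rule fd_times[OF _ fd_phase_Linf(2) fd_velocity(2)[OF seminorms(2) bl_H_sigma_L2]]) simp

lemma fd_stabilisation: "differentiable_into (Lp \<L> 2) (Lp_norm \<L> 2) (%y x. \<bar>old_phase y x\<bar>^2 *R wgrad (Dom P) (potential y) x)"
proof -
 have "differentiable_into (Linf \<L>) (Linf_norm \<L>) (%y x. old_phase y x * old_phase y x)"
  using fd_bilinear[OF seminorms(1,1,1) gauged_Y bb_Linf_Linf fd_phase_Linf(2) fd_phase_Linf(2)] .
 from fd_times[OF _ this fd_potential[OF seminorms(2) bl_wgrad_L2]] show ?thesis by (simp add: power2_eq_square)
qed

end

section \<open>The contact line\<close>

text \<open>The profile is constant to the left of \<open>-1\<close>, so an affine one would be constant
  throughout.\<close>

lemma contact_profile_not_affine: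
 assumes "admissible_contact_profile th"
 shows "EX s. deriv (deriv th) s ~= 0"
proof (rule ccontr)
 assume "\<nexists>s. deriv (deriv th) s ~= 0"
 hence z: "deriv (deriv th) s = 0" for s by blast
 have C: "Ck_real (Suc (Suc 0)) th" and lo: "!!t. t <= -1 ==> th t = - 1 / 2" and hi: "!!t. t >= 1 ==> th t = 1 / 2"
  using assms by (auto simp: admissible_contact_profile_def numeral_2_eq_2)
 have C': "Ck_real (Suc 0) (deriv th)" using C by simp
 have d: "(th has_real_derivative deriv th s) (at s)" for s by (rule Ck_real_derivative(1)[OF C])
 have "(deriv th has_real_derivative 0) (at s)" for s using Ck_real_derivative(1)[OF C', of s] by (simp only: z)
 hence const: "deriv th s = deriv th 0" for s by (rule DERIV_isconst_all[rule_format, where f="deriv th"])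
 have lin: "((%s. th s - deriv th 0 * s) has_real_derivative 0) (at s)" for s
  using d[of s] const[of s] by (auto intro!: derivative_eq_intros)
 have eq: "th s - deriv th 0 * s = th t - deriv th 0 * t" for s t
  by (rule DERIV_isconst_all[where f="%s. th s - deriv th 0 * s"]) (use lin in blast)
 have "th (-2) - deriv th 0 * (-2) = th (-1) - deriv th 0 * (-1)" by (rule eq)
 hence "deriv th 0 = 0" using lo[of "-2"] lo[of "-1"] by simp
 hence "th (-1) = th 1" using eq[of "-1" 1] by simp
 thus False using lo[of "-1"] hi[of 1] by simp
qed

context time_step
begin

lemma tau_pos: "tau P > 0" using model by (simp add: tau_def admissible_model_def)

text \<open>The stabilisation constant bounds the second derivative of the contact line energy uniformly in space;
  since the profile is not affine, this bounds the averaged control itself.\<close>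

lemma contact_coefficient_Linf:
 assumes B: "control_operator P B" and S: "stabilizing P B u"
 shows "(%x. cos (theta_eq P) + B_mean P B m u x) : Linf Ga"
proof -
 define c where "c = (%x. cos (theta_eq P) + B_mean P B m u x)"
 define J where "J = {real (m - 1) * tau P <..< real m * tau P}"
 have Bu: "B u : bochner_L2 (time_measure P) (boundary_L2 P) (boundary_L2_norm P)"
  using B bl_mem unfolding control_operator_def by blast
 have "real m * tau P <= real (steps P) * tau P" using m tau_pos by (intro mult_right_mono) auto
 also have "... = end_time P" using model by (simp add: tau_def admissible_model_def)
 finally have sub: "J <= {0<..<end_time P}"
  using tau_pos unfolding J_def by (intro greaterThanLessThan_subseteq_greaterThanLessThan[THEN iffD2] impI conjI) auto
 have Jm: "J : lmeasurable" by (simp add: J_def)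
 have fin: "finite_measure (lebesgue_on J)"
 proof (rule finite_measureI)
  have sp: "space (lebesgue_on J) = J" by (simp add: space_restrict_space)
  have eq: "emeasure (lebesgue_on J) J = emeasure lebesgue J" by (rule emeasure_restrict_space) (use fmeasurableD[OF Jm] in auto)
  show "emeasure (lebesgue_on J) (space (lebesgue_on J)) ~= \<infinity>"
   unfolding sp eq infinity_ennreal_def by (rule fmeasurableD2[OF Jm])
 qed
 have "B u : bochner_L2 (lebesgue_on J) (boundary_L2 P) (boundary_L2_norm P)"
  by (rule bochner_L2_restrict[OF Bu sub]) (auto simp: J_def)
 from L2_bochner_integral_mem[OF fin this]
 have "B_mean P B m u : bmeas Ga"
  unfolding B_mean_def J_def[symmetric] scaleR_fun_def by (intro borel_measurable_scaleR borel_measurable_const LpD(1))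
 hence cm: "c : bmeas Ga" unfolding c_def by (intro borel_measurable_add borel_measurable_const)
 have prof: "admissible_contact_profile (vtheta P)" using model by (simp add: admissible_model_def)
 then obtain s0 where s0: "deriv (deriv (vtheta P)) s0 ~= 0" using contact_profile_not_affine by blast
 have "Ck_real (Suc 0) (deriv (vtheta P))" using prof by (simp add: admissible_contact_profile_def numeral_2_eq_2)
 hence d: "(deriv (vtheta P) has_real_derivative deriv (deriv (vtheta P)) s0) (at s0)" by (rule Ck_real_derivative(1))
 have lg: "sigma_lg P > 0" using model by (simp add: admissible_model_def)
 define w where "w = sigma_lg P * \<bar>deriv (deriv (vtheta P)) s0\<bar>"
 have w: "w > 0" using lg s0 by (simp add: w_def)
 have ae: "AE x in Ga. ALL s. 1 / 2 * \<bar>deriv (gamma' P B u m x) s\<bar> <= S_gamma P" using S m by (simp add: stabilizing_def)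
 have "AE x in Ga. \<bar>c x\<bar> <= \<bar>2 * S_gamma P / w\<bar>" using ae
 proof eventually_elim
  case (elim x)
  have "(gamma' P B u m x has_real_derivative sigma_lg P * c x * deriv (deriv (vtheta P)) s0) (at s0)"
   unfolding gamma'_def[abs_def] c_def by (rule DERIV_cmult[OF d])
  hence "deriv (gamma' P B u m x) s0 = sigma_lg P * c x * deriv (deriv (vtheta P)) s0" by (rule DERIV_imp_deriv)
  hence "\<bar>deriv (gamma' P B u m x) s0\<bar> = w * \<bar>c x\<bar>" using lg by (simp add: w_def abs_mult)
  hence "\<bar>c x\<bar> * w <= 2 * S_gamma P" using spec[OF elim, of s0] by (simp add: mult.commute)
  hence "\<bar>c x\<bar> <= 2 * S_gamma P / w" using w by (simp add: pos_le_divide_eq)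
  thus ?case by linarith
 qed
 from LinfI(1)[OF cm this] show ?thesis by (simp add: c_def)
qed

lemma fd_trace_increment: "differentiable_into (Lp Ga 2) (Lp_norm Ga 2) (%y x. btrace (Dom P) (phase y) x - btrace (Dom P) (old_phase y) x)"
 using fd_diff[OF seminorms(2) gauged_Y fd_phase[OF seminorms(2) bl_phase_H1[OF bl_btrace_L2]]] by (simp only: fun_diff_def)

text \<open>The trace of the old phase field is essentially bounded, so the profile acts on it by
  superposition; the result is then read in \<open>L\<^sup>2\<close>.\<close>

lemma fd_contact_line:
 assumes B: "control_operator P B" and S: "stabilizing P B u"
 shows "differentiable_into (Lp Ga 2) (Lp_norm Ga 2)
   (%y x. S_gamma P / 2 * (btrace (Dom P) (phase y) x - btrace (Dom P) (old_phase y) x) + gamma' P B u m x (btrace (Dom P) (old_phase y) x))"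
proof -
 define c where "c = (%x. cos (theta_eq P) + B_mean P B m u x)"
 have c: "c : Linf Ga" unfolding c_def by (rule contact_coefficient_Linf[OF B S])
 have C: "Ck_real (Suc 0) (deriv (vtheta P))" using model by (simp add: admissible_model_def admissible_contact_profile_def numeral_2_eq_2)
 have t: "differentiable_into (Linf Ga) (Linf_norm Ga) (%y x. deriv (vtheta P) (btrace (Dom P) (old_phase y) x))"
  by (rule fd_chain[OF seminorms(1,1) gauged_Y fd_phase(2)[OF seminorms(1) bl_btrace_Linf] fd_superposition_Linf[OF Ck_real_derivative[OF C]]])
 have b: "differentiable_into (Linf Ga) (Linf_norm Ga) (%y x. c x * deriv (vtheta P) (btrace (Dom P) (old_phase y) x))"
  using fd_bilinear[OF seminorms(1,1,1) gauged_Y bb_Linf_Linf fd_const[OF seminorms(1) gauged_Y c] t] .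
 have "bounded_linear_btw (Linf Ga) (Linf_norm Ga) (Lp Ga 2) (Lp_norm Ga 2) (%f x. f x *R (1::real))"
  by (rule bl_Linf_Lp[OF Ga.finite_measure_axioms]) simp
 from fd_chain[OF seminorms(1,2) gauged_Y b fd_linear[OF seminorms(2) seminormed.gauged[OF seminorms(1)] this]]
 have g: "differentiable_into (Lp Ga 2) (Lp_norm Ga 2) (%y x. (c x * deriv (vtheta P) (btrace (Dom P) (old_phase y) x)) *R (1::real))" .
 have "differentiable_into (Lp Ga 2) (Lp_norm Ga 2)
   (%y. (S_gamma P / 2) *R (%x. btrace (Dom P) (phase y) x - btrace (Dom P) (old_phase y) x)
    + sigma_lg P *R (%x. (c x * deriv (vtheta P) (btrace (Dom P) (old_phase y) x)) *R (1::real)))"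
  by (intro fd_add[OF seminorms(2) gauged_Y] fd_scale[OF seminorms(2) gauged_Y] fd_trace_increment g)
 thus ?thesis by (rule fd_cong[OF _ gauged_Y, rotated]) (simp add: fun_eq_iff scaleR_fun_def gamma'_def c_def)
qed

section \<open>Differentiability of the residual\<close>

lemma trilinear_eq:
 "trilinear U a v w = 1 / 2 * convection (lebesgue_on U) a (wjac U v) w - 1 / 2 * convection (lebesgue_on U) a (wjac U w) v"
 by (simp add: trilinear_def convection_def L2_inner_def)

text \<open>The summands are collected in the order in which they occur in the residual.\<close>

lemma fd_residual:
 assumes B: "control_operator P B" and S: "stabilizing P B u"
 shows "differentiable_into (dual_space (test_space P) (test_norm P)) (dual_norm (test_space P) (test_norm P)) (%y. e_op P B y u m)"
proof -
 let ?U = "Dom P"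
 note D = seminormed_dual[OF homogeneous_test]
 note add = fd_add[OF D gauged_Y] and diff = fd_diff[OF D gauged_Y] and scale = fd_scale[OF D gauged_Y]
 note L2 = fd_L2_functional[OF homogeneous_test _ gauged_Y]
 have one: "(1::real) <= 2" by simp
 note w = bl_test(1)[OF bl_H_sigma_L2] and w6 = bl_test(1)[OF bl_H_sigma_L6]
  and jac = bl_test(1)[OF bl_subset[OF bl_wjac H_sigma_subset]] and sym = bl_test(1)[OF bl_subset[OF bl_sym_grad H_sigma_subset]]
  and \<Psi> = bl_test(2)[OF bl_H1_L2] and g\<Psi> = bl_test(2)[OF bl_wgrad[OF one]]
  and \<Phi> = bl_test(3)[OF bl_H1_L2] and g\<Phi> = bl_test(3)[OF bl_wgrad[OF one]] and b\<Phi> = bl_test(3)[OF bl_btrace_L2]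
 note conv = fd_convection[OF homogeneous_test gauged_Y fd_transport]
 note c1 = conv(1)[OF w6 fd_velocity(1)[OF seminorms(2) bl_subset[OF bl_wjac H_sigma_subset]]]
  and c2 = conv(2)[OF jac fd_velocity(1)[OF seminorms(4) bl_H_sigma_L6]]
 note s1 = L2[OF w fd_momentum]
 note s2 = add[OF s1 scale[OF diff[OF scale[OF c1, of "1 / 2"] scale[OF c2, of "1 / 2"]], of "tau P"]]
 note s3 = add[OF s2 scale[OF L2[OF sym fd_viscous], of "tau P"]]
 note s4 = add[OF s3 scale[OF L2[OF w fd_capillary], of "tau P"]]
 note s5 = diff[OF s4 scale[OF L2[OF w fd_gravity], of "tau P"]]
 note s6 = add[OF s5 L2[OF \<Psi> fd_phase_increment]]
 note s7 = diff[OF s6 scale[OF L2[OF g\<Psi> fd_phase_flux], of "tau P"]]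
 note s8 = add[OF s7 scale[OF L2[OF g\<Psi> fd_stabilisation], of "(tau P)^2 / rho_min P"]]
 note s9 = add[OF s8 scale[OF L2[OF g\<Psi> fd_potential[OF seminorms(2) bl_wgrad_L2]], of "tau P * mobility P"]]
 note s10 = add[OF s9 scale[OF L2[OF g\<Phi> fd_phase(1)[OF seminorms(2) bl_phase_H1[OF bl_wgrad[OF one]]]], of "tau P * sigma P * eps P"]]
 note s11 = add[OF s10 scale[OF L2[OF \<Phi> fd_double_well], of "tau P * (sigma P / eps P)"]]
 note s12 = diff[OF s11 scale[OF L2[OF \<Phi> fd_potential[OF seminorms(2) bl_W13_L2]], of "tau P"]]
 note s13 = add[OF s12 scale[OF L2[OF b\<Phi> fd_trace_increment], of "relax P"]]
 note s14 = add[OF s13 scale[OF L2[OF b\<Phi> fd_contact_line[OF B S]], of "tau P"]]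
 show ?thesis by (rule fd_cong[OF _ gauged_Y s14])
    (rule ext, simp only: e_op_def Let_def split_beta trilinear_eq old_velocity_def old_phase_def
     plus_fun_apply fun_diff_def scaleR_fun_def real_scaleR_def)
qed

end

theorem theorem20:
 fixes P :: model
  and B :: "'u::real_normed_vector => real => R3 => real"
  and u :: 'u
 assumes "admissible_model P"
  and "reflexive_space TYPE('u)"
  and "control_operator P B"
  and "u : U_ad0 P B"
  and "stabilizing P B u"
 shows "frechet_differentiable (Y_space P) (Y_norm P) (Z_space P) (Z_norm P) (%y. e_op P B y u)"
proof -
 have dom: "polygonal_lipschitz_domain (Dom P)" and M: "1 <= steps P"
  using assms(1) by (auto simp: admissible_model_def)
 have ts: "time_step P m" if "m : {1..steps P}" for m
  using dom that assms(1) unfolding polygonal_lipschitz_domain_def by unfold_locales auto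
 have one: "1 : {1..steps P}" using M by simp
 have Z: "Z_space P = {z. ALL m:{1..steps P}. z m : dual_space (test_space P) (test_norm P)}"
  "Z_norm P = (%z. MAX m\<in>{1..steps P}. dual_norm (test_space P) (test_norm P) (z m))"
  by (simp_all add: Z_space_def Z_norm_def[abs_def])
 show ?thesis unfolding Z
 proof (rule fd_components)
  show "seminormed (dual_space (test_space P) (test_norm P)) (dual_norm (test_space P) (test_norm P))"
   by (rule seminormed_dual[OF time_step.homogeneous_test[OF ts[OF one]]])
  show "gauged (Y_space P) (Y_norm P)" by (rule time_step.gauged_Y[OF ts[OF one]])
  show "frechet_differentiable (Y_space P) (Y_norm P) (dual_space (test_space P) (test_norm P))
    (dual_norm (test_space P) (test_norm P)) (%y. e_op P B y u m)" if "m : {1..steps P}" for m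
   by (rule time_step.fd_residual[OF ts[OF that] assms(3,5)])
 qed (use M in auto)
qed

end
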